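(* Let $R$ be an associative ring with identity and suppose that each flat left $R$-module is filtered by totally ordered direct limits of projective modules. Then the cotorsion pair generated by the class $\mathcal{FM}$ of all flat Mittag-Leffler left $R$-modules is the Enochs cotorsion pair $(\mathcal F,\mathcal C)$, where $\mathcal F$ is the class of all flat left $R$-modules and $\mathcal C$ is the class of all cotorsion left $R$-modules; that is, ${}^{\perp}(\mathcal{FM}^{\perp})=\mathcal F$ and $\mathcal{FM}^{\perp}=\mathcal C$.
   Context: $R$ is a not necessarily commutative ring with identity; "module" means left $R$-module. For a class $\mathcal X$ of modules, $\mathcal X^{\perp}=\{Y : \operatorname{Ext}^1_R(X,Y)=0 \text{ for all } X\in\mathcal X\}$ and ${}^{\perp}\mathcal X=\{Y : \operatorname{Ext}^1_R(Y,X)=0 \text{ for all } X\in\mathcal X\}$. The cotorsion pair generated by $\mathcal X$ is $({}^{\perp}(\mathcal X^{\perp}),\mathcal X^{\perp})$. A module $C$ is cotorsion if $\operatorname{Ext}^1_R(F,C)=0$ for every flat module $F$. A left $R$-module $M$ is Mittag-Leffler if for each family $\{M_i : i\in I\}$ of right $R$-modules the canonical morphism $\left(\prod_{i\in I}M_i\right)\otimes_R M\to\prod_{i\in I}(M_i\otimes_R M)$ is monic. A totally ordered direct limit of projective modules is a module which is the direct limit of a direct system $(P_i,f_{ij})_{i,j\in I}$ of projective modules with $I$ a totally ordered set. For a class $\mathcal X$ of modules, a module $N$ is $\mathcal X$-filtered (filtered by modules in $\mathcal X$) if there are an ordinal $\kappa$ and a continuous chain $\{N_\alpha : \alpha<\kappa\}$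 of submodules of $N$ (increasing, with $N_\alpha=\bigcup_{\beta<\alpha}N_\beta$ for limit $\alpha<\kappa$) such that $N_0=0$, $N=\bigcup_{\alpha<\kappa}N_\alpha$ and $N_{\alpha+1}/N_\alpha\in\mathcal X$ whenever $\alpha+1<\kappa$. "Filtered by totally ordered direct limits of projective modules" means $\mathcal X$-filtered with $\mathcal X$ the class of all totally ordered direct limits of projective modules. *)

theory Defs
  imports "HOL-Algebra.Module" "HOL-Algebra.AbelCoset" "HOL-Algebra.Free_Abelian_Groups"
begin

section \<open>Smallness\<close>

text \<open>
  The type \<open>'u\<close> plays the role of the universe of all sets: modules have their carriers in
  \<open>'u\<close>, and the sets, as opposed to proper classes, are the subsets of \<open>'u\<close> of smaller
  cardinality than \<open>'u\<close> itself. The predicate \<open>universe\<close> says that the cardinality of \<open>'u\<close>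
  is uncountable, strong limit and regular, so that sets are closed under the usual
  set-theoretic operations.
\<close>

unbundle cardinal_syntax

definition small :: "'u set \<Rightarrow> bool" where
  "small A \<longleftrightarrow> |A| <o |UNIV :: 'u set|"

definition universe :: "'u itself \<Rightarrow> bool" where
  "universe _ \<longleftrightarrow>
     (\<exists>A :: 'u set. infinite A \<and> small A) \<and>
     (\<forall>A :: 'u set. small A \<longrightarrow> |Pow A| <o |UNIV :: 'u set| ) \<and>
     (\<forall>(A :: 'u set) (B :: 'u \<Rightarrow> 'u set).
        small A \<and> (\<forall>a\<in>A. small (B a)) \<longrightarrow> small (\<Union>a\<in>A. B a))"


section \<open>Modules over noncommutative rings\<close>

text \<open>
  The library's \<open>module\<close> locale requires a commutative ring. Only the fields \<open>carrier\<close>,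
  \<open>zero\<close>, \<open>add\<close> and \<open>smult\<close> of the record type \<open>module\<close> are meaningful for modules.
\<close>

locale left_module = R?: ring R + M?: abelian_group M
  for R :: "'r ring" (structure) and M :: "('r, 'm) module" (structure) +
  assumes smult_closed:
      "\<lbrakk>a \<in> carrier R; x \<in> carrier M\<rbrakk> \<Longrightarrow> a \<odot>\<^bsub>M\<^esub> x \<in> carrier M"
    and smult_l_distr:
      "\<lbrakk>a \<in> carrier R; b \<in> carrier R; x \<in> carrier M\<rbrakk> \<Longrightarrow>
        (a \<oplus> b) \<odot>\<^bsub>M\<^esub> x = a \<odot>\<^bsub>M\<^esub> x \<oplus>\<^bsub>M\<^esub> b \<odot>\<^bsub>M\<^esub> x"
    and smult_r_distr:
      "\<lbrakk>a \<in> carrier R; x \<in> carrier M; y \<in> carrier M\<rbrakk> \<Longrightarrow>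
        a \<odot>\<^bsub>M\<^esub> (x \<oplus>\<^bsub>M\<^esub> y) = a \<odot>\<^bsub>M\<^esub> x \<oplus>\<^bsub>M\<^esub> a \<odot>\<^bsub>M\<^esub> y"
    and smult_assoc:
      "\<lbrakk>a \<in> carrier R; b \<in> carrier R; x \<in> carrier M\<rbrakk> \<Longrightarrow>
        (a \<otimes> b) \<odot>\<^bsub>M\<^esub> x = a \<odot>\<^bsub>M\<^esub> (b \<odot>\<^bsub>M\<^esub> x)"
    and smult_one:
      "x \<in> carrier M \<Longrightarrow> \<one> \<odot>\<^bsub>M\<^esub> x = x"

definition opposite :: "'r ring \<Rightarrow> 'r ring" where
  "opposite R = R\<lparr>monoid.mult := (\<lambda>x y. y \<otimes>\<^bsub>R\<^esub> x)\<rparr>"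

text \<open>
  The class of all left \<open>R\<close>-modules. Right \<open>R\<close>-modules are the elements of
  \<open>modules (opposite R)\<close>: for such a module \<open>M\<close>, \<open>r \<odot>\<^bsub>M\<^esub> x\<close> stands for the product of \<open>x\<close> by
  \<open>r\<close> on the right.
\<close>

definition modules :: "'r ring \<Rightarrow> ('r, 'u) module set" where
  "modules R = {M. left_module R M \<and> small (carrier M)}"

definition module_hom ::
    "'r ring \<Rightarrow> ('r, 'm) module \<Rightarrow> ('r, 'n) module \<Rightarrow> ('m \<Rightarrow> 'n) set" where
  "module_hom R M N = {f \<in> carrier M \<rightarrow>\<^sub>E carrier N.
     (\<forall>x\<in>carrier M. \<forall>y\<in>carrier M. f (x \<oplus>\<^bsub>M\<^esub> y) = f x \<oplus>\<^bsub>N\<^esub> f y) \<and>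
     (\<forall>r\<in>carrier R. \<forall>x\<in>carrier M. f (r \<odot>\<^bsub>M\<^esub> x) = r \<odot>\<^bsub>N\<^esub> f x)}"

definition module_isomorphic ::
    "'r ring \<Rightarrow> ('r, 'm) module \<Rightarrow> ('r, 'n) module \<Rightarrow> bool" where
  "module_isomorphic R M N \<longleftrightarrow> (\<exists>f\<in>module_hom R M N. bij_betw f (carrier M) (carrier N))"

definition quotient_module :: "('r, 'm) module \<Rightarrow> 'm set \<Rightarrow> ('r, 'm set) module" where
  "quotient_module M K =
     \<lparr>carrier = a_rcosets\<^bsub>M\<^esub> K, monoid.mult = undefined, monoid.one = undefined,
      ring.zero = K, ring.add = set_add M,
      smult = (\<lambda>r U. \<Union>u\<in>U. K +>\<^bsub>M\<^esub> (r \<odot>\<^bsub>M\<^esub> u))\<rparr>"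

definition product_module :: "'i set \<Rightarrow> ('i \<Rightarrow> ('r, 'm) module) \<Rightarrow> ('r, 'i \<Rightarrow> 'm) module" where
  "product_module I M =
     \<lparr>carrier = (\<Pi>\<^sub>E i\<in>I. carrier (M i)), monoid.mult = undefined, monoid.one = undefined,
      ring.zero = (\<lambda>i\<in>I. \<zero>\<^bsub>M i\<^esub>), ring.add = (\<lambda>x y. \<lambda>i\<in>I. x i \<oplus>\<^bsub>M i\<^esub> y i),
      smult = (\<lambda>r x. \<lambda>i\<in>I. r \<odot>\<^bsub>M i\<^esub> x i)\<rparr>"

definition projective_modules :: "'r ring \<Rightarrow> ('r, 'u) module set" where
  "projective_modules R = {P \<in> modules R.
     \<forall>A \<in> (modules R :: ('r, 'u) module set). \<forall>B \<in> (modules R :: ('r, 'u) module set).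
       \<forall>g \<in> module_hom R A B. \<forall>h \<in> module_hom R P B. g ` carrier A = carrier B \<longrightarrow>
         (\<exists>k \<in> module_hom R P A. \<forall>x\<in>carrier P. g (k x) = h x)}"


section \<open>Tensor products, flat and Mittag-Leffler modules\<close>

definition tensor_relators ::
    "'r ring \<Rightarrow> ('r, 'm) module \<Rightarrow> ('r, 'n) module \<Rightarrow> ('m \<times> 'n \<Rightarrow>\<^sub>0 int) set" where
  "tensor_relators R M N =
     {frag_of (x \<oplus>\<^bsub>M\<^esub> x', y) - frag_of (x, y) - frag_of (x', y) | x x' y.
        x \<in> carrier M \<and> x' \<in> carrier M \<and> y \<in> carrier N} \<union>
     {frag_of (x, y \<oplus>\<^bsub>N\<^esub> y') - frag_of (x, y) - frag_of (x, y') | x y y'.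
        x \<in> carrier M \<and> y \<in> carrier N \<and> y' \<in> carrier N} \<union>
     {frag_of (r \<odot>\<^bsub>M\<^esub> x, y) - frag_of (x, r \<odot>\<^bsub>N\<^esub> y) | r x y.
        r \<in> carrier R \<and> x \<in> carrier M \<and> y \<in> carrier N}"

definition tensor_relations ::
    "'r ring \<Rightarrow> ('r, 'm) module \<Rightarrow> ('r, 'n) module \<Rightarrow> ('m \<times> 'n \<Rightarrow>\<^sub>0 int) set" where
  "tensor_relations R M N =
     generate (free_Abelian_group (carrier M \<times> carrier N)) (tensor_relators R M N)"

text \<open>The tensor product of a right module \<open>M\<close> and a left module \<open>N\<close>.\<close>

definition tensor_product ::
    "'r ring \<Rightarrow> ('r, 'm) module \<Rightarrow> ('r, 'n) module \<Rightarrow> ('m \<times> 'n \<Rightarrow>\<^sub>0 int) set monoid" where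
  "tensor_product R M N =
     free_Abelian_group (carrier M \<times> carrier N) Mod tensor_relations R M N"

text \<open>
  For a homomorphism \<open>f\<close> from \<open>A\<close> to \<open>B\<close>, the map from the tensor product of \<open>A\<close> and \<open>N\<close> to
  that of \<open>B\<close> and \<open>N\<close> which is induced by \<open>f\<close> and the identity of \<open>N\<close>. It is constant on each
  coset \<open>U\<close>, so that \<open>the_elem\<close> picks the common value.
\<close>

definition tensor_map ::
    "'r ring \<Rightarrow> ('r, 'b) module \<Rightarrow> ('r, 'n) module \<Rightarrow> ('a \<Rightarrow> 'b)
      \<Rightarrow> ('a \<times> 'n \<Rightarrow>\<^sub>0 int) set \<Rightarrow> ('b \<times> 'n \<Rightarrow>\<^sub>0 int) set" where
  "tensor_map R B N f U =
     the_elem ((\<lambda>c. tensor_relations R B N #>\<^bsub>free_Abelian_group (carrier B \<times> carrier N)\<^esub>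
                      frag_extend (\<lambda>(a, n). frag_of (f a, n)) c) ` U)"

definition flat_modules :: "'r ring \<Rightarrow> ('r, 'u) module set" where
  "flat_modules R = {M \<in> modules R.
     \<forall>A \<in> (modules (opposite R) :: ('r, 'u) module set).
     \<forall>B \<in> (modules (opposite R) :: ('r, 'u) module set).
     \<forall>f \<in> module_hom (opposite R) A B. inj_on f (carrier A) \<longrightarrow>
       inj_on (tensor_map R B M f) (carrier (tensor_product R A M))}"

definition product_tensor_map ::
    "'r ring \<Rightarrow> 'i set \<Rightarrow> ('i \<Rightarrow> ('r, 'm) module) \<Rightarrow> ('r, 'n) module
      \<Rightarrow> (('i \<Rightarrow> 'm) \<times> 'n \<Rightarrow>\<^sub>0 int) set \<Rightarrow> 'i \<Rightarrow> ('m \<times> 'n \<Rightarrow>\<^sub>0 int) set" where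
  "product_tensor_map R I M N U = (\<lambda>i\<in>I. tensor_map R (M i) N (\<lambda>x. x i) U)"

definition mittag_leffler_modules :: "'r ring \<Rightarrow> ('r, 'u) module set" where
  "mittag_leffler_modules R = {M \<in> modules R.
     \<forall>(I :: 'u set) (N :: 'u \<Rightarrow> ('r, 'u) module).
       small I \<and> (\<forall>i\<in>I. N i \<in> modules (opposite R)) \<longrightarrow>
       inj_on (product_tensor_map R I N M) (carrier (tensor_product R (product_module I N) M))}"

definition flat_mittag_leffler_modules :: "'r ring \<Rightarrow> ('r, 'u) module set" where
  "flat_mittag_leffler_modules R = flat_modules R \<inter> mittag_leffler_modules R"


section \<open>Ext and cotorsion pairs\<close>

definition free_module :: "'r ring \<Rightarrow> 's set \<Rightarrow> ('r, 's \<Rightarrow> 'r) module" where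
  "free_module R S =
     \<lparr>carrier = {a \<in> S \<rightarrow>\<^sub>E carrier R. finite {s \<in> S. a s \<noteq> \<zero>\<^bsub>R\<^esub>}},
      monoid.mult = undefined, monoid.one = undefined,
      ring.zero = (\<lambda>s\<in>S. \<zero>\<^bsub>R\<^esub>), ring.add = (\<lambda>a b. \<lambda>s\<in>S. a s \<oplus>\<^bsub>R\<^esub> b s),
      smult = (\<lambda>r a. \<lambda>s\<in>S. r \<otimes>\<^bsub>R\<^esub> a s)\<rparr>"

definition free_cover ::
    "'r ring \<Rightarrow> ('r, 'm) module \<Rightarrow> 'm set \<Rightarrow> ('m \<Rightarrow> 'r) \<Rightarrow> 'm" where
  "free_cover R M S =
     (\<lambda>a\<in>carrier (free_module R S). \<Oplus>\<^bsub>M\<^esub>s\<in>{s \<in> S. a s \<noteq> \<zero>\<^bsub>R\<^esub>}. a s \<odot>\<^bsub>M\<^esub> s)"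

definition hom_group ::
    "'r ring \<Rightarrow> ('r, 'm) module \<Rightarrow> ('r, 'n) module \<Rightarrow> ('m \<Rightarrow> 'n) monoid" where
  "hom_group R M N =
     \<lparr>carrier = module_hom R M N,
      monoid.mult = (\<lambda>f g. \<lambda>x\<in>carrier M. f x \<oplus>\<^bsub>N\<^esub> g x),
      monoid.one = (\<lambda>x\<in>carrier M. \<zero>\<^bsub>N\<^esub>)\<rparr>"

text \<open>
  \<open>Ext1 R X Y\<close> is the first cohomology group of \<open>Hom(F\<^sub>0,Y) \<rightarrow> Hom(F\<^sub>1,Y) \<rightarrow> Hom(F\<^sub>2,Y)\<close>, where
  \<open>F\<^sub>2 \<rightarrow> F\<^sub>1 \<rightarrow> F\<^sub>0 \<rightarrow> X \<rightarrow> 0\<close> is the beginning of the free resolution of \<open>X\<close> in which \<open>F\<^sub>0\<close> is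
  free on the carrier of \<open>X\<close> and each further \<open>F\<^sub>n\<close> is free on the kernel of the previous map.
\<close>

definition Ext1 ::
    "'r ring \<Rightarrow> ('r, 'm) module \<Rightarrow> ('r, 'n) module
      \<Rightarrow> (((('m \<Rightarrow> 'r) \<Rightarrow> 'r) \<Rightarrow> 'n) set) monoid" where
  "Ext1 R X Y =
     (let F\<^sub>0 = free_module R (carrier X);
          K\<^sub>0 = a_kernel F\<^sub>0 X (free_cover R X (carrier X));
          F\<^sub>1 = free_module R K\<^sub>0;
          d\<^sub>1 = free_cover R F\<^sub>0 K\<^sub>0;
          K\<^sub>1 = a_kernel F\<^sub>1 F\<^sub>0 d\<^sub>1;
          F\<^sub>2 = free_module R K\<^sub>1;
          d\<^sub>2 = free_cover R F\<^sub>1 K\<^sub>1;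
          Z = {g \<in> module_hom R F\<^sub>1 Y. \<forall>c\<in>carrier F\<^sub>2. g (d\<^sub>2 c) = \<zero>\<^bsub>Y\<^esub>};
          B = {compose (carrier F\<^sub>1) h d\<^sub>1 | h. h \<in> module_hom R F\<^sub>0 Y}
      in (hom_group R F\<^sub>1 Y)\<lparr>carrier := Z\<rparr> Mod B)"

definition right_perp :: "'r ring \<Rightarrow> ('r, 'u) module set \<Rightarrow> ('r, 'u) module set" where
  "right_perp R \<S> = {Y \<in> modules R. \<forall>X\<in>\<S>. trivial_group (Ext1 R X Y)}"

definition left_perp :: "'r ring \<Rightarrow> ('r, 'u) module set \<Rightarrow> ('r, 'u) module set" where
  "left_perp R \<S> = {Y \<in> modules R. \<forall>X\<in>\<S>. trivial_group (Ext1 R Y X)}"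

definition cotorsion_pair_generated_by ::
    "'r ring \<Rightarrow> ('r, 'u) module set \<Rightarrow> ('r, 'u) module set \<times> ('r, 'u) module set" where
  "cotorsion_pair_generated_by R \<S> = (left_perp R (right_perp R \<S>), right_perp R \<S>)"

definition cotorsion_modules :: "'r ring \<Rightarrow> ('r, 'u) module set" where
  "cotorsion_modules R = {C \<in> modules R.
     \<forall>F \<in> (flat_modules R :: ('r, 'u) module set). trivial_group (Ext1 R F C)}"


section \<open>Totally ordered direct limits\<close>

definition direct_system ::
    "'r ring \<Rightarrow> 'i set \<Rightarrow> 'i rel \<Rightarrow> ('i \<Rightarrow> ('r, 'u) module) \<Rightarrow> ('i \<Rightarrow> 'i \<Rightarrow> 'u \<Rightarrow> 'u) \<Rightarrow> bool" where
  "direct_system R I r P f \<longleftrightarrow>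
     (\<forall>i\<in>I. P i \<in> modules R) \<and>
     (\<forall>(i, j)\<in>r. f i j \<in> module_hom R (P i) (P j)) \<and>
     (\<forall>i\<in>I. \<forall>x\<in>carrier (P i). f i i x = x) \<and>
     (\<forall>i j k. (i, j) \<in> r \<and> (j, k) \<in> r \<longrightarrow>
        (\<forall>x\<in>carrier (P i). f j k (f i j x) = f i k x))"

definition cocone ::
    "'r ring \<Rightarrow> 'i set \<Rightarrow> 'i rel \<Rightarrow> ('i \<Rightarrow> ('r, 'u) module) \<Rightarrow> ('i \<Rightarrow> 'i \<Rightarrow> 'u \<Rightarrow> 'u)
      \<Rightarrow> ('r, 'u) module \<Rightarrow> ('i \<Rightarrow> 'u \<Rightarrow> 'u) \<Rightarrow> bool" where
  "cocone R I r P f L \<phi> \<longleftrightarrow>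
     (\<forall>i\<in>I. \<phi> i \<in> module_hom R (P i) L) \<and>
     (\<forall>(i, j)\<in>r. \<forall>x\<in>carrier (P i). \<phi> j (f i j x) = \<phi> i x)"

definition is_direct_limit ::
    "'r ring \<Rightarrow> 'i set \<Rightarrow> 'i rel \<Rightarrow> ('i \<Rightarrow> ('r, 'u) module) \<Rightarrow> ('i \<Rightarrow> 'i \<Rightarrow> 'u \<Rightarrow> 'u)
      \<Rightarrow> ('r, 'u) module \<Rightarrow> bool" where
  "is_direct_limit R I r P f L \<longleftrightarrow> L \<in> modules R \<and>
     (\<exists>\<phi>. cocone R I r P f L \<phi> \<and>
        (\<forall>N\<in>modules R. \<forall>\<psi>. cocone R I r P f N \<psi> \<longrightarrow>
           (\<exists>!u. u \<in> module_hom R L N \<and>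
                 (\<forall>i\<in>I. \<forall>x\<in>carrier (P i). u (\<phi> i x) = \<psi> i x))))"

definition totally_ordered_limits_of_projectives :: "'r ring \<Rightarrow> ('r, 'u) module set" where
  "totally_ordered_limits_of_projectives R =
     {L. \<exists>(I :: 'u set) r P f.
        small I \<and> I \<noteq> {} \<and> linear_order_on I r \<and>
        (\<forall>i\<in>I. P i \<in> projective_modules R) \<and>
        direct_system R I r P f \<and> is_direct_limit R I r P f L}"


section \<open>Filtrations\<close>

text \<open>Ordinals are represented by well-orders; their elements stand for the smaller ordinals.\<close>

definition immediate_succ :: "'i rel \<Rightarrow> 'i \<Rightarrow> 'i \<Rightarrow> bool" where
  "immediate_succ r \<alpha> \<beta> \<longleftrightarrow> \<alpha> \<in> underS r \<beta> \<and> (\<forall>\<gamma>. \<alpha> \<in> underS r \<gamma> \<longrightarrow> (\<beta>, \<gamma>) \<in> r)"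

definition limit_element :: "'i rel \<Rightarrow> 'i \<Rightarrow> bool" where
  "limit_element r \<alpha> \<longleftrightarrow> \<alpha> \<in> Field r \<and> underS r \<alpha> \<noteq> {} \<and> \<not> (\<exists>\<beta>. immediate_succ r \<beta> \<alpha>)"

text \<open>
  The quotients have carriers in \<open>'u set\<close> rather than \<open>'u\<close>, so they belong to the class
  \<open>\<S>\<close> only up to isomorphism.
\<close>

definition filtered_by :: "'r ring \<Rightarrow> ('r, 'u) module set \<Rightarrow> ('r, 'u) module \<Rightarrow> bool" where
  "filtered_by R \<S> N \<longleftrightarrow>
     (\<exists>(r :: 'u rel) C.
        Well_order r \<and> small (Field r) \<and> Field r \<noteq> {} \<and>
        (\<forall>\<alpha>\<in>Field r. submodule (C \<alpha>) R N) \<and>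
        (\<forall>(\<alpha>, \<beta>)\<in>r. C \<alpha> \<subseteq> C \<beta>) \<and>
        (\<forall>\<alpha>\<in>Field r. underS r \<alpha> = {} \<longrightarrow> C \<alpha> = {\<zero>\<^bsub>N\<^esub>}) \<and>
        (\<forall>\<alpha>. limit_element r \<alpha> \<longrightarrow> C \<alpha> = (\<Union>\<beta>\<in>underS r \<alpha>. C \<beta>)) \<and>
        carrier N = (\<Union>\<alpha>\<in>Field r. C \<alpha>) \<and>
        (\<forall>\<alpha> \<beta>. immediate_succ r \<alpha> \<beta> \<longrightarrow>
           (\<exists>X\<in>\<S>. module_isomorphic R (quotient_module (N\<lparr>carrier := C \<beta>\<rparr>) (C \<alpha>)) X)))"

end

theory Submission
  imports Complex_Main Defs
begin

text \<open>
  The equality of the second components carries the weight. Flat Mittag-Leffler modules are flat,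
  so cotorsion modules are orthogonal to them. Conversely, let \<open>Y\<close> be orthogonal to all flat
  Mittag-Leffler modules. By Eklof's lemma (\<open>filtered_Ext_trivial\<close>) and the assumed filtrations,
  it is enough that \<open>Ext\<^sup>1(L, Y)\<close> vanishes for every totally ordered direct limit \<open>L\<close> of
  projective modules (\<open>limit_Ext_trivial\<close>).

  A totally ordered index set has a cofinal well-ordered subset \<open>W\<close> (\<open>cofinal_well_order\<close>), so
  \<open>L\<close> is the limit of a well-ordered chain of projective modules \<open>P \<alpha>\<close>. Each map from \<open>P \<alpha>\<close> to
  \<open>L\<close> lifts to the free cover of \<open>L\<close>, and the failure of the lifts to be compatible turns a map from
  the kernel of the cover to \<open>Y\<close> into a 1-cocycle \<open>c\<close> of the inverse system \<open>Hom(P \<alpha>, Y)\<close>. The map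
  extends to the cover as soon as \<open>c\<close> is a coboundary. This last fact (\<open>cocycle_coboundary\<close>) is the
  core of the proof.

  It rests on a tree module. A branch \<open>\<nu>\<close> is a function on \<open>W\<close>, and the nodes of the tree are the
  restrictions of branches to the initial segments up to a level. Each branch \<open>\<nu>\<close> and \<open>x \<in> P \<alpha>\<close>
  give a thread, an element of the product of copies of \<open>P \<gamma>\<close> over the nodes of level \<open>\<gamma>\<close>, whose
  coordinates along \<open>\<nu>\<close> from level \<open>\<alpha>\<close> on are the images of \<open>x\<close>. The module \<open>X\<close> spanned by the
  threads is locally projective (\<open>tree_locally_projective\<close>): given finitely many branches, all of
  them have separated from one another at some level, and an element of \<open>X\<close> is
  peeled off level by level through its coordinates, which lie in projective modules. Local
  projectivity yields flatness and the Mittag-Leffler property at once (\<open>locally_projective_flat\<close>,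
  \<open>locally_projective_mittag_leffler\<close>), because over a locally projective module a tensor vanishes
  when all linear forms kill it. So \<open>Ext\<^sup>1(X, Y)\<close> vanishes.

  Attach a cocycle \<open>cc \<nu>\<close> to every branch. These define a map to \<open>Y\<close> on the relations between
  threads, and its extension to the free module on the threads provides \<open>Q \<nu> \<alpha>\<close> in \<open>Hom(P \<alpha>, Y)\<close>
  such that \<open>cc \<nu>\<close>, corrected by the coboundary of \<open>Q \<nu>\<close>, depends at level \<open>\<beta>\<close> only on the part of
  \<open>\<nu>\<close> below \<open>\<beta>\<close> (\<open>branch_prediction\<close>). Now let the value of a branch at level \<open>\<beta>\<close> be a guess of
  the values of a cocycle at level \<open>\<beta>\<close>. By recursion along \<open>W\<close> there is a branch \<open>\<nu>\<close> whose guess is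
  the corrected cocycle of \<open>\<nu>\<close> itself, hence cohomologous to \<open>cc \<nu>\<close>. If \<open>c\<close> were not a
  coboundary, one could set \<open>cc \<nu> = c\<close> when the guess of \<open>\<nu>\<close> is a coboundary and \<open>cc \<nu> = 0\<close>
  otherwise, so that no guess is ever right.

  For the first components it remains that a module orthogonal to all cotorsion modules is flat. For
  a submodule \<open>A\<close> of a right module \<open>B\<close>, the characters of \<open>B\<close> with values in the unit circle that are
  trivial on \<open>A\<close> form a cotorsion left module (\<open>annihilator_Ext_trivial\<close>). They form the kernel of the
  restriction from characters of \<open>B\<close> to characters of \<open>A\<close>, so a module \<open>Y\<close> orthogonal to
  them lifts maps to characters of \<open>A\<close>, that is, characters of the tensor product of \<open>A\<close> and \<open>Y\<close>, to
  \<open>B\<close>. As characters separate points, \<open>Y\<close> is flat (\<open>flat_of_annihilator_Ext_trivial\<close>).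
\<close>

section \<open>Linear maps\<close>

text \<open>
  The functions in \<open>module_hom\<close> are normalised outside the carrier. Composition and pointwise
  operations are simpler for functions that are only constrained on the carrier.
\<close>

definition linear_map ::
    "'r ring \<Rightarrow> ('r, 'm) module \<Rightarrow> ('r, 'n) module \<Rightarrow> ('m \<Rightarrow> 'n) \<Rightarrow> bool" where
  "linear_map R M N f \<longleftrightarrow>
     (\<forall>x\<in>carrier M. f x \<in> carrier N) \<and>
     (\<forall>x\<in>carrier M. \<forall>y\<in>carrier M. f (x \<oplus>\<^bsub>M\<^esub> y) = f x \<oplus>\<^bsub>N\<^esub> f y) \<and>
     (\<forall>r\<in>carrier R. \<forall>x\<in>carrier M. f (r \<odot>\<^bsub>M\<^esub> x) = r \<odot>\<^bsub>N\<^esub> f x)"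

lemma linear_mapI:
  assumes "\<And>x. x \<in> carrier M \<Longrightarrow> f x \<in> carrier N"
    and "\<And>x y. x \<in> carrier M \<Longrightarrow> y \<in> carrier M \<Longrightarrow> f (x \<oplus>\<^bsub>M\<^esub> y) = f x \<oplus>\<^bsub>N\<^esub> f y"
    and "\<And>r x. r \<in> carrier R \<Longrightarrow> x \<in> carrier M \<Longrightarrow> f (r \<odot>\<^bsub>M\<^esub> x) = r \<odot>\<^bsub>N\<^esub> f x"
  shows "linear_map R M N f"
  using assms by (simp add: linear_map_def)

lemma linear_closed: "linear_map R M N f \<Longrightarrow> x \<in> carrier M \<Longrightarrow> f x \<in> carrier N"
  and linear_add: "linear_map R M N f \<Longrightarrow> x \<in> carrier M \<Longrightarrow> y \<in> carrier M \<Longrightarrow>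
    f (x \<oplus>\<^bsub>M\<^esub> y) = f x \<oplus>\<^bsub>N\<^esub> f y"
  and linear_smult: "linear_map R M N f \<Longrightarrow> r \<in> carrier R \<Longrightarrow> x \<in> carrier M \<Longrightarrow>
    f (r \<odot>\<^bsub>M\<^esub> x) = r \<odot>\<^bsub>N\<^esub> f x"
  by (simp_all add: linear_map_def)

lemma module_hom_linear: "f \<in> module_hom R M N \<Longrightarrow> linear_map R M N f"
  by (auto simp: module_hom_def linear_map_def)

lemma module_hom_extensional: "f \<in> module_hom R M N \<Longrightarrow> f \<in> extensional (carrier M)"
  by (auto simp: module_hom_def PiE_def)

context abelian_group
begin

lemma minus_self [simp]: "x \<in> carrier G \<Longrightarrow> x \<ominus> x = \<zero>"
  by (simp add: a_minus_def r_neg)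

lemma minus_zero_right [simp]: "x \<in> carrier G \<Longrightarrow> x \<ominus> \<zero> = x"
  by (metis minus_self a_minus_def l_zero r_zero zero_closed a_inv_closed)

lemma minus_eq_zero_iff: "x \<in> carrier G \<Longrightarrow> y \<in> carrier G \<Longrightarrow> x \<ominus> y = \<zero> \<longleftrightarrow> x = y"
  by (metis a_minus_def a_inv_closed minus_equality minus_minus r_neg)

lemma minus_plus_telescope:
  assumes "x \<in> carrier G" "y \<in> carrier G" "z \<in> carrier G"
  shows "(x \<ominus> y) \<oplus> (y \<ominus> z) = x \<ominus> z"
  using assms by (simp add: a_minus_def a_assoc r_neg1)

lemma minus_plus_cancel:
  assumes "x \<in> carrier G" "y \<in> carrier G"
  shows "(x \<ominus> y) \<oplus> y = x"
  using assms by (simp add: a_minus_def a_assoc l_neg)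

lemma uminus_minus:
  assumes "x \<in> carrier G" "y \<in> carrier G"
  shows "\<ominus> (x \<ominus> y) = y \<ominus> x"
  using assms by (simp add: a_minus_def minus_add a_comm)

lemma plus_minus_minus:
  assumes "x \<in> carrier G" "y \<in> carrier G"
  shows "(x \<oplus> y) \<ominus> x \<ominus> y = \<zero>"
proof -
  have "(x \<oplus> y) \<ominus> x = y" using assms by (simp add: a_minus_def a_assoc r_neg a_comm[of x y])
  then show ?thesis using assms by simp
qed

lemma minus_minus_cancel:
  assumes "x \<in> carrier G" "y \<in> carrier G" "z \<in> carrier G"
  shows "(x \<ominus> z) \<ominus> (y \<ominus> z) = x \<ominus> y"
proof -
  have "(x \<ominus> z) \<ominus> (y \<ominus> z) = (x \<ominus> z) \<oplus> (z \<ominus> y)"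
    using assms uminus_minus by (simp add: a_minus_def[of _ "x \<ominus> z"])
  then show ?thesis using assms by (simp add: minus_plus_telescope)
qed

lemma minus_minus_cancel_left:
  assumes "x \<in> carrier G" "y \<in> carrier G" "z \<in> carrier G"
  shows "(x \<ominus> z) \<ominus> (x \<ominus> y) = y \<ominus> z"
proof -
  have "(x \<ominus> z) \<ominus> (x \<ominus> y) = (y \<ominus> x) \<oplus> (x \<ominus> z)"
    using assms uminus_minus by (simp add: a_minus_def[of _ "x \<ominus> z"] a_comm)
  then show ?thesis using assms by (simp add: minus_plus_telescope)
qed

lemma plus_minus_plus:
  assumes "x \<in> carrier G" "y \<in> carrier G" "z \<in> carrier G" "w \<in> carrier G"
  shows "(x \<oplus> y) \<ominus> (z \<oplus> w) = (x \<ominus> z) \<oplus> (y \<ominus> w)"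
  using assms by (simp add: a_minus_def minus_add a_ac)

lemma uminus_zero [simp]: "\<ominus> \<zero> = \<zero>"
  by (rule minus_equality) simp_all

lemma minus_cong_swap:
  assumes "x \<in> carrier G" "x' \<in> carrier G" "y \<in> carrier G" "y' \<in> carrier G"
    and "y \<ominus> y' = x \<ominus> x'"
  shows "x \<ominus> y = x' \<ominus> y'"
proof -
  have "x \<ominus> y = ((x \<ominus> x') \<oplus> x') \<ominus> ((y \<ominus> y') \<oplus> y')" using assms(1-4) by (simp add: minus_plus_cancel)
  also have "\<dots> = x' \<ominus> y'" using assms by (simp add: plus_minus_plus)
  finally show ?thesis .
qed

end

context left_module
begin

lemma smult_l_null [simp]: "x \<in> carrier M \<Longrightarrow> \<zero> \<odot>\<^bsub>M\<^esub> x = \<zero>\<^bsub>M\<^esub>"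
  by (metis M.add.r_cancel_one' R.r_zero R.zero_closed smult_closed smult_l_distr)

lemma smult_r_null [simp]: "r \<in> carrier R \<Longrightarrow> r \<odot>\<^bsub>M\<^esub> \<zero>\<^bsub>M\<^esub> = \<zero>\<^bsub>M\<^esub>"
  by (metis M.add.r_cancel_one' M.r_zero M.zero_closed smult_closed smult_r_distr)

lemma smult_r_minus:
  "r \<in> carrier R \<Longrightarrow> x \<in> carrier M \<Longrightarrow> r \<odot>\<^bsub>M\<^esub> (\<ominus>\<^bsub>M\<^esub> x) = \<ominus>\<^bsub>M\<^esub> (r \<odot>\<^bsub>M\<^esub> x)"
  by (metis M.a_inv_closed M.minus_equality M.l_neg smult_closed smult_r_distr smult_r_null)

lemma smult_l_minus:
  "r \<in> carrier R \<Longrightarrow> x \<in> carrier M \<Longrightarrow> (\<ominus> r) \<odot>\<^bsub>M\<^esub> x = \<ominus>\<^bsub>M\<^esub> (r \<odot>\<^bsub>M\<^esub> x)"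
  by (metis M.minus_equality R.a_inv_closed R.l_neg smult_closed smult_l_distr smult_l_null)

lemma smult_finsum:
  assumes r: "r \<in> carrier R" and A: "finite A" and f: "\<And>a. a \<in> A \<Longrightarrow> f a \<in> carrier M"
  shows "r \<odot>\<^bsub>M\<^esub> (\<Oplus>\<^bsub>M\<^esub>a\<in>A. f a) = (\<Oplus>\<^bsub>M\<^esub>a\<in>A. r \<odot>\<^bsub>M\<^esub> f a)"
  using A f
proof (induction A rule: finite_induct)
  case empty
  then show ?case by (simp add: r)
next
  case (insert a A)
  have "finsum M f (insert a A) = f a \<oplus>\<^bsub>M\<^esub> finsum M f A"
    by (rule M.finsum_insert) (use insert in auto)
  moreover have "(\<Oplus>\<^bsub>M\<^esub>i\<in>insert a A. r \<odot>\<^bsub>M\<^esub> f i) = r \<odot>\<^bsub>M\<^esub> f a \<oplus>\<^bsub>M\<^esub> (\<Oplus>\<^bsub>M\<^esub>i\<in>A. r \<odot>\<^bsub>M\<^esub> f i)"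
    by (rule M.finsum_insert) (use insert r in \<open>auto intro: smult_closed\<close>)
  moreover have "finsum M f A \<in> carrier M"
    by (rule M.finsum_closed) (use insert in auto)
  ultimately show ?case
    using insert r by (simp add: smult_r_distr)
qed

lemma submodule_left_module:
  assumes "submodule H R M"
  shows "left_module R (M\<lparr>carrier := H\<rparr>)"
proof -
  interpret H: submodule H R M by fact
  have sub: "H \<subseteq> carrier M" using H.subset by simp
  have z: "\<zero>\<^bsub>M\<^esub> \<in> H" using H.one_closed by simp
  have a: "x \<in> H \<Longrightarrow> y \<in> H \<Longrightarrow> x \<oplus>\<^bsub>M\<^esub> y \<in> H" for x y using H.m_closed by simp
  have i: "x \<in> H \<Longrightarrow> \<ominus>\<^bsub>M\<^esub> x \<in> H" for x using H.m_inv_closed by (simp add: a_inv_def)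
  have "abelian_group (M\<lparr>carrier := H\<rparr>)"
  proof (rule abelian_groupI, simp_all add: a z)
    fix x assume x: "x \<in> H"
    then show "\<zero>\<^bsub>M\<^esub> \<oplus>\<^bsub>M\<^esub> x = x" using sub by auto
    show "\<exists>y\<in>H. y \<oplus>\<^bsub>M\<^esub> x = \<zero>\<^bsub>M\<^esub>" using x sub i M.l_neg by blast
    show "\<And>y. y \<in> H \<Longrightarrow> x \<oplus>\<^bsub>M\<^esub> y = y \<oplus>\<^bsub>M\<^esub> x" by (metis x sub M.a_comm subset_iff)
    show "\<And>y z. y \<in> H \<Longrightarrow> z \<in> H \<Longrightarrow> x \<oplus>\<^bsub>M\<^esub> y \<oplus>\<^bsub>M\<^esub> z = x \<oplus>\<^bsub>M\<^esub> (y \<oplus>\<^bsub>M\<^esub> z)"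
      by (metis x sub M.a_assoc subset_iff)
  qed
  then show ?thesis
    using sub H.smult_closed R.ring_axioms
    by (simp add: left_module_def left_module_axioms_def smult_l_distr smult_r_distr smult_assoc
        smult_one subset_iff)
qed

lemma submoduleI:
  assumes "H \<subseteq> carrier M" "\<zero>\<^bsub>M\<^esub> \<in> H" "\<And>x y. x \<in> H \<Longrightarrow> y \<in> H \<Longrightarrow> x \<oplus>\<^bsub>M\<^esub> y \<in> H"
    and "\<And>r x. r \<in> carrier R \<Longrightarrow> x \<in> H \<Longrightarrow> r \<odot>\<^bsub>M\<^esub> x \<in> H"
  shows "submodule H R M"
proof -
  have i: "\<ominus>\<^bsub>M\<^esub> x \<in> H" if "x \<in> H" for x
    using assms(4)[of "\<ominus> \<one>" x] that assms(1) by (auto simp: smult_l_minus smult_one subset_iff)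
  show ?thesis
    using assms i by unfold_locales (auto simp: a_inv_def)
qed

lemma submoduleD:
  assumes "submodule H R M"
  shows "H \<subseteq> carrier M" "\<zero>\<^bsub>M\<^esub> \<in> H" "\<And>x y. x \<in> H \<Longrightarrow> y \<in> H \<Longrightarrow> x \<oplus>\<^bsub>M\<^esub> y \<in> H"
    and "\<And>r x. r \<in> carrier R \<Longrightarrow> x \<in> H \<Longrightarrow> r \<odot>\<^bsub>M\<^esub> x \<in> H"
    and "\<And>x. x \<in> H \<Longrightarrow> \<ominus>\<^bsub>M\<^esub> x \<in> H" "\<And>x y. x \<in> H \<Longrightarrow> y \<in> H \<Longrightarrow> x \<ominus>\<^bsub>M\<^esub> y \<in> H"
proof -
  interpret H: submodule H R M by fact
  show *: "H \<subseteq> carrier M" "\<zero>\<^bsub>M\<^esub> \<in> H" "\<And>x y. x \<in> H \<Longrightarrow> y \<in> H \<Longrightarrow> x \<oplus>\<^bsub>M\<^esub> y \<in> H"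
    "\<And>r x. r \<in> carrier R \<Longrightarrow> x \<in> H \<Longrightarrow> r \<odot>\<^bsub>M\<^esub> x \<in> H" "\<And>x. x \<in> H \<Longrightarrow> \<ominus>\<^bsub>M\<^esub> x \<in> H"
    using H.subset H.one_closed H.m_closed H.smult_closed H.m_inv_closed by (auto simp: a_inv_def)
  then show "\<And>x y. x \<in> H \<Longrightarrow> y \<in> H \<Longrightarrow> x \<ominus>\<^bsub>M\<^esub> y \<in> H"
    by (simp add: a_minus_def)
qed

end

lemma linear_zero:
  assumes "left_module R M" "left_module R N" "linear_map R M N f"
  shows "f \<zero>\<^bsub>M\<^esub> = \<zero>\<^bsub>N\<^esub>"
proof -
  interpret M: left_module R M by fact
  interpret N: left_module R N by fact
  show ?thesis
    using linear_smult[OF assms(3), of "\<zero>\<^bsub>R\<^esub>" "\<zero>\<^bsub>M\<^esub>"] linear_closed[OF assms(3)] by simp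
qed

lemma linear_neg:
  assumes "left_module R M" "left_module R N" "linear_map R M N f" "x \<in> carrier M"
  shows "f (\<ominus>\<^bsub>M\<^esub> x) = \<ominus>\<^bsub>N\<^esub> f x"
proof -
  interpret M: left_module R M by fact
  interpret N: left_module R N by fact
  show ?thesis
    using linear_smult[OF assms(3), of "\<ominus>\<^bsub>R\<^esub> \<one>\<^bsub>R\<^esub>" x] linear_closed[OF assms(3)] assms(4)
    by (simp add: M.smult_l_minus N.smult_l_minus M.smult_one N.smult_one)
qed

lemma linear_diff:
  assumes "left_module R M" "left_module R N" "linear_map R M N f" "x \<in> carrier M" "y \<in> carrier M"
  shows "f (x \<ominus>\<^bsub>M\<^esub> y) = f x \<ominus>\<^bsub>N\<^esub> f y"
proof -
  interpret M: left_module R M by fact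
  show ?thesis
    using assms by (simp add: a_minus_def linear_add[OF assms(3)] linear_neg[OF assms(1-3)])
qed

lemma linear_finsum:
  assumes "left_module R M" "left_module R N" "linear_map R M N f"
    and "finite A" "\<And>a. a \<in> A \<Longrightarrow> g a \<in> carrier M"
  shows "f (\<Oplus>\<^bsub>M\<^esub>a\<in>A. g a) = (\<Oplus>\<^bsub>N\<^esub>a\<in>A. f (g a))"
proof -
  interpret M: left_module R M by fact
  interpret N: left_module R N by fact
  note f = assms(3)
  show ?thesis
    using assms(4,5)
  proof (induction A rule: finite_induct)
    case empty
    then show ?case by (simp add: linear_zero[OF assms(1-3)])
  next
    case (insert a A)
    have "finsum M g (insert a A) = g a \<oplus>\<^bsub>M\<^esub> finsum M g A"
      by (rule M.finsum_insert) (use insert in auto)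
    moreover have "(\<Oplus>\<^bsub>N\<^esub>i\<in>insert a A. f (g i)) = f (g a) \<oplus>\<^bsub>N\<^esub> (\<Oplus>\<^bsub>N\<^esub>i\<in>A. f (g i))"
      by (rule N.finsum_insert) (use insert linear_closed[OF f] in auto)
    moreover have "finsum M g A \<in> carrier M"
      by (rule M.finsum_closed) (use insert in auto)
    ultimately show ?case
      using insert by (simp add: linear_add[OF f])
  qed
qed

lemma linear_comp: "linear_map R M N f \<Longrightarrow> linear_map R N P g \<Longrightarrow> linear_map R M P (\<lambda>x. g (f x))"
  by (simp add: linear_map_def)

lemma linear_id: "linear_map R M M (\<lambda>x. x)"
  by (simp add: linear_map_def)

lemma linear_cong:
  assumes "linear_map R M N f" "left_module R M" "\<And>x. x \<in> carrier M \<Longrightarrow> g x = f x"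
  shows "linear_map R M N g"
proof -
  interpret M: left_module R M by fact
  show ?thesis using assms(1,3) by (simp add: linear_map_def M.smult_closed)
qed

lemma linear_module_hom:
  assumes "left_module R M" "linear_map R M N f"
  shows "restrict f (carrier M) \<in> module_hom R M N"
proof -
  interpret M: left_module R M by fact
  show ?thesis using assms(2) by (auto simp: module_hom_def linear_map_def M.smult_closed)
qed

lemma linear_const_zero: "left_module R N \<Longrightarrow> linear_map R M N (\<lambda>_. \<zero>\<^bsub>N\<^esub>)"
proof -
  assume "left_module R N"
  then interpret N: left_module R N .
  show ?thesis by (simp add: linear_map_def)
qed

lemma linear_plus:
  assumes "left_module R N" "linear_map R M N f" "linear_map R M N g"
  shows "linear_map R M N (\<lambda>x. f x \<oplus>\<^bsub>N\<^esub> g x)"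
proof -
  interpret N: left_module R N by fact
  show ?thesis
    using assms(2,3) by (auto simp: linear_map_def N.smult_r_distr N.a_ac)
qed

lemma linear_uminus:
  assumes "left_module R N" "linear_map R M N f"
  shows "linear_map R M N (\<lambda>x. \<ominus>\<^bsub>N\<^esub> f x)"
proof -
  interpret N: left_module R N by fact
  show ?thesis
    using assms(2) by (auto simp: linear_map_def N.smult_r_minus N.minus_add)
qed

lemma linear_minus:
  assumes "left_module R N" "linear_map R M N f" "linear_map R M N g"
  shows "linear_map R M N (\<lambda>x. f x \<ominus>\<^bsub>N\<^esub> g x)"
  using linear_plus[OF assms(1,2) linear_uminus[OF assms(1,3)]] by (simp add: a_minus_def)

definition lin_kernel :: "('r, 'm) module \<Rightarrow> ('r, 'n) module \<Rightarrow> ('m \<Rightarrow> 'n) \<Rightarrow> 'm set" where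
  "lin_kernel M N f = {x \<in> carrier M. f x = \<zero>\<^bsub>N\<^esub>}"

lemma submodule_vimage:
  assumes "left_module R M" "left_module R N" "linear_map R M N f" "submodule H R N"
  shows "submodule {x \<in> carrier M. f x \<in> H} R M"
proof -
  interpret M: left_module R M by fact
  interpret N: left_module R N by fact
  show ?thesis
    by (rule M.submoduleI)
      (auto simp: linear_zero[OF assms(1-3)] N.submoduleD[OF assms(4)] linear_add[OF assms(3)]
        linear_smult[OF assms(3)] M.smult_closed)
qed

lemma submodule_zero: "left_module R M \<Longrightarrow> submodule {\<zero>\<^bsub>M\<^esub>} R M"
proof -
  assume "left_module R M"
  then interpret M: left_module R M .
  show ?thesis by (rule M.submoduleI) auto
qed

lemma submodule_lin_kernel:
  assumes "left_module R M" "left_module R N" "linear_map R M N f"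
  shows "submodule (lin_kernel M N f) R M"
  using submodule_vimage[OF assms submodule_zero[OF assms(2)]] by (simp add: lin_kernel_def)

section \<open>Free modules\<close>

definition basis_vector :: "'r ring \<Rightarrow> 's set \<Rightarrow> 's \<Rightarrow> 's \<Rightarrow> 'r" where
  "basis_vector R S s = (\<lambda>t\<in>S. if t = s then \<one>\<^bsub>R\<^esub> else \<zero>\<^bsub>R\<^esub>)"

definition free_lift :: "'r ring \<Rightarrow> 's set \<Rightarrow> ('r, 'm) module \<Rightarrow> ('s \<Rightarrow> 'm) \<Rightarrow> ('s \<Rightarrow> 'r) \<Rightarrow> 'm" where
  "free_lift R S M g a = (\<Oplus>\<^bsub>M\<^esub>s\<in>{s \<in> S. a s \<noteq> \<zero>\<^bsub>R\<^esub>}. a s \<odot>\<^bsub>M\<^esub> g s)"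

lemma free_module_left_module:
  assumes "ring R" shows "left_module R (free_module R S)"
proof -
  interpret R: ring R by fact
  have fin: "finite {s \<in> S. f s \<noteq> \<zero>\<^bsub>R\<^esub>}"
    if "finite {s \<in> S. a s \<noteq> \<zero>\<^bsub>R\<^esub>}" "finite {s \<in> S. b s \<noteq> \<zero>\<^bsub>R\<^esub>}"
      "\<And>s. s \<in> S \<Longrightarrow> a s = \<zero>\<^bsub>R\<^esub> \<Longrightarrow> b s = \<zero>\<^bsub>R\<^esub> \<Longrightarrow> f s = \<zero>\<^bsub>R\<^esub>" for a b f
    by (rule finite_subset[OF _ finite_UnI[OF that(1,2)]]) (use that(3) in auto)
  have "abelian_group (free_module R S)"
  proof (rule abelian_groupI)
    fix x assume x: "x \<in> carrier (free_module R S)"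
    show "\<exists>y\<in>carrier (free_module R S). y \<oplus>\<^bsub>free_module R S\<^esub> x = \<zero>\<^bsub>free_module R S\<^esub>"
      using x fin[of x x "\<lambda>s\<in>S. \<ominus>\<^bsub>R\<^esub> x s"]
      by (intro bexI[of _ "\<lambda>s\<in>S. \<ominus>\<^bsub>R\<^esub> x s"])
        (auto simp: free_module_def R.l_neg PiE_iff intro!: restrict_ext)
    fix y assume y: "y \<in> carrier (free_module R S)"
    show "x \<oplus>\<^bsub>free_module R S\<^esub> y \<in> carrier (free_module R S)"
      using x y fin[of x y "\<lambda>s\<in>S. x s \<oplus>\<^bsub>R\<^esub> y s"] by (auto simp: free_module_def)
  qed (auto simp: free_module_def fun_eq_iff R.a_ac PiE_iff extensional_def)
  moreover have "left_module_axioms R (free_module R S)"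
  proof (rule left_module_axioms.intro)
    fix r x assume "r \<in> carrier R" "x \<in> carrier (free_module R S)"
    then show "r \<odot>\<^bsub>free_module R S\<^esub> x \<in> carrier (free_module R S)"
      using fin[of x x "\<lambda>s\<in>S. r \<otimes>\<^bsub>R\<^esub> x s"] by (auto simp: free_module_def)
  qed (auto simp: free_module_def fun_eq_iff R.l_distr R.r_distr R.m_assoc PiE_iff extensional_def)
  ultimately show ?thesis
    by (simp add: left_module_def assms)
qed

lemma basis_vector_closed: "ring R \<Longrightarrow> s \<in> S \<Longrightarrow> basis_vector R S s \<in> carrier (free_module R S)"
proof -
  assume "ring R" "s \<in> S"
  interpret R: ring R by fact
  have "finite {t \<in> S. basis_vector R S s t \<noteq> \<zero>\<^bsub>R\<^esub>}"
    by (rule finite_subset[of _ "{s}"]) (auto simp: basis_vector_def)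
  then show ?thesis by (simp add: free_module_def) (auto simp: basis_vector_def)
qed

lemma free_module_induct [consumes 2, case_names zero add]:
  assumes "ring R" "a \<in> carrier (free_module R S)"
    and zero: "P \<zero>\<^bsub>free_module R S\<^esub>"
    and add: "\<And>r s b. r \<in> carrier R \<Longrightarrow> s \<in> S \<Longrightarrow> b \<in> carrier (free_module R S) \<Longrightarrow> P b \<Longrightarrow>
       P (r \<odot>\<^bsub>free_module R S\<^esub> basis_vector R S s \<oplus>\<^bsub>free_module R S\<^esub> b)"
  shows "P a"
proof -
  interpret R: ring R by fact
  have "finite F \<Longrightarrow> a \<in> carrier (free_module R S) \<Longrightarrow> {s \<in> S. a s \<noteq> \<zero>\<^bsub>R\<^esub>} \<subseteq> F \<Longrightarrow> P a" for F a
  proof (induction F arbitrary: a rule: finite_induct)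
    case empty
    then have "a = \<zero>\<^bsub>free_module R S\<^esub>"
      by (auto simp: free_module_def fun_eq_iff PiE_iff extensional_def)
    then show ?case using zero by simp
  next
    case (insert s F)
    show ?case
    proof (cases "s \<in> S")
      case False
      then show ?thesis using insert by blast
    next
      case True
      define b where "b = (\<lambda>t\<in>S. if t = s then \<zero>\<^bsub>R\<^esub> else a t)"
      have "{t \<in> S. b t \<noteq> \<zero>\<^bsub>R\<^esub>} \<subseteq> {s \<in> S. a s \<noteq> \<zero>\<^bsub>R\<^esub>}" by (auto simp: b_def)
      then have b: "b \<in> carrier (free_module R S)"
        using insert.prems(1) finite_subset[of "{t \<in> S. b t \<noteq> \<zero>\<^bsub>R\<^esub>}" "{s \<in> S. a s \<noteq> \<zero>\<^bsub>R\<^esub>}"]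
        by (simp add: free_module_def) (auto simp: b_def)
      have "P b" by (rule insert.IH[OF b]) (use insert.prems in \<open>auto simp: b_def\<close>)
      moreover have "a = a s \<odot>\<^bsub>free_module R S\<^esub> basis_vector R S s \<oplus>\<^bsub>free_module R S\<^esub> b"
        using insert.prems(1) True
        by (auto simp: free_module_def fun_eq_iff PiE_iff extensional_def b_def basis_vector_def)
      moreover have "a s \<in> carrier R" using insert.prems(1) True by (auto simp: free_module_def)
      ultimately show ?thesis using add[OF _ True b] by metis
    qed
  qed
  then show ?thesis using assms(2) by (auto simp: free_module_def)
qed

lemma free_lift_superset:
  assumes "left_module R M" "g \<in> S \<rightarrow> carrier M" "a \<in> carrier (free_module R S)"
    and "finite F" "F \<subseteq> S" "{s \<in> S. a s \<noteq> \<zero>\<^bsub>R\<^esub>} \<subseteq> F"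
  shows "free_lift R S M g a = (\<Oplus>\<^bsub>M\<^esub>s\<in>F. a s \<odot>\<^bsub>M\<^esub> g s)"
proof -
  interpret M: left_module R M by fact
  have a: "a s \<in> carrier R" if "s \<in> S" for s using assms(3) that by (auto simp: free_module_def)
  show ?thesis unfolding free_lift_def
    by (rule M.add.finprod_mono_neutral_cong_left)
      (use assms(2,4-6) a in \<open>auto simp: Pi_iff subset_iff intro!: M.smult_closed M.smult_l_null\<close>)
qed

lemma free_lift_linear:
  assumes "left_module R M" "g \<in> S \<rightarrow> carrier M"
  shows "linear_map R (free_module R S) M (free_lift R S M g)"
proof -
  interpret M: left_module R M by fact
  interpret F: left_module R "free_module R S" by (rule free_module_left_module) (rule M.R.ring_axioms)
  have c: "a s \<in> carrier R" if "s \<in> S" "a \<in> carrier (free_module R S)" for a s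
    using that by (auto simp: free_module_def)
  have g: "g s \<in> carrier M" if "s \<in> S" for s using assms(2) that by auto
  note sup = free_lift_superset[OF assms]
  show ?thesis
  proof (rule linear_mapI)
    fix a assume a: "a \<in> carrier (free_module R S)"
    show "free_lift R S M g a \<in> carrier M"
      unfolding free_lift_def by (rule M.finsum_closed) (use a c g in \<open>auto intro!: M.smult_closed\<close>)
    fix r assume r: "r \<in> carrier R"
    have fa: "finite {s \<in> S. a s \<noteq> \<zero>\<^bsub>R\<^esub>}" using a by (auto simp: free_module_def)
    have "free_lift R S M g (r \<odot>\<^bsub>free_module R S\<^esub> a) =
        (\<Oplus>\<^bsub>M\<^esub>s\<in>{s \<in> S. a s \<noteq> \<zero>\<^bsub>R\<^esub>}. (r \<odot>\<^bsub>free_module R S\<^esub> a) s \<odot>\<^bsub>M\<^esub> g s)"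
      by (rule sup) (use a r fa F.smult_closed in \<open>auto simp: free_module_def\<close>)
    also have "\<dots> = (\<Oplus>\<^bsub>M\<^esub>s\<in>{s \<in> S. a s \<noteq> \<zero>\<^bsub>R\<^esub>}. r \<odot>\<^bsub>M\<^esub> (a s \<odot>\<^bsub>M\<^esub> g s))"
      by (rule M.finsum_cong') (use a r c g in \<open>auto simp: free_module_def M.smult_assoc intro!: M.smult_closed\<close>)
    also have "\<dots> = r \<odot>\<^bsub>M\<^esub> free_lift R S M g a"
      unfolding free_lift_def by (rule M.smult_finsum[symmetric]) (use fa a c r g in \<open>auto intro!: M.smult_closed\<close>)
    finally show "free_lift R S M g (r \<odot>\<^bsub>free_module R S\<^esub> a) = r \<odot>\<^bsub>M\<^esub> free_lift R S M g a" .
  next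
    fix a b assume a: "a \<in> carrier (free_module R S)" and b: "b \<in> carrier (free_module R S)"
    let ?F = "{s \<in> S. a s \<noteq> \<zero>\<^bsub>R\<^esub>} \<union> {s \<in> S. b s \<noteq> \<zero>\<^bsub>R\<^esub>}"
    have F: "finite ?F" using a b by (auto simp: free_module_def)
    have "free_lift R S M g (a \<oplus>\<^bsub>free_module R S\<^esub> b) =
        (\<Oplus>\<^bsub>M\<^esub>s\<in>?F. (a \<oplus>\<^bsub>free_module R S\<^esub> b) s \<odot>\<^bsub>M\<^esub> g s)"
      by (rule sup) (use a b F F.a_closed[OF a b] in \<open>auto simp: free_module_def\<close>)
    also have "\<dots> = (\<Oplus>\<^bsub>M\<^esub>s\<in>?F. a s \<odot>\<^bsub>M\<^esub> g s \<oplus>\<^bsub>M\<^esub> b s \<odot>\<^bsub>M\<^esub> g s)"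
      by (rule M.finsum_cong')
        (use a b c g in \<open>auto simp: free_module_def M.smult_l_distr intro!: M.smult_closed\<close>)
    also have "\<dots> = (\<Oplus>\<^bsub>M\<^esub>s\<in>?F. a s \<odot>\<^bsub>M\<^esub> g s) \<oplus>\<^bsub>M\<^esub> (\<Oplus>\<^bsub>M\<^esub>s\<in>?F. b s \<odot>\<^bsub>M\<^esub> g s)"
      by (rule M.finsum_addf) (use a b c g in \<open>auto intro!: M.smult_closed\<close>)
    also have "\<dots> = free_lift R S M g a \<oplus>\<^bsub>M\<^esub> free_lift R S M g b"
      using sup[of a ?F] sup[of b ?F] a b F by auto
    finally show "free_lift R S M g (a \<oplus>\<^bsub>free_module R S\<^esub> b) =
        free_lift R S M g a \<oplus>\<^bsub>M\<^esub> free_lift R S M g b" .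
  qed
qed

lemma free_lift_basis:
  assumes "left_module R M" "g \<in> S \<rightarrow> carrier M" "s \<in> S"
  shows "free_lift R S M g (basis_vector R S s) = g s"
proof -
  interpret M: left_module R M by fact
  have g: "g s \<in> carrier M" using assms by auto
  have "free_lift R S M g (basis_vector R S s) = (\<Oplus>\<^bsub>M\<^esub>t\<in>{s}. basis_vector R S s t \<odot>\<^bsub>M\<^esub> g t)"
    by (rule free_lift_superset[OF assms(1,2) basis_vector_closed])
      (use assms M.R.ring_axioms in \<open>auto simp: basis_vector_def\<close>)
  also have "\<dots> = g s"
    using g assms(3) by (simp add: basis_vector_def M.smult_one)
  finally show ?thesis .
qed

lemma free_lift_unique:
  assumes "left_module R M" "linear_map R (free_module R S) M f" "linear_map R (free_module R S) M f'"
    and "\<And>s. s \<in> S \<Longrightarrow> f (basis_vector R S s) = f' (basis_vector R S s)"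
    and "a \<in> carrier (free_module R S)"
  shows "f a = f' a"
proof -
  interpret M: left_module R M by fact
  interpret F: left_module R "free_module R S" by (rule free_module_left_module) (rule M.R.ring_axioms)
  show ?thesis
    using M.R.ring_axioms assms(5)
  proof (induction a rule: free_module_induct)
    case zero
    then show ?case
      using linear_zero[OF F.left_module_axioms assms(1)] assms(2,3) by metis
  next
    case (add r s b)
    have e: "basis_vector R S s \<in> carrier (free_module R S)"
      using basis_vector_closed M.R.ring_axioms add by metis
    show ?case
      using add e by (simp add: linear_add[OF assms(2)] linear_add[OF assms(3)]
        linear_smult[OF assms(2)] linear_smult[OF assms(3)] assms(4) F.smult_closed)
  qed
qed

lemma free_lift_cong:
  assumes "left_module R M" "g \<in> S \<rightarrow> carrier M" "g' \<in> S \<rightarrow> carrier M"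
    and "a \<in> carrier (free_module R S)" "a' \<in> carrier (free_module R S)"
    and eq: "\<And>s. s \<in> S \<Longrightarrow> a s \<noteq> \<zero>\<^bsub>R\<^esub> \<or> a' s \<noteq> \<zero>\<^bsub>R\<^esub> \<Longrightarrow> a s \<odot>\<^bsub>M\<^esub> g s = a' s \<odot>\<^bsub>M\<^esub> g' s"
  shows "free_lift R S M g a = free_lift R S M g' a'"
proof -
  interpret M: left_module R M by fact
  let ?T = "{s \<in> S. a s \<noteq> \<zero>\<^bsub>R\<^esub>} \<union> {s \<in> S. a' s \<noteq> \<zero>\<^bsub>R\<^esub>}"
  have T: "finite ?T" using assms(4,5) by (simp add: free_module_def)
  have "free_lift R S M g a = (\<Oplus>\<^bsub>M\<^esub>s\<in>?T. a s \<odot>\<^bsub>M\<^esub> g s)"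
    by (rule free_lift_superset[OF assms(1,2,4) T]) auto
  also have "\<dots> = (\<Oplus>\<^bsub>M\<^esub>s\<in>?T. a' s \<odot>\<^bsub>M\<^esub> g' s)"
    by (rule M.finsum_cong') (use assms(3,5) eq in \<open>auto simp: free_module_def intro!: M.smult_closed\<close>)
  also have "\<dots> = free_lift R S M g' a'"
    by (rule free_lift_superset[symmetric, OF assms(1,3,5) T]) auto
  finally show ?thesis .
qed

lemma free_lift_eqI:
  assumes M: "left_module R M" and f: "linear_map R (free_module R S) M f"
    and a: "a \<in> carrier (free_module R S)"
  shows "f a = free_lift R S M (\<lambda>s. f (basis_vector R S s)) a"
proof -
  interpret M: left_module R M by fact
  have g: "(\<lambda>s. f (basis_vector R S s)) \<in> S \<rightarrow> carrier M"
    by (auto intro: linear_closed[OF f] basis_vector_closed[OF M.R.ring_axioms])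
  show ?thesis
    by (rule free_lift_unique[OF M f free_lift_linear[OF M g] _ a]) (simp add: free_lift_basis[OF M g])
qed

lemma free_cover_eq:
  "a \<in> carrier (free_module R S) \<Longrightarrow> free_cover R M S a = free_lift R S M (\<lambda>s. s) a"
  by (simp add: free_cover_def free_lift_def)

lemma free_cover_linear:
  assumes "left_module R M" "S \<subseteq> carrier M"
  shows "linear_map R (free_module R S) M (free_cover R M S)"
proof -
  interpret M: left_module R M by fact
  show ?thesis
    by (rule linear_cong[OF free_lift_linear[OF assms(1)]])
      (use assms in \<open>auto simp: free_cover_eq intro!: free_module_left_module M.R.ring_axioms\<close>)
qed

lemma free_cover_basis:
  assumes "left_module R M" "S \<subseteq> carrier M" "s \<in> S"
  shows "free_cover R M S (basis_vector R S s) = s"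
proof -
  interpret M: left_module R M by fact
  show ?thesis
    using assms by (subst free_cover_eq)
      (auto simp: free_lift_basis basis_vector_closed[OF M.R.ring_axioms] subset_iff)
qed

lemma free_cover_onto:
  assumes "left_module R M" "x \<in> carrier M"
  obtains a where "a \<in> carrier (free_module R (carrier M))" "free_cover R M (carrier M) a = x"
proof -
  interpret M: left_module R M by fact
  show thesis
    using that[OF basis_vector_closed[OF M.R.ring_axioms assms(2)] free_cover_basis[OF assms(1) _ assms(2)]]
    by simp
qed

section \<open>Cardinalities below the universe\<close>

lemma card_le_image: "|A| <o (r :: 'c rel) \<Longrightarrow> |f ` A| <o r"
  using card_of_image ordLeq_ordLess_trans by blast

lemma card_le_subset: "A \<subseteq> B \<Longrightarrow> |B| <o (r :: 'c rel) \<Longrightarrow> |A| <o r"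
  using card_of_mono1 ordLeq_ordLess_trans by blast

lemma card_le_inj:
  assumes "inj_on f A" "f ` A \<subseteq> B" "|B| <o (r :: 'c rel)"
  shows "|A| <o r"
  using assms card_of_ordLeqI[of f A B] ordLeq_ordLess_trans by blast

context
  assumes U: "universe TYPE('u)"
begin

lemma universe_infinite: "infinite (UNIV :: 'u set)"
  using U by (auto simp: universe_def intro: finite_subset[OF subset_UNIV])

lemma universe_nat: "|UNIV :: nat set| <o |UNIV :: 'u set|"
proof -
  obtain A :: "'u set" where A: "infinite A" "|A| <o |UNIV :: 'u set|"
    using U by (auto simp: universe_def small_def)
  then show ?thesis
    using infinite_iff_card_of_nat ordLeq_ordLess_trans by blast
qed

lemma universe_countable: "countable A \<Longrightarrow> |A| <o |UNIV :: 'u set|"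
  using universe_nat by (metis card_le_inj countable_def subset_UNIV)

lemma universe_Pow:
  assumes "|A| <o |UNIV :: 'u set|"
  shows "|Pow A| <o |UNIV :: 'u set|"
proof -
  obtain f where f: "inj_on f A" "range f \<subseteq> (UNIV :: 'u set)"
    using assms ordLess_imp_ordLeq[OF assms] by (metis card_of_ordLeq subset_UNIV)
  have "|f ` A| <o |UNIV :: 'u set|"
    by (rule card_le_image[OF assms])
  then have "|Pow (f ` A)| <o |UNIV :: 'u set|"
    using U by (auto simp: universe_def small_def)
  moreover have "inj_on (image f) (Pow A)"
    by (rule inj_on_image_Pow[OF f(1)])
  ultimately show ?thesis
    by (rule card_le_inj[rotated 2]) auto
qed

lemma universe_Times:
  assumes "|A| <o |UNIV :: 'u set|" "|B| <o |UNIV :: 'u set|"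
  shows "|A \<times> B| <o |UNIV :: 'u set|"
  using assms card_of_Times_ordLess_infinite[OF universe_infinite] by blast

lemma universe_PiE:
  assumes "|A| <o |UNIV :: 'u set|" "|B| <o |UNIV :: 'u set|"
  shows "|A \<rightarrow>\<^sub>E B| <o |UNIV :: 'u set|"
proof (rule card_le_inj)
  show "|Pow (A \<times> B)| <o |UNIV :: 'u set|"
    by (intro universe_Pow universe_Times assms)
  show "inj_on (\<lambda>f. (\<lambda>a. (a, f a)) ` A) (A \<rightarrow>\<^sub>E B)"
  proof (rule inj_onI)
    fix f g assume f: "f \<in> A \<rightarrow>\<^sub>E B" "g \<in> A \<rightarrow>\<^sub>E B" and "(\<lambda>a. (a, f a)) ` A = (\<lambda>a. (a, g a)) ` A"
    then have "\<forall>a\<in>A. f a = g a" by blast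
    then show "f = g" using f by (metis PiE_ext)
  qed
qed auto

lemma universe_complex: "|UNIV :: complex set| <o |UNIV :: 'u set|"
proof -
  have 1: "|Pow (UNIV :: rat set)| <o |UNIV :: 'u set|"
    by (intro universe_Pow universe_countable) simp
  have "inj (\<lambda>x :: real. {q. of_rat q < x})"
  proof (rule injI, rule ccontr)
    fix x y :: real
    assume eq: "{q. of_rat q < x} = {q. of_rat q < y}" and "x \<noteq> y"
    then have "x < y \<or> y < x" by linarith
    then obtain q where "(x < of_rat q \<and> of_rat q < y) \<or> (y < of_rat q \<and> of_rat q < x)"
      using of_rat_dense by metis
    then show False using eq by (auto simp: set_eq_iff) (meson less_asym)+
  qed
  then have "|UNIV :: real set| <o |UNIV :: 'u set|"
    using card_le_inj[OF _ _ 1] by blast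
  then have 2: "|(UNIV :: real set) \<times> (UNIV :: real set)| <o |UNIV :: 'u set|"
    by (intro universe_Times)
  have "inj (\<lambda>z. (Re z, Im z))" by (rule injI) (simp add: complex_eq_iff)
  then show ?thesis using card_le_inj[OF _ _ 2] by blast
qed

lemma universe_free_module:
  fixes R :: "'r ring"
  assumes "|carrier R| <o |UNIV :: 'u set|" "|S| <o |UNIV :: 'u set|"
  shows "|carrier (free_module R S)| <o |UNIV :: 'u set|"
  by (rule card_le_subset[OF _ universe_PiE[OF assms(2,1)]]) (auto simp: free_module_def)

end

section \<open>Small quotients\<close>

text \<open>
  The module structure that makes \<open>\<rho>\<close> linear, transported along a section of \<open>\<rho>\<close>. It is a module
  whenever the fibres of \<open>\<rho>\<close> are the cosets of a submodule.
\<close>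

definition induced_module :: "('r, 'm) module \<Rightarrow> ('m \<Rightarrow> 'n) \<Rightarrow> ('r, 'n) module" where
  "induced_module M \<rho> =
     (let \<sigma> = inv_into (carrier M) \<rho> in
      \<lparr>carrier = \<rho> ` carrier M, monoid.mult = undefined, monoid.one = undefined,
       ring.zero = \<rho> \<zero>\<^bsub>M\<^esub>, ring.add = (\<lambda>a b. \<rho> (\<sigma> a \<oplus>\<^bsub>M\<^esub> \<sigma> b)),
       smult = (\<lambda>r a. \<rho> (r \<odot>\<^bsub>M\<^esub> \<sigma> a))\<rparr>)"

text \<open>
  Cosets are sets of elements. Choosing one element of each coset and embedding the chosen elements
  into \<open>'u\<close> makes the quotient a member of \<open>modules R\<close>, to which hypotheses about that class apply.
\<close>

lemma quotient_exists:
  fixes M :: "('r, 'm) module"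
  assumes M: "left_module R M" and N: "submodule N R M"
    and card: "|carrier M| <o |UNIV :: 'u set|"
  obtains X :: "('r, 'u) module" and \<rho> where "X \<in> modules R" "linear_map R M X \<rho>"
    "\<rho> ` carrier M = carrier X" "\<And>x. x \<in> carrier M \<Longrightarrow> \<rho> x = \<zero>\<^bsub>X\<^esub> \<longleftrightarrow> x \<in> N"
proof -
  interpret M: left_module R M by fact
  note N = M.submoduleD[OF N]
  obtain e :: "'m \<Rightarrow> 'u" where e: "inj_on e (carrier M)"
    using ordLess_imp_ordLeq[OF card] by (metis card_of_ordLeq)
  define rep where "rep x = (SOME y. y \<in> carrier M \<and> x \<ominus>\<^bsub>M\<^esub> y \<in> N)" for x
  have rep: "rep x \<in> carrier M \<and> x \<ominus>\<^bsub>M\<^esub> rep x \<in> N" if "x \<in> carrier M" for x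
    unfolding rep_def by (rule someI[of _ x]) (use that N in auto)
  have rep_eq: "rep x = rep y \<longleftrightarrow> x \<ominus>\<^bsub>M\<^esub> y \<in> N" if xy: "x \<in> carrier M" "y \<in> carrier M" for x y
  proof
    assume eq: "rep x = rep y"
    have "(x \<ominus>\<^bsub>M\<^esub> rep x) \<ominus>\<^bsub>M\<^esub> (y \<ominus>\<^bsub>M\<^esub> rep x) \<in> N"
      by (rule N(6)) (use rep[OF xy(1)] rep[OF xy(2)] eq in auto)
    also have "(x \<ominus>\<^bsub>M\<^esub> rep x) \<ominus>\<^bsub>M\<^esub> (y \<ominus>\<^bsub>M\<^esub> rep x) = x \<ominus>\<^bsub>M\<^esub> y"
      using xy rep[OF xy(1)] by (simp add: M.minus_minus_cancel)
    finally show "x \<ominus>\<^bsub>M\<^esub> y \<in> N" .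
  next
    assume d: "x \<ominus>\<^bsub>M\<^esub> y \<in> N"
    have "x \<ominus>\<^bsub>M\<^esub> z \<in> N \<longleftrightarrow> y \<ominus>\<^bsub>M\<^esub> z \<in> N" if z: "z \<in> carrier M" for z
    proof
      assume "x \<ominus>\<^bsub>M\<^esub> z \<in> N"
      then have "(x \<ominus>\<^bsub>M\<^esub> z) \<ominus>\<^bsub>M\<^esub> (x \<ominus>\<^bsub>M\<^esub> y) \<in> N" using d by (rule N(6))
      also have "(x \<ominus>\<^bsub>M\<^esub> z) \<ominus>\<^bsub>M\<^esub> (x \<ominus>\<^bsub>M\<^esub> y) = y \<ominus>\<^bsub>M\<^esub> z"
        using xy z by (simp add: M.minus_minus_cancel_left)
      finally show "y \<ominus>\<^bsub>M\<^esub> z \<in> N" .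
    next
      assume "y \<ominus>\<^bsub>M\<^esub> z \<in> N"
      then have "(x \<ominus>\<^bsub>M\<^esub> y) \<oplus>\<^bsub>M\<^esub> (y \<ominus>\<^bsub>M\<^esub> z) \<in> N" by (rule N(3)[OF d])
      also have "(x \<ominus>\<^bsub>M\<^esub> y) \<oplus>\<^bsub>M\<^esub> (y \<ominus>\<^bsub>M\<^esub> z) = x \<ominus>\<^bsub>M\<^esub> z"
        using xy z by (simp add: M.minus_plus_telescope)
      finally show "x \<ominus>\<^bsub>M\<^esub> z \<in> N" .
    qed
    then show "rep x = rep y" unfolding rep_def by (metis (lifting))
  qed
  define \<rho> where "\<rho> x = e (rep x)" for x
  define \<sigma> where "\<sigma> = inv_into (carrier M) \<rho>"
  have \<rho>_eq: "\<rho> x = \<rho> y \<longleftrightarrow> x \<ominus>\<^bsub>M\<^esub> y \<in> N" if xy: "x \<in> carrier M" "y \<in> carrier M" for x y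
    using rep_eq[OF xy] rep[OF xy(1)] rep[OF xy(2)] e by (auto simp: \<rho>_def inj_on_def)
  have \<sigma>: "\<sigma> (\<rho> x) \<in> carrier M" "\<rho> (\<sigma> (\<rho> x)) = \<rho> x" if "x \<in> carrier M" for x
    using that by (auto simp: \<sigma>_def inv_into_into f_inv_into_f)
  define X where "X = induced_module M \<rho>"
  have X: "carrier X = \<rho> ` carrier M" "\<zero>\<^bsub>X\<^esub> = \<rho> \<zero>\<^bsub>M\<^esub>" "\<And>a b. a \<oplus>\<^bsub>X\<^esub> b = \<rho> (\<sigma> a \<oplus>\<^bsub>M\<^esub> \<sigma> b)"
     "\<And>r a. r \<odot>\<^bsub>X\<^esub> a = \<rho> (r \<odot>\<^bsub>M\<^esub> \<sigma> a)"
    by (simp_all add: X_def induced_module_def \<sigma>_def Let_def)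
  have add: "\<rho> x \<oplus>\<^bsub>X\<^esub> \<rho> y = \<rho> (x \<oplus>\<^bsub>M\<^esub> y)" if xy: "x \<in> carrier M" "y \<in> carrier M" for x y
  proof -
    have "\<sigma> (\<rho> x) \<ominus>\<^bsub>M\<^esub> x \<in> N" "\<sigma> (\<rho> y) \<ominus>\<^bsub>M\<^esub> y \<in> N"
      using \<rho>_eq \<sigma> xy by auto
    then have "(\<sigma> (\<rho> x) \<ominus>\<^bsub>M\<^esub> x) \<oplus>\<^bsub>M\<^esub> (\<sigma> (\<rho> y) \<ominus>\<^bsub>M\<^esub> y) \<in> N" by (rule N(3))
    also have "(\<sigma> (\<rho> x) \<ominus>\<^bsub>M\<^esub> x) \<oplus>\<^bsub>M\<^esub> (\<sigma> (\<rho> y) \<ominus>\<^bsub>M\<^esub> y) =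
        (\<sigma> (\<rho> x) \<oplus>\<^bsub>M\<^esub> \<sigma> (\<rho> y)) \<ominus>\<^bsub>M\<^esub> (x \<oplus>\<^bsub>M\<^esub> y)"
      using xy \<sigma> by (simp add: M.plus_minus_plus)
    finally show ?thesis using xy \<sigma> by (simp add: X \<rho>_eq)
  qed
  have smult: "r \<odot>\<^bsub>X\<^esub> \<rho> x = \<rho> (r \<odot>\<^bsub>M\<^esub> x)" if xy: "r \<in> carrier R" "x \<in> carrier M" for r x
  proof -
    have "\<sigma> (\<rho> x) \<ominus>\<^bsub>M\<^esub> x \<in> N"
      using \<rho>_eq \<sigma> xy by auto
    then have "r \<odot>\<^bsub>M\<^esub> (\<sigma> (\<rho> x) \<ominus>\<^bsub>M\<^esub> x) \<in> N" by (rule N(4)[OF xy(1)])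
    also have "r \<odot>\<^bsub>M\<^esub> (\<sigma> (\<rho> x) \<ominus>\<^bsub>M\<^esub> x) = r \<odot>\<^bsub>M\<^esub> \<sigma> (\<rho> x) \<ominus>\<^bsub>M\<^esub> r \<odot>\<^bsub>M\<^esub> x"
      using xy \<sigma> by (simp add: a_minus_def M.smult_r_distr M.smult_r_minus)
    finally show ?thesis using xy \<sigma> by (simp add: X \<rho>_eq M.smult_closed)
  qed
  have "abelian_group X"
  proof (rule abelian_groupI)
    fix a assume "a \<in> carrier X"
    then obtain x where x: "x \<in> carrier M" "a = \<rho> x" by (auto simp: X)
    have "\<rho> (\<ominus>\<^bsub>M\<^esub> x) \<oplus>\<^bsub>X\<^esub> a = \<zero>\<^bsub>X\<^esub>"
      using x by (simp add: add X(2) M.l_neg)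
    then show "\<exists>b\<in>carrier X. b \<oplus>\<^bsub>X\<^esub> a = \<zero>\<^bsub>X\<^esub>" using x(1) by (auto simp: X(1))
    show "\<zero>\<^bsub>X\<^esub> \<oplus>\<^bsub>X\<^esub> a = a" using x by (simp add: add X(2))
  qed (auto simp: X(1,2) add M.a_ac)
  then have Xm: "left_module R X"
    using M.R.ring_axioms
    by (auto simp: left_module_def left_module_axioms_def X(1) add smult M.smult_closed
        M.smult_l_distr M.smult_r_distr M.smult_assoc M.smult_one)
  moreover have "|carrier X| <o |UNIV :: 'u set|"
    unfolding X(1) by (rule card_le_image[OF card])
  ultimately have "X \<in> modules R" by (simp add: modules_def small_def)
  moreover have "linear_map R M X \<rho>" by (auto simp: linear_map_def X(1) add smult)
  moreover have "\<rho> x = \<zero>\<^bsub>X\<^esub> \<longleftrightarrow> x \<in> N" if "x \<in> carrier M" for x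
    using that by (simp add: X(2) \<rho>_eq)
  ultimately show thesis using that[of X \<rho>] X(1) by blast
qed

lemma linear_factor:
  assumes "left_module R M" "left_module R X" "left_module R Z"
    and \<rho>: "linear_map R M X \<rho>" "\<rho> ` carrier M = carrier X"
    and h: "linear_map R M Z h" "\<And>x. x \<in> carrier M \<Longrightarrow> \<rho> x = \<zero>\<^bsub>X\<^esub> \<Longrightarrow> h x = \<zero>\<^bsub>Z\<^esub>"
  obtains h' where "linear_map R X Z h'" "\<And>x. x \<in> carrier M \<Longrightarrow> h' (\<rho> x) = h x"
proof -
  interpret M: left_module R M by fact
  interpret X: left_module R X by fact
  interpret Z: left_module R Z by fact
  define \<sigma> where "\<sigma> = inv_into (carrier M) \<rho>"
  have \<sigma>: "\<sigma> a \<in> carrier M" "\<rho> (\<sigma> a) = a" if "a \<in> carrier X" for a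
    using that \<rho>(2) by (auto simp: \<sigma>_def inv_into_into f_inv_into_f)
  have eq: "h x = h y" if "x \<in> carrier M" "y \<in> carrier M" "\<rho> x = \<rho> y" for x y
  proof -
    have "\<rho> (x \<ominus>\<^bsub>M\<^esub> y) = \<zero>\<^bsub>X\<^esub>"
      using that linear_diff[OF assms(1,2) \<rho>(1)] linear_closed[OF \<rho>(1)] by simp
    then have "h x \<ominus>\<^bsub>Z\<^esub> h y = \<zero>\<^bsub>Z\<^esub>"
      using h(2)[of "x \<ominus>\<^bsub>M\<^esub> y"] that linear_diff[OF assms(1,3) h(1)] by simp
    then show ?thesis
      using that linear_closed[OF h(1)] by (simp add: Z.minus_eq_zero_iff)
  qed
  have "linear_map R X Z (\<lambda>a. h (\<sigma> a))"
  proof (rule linear_mapI)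
    fix a b assume ab: "a \<in> carrier X" "b \<in> carrier X"
    have "h (\<sigma> (a \<oplus>\<^bsub>X\<^esub> b)) = h (\<sigma> a \<oplus>\<^bsub>M\<^esub> \<sigma> b)"
      by (rule eq) (use ab \<sigma> in \<open>auto simp: linear_add[OF \<rho>(1)]\<close>)
    then show "h (\<sigma> (a \<oplus>\<^bsub>X\<^esub> b)) = h (\<sigma> a) \<oplus>\<^bsub>Z\<^esub> h (\<sigma> b)"
      using ab \<sigma> by (simp add: linear_add[OF h(1)])
  next
    fix r a assume ra: "r \<in> carrier R" "a \<in> carrier X"
    have "h (\<sigma> (r \<odot>\<^bsub>X\<^esub> a)) = h (r \<odot>\<^bsub>M\<^esub> \<sigma> a)"
      by (rule eq) (use ra \<sigma> in \<open>auto simp: linear_smult[OF \<rho>(1)] X.smult_closed M.smult_closed\<close>)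
    then show "h (\<sigma> (r \<odot>\<^bsub>X\<^esub> a)) = r \<odot>\<^bsub>Z\<^esub> h (\<sigma> a)"
      using ra \<sigma> by (simp add: linear_smult[OF h(1)])
  qed (use \<sigma> linear_closed[OF h(1)] in auto)
  moreover have "h (\<sigma> (\<rho> x)) = h x" if "x \<in> carrier M" for x
    using that \<sigma>[OF linear_closed[OF \<rho>(1) that]] by (intro eq) auto
  ultimately show thesis using that by blast
qed

lemma small_copy:
  fixes M :: "('r, 'm) module"
  assumes M: "left_module R M" and card: "|carrier M| <o |UNIV :: 'u set|"
  obtains X :: "('r, 'u) module" and \<rho> \<sigma> where "X \<in> modules R" "linear_map R M X \<rho>" "linear_map R X M \<sigma>"
    "\<And>x. x \<in> carrier M \<Longrightarrow> \<sigma> (\<rho> x) = x" "\<And>x. x \<in> carrier X \<Longrightarrow> \<rho> (\<sigma> x) = x"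
proof -
  obtain X :: "('r, 'u) module" and \<rho> where X: "X \<in> modules R" "linear_map R M X \<rho>"
    "\<rho> ` carrier M = carrier X" "\<And>x. x \<in> carrier M \<Longrightarrow> \<rho> x = \<zero>\<^bsub>X\<^esub> \<longleftrightarrow> x \<in> {\<zero>\<^bsub>M\<^esub>}"
    using quotient_exists[OF M submodule_zero[OF M] card] by metis
  have Xm: "left_module R X" using X(1) by (simp add: modules_def)
  obtain \<sigma> where \<sigma>: "linear_map R X M \<sigma>" "\<And>x. x \<in> carrier M \<Longrightarrow> \<sigma> (\<rho> x) = x"
    using linear_factor[OF M Xm M X(2,3) linear_id] X(4) by (metis singletonD)
  moreover have "\<rho> (\<sigma> x) = x" if "x \<in> carrier X" for x
    using that X(3) \<sigma>(2) by (metis imageE)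
  ultimately show thesis using that X(1,2) by blast
qed

section \<open>Vanishing of Ext\<close>

abbreviation free_kernel :: "'r ring \<Rightarrow> ('r, 'm) module \<Rightarrow> ('m \<Rightarrow> 'r) set" where
  "free_kernel R X \<equiv> lin_kernel (free_module R (carrier X)) X (free_cover R X (carrier X))"

lemma a_kernel_lin_kernel: "a_kernel M N f = lin_kernel M N f"
  by (simp add: a_kernel_def' lin_kernel_def)

lemma hom_group_comm_group:
  assumes M: "left_module R M" and N: "left_module R N"
  shows "comm_group (hom_group R M N)"
proof -
  interpret M: left_module R M by fact
  interpret N: left_module R N by fact
  have hom: "f \<in> module_hom R M N \<longleftrightarrow> linear_map R M N f \<and> f \<in> extensional (carrier M)" for f
    by (auto simp: module_hom_def linear_map_def PiE_def)
  have ext: "f = g" if "f \<in> module_hom R M N" "g \<in> module_hom R M N"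
      "\<And>x. x \<in> carrier M \<Longrightarrow> f x = g x" for f g
    using that unfolding hom by (intro extensionalityI) auto
  note cl = linear_closed[OF module_hom_linear[of _ R M N]]
  have pl: "(\<lambda>x\<in>carrier M. f x \<oplus>\<^bsub>N\<^esub> g x) \<in> module_hom R M N"
    if "f \<in> module_hom R M N" "g \<in> module_hom R M N" for f g
    by (intro linear_module_hom M linear_plus N module_hom_linear that)
  have ze: "(\<lambda>x\<in>carrier M. \<zero>\<^bsub>N\<^esub>) \<in> module_hom R M N"
    by (intro linear_module_hom M linear_const_zero N)
  show ?thesis
  proof (rule comm_groupI, simp_all add: hom_group_def pl ze)
    fix f g h assume f: "f \<in> module_hom R M N"
    show "(\<lambda>x\<in>carrier M. (if x \<in> carrier M then \<zero>\<^bsub>N\<^esub> else undefined) \<oplus>\<^bsub>N\<^esub> f x) = f"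
      using f cl by (intro ext) (auto intro!: linear_module_hom M linear_cong[OF module_hom_linear[OF f] M])
    have u: "(\<lambda>x\<in>carrier M. \<ominus>\<^bsub>N\<^esub> f x) \<in> module_hom R M N"
      by (intro linear_module_hom M linear_uminus N module_hom_linear f)
    show "\<exists>y\<in>module_hom R M N. (\<lambda>x\<in>carrier M. y x \<oplus>\<^bsub>N\<^esub> f x) = (\<lambda>x\<in>carrier M. \<zero>\<^bsub>N\<^esub>)"
      by (rule bexI[OF _ u]) (use f cl in \<open>auto simp: N.l_neg\<close>)
    assume g: "g \<in> module_hom R M N"
    show "(\<lambda>x\<in>carrier M. f x \<oplus>\<^bsub>N\<^esub> g x) = (\<lambda>x\<in>carrier M. g x \<oplus>\<^bsub>N\<^esub> f x)"
      using f g cl N.a_comm by auto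
    assume h: "h \<in> module_hom R M N"
    show "(\<lambda>x\<in>carrier M. (if x \<in> carrier M then f x \<oplus>\<^bsub>N\<^esub> g x else undefined) \<oplus>\<^bsub>N\<^esub> h x) =
       (\<lambda>x\<in>carrier M. f x \<oplus>\<^bsub>N\<^esub> (if x \<in> carrier M then g x \<oplus>\<^bsub>N\<^esub> h x else undefined))"
      using f g h cl N.a_assoc by auto
  qed
qed

lemma subgroup_carrier_eqI: "group G \<Longrightarrow> subgroup B G \<Longrightarrow> trivial_group (G Mod B) \<Longrightarrow> carrier G \<subseteq> B"
proof
  fix x assume *: "group G" "subgroup B G" "trivial_group (G Mod B)" "x \<in> carrier G"
  interpret group G by fact
  have "B #>\<^bsub>G\<^esub> x \<in> rcosets\<^bsub>G\<^esub> B" using * by (auto simp: RCOSETS_def)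
  then have "B #>\<^bsub>G\<^esub> x = B" using * by (simp add: trivial_group_def FactGroup_def)
  then show "x \<in> B" using rcos_self[OF *(4,2)] by simp
qed

lemma trivial_Mod_self: "comm_group G \<Longrightarrow> carrier G = B \<Longrightarrow> trivial_group (G Mod B)"
proof -
  assume *: "comm_group G" "carrier G = B"
  interpret comm_group G by fact
  have sub: "subgroup B G" using subgroup_self *(2) by simp
  interpret B: normal B G using normal_iff_subgroup sub by blast
  have "rcosets\<^bsub>G\<^esub> B = {B}"
    using *(2) coset_join2[OF _ sub] one_closed by (auto simp: RCOSETS_def)
  then show ?thesis
    using B.factorgroup_is_group by (simp add: trivial_group_def FactGroup_def)
qed

text \<open>
  A 1-cocycle is a map on \<open>F\<^sub>1\<close> that vanishes on the kernel of the surjection from \<open>F\<^sub>1\<close> onto the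
  kernel of the free cover, so it is the same as a map on that kernel. It is a coboundary when this
  map extends to \<open>F\<^sub>0\<close>.
\<close>

lemma Ext1_trivial_iff:
  assumes X: "left_module R X" and Y: "left_module R Y"
  shows "trivial_group (Ext1 R X Y) \<longleftrightarrow>
    (\<forall>g. linear_map R ((free_module R (carrier X))\<lparr>carrier := free_kernel R X\<rparr>) Y g \<longrightarrow>
      (\<exists>h. linear_map R (free_module R (carrier X)) Y h \<and> (\<forall>k\<in>free_kernel R X. h k = g k)))"
proof -
  interpret X: left_module R X by fact
  interpret Y: left_module R Y by fact
  define F\<^sub>0 where "F\<^sub>0 = free_module R (carrier X)"
  define \<pi> where "\<pi> = free_cover R X (carrier X)"
  define K\<^sub>0 where "K\<^sub>0 = lin_kernel F\<^sub>0 X \<pi>"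
  define F\<^sub>1 where "F\<^sub>1 = free_module R K\<^sub>0"
  define d\<^sub>1 where "d\<^sub>1 = free_cover R F\<^sub>0 K\<^sub>0"
  define K\<^sub>1 where "K\<^sub>1 = lin_kernel F\<^sub>1 F\<^sub>0 d\<^sub>1"
  define F\<^sub>2 where "F\<^sub>2 = free_module R K\<^sub>1"
  define d\<^sub>2 where "d\<^sub>2 = free_cover R F\<^sub>1 K\<^sub>1"
  define Z where "Z = {g \<in> module_hom R F\<^sub>1 Y. \<forall>c\<in>carrier F\<^sub>2. g (d\<^sub>2 c) = \<zero>\<^bsub>Y\<^esub>}"
  define B where "B = {compose (carrier F\<^sub>1) h d\<^sub>1 | h. h \<in> module_hom R F\<^sub>0 Y}"
  define G where "G = (hom_group R F\<^sub>1 Y)\<lparr>carrier := Z\<rparr>"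
  have Ext: "Ext1 R X Y = G Mod B"
    by (simp add: Ext1_def Let_def G_def B_def Z_def d\<^sub>2_def F\<^sub>2_def K\<^sub>1_def d\<^sub>1_def F\<^sub>1_def K\<^sub>0_def \<pi>_def
        F\<^sub>0_def a_kernel_lin_kernel)
  have R: "ring R" by (rule X.R.ring_axioms)
  have F: "left_module R F\<^sub>0" "left_module R F\<^sub>1" "left_module R F\<^sub>2"
    unfolding F\<^sub>0_def F\<^sub>1_def F\<^sub>2_def by (intro free_module_left_module R)+
  interpret F\<^sub>1: left_module R F\<^sub>1 by fact
  have \<pi>: "linear_map R F\<^sub>0 X \<pi>" unfolding \<pi>_def F\<^sub>0_def by (rule free_cover_linear[OF X]) simp
  have K\<^sub>0: "submodule K\<^sub>0 R F\<^sub>0" unfolding K\<^sub>0_def by (rule submodule_lin_kernel[OF F(1) X \<pi>])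
  have K\<^sub>0_sub: "K\<^sub>0 \<subseteq> carrier F\<^sub>0" by (auto simp: K\<^sub>0_def lin_kernel_def)
  define K where "K = F\<^sub>0\<lparr>carrier := K\<^sub>0\<rparr>"
  have K: "left_module R K" unfolding K_def by (rule left_module.submodule_left_module[OF F(1) K\<^sub>0])
  have d\<^sub>1: "linear_map R F\<^sub>1 F\<^sub>0 d\<^sub>1" unfolding d\<^sub>1_def F\<^sub>1_def by (rule free_cover_linear[OF F(1) K\<^sub>0_sub])
  have d\<^sub>1K: "d\<^sub>1 a \<in> K\<^sub>0" if "a \<in> carrier F\<^sub>1" for a
  proof -
    have "\<pi> (d\<^sub>1 a) = \<zero>\<^bsub>X\<^esub>"
    proof (rule free_lift_unique[where f = "\<lambda>a. \<pi> (d\<^sub>1 a)" and f' = "\<lambda>_. \<zero>\<^bsub>X\<^esub>", OF X])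
      show "linear_map R (free_module R K\<^sub>0) X (\<lambda>a. \<pi> (d\<^sub>1 a))"
        using linear_comp[OF d\<^sub>1 \<pi>] by (simp add: F\<^sub>1_def)
      show "linear_map R (free_module R K\<^sub>0) X (\<lambda>_. \<zero>\<^bsub>X\<^esub>)" by (rule linear_const_zero[OF X])
      show "\<pi> (d\<^sub>1 (basis_vector R K\<^sub>0 s)) = \<zero>\<^bsub>X\<^esub>" if "s \<in> K\<^sub>0" for s
        unfolding d\<^sub>1_def using that
        by (simp add: free_cover_basis[OF F(1) K\<^sub>0_sub]) (simp add: K\<^sub>0_def lin_kernel_def)
    qed (use that in \<open>simp add: F\<^sub>1_def\<close>)
    then show ?thesis using linear_closed[OF d\<^sub>1 that] by (simp add: K\<^sub>0_def lin_kernel_def)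
  qed
  have d\<^sub>1': "linear_map R F\<^sub>1 K d\<^sub>1"
    using d\<^sub>1 d\<^sub>1K by (simp add: linear_map_def K_def)
  have d\<^sub>1_onto: "d\<^sub>1 ` carrier F\<^sub>1 = carrier K"
  proof
    show "d\<^sub>1 ` carrier F\<^sub>1 \<subseteq> carrier K" using d\<^sub>1K by (auto simp: K_def)
    show "carrier K \<subseteq> d\<^sub>1 ` carrier F\<^sub>1"
    proof
      fix k assume k: "k \<in> carrier K"
      then have "d\<^sub>1 (basis_vector R K\<^sub>0 k) = k" "basis_vector R K\<^sub>0 k \<in> carrier F\<^sub>1"
        unfolding d\<^sub>1_def F\<^sub>1_def K_def
        by (auto intro: free_cover_basis[OF F(1) K\<^sub>0_sub] basis_vector_closed[OF R])
      then show "k \<in> d\<^sub>1 ` carrier F\<^sub>1" by (metis imageI)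
    qed
  qed
  have K\<^sub>1_sub: "K\<^sub>1 \<subseteq> carrier F\<^sub>1" by (auto simp: K\<^sub>1_def lin_kernel_def)
  have K\<^sub>1: "submodule K\<^sub>1 R F\<^sub>1" unfolding K\<^sub>1_def by (rule submodule_lin_kernel[OF F(2,1) d\<^sub>1])
  have d\<^sub>2: "linear_map R F\<^sub>2 F\<^sub>1 d\<^sub>2" unfolding d\<^sub>2_def F\<^sub>2_def by (rule free_cover_linear[OF F(2) K\<^sub>1_sub])
  have Z_iff: "g \<in> Z \<longleftrightarrow> g \<in> module_hom R F\<^sub>1 Y \<and> (\<forall>k\<in>K\<^sub>1. g k = \<zero>\<^bsub>Y\<^esub>)" for g
  proof -
    have "(\<forall>c\<in>carrier F\<^sub>2. g (d\<^sub>2 c) = \<zero>\<^bsub>Y\<^esub>) \<longleftrightarrow> (\<forall>k\<in>K\<^sub>1. g k = \<zero>\<^bsub>Y\<^esub>)" if g: "g \<in> module_hom R F\<^sub>1 Y"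
    proof safe
      fix k assume *: "\<forall>c\<in>carrier F\<^sub>2. g (d\<^sub>2 c) = \<zero>\<^bsub>Y\<^esub>" "k \<in> K\<^sub>1"
      then have "g (d\<^sub>2 (basis_vector R K\<^sub>1 k)) = \<zero>\<^bsub>Y\<^esub>" using basis_vector_closed[OF R *(2)] by (auto simp: F\<^sub>2_def)
      then show "g k = \<zero>\<^bsub>Y\<^esub>" unfolding d\<^sub>2_def by (simp add: free_cover_basis[OF F(2) K\<^sub>1_sub *(2)])
    next
      fix c assume *: "\<forall>k\<in>K\<^sub>1. g k = \<zero>\<^bsub>Y\<^esub>" "c \<in> carrier F\<^sub>2"
      show "g (d\<^sub>2 c) = \<zero>\<^bsub>Y\<^esub>"
      proof (rule free_lift_unique[where f = "\<lambda>a. g (d\<^sub>2 a)" and f' = "\<lambda>_. \<zero>\<^bsub>Y\<^esub>", OF Y])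
        show "linear_map R (free_module R K\<^sub>1) Y (\<lambda>a. g (d\<^sub>2 a))"
          using linear_comp[OF d\<^sub>2 module_hom_linear[OF g]] by (simp add: F\<^sub>2_def)
        show "linear_map R (free_module R K\<^sub>1) Y (\<lambda>_. \<zero>\<^bsub>Y\<^esub>)" by (rule linear_const_zero[OF Y])
        show "g (d\<^sub>2 (basis_vector R K\<^sub>1 s)) = \<zero>\<^bsub>Y\<^esub>" if "s \<in> K\<^sub>1" for s
          unfolding d\<^sub>2_def using that * by (simp add: free_cover_basis[OF F(2) K\<^sub>1_sub])
      qed (use * in \<open>simp add: F\<^sub>2_def\<close>)
    qed
    then show ?thesis by (auto simp: Z_def)
  qed
  have Bh: "compose (carrier F\<^sub>1) h d\<^sub>1 \<in> Z" if h: "linear_map R F\<^sub>0 Y h" for h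
    using linear_module_hom[OF F(2) linear_comp[OF d\<^sub>1 h]] linear_zero[OF F(1) Y h] K\<^sub>1_sub
    by (auto simp: Z_iff compose_def K\<^sub>1_def lin_kernel_def)
  have BZ: "B \<subseteq> Z" using Bh[OF module_hom_linear] by (auto simp: B_def)
  interpret H: comm_group "hom_group R F\<^sub>1 Y" by (rule hom_group_comm_group[OF F(2) Y])
  have Hs: "carrier (hom_group R F\<^sub>1 Y) = module_hom R F\<^sub>1 Y" "monoid.one (hom_group R F\<^sub>1 Y) = (\<lambda>x\<in>carrier F\<^sub>1. \<zero>\<^bsub>Y\<^esub>)"
    "\<And>f g. f \<otimes>\<^bsub>hom_group R F\<^sub>1 Y\<^esub> g = (\<lambda>x\<in>carrier F\<^sub>1. f x \<oplus>\<^bsub>Y\<^esub> g x)"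
    by (simp_all add: hom_group_def)
  have inv: "inv\<^bsub>hom_group R F\<^sub>1 Y\<^esub> f = (\<lambda>x\<in>carrier F\<^sub>1. \<ominus>\<^bsub>Y\<^esub> f x)" if f: "f \<in> module_hom R F\<^sub>1 Y" for f
  proof (rule H.inv_equality)
    show u: "(\<lambda>x\<in>carrier F\<^sub>1. \<ominus>\<^bsub>Y\<^esub> f x) \<in> carrier (hom_group R F\<^sub>1 Y)"
      unfolding Hs by (intro linear_module_hom F(2) linear_uminus Y module_hom_linear f)
    show "(\<lambda>x\<in>carrier F\<^sub>1. \<ominus>\<^bsub>Y\<^esub> f x) \<otimes>\<^bsub>hom_group R F\<^sub>1 Y\<^esub> f = \<one>\<^bsub>hom_group R F\<^sub>1 Y\<^esub>"
      using linear_closed[OF module_hom_linear[OF f]] by (auto simp: Hs Y.l_neg)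
  qed (use f in \<open>simp add: Hs\<close>)
  have Zsub: "subgroup Z (hom_group R F\<^sub>1 Y)"
  proof (rule H.subgroupI)
    have "(\<lambda>x\<in>carrier F\<^sub>1. \<zero>\<^bsub>Y\<^esub>) \<in> Z"
      using linear_module_hom[OF F(2) linear_const_zero[OF Y]] K\<^sub>1_sub by (auto simp: Z_iff)
    then show "Z \<noteq> {}" by blast
  next
    fix f assume f: "f \<in> Z"
    have "(\<lambda>x\<in>carrier F\<^sub>1. \<ominus>\<^bsub>Y\<^esub> f x) \<in> module_hom R F\<^sub>1 Y"
      using f by (intro linear_module_hom F(2) linear_uminus Y module_hom_linear) (simp add: Z_iff)
    then show "inv\<^bsub>hom_group R F\<^sub>1 Y\<^esub> f \<in> Z" using f K\<^sub>1_sub by (auto simp: Z_iff inv)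
    fix g assume g: "g \<in> Z"
    have "(\<lambda>x\<in>carrier F\<^sub>1. f x \<oplus>\<^bsub>Y\<^esub> g x) \<in> module_hom R F\<^sub>1 Y"
      using f g by (intro linear_module_hom F(2) linear_plus Y module_hom_linear) (simp_all add: Z_iff)
    then show "f \<otimes>\<^bsub>hom_group R F\<^sub>1 Y\<^esub> g \<in> Z" using f g K\<^sub>1_sub by (auto simp: Z_iff Hs)
  qed (auto simp: Z_iff Hs)
  have G: "comm_group G" 
  proof (rule group.group_comm_groupI)
    show "group G" unfolding G_def by (rule H.subgroup_imp_group[OF Zsub])
    show "x \<otimes>\<^bsub>G\<^esub> y = y \<otimes>\<^bsub>G\<^esub> x" if "x \<in> carrier G" "y \<in> carrier G" for x y
      using that H.m_comm[of x y] by (simp add: G_def Hs(1) Z_iff)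
  qed
  interpret G: comm_group G by fact
  have Gs: "carrier G = Z" "\<And>f g. f \<otimes>\<^bsub>G\<^esub> g = (\<lambda>x\<in>carrier F\<^sub>1. f x \<oplus>\<^bsub>Y\<^esub> g x)"
    by (simp_all add: G_def Hs)
  have invG: "inv\<^bsub>G\<^esub> f = (\<lambda>x\<in>carrier F\<^sub>1. \<ominus>\<^bsub>Y\<^esub> f x)" if f: "f \<in> Z" for f
    unfolding G_def using H.m_inv_consistent[OF Zsub f] inv[of f] f by (simp add: Z_iff)
  have Bsub: "subgroup B G"
  proof (rule G.subgroupI)
    show "B \<subseteq> carrier G" using BZ by (simp add: Gs)
    show "B \<noteq> {}" using linear_module_hom[OF F(1) linear_const_zero[OF Y]] by (auto simp: B_def)
  next
    fix f assume f: "f \<in> B"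
    then obtain h where h: "h \<in> module_hom R F\<^sub>0 Y" "f = compose (carrier F\<^sub>1) h d\<^sub>1" by (auto simp: B_def)
    have "(\<lambda>x\<in>carrier F\<^sub>0. \<ominus>\<^bsub>Y\<^esub> h x) \<in> module_hom R F\<^sub>0 Y"
      by (intro linear_module_hom F(1) linear_uminus Y module_hom_linear h)
    moreover have "inv\<^bsub>G\<^esub> f = compose (carrier F\<^sub>1) (\<lambda>x\<in>carrier F\<^sub>0. \<ominus>\<^bsub>Y\<^esub> h x) d\<^sub>1"
      using f BZ linear_closed[OF d\<^sub>1] by (subst invG) (auto simp: h compose_def)
    ultimately show "inv\<^bsub>G\<^esub> f \<in> B" by (auto simp: B_def)
    fix f' assume f': "f' \<in> B"
    then obtain h' where h': "h' \<in> module_hom R F\<^sub>0 Y" "f' = compose (carrier F\<^sub>1) h' d\<^sub>1" by (auto simp: B_def)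
    have "(\<lambda>x\<in>carrier F\<^sub>0. h x \<oplus>\<^bsub>Y\<^esub> h' x) \<in> module_hom R F\<^sub>0 Y"
      by (intro linear_module_hom F(1) linear_plus Y module_hom_linear h h')
    moreover have "f \<otimes>\<^bsub>G\<^esub> f' = compose (carrier F\<^sub>1) (\<lambda>x\<in>carrier F\<^sub>0. h x \<oplus>\<^bsub>Y\<^esub> h' x) d\<^sub>1"
      using linear_closed[OF d\<^sub>1] by (auto simp: h h' Gs compose_def)
    ultimately show "f \<otimes>\<^bsub>G\<^esub> f' \<in> B" by (auto simp: B_def)
  qed
  have "trivial_group (Ext1 R X Y) \<longleftrightarrow> Z \<subseteq> B"
    unfolding Ext using subgroup_carrier_eqI[OF G.is_group Bsub] trivial_Mod_self[OF G, of B] BZ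
    by (auto simp: Gs)
  also have "\<dots> \<longleftrightarrow> (\<forall>g. linear_map R K Y g \<longrightarrow> (\<exists>h. linear_map R F\<^sub>0 Y h \<and> (\<forall>k\<in>K\<^sub>0. h k = g k)))"
  proof safe
    fix g assume ZB: "Z \<subseteq> B" and g: "linear_map R K Y g"
    have "restrict (\<lambda>a. g (d\<^sub>1 a)) (carrier F\<^sub>1) \<in> Z"
      using linear_module_hom[OF F(2) linear_comp[OF d\<^sub>1' g]] linear_zero[OF K Y g] K\<^sub>1_sub
      by (auto simp: Z_iff K\<^sub>1_def lin_kernel_def K_def)
    then obtain h where h: "h \<in> module_hom R F\<^sub>0 Y" "restrict (\<lambda>a. g (d\<^sub>1 a)) (carrier F\<^sub>1) = compose (carrier F\<^sub>1) h d\<^sub>1"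
      using ZB by (auto simp: B_def)
    have "h k = g k" if k: "k \<in> K\<^sub>0" for k
    proof -
      obtain a where a: "a \<in> carrier F\<^sub>1" "k = d\<^sub>1 a" using k d\<^sub>1_onto by (auto simp: K_def)
      then show ?thesis using fun_cong[OF h(2), of a] by (simp add: compose_def)
    qed
    then show "\<exists>h. linear_map R F\<^sub>0 Y h \<and> (\<forall>k\<in>K\<^sub>0. h k = g k)" using module_hom_linear[OF h(1)] by blast
  next
    fix f assume *: "\<forall>g. linear_map R K Y g \<longrightarrow> (\<exists>h. linear_map R F\<^sub>0 Y h \<and> (\<forall>k\<in>K\<^sub>0. h k = g k))"
      and f: "f \<in> Z"
    have fl: "linear_map R F\<^sub>1 Y f" using f module_hom_linear by (auto simp: Z_iff)
    obtain g where g: "linear_map R K Y g" "\<And>a. a \<in> carrier F\<^sub>1 \<Longrightarrow> g (d\<^sub>1 a) = f a"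
      by (rule linear_factor[OF F(2) K Y d\<^sub>1' d\<^sub>1_onto fl])
        (use f in \<open>auto simp: Z_iff K\<^sub>1_def lin_kernel_def K_def\<close>)
    obtain h where h: "linear_map R F\<^sub>0 Y h" "\<And>k. k \<in> K\<^sub>0 \<Longrightarrow> h k = g k" using * g(1) by blast
    have "f = compose (carrier F\<^sub>1) (restrict h (carrier F\<^sub>0)) d\<^sub>1"
    proof (rule extensionalityI)
      show "f \<in> extensional (carrier F\<^sub>1)" using f module_hom_extensional by (auto simp: Z_iff)
      show "f a = compose (carrier F\<^sub>1) (restrict h (carrier F\<^sub>0)) d\<^sub>1 a" if "a \<in> carrier F\<^sub>1" for a
        using that g(2) h(2)[OF d\<^sub>1K[OF that]] linear_closed[OF d\<^sub>1 that] by (simp add: compose_def)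
    qed (rule compose_extensional)
    then show "f \<in> B" using linear_module_hom[OF F(1) h(1)] by (auto simp: B_def)
  qed
  finally show ?thesis by (simp add: K_def K\<^sub>0_def F\<^sub>0_def \<pi>_def)
qed

text \<open>
  The characterisation by the free cover carries over to any surjection \<open>p\<close> onto \<open>X\<close>: the free cover
  maps to \<open>E\<close> over \<open>X\<close>, and the pullback of the two surjections compares their kernels.
\<close>

lemma Ext1_trivial_extend:
  assumes X: "left_module R X" and Y: "left_module R Y" and E: "left_module R E"
    and triv: "trivial_group (Ext1 R X Y)"
    and p: "linear_map R E X p" "p ` carrier E = carrier X"
    and g: "linear_map R (E\<lparr>carrier := lin_kernel E X p\<rparr>) Y g"
  obtains h where "linear_map R E Y h" "\<And>k. k \<in> lin_kernel E X p \<Longrightarrow> h k = g k"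
proof -
  interpret X: left_module R X by fact
  interpret Y: left_module R Y by fact
  interpret E: left_module R E by fact
  define F where "F = free_module R (carrier X)"
  define \<pi> where "\<pi> = free_cover R X (carrier X)"
  have F: "left_module R F" unfolding F_def by (rule free_module_left_module[OF X.R.ring_axioms])
  interpret F: left_module R F by fact
  have \<pi>: "linear_map R F X \<pi>" unfolding \<pi>_def F_def by (rule free_cover_linear[OF X]) simp
  define \<sigma> where "\<sigma> = inv_into (carrier E) p"
  have \<sigma>: "\<sigma> x \<in> carrier E" "p (\<sigma> x) = x" if "x \<in> carrier X" for x
    using that p(2) by (auto simp: \<sigma>_def inv_into_into f_inv_into_f)
  have \<sigma>c: "\<sigma> \<in> carrier X \<rightarrow> carrier E" using \<sigma> by auto
  define t where "t = free_lift R (carrier X) E \<sigma>"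
  have t: "linear_map R F E t" unfolding t_def F_def by (rule free_lift_linear[OF E \<sigma>c])
  have pt: "p (t a) = \<pi> a" if "a \<in> carrier F" for a
    by (rule free_lift_unique[where f = "\<lambda>a. p (t a)" and f' = \<pi> and S = "carrier X" and R = R and M = X, OF X])
      (use linear_comp[OF t p(1)] \<pi> that in \<open>auto simp: F_def \<pi>_def free_cover_basis[OF X] t_def
         free_lift_basis[OF E \<sigma>c] \<sigma>\<close>)
  have gt: "linear_map R (F\<lparr>carrier := lin_kernel F X \<pi>\<rparr>) Y (\<lambda>a. g (t a))"
  proof (rule linear_comp[OF _ g])
    show "linear_map R (F\<lparr>carrier := lin_kernel F X \<pi>\<rparr>) (E\<lparr>carrier := lin_kernel E X p\<rparr>) t"
      using t pt by (auto simp: linear_map_def lin_kernel_def)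
  qed
  obtain h where h: "linear_map R F Y h" "\<And>k. k \<in> lin_kernel F X \<pi> \<Longrightarrow> h k = g (t k)"
    using triv gt unfolding Ext1_trivial_iff[OF X Y] F_def \<pi>_def by blast
  interpret K: left_module R "E\<lparr>carrier := lin_kernel E X p\<rparr>"
    by (rule E.submodule_left_module[OF submodule_lin_kernel[OF E X p(1)]])
  \<comment> \<open>pairs \<open>(e, a)\<close> in the pullback are sent to \<open>g (e - t a) + h a\<close>, which depends only on \<open>e\<close>\<close>
  define b where "b x = basis_vector R (carrier X) x" for x
  have b: "b x \<in> carrier F" "\<pi> (b x) = x" if "x \<in> carrier X" for x
    unfolding b_def F_def \<pi>_def using that
    by (auto intro: basis_vector_closed[OF X.R.ring_axioms] free_cover_basis[OF X])
  define f where "f e = g (e \<ominus>\<^bsub>E\<^esub> t (b (p e))) \<oplus>\<^bsub>Y\<^esub> h (b (p e))" for e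
  have ker: "e \<ominus>\<^bsub>E\<^esub> t a \<in> lin_kernel E X p" if "e \<in> carrier E" "a \<in> carrier F" "p e = \<pi> a" for e a
    using that linear_closed[OF t] linear_closed[OF p(1)] linear_closed[OF \<pi>]
    by (simp add: lin_kernel_def linear_diff[OF E X p(1)] pt)
  have gadd: "g (x \<oplus>\<^bsub>E\<^esub> y) = g x \<oplus>\<^bsub>Y\<^esub> g y" if "x \<in> lin_kernel E X p" "y \<in> lin_kernel E X p" for x y
    using linear_add[OF g] that by simp
  have gsm: "g (r \<odot>\<^bsub>E\<^esub> x) = r \<odot>\<^bsub>Y\<^esub> g x" if "x \<in> lin_kernel E X p" "r \<in> carrier R" for r x
    using linear_smult[OF g] that by simp
  have gcl: "g x \<in> carrier Y" if "x \<in> lin_kernel E X p" for x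
    using linear_closed[OF g] that by simp
  have f: "f e = g (e \<ominus>\<^bsub>E\<^esub> t a) \<oplus>\<^bsub>Y\<^esub> h a" if e: "e \<in> carrier E" and a: "a \<in> carrier F" and pe: "p e = \<pi> a" for e a
  proof -
    define c where "c = b (p e)"
    have c: "c \<in> carrier F" "\<pi> c = p e" using b[OF linear_closed[OF p(1) e]] by (auto simp: c_def)
    have ac: "a \<ominus>\<^bsub>F\<^esub> c \<in> lin_kernel F X \<pi>"
      using a c pe linear_closed[OF \<pi>] by (simp add: lin_kernel_def linear_diff[OF F X \<pi>])
    have tac: "t a \<ominus>\<^bsub>E\<^esub> t c \<in> lin_kernel E X p"
      using a c pe linear_closed[OF t] linear_closed[OF \<pi>]
      by (simp add: lin_kernel_def linear_diff[OF E X p(1)] pt)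
    have ea: "e \<ominus>\<^bsub>E\<^esub> t a \<in> lin_kernel E X p" by (rule ker[OF e a pe])
    have 1: "h a \<ominus>\<^bsub>Y\<^esub> h c = g (t a \<ominus>\<^bsub>E\<^esub> t c)"
      using h(2)[OF ac] a c by (simp add: linear_diff[OF F Y h(1)] linear_diff[OF F E t])
    have "e \<ominus>\<^bsub>E\<^esub> t c = (e \<ominus>\<^bsub>E\<^esub> t a) \<oplus>\<^bsub>E\<^esub> (t a \<ominus>\<^bsub>E\<^esub> t c)"
      using e linear_closed[OF t a] linear_closed[OF t c(1)]
      by (simp add: E.minus_plus_telescope)
    then have "f e = g (e \<ominus>\<^bsub>E\<^esub> t a) \<oplus>\<^bsub>Y\<^esub> (h a \<ominus>\<^bsub>Y\<^esub> h c) \<oplus>\<^bsub>Y\<^esub> h c"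
      by (simp add: f_def gadd[OF ea tac] 1 flip: c_def)
    then show ?thesis
      using gcl[OF ea] linear_closed[OF h(1) a] linear_closed[OF h(1) c(1)]
      by (simp add: Y.a_assoc Y.minus_plus_cancel)
  qed
  have "linear_map R E Y f"
  proof (rule linear_mapI)
    fix e assume e: "e \<in> carrier E"
    note be = b[OF linear_closed[OF p(1) e]]
    note k = ker[OF e be(1) be(2)[symmetric]]
    note fe = f[OF e be(1) be(2)[symmetric]]
    show "f e \<in> carrier Y" unfolding fe using gcl[OF k] linear_closed[OF h(1)] be by auto
    note te = linear_closed[OF t be(1)]
    fix r assume r: "r \<in> carrier R"
    have "f (r \<odot>\<^bsub>E\<^esub> e) = g (r \<odot>\<^bsub>E\<^esub> e \<ominus>\<^bsub>E\<^esub> t (r \<odot>\<^bsub>F\<^esub> b (p e))) \<oplus>\<^bsub>Y\<^esub> h (r \<odot>\<^bsub>F\<^esub> b (p e))"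
      by (rule f) (use r e be in \<open>auto simp: E.smult_closed F.smult_closed linear_smult[OF p(1)] linear_smult[OF \<pi>]\<close>)
    also have "r \<odot>\<^bsub>E\<^esub> e \<ominus>\<^bsub>E\<^esub> t (r \<odot>\<^bsub>F\<^esub> b (p e)) = r \<odot>\<^bsub>E\<^esub> (e \<ominus>\<^bsub>E\<^esub> t (b (p e)))"
      using r e be te by (simp add: linear_smult[OF t] a_minus_def E.smult_r_distr E.smult_r_minus)
    finally show "f (r \<odot>\<^bsub>E\<^esub> e) = r \<odot>\<^bsub>Y\<^esub> f e"
      using r be gcl[OF k] linear_closed[OF h(1) be(1)]
      by (simp add: fe gsm[OF k r] linear_smult[OF h(1)] Y.smult_r_distr)
  next
    fix e e' assume e: "e \<in> carrier E" and e': "e' \<in> carrier E"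
    note be = b[OF linear_closed[OF p(1) e]] b[OF linear_closed[OF p(1) e']]
    note k = ker[OF e be(1) be(2)[symmetric]] ker[OF e' be(3) be(4)[symmetric]]
    note te = linear_closed[OF t be(1)] linear_closed[OF t be(3)]
    have "f (e \<oplus>\<^bsub>E\<^esub> e') = g ((e \<oplus>\<^bsub>E\<^esub> e') \<ominus>\<^bsub>E\<^esub> t (b (p e) \<oplus>\<^bsub>F\<^esub> b (p e'))) \<oplus>\<^bsub>Y\<^esub> h (b (p e) \<oplus>\<^bsub>F\<^esub> b (p e'))"
      by (rule f) (use e e' be in \<open>auto simp: linear_add[OF p(1)] linear_add[OF \<pi>]\<close>)
    also have "(e \<oplus>\<^bsub>E\<^esub> e') \<ominus>\<^bsub>E\<^esub> t (b (p e) \<oplus>\<^bsub>F\<^esub> b (p e')) =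
        (e \<ominus>\<^bsub>E\<^esub> t (b (p e))) \<oplus>\<^bsub>E\<^esub> (e' \<ominus>\<^bsub>E\<^esub> t (b (p e')))"
      using e e' be te by (simp add: linear_add[OF t] E.plus_minus_plus)
    finally show "f (e \<oplus>\<^bsub>E\<^esub> e') = f e \<oplus>\<^bsub>Y\<^esub> f e'"
      using be gcl[OF k(1)] gcl[OF k(2)] linear_closed[OF h(1) be(1)] linear_closed[OF h(1) be(3)]
      by (simp add: f[OF e be(1) be(2)[symmetric]] f[OF e' be(3) be(4)[symmetric]] gadd[OF k]
          linear_add[OF h(1)] Y.a_ac)
  qed
  moreover have "f k = g k" if k: "k \<in> lin_kernel E X p" for k
  proof -
    have "f k = g (k \<ominus>\<^bsub>E\<^esub> t \<zero>\<^bsub>F\<^esub>) \<oplus>\<^bsub>Y\<^esub> h \<zero>\<^bsub>F\<^esub>"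
      by (rule f) (use k in \<open>auto simp: lin_kernel_def linear_zero[OF F X \<pi>]\<close>)
    then show ?thesis
      using k gcl[OF k] by (simp add: lin_kernel_def linear_zero[OF F E t] linear_zero[OF F Y h(1)])
  qed
  ultimately show thesis using that by blast
qed

section \<open>Projective and locally projective modules\<close>

text \<open>
  Projectivity speaks only of surjections between modules in the universe, whereas the carrier of the
  free cover is a set of functions. The free cover is therefore replaced by an isomorphic copy.
\<close>

lemma projective_split:
  fixes P :: "('r, 'u) module"
  assumes U: "universe TYPE('u)" and R: "|carrier R| <o |UNIV :: 'u set|"
    and P: "P \<in> projective_modules R"
  obtains k where "linear_map R P (free_module R (carrier P)) k"
    "\<And>x. x \<in> carrier P \<Longrightarrow> free_cover R P (carrier P) (k x) = x"
proof -
  have Pm: "left_module R P" "|carrier P| <o |UNIV :: 'u set|" "P \<in> modules R"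
    using P by (auto simp: projective_modules_def modules_def small_def)
  interpret P: left_module R P by fact
  let ?F = "free_module R (carrier P)" and ?\<pi> = "free_cover R P (carrier P)"
  have F: "left_module R ?F" by (rule free_module_left_module[OF P.R.ring_axioms])
  have \<pi>: "linear_map R ?F P ?\<pi>" by (rule free_cover_linear[OF Pm(1)]) simp
  obtain A :: "('r, 'u) module" and \<rho> \<sigma> where A: "A \<in> modules R" "linear_map R ?F A \<rho>" "linear_map R A ?F \<sigma>"
    "\<And>x. x \<in> carrier ?F \<Longrightarrow> \<sigma> (\<rho> x) = x" "\<And>x. x \<in> carrier A \<Longrightarrow> \<rho> (\<sigma> x) = x"
    using small_copy[OF F universe_free_module[OF U R Pm(2)]] by metis
  have Am: "left_module R A" using A(1) by (simp add: modules_def)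
  let ?g = "restrict (\<lambda>x. ?\<pi> (\<sigma> x)) (carrier A)"
  have g: "?g \<in> module_hom R A P" by (rule linear_module_hom[OF Am linear_comp[OF A(3) \<pi>]])
  have "?g ` carrier A = carrier P"
  proof
    show "?g ` carrier A \<subseteq> carrier P" using linear_closed[OF module_hom_linear[OF g]] by auto
    show "carrier P \<subseteq> ?g ` carrier A"
    proof
      fix x assume x: "x \<in> carrier P"
      then obtain a where a: "a \<in> carrier ?F" "?\<pi> a = x" using free_cover_onto[OF Pm(1)] by metis
      then have "?g (\<rho> a) = x" using linear_closed[OF A(2)] A(4) by simp
      then show "x \<in> ?g ` carrier A" using linear_closed[OF A(2) a(1)] by (metis imageI)
    qed
  qed
  then obtain k where k: "k \<in> module_hom R P A" "\<And>x. x \<in> carrier P \<Longrightarrow> ?g (k x) = x"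
    using P g A(1) Pm(3) linear_module_hom[OF Pm(1) linear_id] unfolding projective_modules_def
    by (smt (verit) mem_Collect_eq restrict_apply')
  show thesis
  proof (rule that)
    show "linear_map R P ?F (\<lambda>x. \<sigma> (k x))" by (rule linear_comp[OF module_hom_linear[OF k(1)] A(3)])
    show "?\<pi> (\<sigma> (k x)) = x" if "x \<in> carrier P" for x
      using k(2)[OF that] linear_closed[OF module_hom_linear[OF k(1)] that] by simp
  qed
qed

lemma projective_lift:
  fixes P :: "('r, 'u) module"
  assumes U: "universe TYPE('u)" and R: "|carrier R| <o |UNIV :: 'u set|"
    and P: "P \<in> projective_modules R"
    and A: "left_module R A" and B: "left_module R B"
    and g: "linear_map R A B g" "g ` carrier A = carrier B" and h: "linear_map R P B h"
  obtains l where "linear_map R P A l" "\<And>x. x \<in> carrier P \<Longrightarrow> g (l x) = h x"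
proof -
  have Pm: "left_module R P" using P by (auto simp: projective_modules_def modules_def)
  obtain k where k: "linear_map R P (free_module R (carrier P)) k"
    "\<And>x. x \<in> carrier P \<Longrightarrow> free_cover R P (carrier P) (k x) = x"
    using projective_split[OF U R P] by blast
  define \<sigma> where "\<sigma> x = inv_into (carrier A) g (h x)" for x
  have \<sigma>: "\<sigma> x \<in> carrier A" "g (\<sigma> x) = h x" if "x \<in> carrier P" for x
    using linear_closed[OF h that] g(2) by (auto simp: \<sigma>_def inv_into_into f_inv_into_f)
  have \<sigma>c: "\<sigma> \<in> carrier P \<rightarrow> carrier A" using \<sigma> by auto
  let ?t = "free_lift R (carrier P) A \<sigma>"
  have t: "linear_map R (free_module R (carrier P)) A ?t" by (rule free_lift_linear[OF A \<sigma>c])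
  have gt: "g (?t a) = h (free_cover R P (carrier P) a)" if "a \<in> carrier (free_module R (carrier P))" for a
  proof (rule free_lift_unique[OF B _ _ _ that, where f = "\<lambda>a. g (?t a)"])
    show "linear_map R (free_module R (carrier P)) B (\<lambda>a. g (?t a))" by (rule linear_comp[OF t g(1)])
    show "linear_map R (free_module R (carrier P)) B (\<lambda>a. h (free_cover R P (carrier P) a))"
      by (rule linear_comp[OF free_cover_linear[OF Pm] h]) simp
  qed (simp add: free_lift_basis[OF A \<sigma>c] free_cover_basis[OF Pm] \<sigma>)
  show thesis
    by (rule that[of "\<lambda>x. ?t (k x)"]) (use linear_comp[OF k(1) t] k(2) gt linear_closed[OF k(1)] in auto)
qed

definition linear_form :: "'r ring \<Rightarrow> ('r, 'm) module \<Rightarrow> ('m \<Rightarrow> 'r) \<Rightarrow> bool" where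
  "linear_form R M \<phi> \<longleftrightarrow>
     (\<forall>x\<in>carrier M. \<phi> x \<in> carrier R) \<and>
     (\<forall>x\<in>carrier M. \<forall>y\<in>carrier M. \<phi> (x \<oplus>\<^bsub>M\<^esub> y) = \<phi> x \<oplus>\<^bsub>R\<^esub> \<phi> y) \<and>
     (\<forall>r\<in>carrier R. \<forall>x\<in>carrier M. \<phi> (r \<odot>\<^bsub>M\<^esub> x) = r \<otimes>\<^bsub>R\<^esub> \<phi> x)"

text \<open>
  The image of the canonical map from the tensor product of the dual of \<open>M\<close> with \<open>N\<close> to
  \<open>Hom(M, N)\<close>. The last rule is there because only values on the carrier matter.
\<close>

inductive finite_rank :: "'r ring \<Rightarrow> ('r, 'm) module \<Rightarrow> ('r, 'n) module \<Rightarrow> ('m \<Rightarrow> 'n) \<Rightarrow> bool"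
  for R M N where
    zero: "finite_rank R M N (\<lambda>_. \<zero>\<^bsub>N\<^esub>)"
  | add: "finite_rank R M N e \<Longrightarrow> linear_form R M \<phi> \<Longrightarrow> y \<in> carrier N \<Longrightarrow>
      finite_rank R M N (\<lambda>x. \<phi> x \<odot>\<^bsub>N\<^esub> y \<oplus>\<^bsub>N\<^esub> e x)"
  | cong: "finite_rank R M N e \<Longrightarrow> (\<And>x. x \<in> carrier M \<Longrightarrow> e' x = e x) \<Longrightarrow> finite_rank R M N e'"

lemma finite_rank_linear:
  assumes "left_module R M" "left_module R N" "finite_rank R M N e"
  shows "linear_map R M N e"
proof -
  interpret N: left_module R N by fact
  show ?thesis
    using assms(3)
  proof (induction rule: finite_rank.induct)
    case zero
    show ?case by (rule linear_const_zero[OF assms(2)])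
  next
    case (add e \<phi> y)
    have "linear_map R M N (\<lambda>x. \<phi> x \<odot>\<^bsub>N\<^esub> y)"
      using add(2,3) by (auto simp: linear_form_def linear_map_def N.smult_closed N.smult_l_distr N.smult_assoc)
    then show ?case by (rule linear_plus[OF assms(2) _ add.IH])
  next
    case (cong e e')
    show ?case by (rule linear_cong[OF cong(3) assms(1) cong(2)])
  qed
qed

lemma finite_rank_plus:
  assumes "left_module R M" "left_module R N" "finite_rank R M N e" "finite_rank R M N e'"
  shows "finite_rank R M N (\<lambda>x. e x \<oplus>\<^bsub>N\<^esub> e' x)"
proof -
  interpret N: left_module R N by fact
  note e' = linear_closed[OF finite_rank_linear[OF assms(1,2,4)]]
  show ?thesis
    using assms(3)
  proof (induction rule: finite_rank.induct)
    case zero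
    show ?case by (rule finite_rank.cong[OF assms(4)]) (use e' in simp)
  next
    case (add e \<phi> y)
    note e = linear_closed[OF finite_rank_linear[OF assms(1,2) add(1)]]
    show ?case
      by (rule finite_rank.cong[OF finite_rank.add[OF add.IH add(2,3)]])
        (use e e' add(2,3) in \<open>auto simp: linear_form_def N.smult_closed N.a_assoc\<close>)
  next
    case (cong e e'')
    show ?case by (rule finite_rank.cong[OF cong(3)]) (simp add: cong(2))
  qed
qed

lemma finite_rank_post:
  assumes "left_module R M" "left_module R N" "left_module R N'" "finite_rank R M N e" "linear_map R N N' h"
  shows "finite_rank R M N' (\<lambda>x. h (e x))"
proof -
  interpret N: left_module R N by fact
  show ?thesis
    using assms(4)
  proof (induction rule: finite_rank.induct)
    case zero
    show ?case by (simp add: linear_zero[OF assms(2,3,5)] finite_rank.zero)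
  next
    case (add e \<phi> y)
    note e = linear_closed[OF finite_rank_linear[OF assms(1,2) add(1)]]
    show ?case
      by (rule finite_rank.cong[OF finite_rank.add[OF add.IH add(2) linear_closed[OF assms(5) add(3)]]])
        (use e add(2,3) in \<open>auto simp: linear_form_def N.smult_closed linear_add[OF assms(5)] linear_smult[OF assms(5)]\<close>)
  next
    case (cong e e')
    show ?case by (rule finite_rank.cong[OF cong(3)]) (simp add: cong(2))
  qed
qed

lemma finite_rank_pre:
  assumes "finite_rank R M N e" "linear_map R M' M h"
  shows "finite_rank R M' N (\<lambda>x. e (h x))"
  using assms(1)
proof (induction rule: finite_rank.induct)
  case zero
  show ?case by (rule finite_rank.zero)
next
  case (add e \<phi> y)
  have "linear_form R M' (\<lambda>x. \<phi> (h x))"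
    using add(2) assms(2) by (auto simp: linear_form_def linear_map_def)
  then show ?case by (rule finite_rank.add[OF add.IH _ add(3)])
next
  case (cong e e')
  show ?case by (rule finite_rank.cong[OF cong(3)]) (simp add: cong(2) linear_closed[OF assms(2)])
qed

text \<open>
  These are the locally projective modules in the sense of Zimmermann-Huisgen, or trace modules in the
  sense of Ohm and Rush: every \<open>x\<close> is the sum of \<open>\<phi>\<^sub>i x \<odot> y\<^sub>i\<close> for finitely many linear forms \<open>\<phi>\<^sub>i\<close>
  and elements \<open>y\<^sub>i\<close>.
\<close>

definition locally_projective :: "'r ring \<Rightarrow> ('r, 'm) module \<Rightarrow> bool" where
  "locally_projective R M \<longleftrightarrow> left_module R M \<and>
     (\<forall>x\<in>carrier M. \<exists>e. finite_rank R M M e \<and> e x = x)"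

text \<open>
  The complement of \<open>e''\<close> is the product \<open>(1 - e') (1 - e)\<close>, which kills whatever \<open>1 - e\<close> kills and
  also kills \<open>x\<close>.
\<close>

lemma fixing_extend:
  assumes M: "left_module R M" and e: "finite_rank R M M e" and e': "finite_rank R M M e'"
    and x: "x \<in> carrier M" "e' (x \<ominus>\<^bsub>M\<^esub> e x) = x \<ominus>\<^bsub>M\<^esub> e x"
  obtains e'' where "finite_rank R M M e''" "e'' x = x"
    "\<And>y. y \<in> carrier M \<Longrightarrow> e y = y \<Longrightarrow> e'' y = y"
proof -
  interpret M: left_module R M by fact
  note el = finite_rank_linear[OF M M e] and el' = finite_rank_linear[OF M M e']
  define e'' where "e'' y = e y \<oplus>\<^bsub>M\<^esub> e' (y \<ominus>\<^bsub>M\<^esub> e y)" for y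
  have "finite_rank R M M e''"
    unfolding e''_def
    by (intro finite_rank_plus[OF M M e] finite_rank_pre[OF e'] linear_minus[OF M] linear_id el)
  moreover have "e'' x = x"
    using x linear_closed[OF el x(1)] M.minus_plus_cancel by (simp add: e''_def M.a_comm)
  moreover have "e'' y = y" if "y \<in> carrier M" "e y = y" for y
    using that by (simp add: e''_def linear_zero[OF M M el'])
  ultimately show thesis using that by blast
qed

lemma locally_projective_finite:
  assumes "locally_projective R M" "finite X" "X \<subseteq> carrier M"
  shows "\<exists>e. finite_rank R M M e \<and> (\<forall>x\<in>X. e x = x)"
  using assms(2,3)
proof (induction X rule: finite_induct)
  case empty
  show ?case using finite_rank.zero by blast
next
  case (insert x X)
  have M: "left_module R M" using assms(1) by (simp add: locally_projective_def)
  interpret M: left_module R M by fact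
  obtain e where e: "finite_rank R M M e" "\<forall>x\<in>X. e x = x" using insert by auto
  have "x \<ominus>\<^bsub>M\<^esub> e x \<in> carrier M"
    using linear_closed[OF finite_rank_linear[OF M M e(1)]] insert.prems by auto
  then obtain e' where e': "finite_rank R M M e'" "e' (x \<ominus>\<^bsub>M\<^esub> e x) = x \<ominus>\<^bsub>M\<^esub> e x"
    using assms(1) unfolding locally_projective_def by blast
  have x: "x \<in> carrier M" using insert.prems by simp
  obtain e'' where e'': "finite_rank R M M e''" "e'' x = x" "\<And>y. y \<in> carrier M \<Longrightarrow> e y = y \<Longrightarrow> e'' y = y"
    using fixing_extend[OF M e(1) e'(1) x e'(2)] by blast
  show ?case
    by (rule exI[of _ e'']) (use e'' e(2) insert.prems in auto)
qed

text \<open>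
  A splitting of the free cover gives a dual basis: its coordinates are linear forms, and only finitely
  many of them are nonzero at a given element.
\<close>

lemma projective_locally_projective:
  fixes P :: "('r, 'u) module"
  assumes U: "universe TYPE('u)" and R: "|carrier R| <o |UNIV :: 'u set|"
    and P: "P \<in> projective_modules R"
  shows "locally_projective R P"
proof -
  have Pm: "left_module R P" using P by (auto simp: projective_modules_def modules_def)
  interpret P: left_module R P by fact
  obtain k where k: "linear_map R P (free_module R (carrier P)) k"
    "\<And>x. x \<in> carrier P \<Longrightarrow> free_cover R P (carrier P) (k x) = x"
    using projective_split[OF U R P] by blast
  have form: "linear_form R P (\<lambda>x. k x s)" if "s \<in> carrier P" for s
    using k(1) that by (auto simp: linear_form_def linear_map_def free_module_def)
  have fr: "finite_rank R P P (\<lambda>x. \<Oplus>\<^bsub>P\<^esub>s\<in>F. k x s \<odot>\<^bsub>P\<^esub> s)" if "finite F" "F \<subseteq> carrier P" for F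
    using that
  proof (induction F rule: finite_induct)
    case empty
    then show ?case using finite_rank.zero by simp
  next
    case (insert s F)
    have s: "s \<in> carrier P" using insert.prems by simp
    have "finite_rank R P P (\<lambda>x. k x s \<odot>\<^bsub>P\<^esub> s \<oplus>\<^bsub>P\<^esub> (\<Oplus>\<^bsub>P\<^esub>s\<in>F. k x s \<odot>\<^bsub>P\<^esub> s))"
      by (rule finite_rank.add[OF insert.IH form[OF s] s]) (use insert.prems in simp)
    then show ?case
    proof (rule finite_rank.cong)
      fix x assume x: "x \<in> carrier P"
      show "(\<Oplus>\<^bsub>P\<^esub>s\<in>insert s F. k x s \<odot>\<^bsub>P\<^esub> s) = k x s \<odot>\<^bsub>P\<^esub> s \<oplus>\<^bsub>P\<^esub> (\<Oplus>\<^bsub>P\<^esub>s\<in>F. k x s \<odot>\<^bsub>P\<^esub> s)"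
        by (rule P.finsum_insert)
          (use insert x form in \<open>auto simp: linear_form_def subset_iff intro!: P.smult_closed\<close>)
    qed
  qed
  have "\<exists>e. finite_rank R P P e \<and> e x = x" if x: "x \<in> carrier P" for x
  proof -
    let ?F = "{s \<in> carrier P. k x s \<noteq> \<zero>\<^bsub>R\<^esub>}"
    have kx: "k x \<in> carrier (free_module R (carrier P))" by (rule linear_closed[OF k(1) x])
    then have "finite ?F" by (simp add: free_module_def)
    moreover have "(\<Oplus>\<^bsub>P\<^esub>s\<in>?F. k x s \<odot>\<^bsub>P\<^esub> s) = x"
      using k(2)[OF x] kx by (simp add: free_cover_def)
    ultimately show ?thesis using fr[of ?F] by blast
  qed
  then show ?thesis using Pm by (simp add: locally_projective_def)
qed

section \<open>Tensor products\<close>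

lemma opposite_simps [simp]:
  "carrier (opposite R) = carrier R" "\<zero>\<^bsub>opposite R\<^esub> = \<zero>\<^bsub>R\<^esub>" "\<one>\<^bsub>opposite R\<^esub> = \<one>\<^bsub>R\<^esub>"
  "x \<oplus>\<^bsub>opposite R\<^esub> y = x \<oplus>\<^bsub>R\<^esub> y" "x \<otimes>\<^bsub>opposite R\<^esub> y = y \<otimes>\<^bsub>R\<^esub> x"
  by (simp_all add: opposite_def)

lemma opposite_opposite [simp]: "opposite (opposite R) = (R :: 'r ring)"
  by (simp add: opposite_def)

lemma opposite_ring:
  assumes "ring R" shows "ring (opposite R)"
proof -
  interpret R: ring R by fact
  have "abelian_group (opposite R)"
    by (rule abelian_groupI) (auto simp: R.a_ac intro: R.l_neg)
  moreover have "monoid (opposite R)"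
    by (rule monoidI) (auto simp: R.m_assoc)
  ultimately show ?thesis
    by (intro ringI) (auto simp: R.l_distr R.r_distr abelian_group.axioms)
qed

abbreviation rel_group :: "'m set \<Rightarrow> 'n set \<Rightarrow> ('m \<times> 'n \<Rightarrow>\<^sub>0 int) monoid" where
  "rel_group A B \<equiv> free_Abelian_group (A \<times> B)"

abbreviation frag_map :: "('a \<Rightarrow> 'b) \<Rightarrow> ('a \<times> 'n \<Rightarrow>\<^sub>0 int) \<Rightarrow> ('b \<times> 'n \<Rightarrow>\<^sub>0 int)" where
  "frag_map f \<equiv> frag_extend (\<lambda>(a, n). frag_of (f a, n))"

lemma frag_hom_diff:
  assumes "group G" "h \<in> hom (free_Abelian_group S) G" "Poly_Mapping.keys c \<subseteq> S" "Poly_Mapping.keys d \<subseteq> S"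
  shows "h (c - d) = h c \<otimes>\<^bsub>G\<^esub> inv\<^bsub>G\<^esub> h d"
proof -
  interpret h: group_hom "free_Abelian_group S" G h
    using assms by (simp add: group_hom_def group_hom_axioms_def)
  show ?thesis
    using h.hom_mult[of c "- d"] h.hom_inv[of d] assms by simp
qed

lemma frag_hom_zero:
  assumes "group G" "h \<in> hom (free_Abelian_group S) G"
  shows "h 0 = \<one>\<^bsub>G\<^esub>"
proof -
  interpret h: group_hom "free_Abelian_group S" G h
    using assms by (simp add: group_hom_def group_hom_axioms_def)
  show ?thesis using h.hom_one by simp
qed

lemma frag_map_keys: "Poly_Mapping.keys c \<subseteq> A \<times> N \<Longrightarrow> f ` A \<subseteq> B \<Longrightarrow> Poly_Mapping.keys (frag_map f c) \<subseteq> B \<times> N"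
  using keys_frag_extend[of "\<lambda>(a, n). frag_of (f a, n)" c] by (fastforce simp: keys_frag_of)

lemma tensor_relators_cases:
  assumes "c \<in> tensor_relators R A M"
  obtains x x' y where "x \<in> carrier A" "x' \<in> carrier A" "y \<in> carrier M"
      "c = frag_of (x \<oplus>\<^bsub>A\<^esub> x', y) - frag_of (x, y) - frag_of (x', y)"
    | x y y' where "x \<in> carrier A" "y \<in> carrier M" "y' \<in> carrier M"
      "c = frag_of (x, y \<oplus>\<^bsub>M\<^esub> y') - frag_of (x, y) - frag_of (x, y')"
    | r x y where "r \<in> carrier R" "x \<in> carrier A" "y \<in> carrier M"
      "c = frag_of (r \<odot>\<^bsub>A\<^esub> x, y) - frag_of (x, r \<odot>\<^bsub>M\<^esub> y)"
  using assms unfolding tensor_relators_def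
  apply (elim UnE CollectE exE conjE)
  subgoal by (rule that(1))
  subgoal by (rule that(2))
  subgoal by (rule that(3))
  done

lemma relators_keys:
  assumes "left_module (opposite R) A" "left_module R M" "c \<in> tensor_relators R A M"
  shows "Poly_Mapping.keys c \<subseteq> carrier A \<times> carrier M"
proof -
  interpret A: left_module "opposite R" A by fact
  interpret M: left_module R M by fact
  have sm: "r \<odot>\<^bsub>A\<^esub> x \<in> carrier A" if "r \<in> carrier R" "x \<in> carrier A" for r x
    using A.smult_closed that by simp
  have 3: "Poly_Mapping.keys (frag_of p - frag_of q - frag_of s) \<subseteq> {p, q, s}" for p q s :: "'b \<times> 'c"
    using keys_diff[of "frag_of p - frag_of q" "frag_of s"] keys_diff[of "frag_of p" "frag_of q"]
    by (auto simp: keys_frag_of)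
  have 2: "Poly_Mapping.keys (frag_of p - frag_of q) \<subseteq> {p, q}" for p q :: "'b \<times> 'c"
    using keys_diff[of "frag_of p" "frag_of q"] by (auto simp: keys_frag_of)
  show ?thesis
  proof
    fix z assume "z \<in> Poly_Mapping.keys c"
    then show "z \<in> carrier A \<times> carrier M"
      using assms(3) sm M.smult_closed unfolding tensor_relators_def
      by (auto dest!: subsetD[OF 3] subsetD[OF 2])
  qed
qed

lemma relations_subgroup:
  assumes "left_module (opposite R) A" "left_module R M"
  shows "subgroup (tensor_relations R A M) (rel_group (carrier A) (carrier M))"
  unfolding tensor_relations_def
  by (rule group.generate_is_subgroup) (use relators_keys[OF assms] in auto)

lemma
  assumes "left_module (opposite R) A" "left_module R M"
  shows relations_keys: "c \<in> tensor_relations R A M \<Longrightarrow> Poly_Mapping.keys c \<subseteq> carrier A \<times> carrier M"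
    and relations_zero: "0 \<in> tensor_relations R A M"
    and relations_uminus: "c \<in> tensor_relations R A M \<Longrightarrow> - c \<in> tensor_relations R A M"
    and relations_add: "c \<in> tensor_relations R A M \<Longrightarrow> d \<in> tensor_relations R A M \<Longrightarrow> c + d \<in> tensor_relations R A M"
    and relations_diff: "c \<in> tensor_relations R A M \<Longrightarrow> d \<in> tensor_relations R A M \<Longrightarrow> c - d \<in> tensor_relations R A M"
proof -
  interpret S: subgroup "tensor_relations R A M" "rel_group (carrier A) (carrier M)"
    by (rule relations_subgroup[OF assms])
  show k: "Poly_Mapping.keys c \<subseteq> carrier A \<times> carrier M" if "c \<in> tensor_relations R A M" for c
    using subsetD[OF S.subset that] by simp
  show "0 \<in> tensor_relations R A M" using S.one_closed by simp
  show u: "- c \<in> tensor_relations R A M" if "c \<in> tensor_relations R A M" for c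
    using S.m_inv_closed[OF that] k[OF that] by simp
  show a: "c + d \<in> tensor_relations R A M" if "c \<in> tensor_relations R A M" "d \<in> tensor_relations R A M" for c d
    using S.m_closed[OF that] by simp
  show "c - d \<in> tensor_relations R A M" if "c \<in> tensor_relations R A M" "d \<in> tensor_relations R A M"
    using a[OF that(1) u[OF that(2)]] by simp
qed

lemma relators_relations: "c \<in> tensor_relators R A M \<Longrightarrow> c \<in> tensor_relations R A M"
  unfolding tensor_relations_def by (rule generate.incl)

lemma hom_relations_one:
  assumes A: "left_module (opposite R) A" and M: "left_module R M" and G: "group G"
    and h: "h \<in> hom (rel_group (carrier A) (carrier M)) G"
    and rel: "\<And>c. c \<in> tensor_relators R A M \<Longrightarrow> h c = \<one>\<^bsub>G\<^esub>"
    and c: "c \<in> tensor_relations R A M"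
  shows "h c = \<one>\<^bsub>G\<^esub>"
proof -
  interpret h: group_hom "rel_group (carrier A) (carrier M)" G h
    using G h by (simp add: group_hom_def group_hom_axioms_def)
  note keys = relations_keys[OF A M, unfolded tensor_relations_def]
  show ?thesis
    using c unfolding tensor_relations_def
  proof (induction rule: generate.induct)
    case one
    then show ?case by (rule h.hom_one)
  next
    case (incl c)
    then show ?case by (rule rel)
  next
    case (inv c)
    have "c \<in> carrier (rel_group (carrier A) (carrier M))" using relators_keys[OF A M inv] by simp
    then show ?case using rel[OF inv] h.hom_inv h.H.inv_one by metis
  next
    case (eng c d)
    then show ?case using h.hom_mult[of c d] keys by simp
  qed
qed

lemma tensor_relators_hom:
  assumes f: "linear_map (opposite R) A B f" and c: "c \<in> tensor_relators R A M"
  shows "frag_map f c \<in> tensor_relators R B M"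
  using c unfolding tensor_relators_def
  apply (elim UnE CollectE exE conjE; hypsubst)
  subgoal for x x' y
    by (intro UnI1 CollectI exI[of _ "f x"] exI[of _ "f x'"] exI[of _ y])
      (simp add: frag_extend_diff linear_add[OF f] linear_closed[OF f])
  subgoal for x y y'
    by (intro UnI1 UnI2 CollectI exI[of _ "f x"] exI[of _ y] exI[of _ y'])
      (simp add: frag_extend_diff linear_closed[OF f])
  subgoal for r x y
    by (intro UnI2 CollectI exI[of _ r] exI[of _ "f x"] exI[of _ y])
      (simp add: frag_extend_diff linear_closed[OF f] linear_smult[OF f])
  done

lemma frag_map_relations:
  assumes A: "left_module (opposite R) A" and B: "left_module (opposite R) B" and M: "left_module R M"
    and f: "linear_map (opposite R) A B f" and c: "c \<in> tensor_relations R A M"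
  shows "frag_map f c \<in> tensor_relations R B M"
proof -
  note keys = relators_keys[OF A M]
  show ?thesis
    using c unfolding tensor_relations_def[of R A M]
  proof (induction rule: generate.induct)
    case one
    then show ?case using relations_zero[OF B M] by simp
  next
    case (incl c)
    then show ?case by (intro relators_relations tensor_relators_hom[OF f])
  next
    case (inv c)
    then have "frag_map f c \<in> tensor_relations R B M" by (intro relators_relations tensor_relators_hom[OF f])
    then show ?case using keys[OF inv] relations_uminus[OF B M] by (simp add: frag_extend_minus)
  next
    case (eng c d)
    then show ?case using relations_add[OF B M] by (simp add: frag_extend_add)
  qed
qed

abbreviation relations_coset where
  "relations_coset R A M c \<equiv> tensor_relations R A M #>\<^bsub>rel_group (carrier A) (carrier M)\<^esub> c"

lemma relations_coset_eq_iff: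
  assumes A: "left_module (opposite R) A" and M: "left_module R M"
    and "Poly_Mapping.keys c \<subseteq> carrier A \<times> carrier M" "Poly_Mapping.keys d \<subseteq> carrier A \<times> carrier M"
  shows "relations_coset R A M c = relations_coset R A M d \<longleftrightarrow> c - d \<in> tensor_relations R A M"
proof
  let ?G = "rel_group (carrier A) (carrier M)"
  interpret G: group ?G by simp
  interpret S: subgroup "tensor_relations R A M" ?G by (rule relations_subgroup[OF A M])
  show "c - d \<in> tensor_relations R A M" if "relations_coset R A M c = relations_coset R A M d"
  proof -
    have "c \<in> relations_coset R A M d"
      using G.rcos_self[OF _ S.subgroup_axioms, of c] assms(3) that by simp
    then show ?thesis by (auto simp: r_coset_def)
  qed
  show "relations_coset R A M c = relations_coset R A M d" if "c - d \<in> tensor_relations R A M"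
  proof (rule G.repr_independence[symmetric])
    show "c \<in> relations_coset R A M d"
      unfolding r_coset_def by (rule UN_I[OF that]) simp
  qed (use assms S.subgroup_axioms in auto)
qed

lemma tensor_carrier:
  "carrier (tensor_product R A M) = relations_coset R A M ` {c. Poly_Mapping.keys c \<subseteq> carrier A \<times> carrier M}"
  by (auto simp: tensor_product_def FactGroup_def RCOSETS_def)

lemma tensor_map_coset:
  assumes A: "left_module (opposite R) A" and B: "left_module (opposite R) B" and M: "left_module R M"
    and f: "linear_map (opposite R) A B f" and c: "Poly_Mapping.keys c \<subseteq> carrier A \<times> carrier M"
  shows "tensor_map R B M f (relations_coset R A M c) = relations_coset R B M (frag_map f c)"
proof -
  have keys: "Poly_Mapping.keys (frag_map f c) \<subseteq> carrier B \<times> carrier M"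
    if "Poly_Mapping.keys c \<subseteq> carrier A \<times> carrier M" for c
    using frag_map_keys[OF that] linear_closed[OF f] by blast
  have eq: "relations_coset R B M (frag_map f (r + c)) = relations_coset R B M (frag_map f c)"
    if r: "r \<in> tensor_relations R A M" for r
  proof -
    have "Poly_Mapping.keys (r + c) \<subseteq> carrier A \<times> carrier M"
      using keys_add[of r c] relations_keys[OF A M r] c by blast
    then show ?thesis
      using frag_map_relations[OF A B M f r] c
      by (subst relations_coset_eq_iff[OF B M keys keys]) (auto simp: frag_extend_add)
  qed
  have "(\<lambda>c. relations_coset R B M (frag_map f c)) ` relations_coset R A M c =
      (\<lambda>r. relations_coset R B M (frag_map f (r + c))) ` tensor_relations R A M"
    by (force simp: r_coset_def)
  also have "\<dots> = {relations_coset R B M (frag_map f c)}"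
    using eq relations_zero[OF A M] by auto
  finally show ?thesis by (simp add: tensor_map_def)
qed

text \<open>
  Injectivity on the tensor product becomes a statement about formal sums of pairs, which is the form
  in which it is established and used below.
\<close>

lemma tensor_map_inj_iff:
  assumes A: "left_module (opposite R) A" and B: "left_module (opposite R) B" and M: "left_module R M"
    and f: "linear_map (opposite R) A B f"
  shows "inj_on (tensor_map R B M f) (carrier (tensor_product R A M)) \<longleftrightarrow>
    (\<forall>c. Poly_Mapping.keys c \<subseteq> carrier A \<times> carrier M \<longrightarrow> frag_map f c \<in> tensor_relations R B M \<longrightarrow>
      c \<in> tensor_relations R A M)"
proof -
  have keys: "Poly_Mapping.keys (frag_map f c) \<subseteq> carrier B \<times> carrier M"
    if "Poly_Mapping.keys c \<subseteq> carrier A \<times> carrier M" for c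
    using frag_map_keys[OF that] linear_closed[OF f] by blast
  have "inj_on (tensor_map R B M f) (carrier (tensor_product R A M)) \<longleftrightarrow>
    (\<forall>c d. Poly_Mapping.keys c \<subseteq> carrier A \<times> carrier M \<longrightarrow> Poly_Mapping.keys d \<subseteq> carrier A \<times> carrier M \<longrightarrow>
       frag_map f c - frag_map f d \<in> tensor_relations R B M \<longrightarrow> c - d \<in> tensor_relations R A M)"
    unfolding inj_on_def tensor_carrier
    by (auto simp: tensor_map_coset[OF A B M f] relations_coset_eq_iff[OF A M] relations_coset_eq_iff[OF B M keys keys])
  also have "\<dots> \<longleftrightarrow> (\<forall>c. Poly_Mapping.keys c \<subseteq> carrier A \<times> carrier M \<longrightarrow> frag_map f c \<in> tensor_relations R B M \<longrightarrow>
      c \<in> tensor_relations R A M)" (is "?L = ?R")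
  proof
    assume ?L
    show ?R
    proof (intro allI impI)
      fix c assume "Poly_Mapping.keys c \<subseteq> carrier A \<times> carrier M" "frag_map f c \<in> tensor_relations R B M"
      then show "c \<in> tensor_relations R A M" using \<open>?L\<close>[rule_format, of c 0] by simp
    qed
  next
    assume ?R
    show ?L
    proof (intro allI impI)
      fix c d assume cd: "Poly_Mapping.keys c \<subseteq> carrier A \<times> carrier M" "Poly_Mapping.keys d \<subseteq> carrier A \<times> carrier M"
        "frag_map f c - frag_map f d \<in> tensor_relations R B M"
      have "Poly_Mapping.keys (c - d) \<subseteq> carrier A \<times> carrier M" using keys_diff[of c d] cd by blast
      then show "c - d \<in> tensor_relations R A M"
        using \<open>?R\<close> cd(3) by (simp add: frag_extend_diff)
    qed
  qed
  finally show ?thesis .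
qed

text \<open>
  The homomorphism on a free abelian group with prescribed values on the generators. Its values
  outside the group are arbitrary.
\<close>

definition frag_lift :: "'s set \<Rightarrow> ('g, 'x) monoid_scheme \<Rightarrow> ('s \<Rightarrow> 'g) \<Rightarrow> ('s \<Rightarrow>\<^sub>0 int) \<Rightarrow> 'g" where
  "frag_lift S G f = (SOME h. h \<in> hom (free_Abelian_group S) G \<and> (\<forall>x\<in>S. h (frag_of x) = f x))"

lemma
  assumes "comm_group G" "f ` S \<subseteq> carrier G"
  shows frag_lift_hom: "frag_lift S G f \<in> hom (free_Abelian_group S) G"
    and frag_lift_of: "x \<in> S \<Longrightarrow> frag_lift S G f (frag_of x) = f x"
proof -
  have "\<exists>h. h \<in> hom (free_Abelian_group S) G \<and> (\<forall>x\<in>S. h (frag_of x) = f x)"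
    using comm_group.free_Abelian_group_universal[OF assms] by metis
  from someI_ex[OF this] show "frag_lift S G f \<in> hom (free_Abelian_group S) G"
    "x \<in> S \<Longrightarrow> frag_lift S G f (frag_of x) = f x"
    unfolding frag_lift_def by blast+
qed

text \<open>
  Contraction with a linear form, on formal sums of pairs.
\<close>

definition tensor_eval :: "('r, 'm) module \<Rightarrow> ('r, 'n) module \<Rightarrow> ('n \<Rightarrow> 'r) \<Rightarrow> ('m \<times> 'n \<Rightarrow>\<^sub>0 int) \<Rightarrow> 'm" where
  "tensor_eval A M \<phi> = frag_lift (carrier A \<times> carrier M) (add_monoid A) (\<lambda>(a, x). \<phi> x \<odot>\<^bsub>A\<^esub> a)"

lemma
  assumes A: "left_module (opposite R) A" and \<phi>: "linear_form R M \<phi>"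
  shows tensor_eval_hom: "tensor_eval A M \<phi> \<in> hom (rel_group (carrier A) (carrier M)) (add_monoid A)"
    and tensor_eval_of: "a \<in> carrier A \<Longrightarrow> x \<in> carrier M \<Longrightarrow> tensor_eval A M \<phi> (frag_of (a, x)) = \<phi> x \<odot>\<^bsub>A\<^esub> a"
    and tensor_eval_diff: "Poly_Mapping.keys c \<subseteq> carrier A \<times> carrier M \<Longrightarrow>
      Poly_Mapping.keys d \<subseteq> carrier A \<times> carrier M \<Longrightarrow>
      tensor_eval A M \<phi> (c - d) = tensor_eval A M \<phi> c \<ominus>\<^bsub>A\<^esub> tensor_eval A M \<phi> d"
    and tensor_eval_zero: "tensor_eval A M \<phi> 0 = \<zero>\<^bsub>A\<^esub>"
    and tensor_eval_closed: "Poly_Mapping.keys c \<subseteq> carrier A \<times> carrier M \<Longrightarrow> tensor_eval A M \<phi> c \<in> carrier A"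
proof -
  interpret A: left_module "opposite R" A by fact
  have "(\<lambda>(a, x). \<phi> x \<odot>\<^bsub>A\<^esub> a) ` (carrier A \<times> carrier M) \<subseteq> carrier (add_monoid A)"
    using \<phi> A.smult_closed by (auto simp: linear_form_def)
  note * = frag_lift_hom[OF A.M.a_comm_group this] frag_lift_of[OF A.M.a_comm_group this]
  show h: "tensor_eval A M \<phi> \<in> hom (rel_group (carrier A) (carrier M)) (add_monoid A)"
    unfolding tensor_eval_def by (rule *)
  show "tensor_eval A M \<phi> (frag_of (a, x)) = \<phi> x \<odot>\<^bsub>A\<^esub> a" if "a \<in> carrier A" "x \<in> carrier M" for a x
    unfolding tensor_eval_def using *(2)[of "(a, x)"] that by simp
  have g: "group (add_monoid A)" using A.M.a_comm_group by (simp add: comm_group_def)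
  show "tensor_eval A M \<phi> (c - d) = tensor_eval A M \<phi> c \<ominus>\<^bsub>A\<^esub> tensor_eval A M \<phi> d"
    if "Poly_Mapping.keys c \<subseteq> carrier A \<times> carrier M" "Poly_Mapping.keys d \<subseteq> carrier A \<times> carrier M" for c d
    using frag_hom_diff[OF g h that] by (simp add: a_minus_def a_inv_def)
  show "tensor_eval A M \<phi> 0 = \<zero>\<^bsub>A\<^esub>" using frag_hom_zero[OF g h] by simp
  show "tensor_eval A M \<phi> c \<in> carrier A" if "Poly_Mapping.keys c \<subseteq> carrier A \<times> carrier M" for c
    using hom_in_carrier[OF h, of c] that by simp
qed

lemma tensor_eval_relations:
  assumes A: "left_module (opposite R) A" and M: "left_module R M" and \<phi>: "linear_form R M \<phi>"
    and c: "c \<in> tensor_relations R A M"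
  shows "tensor_eval A M \<phi> c = \<zero>\<^bsub>A\<^esub>"
proof -
  interpret A: left_module "opposite R" A by fact
  interpret M: left_module R M by fact
  note ev = tensor_eval_of[OF A \<phi>] tensor_eval_diff[OF A \<phi>]
  have g: "group (add_monoid A)" using A.M.a_comm_group by (simp add: comm_group_def)
  have p: "\<phi> x \<in> carrier R" "\<phi> (x \<oplus>\<^bsub>M\<^esub> y) = \<phi> x \<oplus>\<^bsub>R\<^esub> \<phi> y" "r \<in> carrier R \<Longrightarrow> \<phi> (r \<odot>\<^bsub>M\<^esub> x) = r \<otimes>\<^bsub>R\<^esub> \<phi> x"
    if "x \<in> carrier M" "y \<in> carrier M" for r x y using \<phi> that by (auto simp: linear_form_def)
  have sm: "r \<odot>\<^bsub>A\<^esub> x \<in> carrier A" if "r \<in> carrier R" "x \<in> carrier A" for r x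
    using A.smult_closed that by simp
  have k2: "Poly_Mapping.keys (frag_of p - frag_of q) \<subseteq> carrier A \<times> carrier M"
    if "p \<in> carrier A \<times> carrier M" "q \<in> carrier A \<times> carrier M" for p q
    using keys_diff[of "frag_of p" "frag_of q"] that by (auto simp: keys_frag_of)
  have "tensor_eval A M \<phi> c = \<one>\<^bsub>add_monoid A\<^esub>"
  proof (rule hom_relations_one[OF A M g tensor_eval_hom[OF A \<phi>] _ c])
    fix c assume "c \<in> tensor_relators R A M"
    then show "tensor_eval A M \<phi> c = \<one>\<^bsub>add_monoid A\<^esub>"
    proof (cases rule: tensor_relators_cases)
      case (1 x x' y)
      then show ?thesis
        using p sm by (simp add: ev k2 keys_frag_of A.smult_r_distr A.plus_minus_minus)
    next
      case (2 x y y')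
      have "\<phi> (y \<oplus>\<^bsub>M\<^esub> y') \<odot>\<^bsub>A\<^esub> x = \<phi> y \<odot>\<^bsub>A\<^esub> x \<oplus>\<^bsub>A\<^esub> \<phi> y' \<odot>\<^bsub>A\<^esub> x"
        using A.smult_l_distr[of "\<phi> y" "\<phi> y'" x] 2 p by simp
      then show ?thesis
        using 2 p sm by (simp add: ev k2 keys_frag_of A.plus_minus_minus)
    next
      case (3 r x y)
      have "\<phi> (r \<odot>\<^bsub>M\<^esub> y) \<odot>\<^bsub>A\<^esub> x = \<phi> y \<odot>\<^bsub>A\<^esub> (r \<odot>\<^bsub>A\<^esub> x)"
        using A.smult_assoc[of "\<phi> y" r x] 3 p by simp
      then show ?thesis
        using 3 p sm M.smult_closed by (simp add: ev keys_frag_of)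
    qed
  qed
  then show ?thesis by simp
qed

text \<open>
  If \<open>e\<close> is the sum of the maps \<open>\<phi>\<^sub>i y\<^sub>i\<close>, then applying \<open>e\<close> to the right factors of a tensor \<open>c\<close> gives the
  sum of the tensors \<open>\<phi>\<^sub>i(c) \<otimes> y\<^sub>i\<close>, where \<open>\<phi>\<^sub>i(c)\<close> is the contraction of \<open>c\<close> with \<open>\<phi>\<^sub>i\<close>. All
  of these contractions vanish.
\<close>

lemma finite_rank_tensor_zero:
  assumes A: "left_module (opposite R) A" and M: "left_module R M" and e: "finite_rank R M M e"
    and c: "Poly_Mapping.keys c \<subseteq> carrier A \<times> carrier M"
    and zero: "\<And>\<phi>. linear_form R M \<phi> \<Longrightarrow> tensor_eval A M \<phi> c = \<zero>\<^bsub>A\<^esub>"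
  shows "frag_extend (\<lambda>(a, x). frag_of (a, e x)) c \<in> tensor_relations R A M"
  using e
proof (induction rule: finite_rank.induct)
  interpret A: left_module "opposite R" A by fact
  interpret M: left_module R M by fact
  note rel0 = relations_zero[OF A M] and rel_add = relations_add[OF A M]
    and rel_diff = relations_diff[OF A M] and rel_uminus = relations_uminus[OF A M]
  have bilin: "frag_of (x \<oplus>\<^bsub>A\<^esub> x', y) - frag_of (x, y) - frag_of (x', y) \<in> tensor_relations R A M"
    if "x \<in> carrier A" "x' \<in> carrier A" "y \<in> carrier M" for x x' y
    by (rule relators_relations) (use that in \<open>unfold tensor_relators_def, blast\<close>)
  have bilin': "frag_of (x, y \<oplus>\<^bsub>M\<^esub> y') - frag_of (x, y) - frag_of (x, y') \<in> tensor_relations R A M"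
    if "x \<in> carrier A" "y \<in> carrier M" "y' \<in> carrier M" for x y y'
    by (rule relators_relations) (use that in \<open>unfold tensor_relators_def, blast\<close>)
  have bal: "frag_of (r \<odot>\<^bsub>A\<^esub> x, y) - frag_of (x, r \<odot>\<^bsub>M\<^esub> y) \<in> tensor_relations R A M"
    if "r \<in> carrier R" "x \<in> carrier A" "y \<in> carrier M" for r x y
    by (rule relators_relations) (use that in \<open>unfold tensor_relators_def, blast\<close>)
  have zero_l: "frag_of (\<zero>\<^bsub>A\<^esub>, y) \<in> tensor_relations R A M" if "y \<in> carrier M" for y
    using rel_uminus[OF bilin[of "\<zero>\<^bsub>A\<^esub>" "\<zero>\<^bsub>A\<^esub>" y]] that by simp
  have zero_r: "frag_of (a, \<zero>\<^bsub>M\<^esub>) \<in> tensor_relations R A M" if "a \<in> carrier A" for a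
    using rel_uminus[OF bilin'[of a "\<zero>\<^bsub>M\<^esub>" "\<zero>\<^bsub>M\<^esub>"]] that by simp
  {
    case zero
    show ?case
      by (rule free_Abelian_group_induct[OF c]) (auto simp: rel0 frag_extend_diff rel_diff zero_r)
  next
    case (add e \<phi> y)
    note el = linear_closed[OF finite_rank_linear[OF M M add(1)]]
    have ph: "\<phi> x \<in> carrier R" if "x \<in> carrier M" for x using add(2) that by (simp add: linear_form_def)
    define D where "D c = frag_extend (\<lambda>(a, x). frag_of (a, \<phi> x \<odot>\<^bsub>M\<^esub> y \<oplus>\<^bsub>M\<^esub> e x)) c
        - frag_of (tensor_eval A M \<phi> c, y) - frag_extend (\<lambda>(a, x). frag_of (a, e x)) c" for c
    \<comment> \<open>applying \<open>\<phi> y + e\<close> to the right factor amounts to contracting with \<open>\<phi>\<close> and tensoring with \<open>y\<close>,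
      plus applying \<open>e\<close>; only additivity in \<open>c\<close> has to be checked\<close>
    have "Poly_Mapping.keys c \<subseteq> carrier A \<times> carrier M \<and> D c \<in> tensor_relations R A M"
    proof (rule free_Abelian_group_induct[OF c])
      show "Poly_Mapping.keys 0 \<subseteq> carrier A \<times> carrier M \<and> D 0 \<in> tensor_relations R A M"
        using rel_uminus[OF zero_l[OF add(3)]] by (simp add: D_def tensor_eval_zero[OF A add(2)])
    next
      fix c d assume k: "Poly_Mapping.keys c \<subseteq> carrier A \<times> carrier M" "Poly_Mapping.keys d \<subseteq> carrier A \<times> carrier M"
        and IH: "Poly_Mapping.keys c \<subseteq> carrier A \<times> carrier M \<and> D c \<in> tensor_relations R A M"
          "Poly_Mapping.keys d \<subseteq> carrier A \<times> carrier M \<and> D d \<in> tensor_relations R A M"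
      let ?c = "tensor_eval A M \<phi> c" and ?d = "tensor_eval A M \<phi> d"
      have cd: "?c \<in> carrier A" "?d \<in> carrier A" using tensor_eval_closed[OF A add(2)] k by auto
      have r: "frag_of (?c, y) - frag_of (?c \<ominus>\<^bsub>A\<^esub> ?d, y) - frag_of (?d, y) \<in> tensor_relations R A M"
        using bilin[of "?c \<ominus>\<^bsub>A\<^esub> ?d" ?d y] cd add(3) by (simp add: A.minus_plus_cancel)
      have "D c - D d + (frag_of (?c, y) - frag_of (?c \<ominus>\<^bsub>A\<^esub> ?d, y) - frag_of (?d, y)) \<in> tensor_relations R A M"
        using rel_add[OF rel_diff r] IH by blast
      moreover have "D (c - d) = D c - D d + (frag_of (?c, y) - frag_of (?c \<ominus>\<^bsub>A\<^esub> ?d, y) - frag_of (?d, y))"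
        by (simp add: D_def frag_extend_diff tensor_eval_diff[OF A add(2) k])
      ultimately show "Poly_Mapping.keys (c - d) \<subseteq> carrier A \<times> carrier M \<and> D (c - d) \<in> tensor_relations R A M"
        using keys_diff[of c d] k by auto
    next
      fix ax assume "ax \<in> carrier A \<times> carrier M"
      then obtain a x where ax: "ax = (a, x)" "a \<in> carrier A" "x \<in> carrier M" by auto
      have "D (frag_of ax) =
          (frag_of (a, \<phi> x \<odot>\<^bsub>M\<^esub> y \<oplus>\<^bsub>M\<^esub> e x) - frag_of (a, \<phi> x \<odot>\<^bsub>M\<^esub> y) - frag_of (a, e x))
          - (frag_of (\<phi> x \<odot>\<^bsub>A\<^esub> a, y) - frag_of (a, \<phi> x \<odot>\<^bsub>M\<^esub> y))"
        using ax by (simp add: D_def tensor_eval_of[OF A add(2)])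
      also have "\<dots> \<in> tensor_relations R A M"
        by (intro rel_diff[OF bilin' bal]) (use ax ph el add(3) M.smult_closed in auto)
      finally show "Poly_Mapping.keys (frag_of ax) \<subseteq> carrier A \<times> carrier M \<and> D (frag_of ax) \<in> tensor_relations R A M"
        using ax by (simp add: keys_frag_of)
    qed
    then have "D c + frag_of (\<zero>\<^bsub>A\<^esub>, y) + frag_extend (\<lambda>(a, x). frag_of (a, e x)) c \<in> tensor_relations R A M"
      by (intro rel_add zero_l add) auto
    then show ?case by (simp add: D_def zero[OF add(2)])
  next
    case (cong e e')
    have "frag_extend (\<lambda>(a, x). frag_of (a, e' x)) c = frag_extend (\<lambda>(a, x). frag_of (a, e x)) c"
      by (rule frag_extend_eq) (use c cong(2) in auto)
    then show ?case using cong by simp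
  }
qed

text \<open>
  Some map of finite rank fixes all right factors of \<open>c\<close> at once, and by the preceding lemma it sends
  \<open>c\<close> to zero.
\<close>

lemma locally_projective_tensor_zero:
  assumes A: "left_module (opposite R) A" and M: "locally_projective R M"
    and c: "Poly_Mapping.keys c \<subseteq> carrier A \<times> carrier M"
    and zero: "\<And>\<phi>. linear_form R M \<phi> \<Longrightarrow> tensor_eval A M \<phi> c = \<zero>\<^bsub>A\<^esub>"
  shows "c \<in> tensor_relations R A M"
proof -
  have Mm: "left_module R M" using M by (simp add: locally_projective_def)
  obtain e where e: "finite_rank R M M e" "\<forall>x\<in>snd ` Poly_Mapping.keys c. e x = x"
    using locally_projective_finite[OF M, of "snd ` Poly_Mapping.keys c"] c by force
  have "frag_extend (\<lambda>(a, x). frag_of (a, e x)) c = frag_extend frag_of c"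
    by (rule frag_extend_eq) (use e(2) in force)
  also have "\<dots> = c" by (rule frag_expansion[symmetric])
  finally show ?thesis using finite_rank_tensor_zero[OF A Mm e(1) c zero] by simp
qed

lemma tensor_eval_frag_map:
  assumes A: "left_module (opposite R) A" and B: "left_module (opposite R) B" and \<phi>: "linear_form R M \<phi>"
    and f: "linear_map (opposite R) A B f" and c: "Poly_Mapping.keys c \<subseteq> carrier A \<times> carrier M"
  shows "tensor_eval B M \<phi> (frag_map f c) = f (tensor_eval A M \<phi> c)"
proof -
  have fA: "f ` carrier A \<subseteq> carrier B" using linear_closed[OF f] by blast
  have "Poly_Mapping.keys c \<subseteq> carrier A \<times> carrier M \<and>
      tensor_eval B M \<phi> (frag_map f c) = f (tensor_eval A M \<phi> c)"
  proof (rule free_Abelian_group_induct[OF c])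
    show "Poly_Mapping.keys 0 \<subseteq> carrier A \<times> carrier M \<and>
        tensor_eval B M \<phi> (frag_map f 0) = f (tensor_eval A M \<phi> 0)"
      by (simp add: tensor_eval_zero[OF A \<phi>] tensor_eval_zero[OF B \<phi>] linear_zero[OF A B f])
  next
    fix c d assume k: "Poly_Mapping.keys c \<subseteq> carrier A \<times> carrier M" "Poly_Mapping.keys d \<subseteq> carrier A \<times> carrier M"
      and IH: "Poly_Mapping.keys c \<subseteq> carrier A \<times> carrier M \<and> tensor_eval B M \<phi> (frag_map f c) = f (tensor_eval A M \<phi> c)"
       "Poly_Mapping.keys d \<subseteq> carrier A \<times> carrier M \<and> tensor_eval B M \<phi> (frag_map f d) = f (tensor_eval A M \<phi> d)"
    have "tensor_eval B M \<phi> (frag_map f (c - d)) = f (tensor_eval A M \<phi> (c - d))"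
      using IH by (simp add: frag_extend_diff tensor_eval_diff[OF A \<phi> k] tensor_eval_closed[OF A \<phi>]
          tensor_eval_diff[OF B \<phi> frag_map_keys[OF k(1) fA] frag_map_keys[OF k(2) fA]] linear_diff[OF A B f])
    then show "Poly_Mapping.keys (c - d) \<subseteq> carrier A \<times> carrier M \<and>
        tensor_eval B M \<phi> (frag_map f (c - d)) = f (tensor_eval A M \<phi> (c - d))"
      using keys_diff[of c d] k by auto
  next
    fix ax assume "ax \<in> carrier A \<times> carrier M"
    then show "Poly_Mapping.keys (frag_of ax) \<subseteq> carrier A \<times> carrier M \<and>
        tensor_eval B M \<phi> (frag_map f (frag_of ax)) = f (tensor_eval A M \<phi> (frag_of ax))"
      using \<phi> linear_closed[OF f] linear_smult[OF f]
      by (auto simp: keys_frag_of tensor_eval_of[OF A \<phi>] tensor_eval_of[OF B \<phi>] linear_form_def)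
  qed
  then show ?thesis by blast
qed

lemma product_module_left_module:
  assumes R: "ring R" and N: "\<And>i. i \<in> I \<Longrightarrow> left_module R (N i)"
  shows "left_module R (product_module I N)"
proof -
  have G: "abelian_group (N i)" if "i \<in> I" for i using N[OF that] by (simp add: left_module_def)
  note N' = left_module.smult_closed[OF N] left_module.smult_l_distr[OF N] left_module.smult_r_distr[OF N]
    left_module.smult_assoc[OF N] left_module.smult_one[OF N]
  note G' = abelian_monoid.a_closed[OF abelian_group.axioms(1)[OF G]]
    abelian_monoid.zero_closed[OF abelian_group.axioms(1)[OF G]]
  have "abelian_group (product_module I N)"
  proof (rule abelian_groupI)
    fix x assume x: "x \<in> carrier (product_module I N)"
    show "\<exists>y\<in>carrier (product_module I N). y \<oplus>\<^bsub>product_module I N\<^esub> x = \<zero>\<^bsub>product_module I N\<^esub>"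
      using x abelian_group.a_inv_closed[OF G] abelian_group.l_neg[OF G]
      by (intro bexI[of _ "\<lambda>i\<in>I. \<ominus>\<^bsub>N i\<^esub> x i"]) (auto simp: product_module_def PiE_iff intro!: restrict_ext)
  qed (use G' abelian_monoid.a_assoc[OF abelian_group.axioms(1)[OF G]] abelian_monoid.l_zero[OF abelian_group.axioms(1)[OF G]]
      abelian_monoid.a_comm[OF abelian_group.axioms(1)[OF G]]
      in \<open>auto simp: product_module_def fun_eq_iff PiE_iff extensional_def\<close>)
  moreover have "left_module_axioms R (product_module I N)"
    by (rule left_module_axioms.intro)
      (use N' ring.ring_simprules(1,5,6)[OF R] in \<open>auto simp: product_module_def fun_eq_iff PiE_iff extensional_def\<close>)
  ultimately show ?thesis using R by (simp add: left_module_def)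
qed

text \<open>
  Contractions commute with \<open>f\<close>, so an injective \<open>f\<close> reflects the vanishing of all contractions of a
  tensor, and hence the vanishing of the tensor.
\<close>

lemma locally_projective_flat:
  fixes M :: "('r, 'u) module"
  assumes M: "locally_projective R M" "M \<in> modules R"
  shows "M \<in> flat_modules R"
  unfolding flat_modules_def
proof (intro CollectI conjI ballI impI M(2))
  fix A B :: "('r, 'u) module" and f
  assume AB: "A \<in> modules (opposite R)" "B \<in> modules (opposite R)" and f: "f \<in> module_hom (opposite R) A B"
    and inj: "inj_on f (carrier A)"
  have A: "left_module (opposite R) A" and B: "left_module (opposite R) B" using AB by (auto simp: modules_def)
  have Mm: "left_module R M" using M by (simp add: modules_def)
  interpret A: left_module "opposite R" A by fact
  note fl = module_hom_linear[OF f]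
  show "inj_on (tensor_map R B M f) (carrier (tensor_product R A M))"
    unfolding tensor_map_inj_iff[OF A B Mm fl]
  proof (intro allI impI)
    fix c assume c: "Poly_Mapping.keys c \<subseteq> carrier A \<times> carrier M" and fc: "frag_map f c \<in> tensor_relations R B M"
    show "c \<in> tensor_relations R A M"
    proof (rule locally_projective_tensor_zero[OF A M(1) c])
      fix \<phi> assume \<phi>: "linear_form R M \<phi>"
      have "f (tensor_eval A M \<phi> c) = f \<zero>\<^bsub>A\<^esub>"
        using tensor_eval_frag_map[OF A B \<phi> fl c] tensor_eval_relations[OF B Mm \<phi> fc] linear_zero[OF A B fl] by simp
      then show "tensor_eval A M \<phi> c = \<zero>\<^bsub>A\<^esub>"
        using inj_onD[OF inj] tensor_eval_closed[OF A \<phi> c] by blast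
    qed
  qed
qed

text \<open>
  Contractions commute with the projections of the product, and an element of a product vanishes when
  all its coordinates do.
\<close>

lemma locally_projective_mittag_leffler:
  fixes M :: "('r, 'u) module"
  assumes M: "locally_projective R M" "M \<in> modules R"
  shows "M \<in> mittag_leffler_modules R"
  unfolding mittag_leffler_modules_def
proof (intro CollectI conjI allI impI M(2))
  fix I :: "'u set" and N :: "'u \<Rightarrow> ('r, 'u) module"
  assume IN: "small I \<and> (\<forall>i\<in>I. N i \<in> modules (opposite R))"
  have N: "left_module (opposite R) (N i)" if "i \<in> I" for i using IN that by (auto simp: modules_def)
  have Mm: "left_module R M" using M by (simp add: modules_def)
  have R: "ring (opposite R)" using Mm by (simp add: left_module_def opposite_ring)
  let ?A = "product_module I N"
  have A: "left_module (opposite R) ?A" by (rule product_module_left_module[OF R N])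
  have pr: "linear_map (opposite R) ?A (N i) (\<lambda>x. x i)" if "i \<in> I" for i
    using that by (auto simp: linear_map_def product_module_def)
  have key: "c \<in> tensor_relations R ?A M"
    if c: "Poly_Mapping.keys c \<subseteq> carrier ?A \<times> carrier M"
      and z: "\<And>i. i \<in> I \<Longrightarrow> frag_map (\<lambda>x. x i) c \<in> tensor_relations R (N i) M" for c
  proof (rule locally_projective_tensor_zero[OF A M(1) c])
    fix \<phi> assume \<phi>: "linear_form R M \<phi>"
    have "tensor_eval ?A M \<phi> c i = \<zero>\<^bsub>N i\<^esub>" if i: "i \<in> I" for i
      using tensor_eval_frag_map[OF A N[OF i] \<phi> pr[OF i] c] tensor_eval_relations[OF N[OF i] Mm \<phi> z[OF i]] by simp
    then show "tensor_eval ?A M \<phi> c = \<zero>\<^bsub>?A\<^esub>"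
      using tensor_eval_closed[OF A \<phi> c] by (auto simp: product_module_def PiE_iff extensional_def)
  qed
  show "inj_on (product_tensor_map R I N M) (carrier (tensor_product R ?A M))"
    unfolding tensor_carrier
  proof (intro inj_onI, clarify)
    fix c d assume c: "Poly_Mapping.keys c \<subseteq> carrier ?A \<times> carrier M" and d: "Poly_Mapping.keys d \<subseteq> carrier ?A \<times> carrier M"
      and eq: "product_tensor_map R I N M (relations_coset R ?A M c) = product_tensor_map R I N M (relations_coset R ?A M d)"
    have "c - d \<in> tensor_relations R ?A M"
    proof (rule key)
      show "Poly_Mapping.keys (c - d) \<subseteq> carrier ?A \<times> carrier M" using keys_diff[of c d] c d by blast
      fix i assume i: "i \<in> I"
      have im: "(\<lambda>x. x i) ` carrier ?A \<subseteq> carrier (N i)" using linear_closed[OF pr[OF i]] by blast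
      have "relations_coset R (N i) M (frag_map (\<lambda>x. x i) c) = relations_coset R (N i) M (frag_map (\<lambda>x. x i) d)"
        using fun_cong[OF eq, of i] i tensor_map_coset[OF A N[OF i] Mm pr[OF i] c]
          tensor_map_coset[OF A N[OF i] Mm pr[OF i] d]
        by (simp add: product_tensor_map_def)
      then show "frag_map (\<lambda>x. x i) (c - d) \<in> tensor_relations R (N i) M"
        using relations_coset_eq_iff[OF N[OF i] Mm frag_map_keys[OF c im] frag_map_keys[OF d im]]
        by (simp add: frag_extend_diff)
    qed
    then show "relations_coset R ?A M c = relations_coset R ?A M d"
      using relations_coset_eq_iff[OF A Mm c d] by simp
  qed
qed

section \<open>Trees of branches over a chain of projective modules\<close>

text \<open>
  A chain of projective modules indexed by the well-order \<open>W\<close>, together with a module \<open>Y\<close> of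
  coefficients for cocycles.
\<close>

locale projective_chain =
  fixes R :: "'r ring" and W :: "'u set" and le :: "'u rel"
    and P :: "'u \<Rightarrow> ('r, 'u) module" and f :: "'u \<Rightarrow> 'u \<Rightarrow> 'u \<Rightarrow> 'u" and Y :: "('r, 'u) module"
  assumes univ: "universe TYPE('u)" and Rcard: "|carrier R| <o |UNIV :: 'u set|"
    and Wsmall: "small W" and Wne: "W \<noteq> {}" and wo: "well_order_on W le"
    and P: "\<And>\<alpha>. \<alpha> \<in> W \<Longrightarrow> P \<alpha> \<in> projective_modules R"
    and f: "\<And>\<alpha> \<beta>. (\<alpha>, \<beta>) \<in> le \<Longrightarrow> linear_map R (P \<alpha>) (P \<beta>) (f \<alpha> \<beta>)"
    and f_id: "\<And>\<alpha> x. \<alpha> \<in> W \<Longrightarrow> x \<in> carrier (P \<alpha>) \<Longrightarrow> f \<alpha> \<alpha> x = x"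
    and f_comp: "\<And>\<alpha> \<beta> \<gamma> x. (\<alpha>, \<beta>) \<in> le \<Longrightarrow> (\<beta>, \<gamma>) \<in> le \<Longrightarrow> x \<in> carrier (P \<alpha>) \<Longrightarrow>
      f \<beta> \<gamma> (f \<alpha> \<beta> x) = f \<alpha> \<gamma> x"
    and Y: "Y \<in> modules R"
begin

lemma Pm: "\<alpha> \<in> W \<Longrightarrow> left_module R (P \<alpha>)"
  using P by (auto simp: projective_modules_def modules_def)

lemma Ym: "left_module R Y"
  using Y by (simp add: modules_def)

sublocale Y: left_module R Y by (rule Ym)

lemma le_W: "(\<alpha>, \<beta>) \<in> le \<Longrightarrow> \<alpha> \<in> W \<and> \<beta> \<in> W"
  using wo by (auto simp: well_order_on_def linear_order_on_def partial_order_on_def preorder_on_def)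

lemma le_refl: "\<alpha> \<in> W \<Longrightarrow> (\<alpha>, \<alpha>) \<in> le"
  using wo by (auto simp: well_order_on_def linear_order_on_def partial_order_on_def preorder_on_def refl_on_def)

lemma le_trans: "(\<alpha>, \<beta>) \<in> le \<Longrightarrow> (\<beta>, \<gamma>) \<in> le \<Longrightarrow> (\<alpha>, \<gamma>) \<in> le"
  using wo by (auto simp: well_order_on_def linear_order_on_def partial_order_on_def preorder_on_def dest: transD)

lemma le_antisym: "(\<alpha>, \<beta>) \<in> le \<Longrightarrow> (\<beta>, \<alpha>) \<in> le \<Longrightarrow> \<alpha> = \<beta>"
  using wo by (auto simp: well_order_on_def linear_order_on_def partial_order_on_def dest: antisymD)

lemma le_total: "\<alpha> \<in> W \<Longrightarrow> \<beta> \<in> W \<Longrightarrow> (\<alpha>, \<beta>) \<in> le \<or> (\<beta>, \<alpha>) \<in> le"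
  using wo le_refl by (cases "\<alpha> = \<beta>") (auto simp: well_order_on_def linear_order_on_def total_on_def)

lemma le_wf: "wf (le - Id)"
  using wo by (simp add: well_order_on_def)

lemma le_min:
  assumes "A \<subseteq> W" "A \<noteq> {}"
  obtains m where "m \<in> A" "\<And>a. a \<in> A \<Longrightarrow> (m, a) \<in> le"
proof -
  obtain m where m: "m \<in> A" "\<And>y. (y, m) \<in> le - Id \<Longrightarrow> y \<notin> A"
    using wfE_min[OF le_wf, of _ A] assms(2) by blast
  have "(m, a) \<in> le" if "a \<in> A" for a
    using le_total[of m a] m that assms(1) by auto
  then show thesis using that m(1) by blast
qed

lemma le_max:
  assumes "finite A" "A \<subseteq> W"
  obtains m where "m \<in> W" "\<And>a. a \<in> A \<Longrightarrow> (a, m) \<in> le"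
proof -
  have "\<exists>m\<in>W. \<forall>a\<in>A. (a, m) \<in> le"
    using assms
  proof (induction A rule: finite_induct)
    case empty
    then show ?case using Wne by auto
  next
    case (insert a A)
    then obtain m where m: "m \<in> W" "\<forall>a\<in>A. (a, m) \<in> le" by auto
    consider "(a, m) \<in> le" | "(m, a) \<in> le" using le_total[of a m] m insert.prems by auto
    then show ?case
    proof cases
      case 1
      then show ?thesis using m by auto
    next
      case 2
      then have "\<forall>b\<in>insert a A. (b, a) \<in> le" using m le_trans le_W le_refl by blast
      then show ?thesis using insert.prems by auto
    qed
  qed
  then show thesis using that by blast
qed

lemma le_less_linear: "\<alpha> \<in> W \<Longrightarrow> \<beta> \<in> W \<Longrightarrow> (\<alpha>, \<beta>) \<notin> le \<Longrightarrow> (\<beta>, \<alpha>) \<in> le \<and> \<beta> \<noteq> \<alpha>"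
  using le_total le_refl by blast

text \<open>
  The 1-cocycles of the inverse system of the groups \<open>Hom(P \<alpha>, Y)\<close>; modulo coboundaries they form its
  first derived limit.
\<close>

definition cocycle :: "('u \<Rightarrow> 'u \<Rightarrow> 'u \<Rightarrow> 'u) \<Rightarrow> bool" where
  "cocycle c \<longleftrightarrow>
     (\<forall>(\<alpha>, \<beta>)\<in>le. linear_map R (P \<alpha>) Y (c \<alpha> \<beta>)) \<and>
     (\<forall>\<alpha> \<beta> \<gamma>. (\<alpha>, \<beta>) \<in> le \<longrightarrow> (\<beta>, \<gamma>) \<in> le \<longrightarrow>
        (\<forall>x\<in>carrier (P \<alpha>). c \<alpha> \<gamma> x = c \<alpha> \<beta> x \<oplus>\<^bsub>Y\<^esub> c \<beta> \<gamma> (f \<alpha> \<beta> x)))"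

text \<open>
  On the diagonal a cocycle vanishes and so does the right-hand side, so the equation is imposed only
  for distinct indices. The definition applies to arbitrary families of functions, because the guesses
  encoded by branches need not be cocycles.
\<close>

definition coboundary :: "('u \<Rightarrow> 'u \<Rightarrow> 'u \<Rightarrow> 'u) \<Rightarrow> bool" where
  "coboundary c \<longleftrightarrow>
     (\<exists>\<theta>. (\<forall>\<alpha>\<in>W. linear_map R (P \<alpha>) Y (\<theta> \<alpha>)) \<and>
        (\<forall>\<alpha> \<beta>. (\<alpha>, \<beta>) \<in> le \<longrightarrow> \<alpha> \<noteq> \<beta> \<longrightarrow>
           (\<forall>x\<in>carrier (P \<alpha>). c \<alpha> \<beta> x = \<theta> \<alpha> x \<ominus>\<^bsub>Y\<^esub> \<theta> \<beta> (f \<alpha> \<beta> x))))"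

definition points :: "('u \<times> 'u) set" where
  "points = (SIGMA \<alpha>:W. carrier (P \<alpha>))"

text \<open>
  A label at level \<open>\<beta>\<close> is a guess of a whole family of values \<open>c \<alpha> \<beta> x\<close>, one for each point \<open>(\<alpha>, x)\<close>.
\<close>

definition labels :: "('u \<times> 'u \<Rightarrow> 'u) set" where
  "labels = points \<rightarrow>\<^sub>E carrier Y"

definition branches :: "('u \<Rightarrow> 'u \<times> 'u \<Rightarrow> 'u) set" where
  "branches = W \<rightarrow>\<^sub>E labels"

text \<open>
  Two branches agree at \<open>\<gamma>\<close> when they pass through the same node of level \<open>\<gamma>\<close>. The label at \<open>\<gamma>\<close> itself
  belongs to this node; it is left out in \<open>agree_below\<close>.
\<close>

definition agree :: "('u \<Rightarrow> 'u \<times> 'u \<Rightarrow> 'u) \<Rightarrow> ('u \<Rightarrow> 'u \<times> 'u \<Rightarrow> 'u) \<Rightarrow> 'u \<Rightarrow> bool" where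
  "agree \<nu> \<mu> \<gamma> \<longleftrightarrow> (\<forall>\<delta>. (\<delta>, \<gamma>) \<in> le \<longrightarrow> \<nu> \<delta> = \<mu> \<delta>)"

definition agree_below :: "('u \<Rightarrow> 'u \<times> 'u \<Rightarrow> 'u) \<Rightarrow> ('u \<Rightarrow> 'u \<times> 'u \<Rightarrow> 'u) \<Rightarrow> 'u \<Rightarrow> bool" where
  "agree_below \<nu> \<mu> \<gamma> \<longleftrightarrow> (\<forall>\<delta>. (\<delta>, \<gamma>) \<in> le \<longrightarrow> \<delta> \<noteq> \<gamma> \<longrightarrow> \<nu> \<delta> = \<mu> \<delta>)"

lemma agree_mono: "agree \<nu> \<mu> \<gamma> \<Longrightarrow> (\<delta>, \<gamma>) \<in> le \<Longrightarrow> agree \<nu> \<mu> \<delta>"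
  using le_trans by (auto simp: agree_def)

lemma agree_refl: "agree \<nu> \<nu> \<gamma>"
  by (simp add: agree_def)

lemma agree_sym: "agree \<nu> \<mu> \<gamma> \<Longrightarrow> agree \<mu> \<nu> \<gamma>"
  by (simp add: agree_def)

lemma agree_trans: "agree \<nu> \<mu> \<gamma> \<Longrightarrow> agree \<mu> \<kappa> \<gamma> \<Longrightarrow> agree \<nu> \<kappa> \<gamma>"
  by (simp add: agree_def)

lemma agree_below_agree: "agree_below \<nu> \<mu> \<beta> \<Longrightarrow> (\<gamma>, \<beta>) \<in> le \<Longrightarrow> \<gamma> \<noteq> \<beta> \<Longrightarrow> agree \<nu> \<mu> \<gamma>"
  unfolding agree_below_def agree_def using le_trans le_antisym by blast

definition gens :: "(('u \<Rightarrow> 'u \<times> 'u \<Rightarrow> 'u) \<times> 'u \<times> 'u) set" where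
  "gens = branches \<times> points"

abbreviation E where "E \<equiv> free_module R gens"

abbreviation bv where "bv \<nu> \<alpha> x \<equiv> basis_vector R gens (\<nu>, \<alpha>, x)"

lemma Em: "left_module R E"
  by (rule free_module_left_module) (rule Y.R.ring_axioms)

sublocale E: left_module R E by (rule Em)

lemma gensI: "\<nu> \<in> branches \<Longrightarrow> \<alpha> \<in> W \<Longrightarrow> x \<in> carrier (P \<alpha>) \<Longrightarrow> (\<nu>, \<alpha>, x) \<in> gens"
  by (simp add: gens_def points_def)

lemma bv_closed: "\<nu> \<in> branches \<Longrightarrow> \<alpha> \<in> W \<Longrightarrow> x \<in> carrier (P \<alpha>) \<Longrightarrow> bv \<nu> \<alpha> x \<in> carrier E"
  by (intro basis_vector_closed gensI Y.R.ring_axioms)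

lemma E_card: "|carrier E| <o |UNIV :: 'u set|"
proof -
  have W: "|W| <o |UNIV :: 'u set|" using Wsmall by (simp add: small_def)
  have "\<forall>\<alpha>\<in>W. small (carrier (P \<alpha>))" using P by (auto simp: projective_modules_def modules_def)
  then have "|\<Union>\<alpha>\<in>W. carrier (P \<alpha>)| <o |UNIV :: 'u set|"
    using univ Wsmall by (auto simp: universe_def small_def)
  then have "|W \<times> (\<Union>\<alpha>\<in>W. carrier (P \<alpha>))| <o |UNIV :: 'u set|"
    by (intro universe_Times[OF univ] W)
  then have p: "|points| <o |UNIV :: 'u set|"
    by (rule card_le_subset[rotated]) (auto simp: points_def)
  have "|carrier Y| <o |UNIV :: 'u set|" using Y by (simp add: modules_def small_def)
  then have "|gens| <o |UNIV :: 'u set|"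
    unfolding gens_def branches_def labels_def
    by (intro universe_Times[OF univ] universe_PiE[OF univ] p W)
  then show ?thesis by (rule universe_free_module[OF univ Rcard])
qed

text \<open>
  The coordinate of the thread of \<open>(\<nu>, \<alpha>, x)\<close> at the node of level \<open>\<gamma>\<close> on the branch \<open>\<mu>\<close>. A thread starts at
  level \<open>\<alpha>\<close> and follows \<open>\<nu>\<close>.
\<close>

definition node_gen where
  "node_gen \<gamma> \<mu> = (\<lambda>(\<nu>, \<alpha>, x). if (\<alpha>, \<gamma>) \<in> le \<and> agree \<nu> \<mu> \<gamma> then f \<alpha> \<gamma> x else \<zero>\<^bsub>P \<gamma>\<^esub>)"

definition node where
  "node \<gamma> \<mu> = free_lift R gens (P \<gamma>) (node_gen \<gamma> \<mu>)"

lemma P_zero: "\<gamma> \<in> W \<Longrightarrow> \<zero>\<^bsub>P \<gamma>\<^esub> \<in> carrier (P \<gamma>)"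
proof -
  assume "\<gamma> \<in> W"
  then interpret P: left_module R "P \<gamma>" by (rule Pm)
  show ?thesis by simp
qed

lemma node_gen_closed: "\<gamma> \<in> W \<Longrightarrow> node_gen \<gamma> \<mu> \<in> gens \<rightarrow> carrier (P \<gamma>)"
  using linear_closed[OF f] P_zero by (auto simp: node_gen_def gens_def points_def)

lemma node_linear: "\<gamma> \<in> W \<Longrightarrow> linear_map R E (P \<gamma>) (node \<gamma> \<mu>)"
  unfolding node_def by (intro free_lift_linear Pm node_gen_closed)

lemma node_bv:
  "\<gamma> \<in> W \<Longrightarrow> \<nu> \<in> branches \<Longrightarrow> \<alpha> \<in> W \<Longrightarrow> x \<in> carrier (P \<alpha>) \<Longrightarrow>
    node \<gamma> \<mu> (bv \<nu> \<alpha> x) = (if (\<alpha>, \<gamma>) \<in> le \<and> agree \<nu> \<mu> \<gamma> then f \<alpha> \<gamma> x else \<zero>\<^bsub>P \<gamma>\<^esub>)"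
  unfolding node_def by (subst free_lift_basis[OF Pm node_gen_closed gensI]) (auto simp: node_gen_def)

text \<open>
  All linear relations between threads, so that \<open>E\<close> modulo \<open>N\<close> is the module spanned by the threads in
  the product of the \<open>P \<gamma>\<close> over all nodes.
\<close>

definition N where
  "N = {z \<in> carrier E. \<forall>\<gamma>\<in>W. \<forall>\<mu>\<in>branches. node \<gamma> \<mu> z = \<zero>\<^bsub>P \<gamma>\<^esub>}"

lemma N_sub: "submodule N R E"
proof (rule E.submoduleI)
  show "\<zero>\<^bsub>E\<^esub> \<in> N" using linear_zero[OF Em Pm node_linear] by (auto simp: N_def)
next
  fix x y assume xy: "x \<in> N" "y \<in> N"
  have "node \<gamma> \<mu> (x \<oplus>\<^bsub>E\<^esub> y) = \<zero>\<^bsub>P \<gamma>\<^esub>" if "\<gamma> \<in> W" "\<mu> \<in> branches" for \<gamma> \<mu>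
  proof -
    interpret P: left_module R "P \<gamma>" using that by (intro Pm)
    show ?thesis using xy that linear_add[OF node_linear[OF that(1), of \<mu>], of x y] by (auto simp: N_def)
  qed
  then show "x \<oplus>\<^bsub>E\<^esub> y \<in> N" using xy by (simp add: N_def)
next
  fix r x assume r: "r \<in> carrier R" and x: "x \<in> N"
  have "node \<gamma> \<mu> (r \<odot>\<^bsub>E\<^esub> x) = \<zero>\<^bsub>P \<gamma>\<^esub>" if "\<gamma> \<in> W" "\<mu> \<in> branches" for \<gamma> \<mu>
  proof -
    interpret P: left_module R "P \<gamma>" using that by (intro Pm)
    show ?thesis using r x that linear_smult[OF node_linear[OF that(1), of \<mu>], of r x] by (auto simp: N_def)
  qed
  then show "r \<odot>\<^bsub>E\<^esub> x \<in> N" using r x E.smult_closed by (simp add: N_def)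
qed (auto simp: N_def)

lemma N_add:
  assumes "\<nu> \<in> branches" "\<alpha> \<in> W" "x \<in> carrier (P \<alpha>)" "y \<in> carrier (P \<alpha>)"
  shows "bv \<nu> \<alpha> (x \<oplus>\<^bsub>P \<alpha>\<^esub> y) \<ominus>\<^bsub>E\<^esub> (bv \<nu> \<alpha> x \<oplus>\<^bsub>E\<^esub> bv \<nu> \<alpha> y) \<in> N"
proof -
  interpret A: left_module R "P \<alpha>" using assms by (intro Pm)
  note b = bv_closed[OF assms(1,2)]
  have "node \<gamma> \<mu> (bv \<nu> \<alpha> (x \<oplus>\<^bsub>P \<alpha>\<^esub> y) \<ominus>\<^bsub>E\<^esub> (bv \<nu> \<alpha> x \<oplus>\<^bsub>E\<^esub> bv \<nu> \<alpha> y)) = \<zero>\<^bsub>P \<gamma>\<^esub>"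
    if "\<gamma> \<in> W" "\<mu> \<in> branches" for \<gamma> \<mu>
  proof -
    interpret P: left_module R "P \<gamma>" using that by (intro Pm)
    note l = node_linear[OF that(1), of \<mu>]
    show ?thesis
      using that assms b linear_closed[OF f]
      by (auto simp: linear_diff[OF Em Pm[OF that(1)] l] linear_add[OF l] node_bv linear_add[OF f])
  qed
  then show ?thesis using assms b by (simp add: N_def)
qed

lemma N_smult:
  assumes "\<nu> \<in> branches" "\<alpha> \<in> W" "x \<in> carrier (P \<alpha>)" "r \<in> carrier R"
  shows "bv \<nu> \<alpha> (r \<odot>\<^bsub>P \<alpha>\<^esub> x) \<ominus>\<^bsub>E\<^esub> r \<odot>\<^bsub>E\<^esub> bv \<nu> \<alpha> x \<in> N"
proof -
  interpret A: left_module R "P \<alpha>" using assms by (intro Pm)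
  note b = bv_closed[OF assms(1,2)]
  have "node \<gamma> \<mu> (bv \<nu> \<alpha> (r \<odot>\<^bsub>P \<alpha>\<^esub> x) \<ominus>\<^bsub>E\<^esub> r \<odot>\<^bsub>E\<^esub> bv \<nu> \<alpha> x) = \<zero>\<^bsub>P \<gamma>\<^esub>"
    if "\<gamma> \<in> W" "\<mu> \<in> branches" for \<gamma> \<mu>
  proof -
    interpret P: left_module R "P \<gamma>" using that by (intro Pm)
    note l = node_linear[OF that(1), of \<mu>]
    show ?thesis
      using that assms b linear_closed[OF f]
      by (auto simp: linear_diff[OF Em Pm[OF that(1)] l] linear_smult[OF l] node_bv linear_smult[OF f]
          A.smult_closed E.smult_closed P.smult_closed)
  qed
  then show ?thesis using assms b by (simp add: N_def A.smult_closed E.smult_closed)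
qed

text \<open>
  The difference of the threads of \<open>x\<close> and \<open>f \<alpha> \<beta> x\<close> along a branch has nonzero coordinates only at
  levels from \<open>\<alpha>\<close> up to but excluding \<open>\<beta>\<close>, and there it depends on the branch below \<open>\<beta>\<close> only.
\<close>

lemma N_segment:
  assumes "\<nu> \<in> branches" "\<nu>' \<in> branches" "agree_below \<nu> \<nu>' \<beta>" "(\<alpha>, \<beta>) \<in> le" "x \<in> carrier (P \<alpha>)"
  shows "(bv \<nu> \<alpha> x \<ominus>\<^bsub>E\<^esub> bv \<nu> \<beta> (f \<alpha> \<beta> x)) \<ominus>\<^bsub>E\<^esub> (bv \<nu>' \<alpha> x \<ominus>\<^bsub>E\<^esub> bv \<nu>' \<beta> (f \<alpha> \<beta> x)) \<in> N"
proof -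
  have W: "\<alpha> \<in> W" "\<beta> \<in> W" using le_W assms(4) by auto
  have fx: "f \<alpha> \<beta> x \<in> carrier (P \<beta>)" by (rule linear_closed[OF f[OF assms(4)] assms(5)])
  note b = bv_closed[OF assms(1) W(1) assms(5)] bv_closed[OF assms(2) W(1) assms(5)]
    bv_closed[OF assms(1) W(2) fx] bv_closed[OF assms(2) W(2) fx]
  have "node \<gamma> \<mu> ((bv \<nu> \<alpha> x \<ominus>\<^bsub>E\<^esub> bv \<nu> \<beta> (f \<alpha> \<beta> x)) \<ominus>\<^bsub>E\<^esub> (bv \<nu>' \<alpha> x \<ominus>\<^bsub>E\<^esub> bv \<nu>' \<beta> (f \<alpha> \<beta> x))) = \<zero>\<^bsub>P \<gamma>\<^esub>"
    if g: "\<gamma> \<in> W" "\<mu> \<in> branches" for \<gamma> \<mu>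
  proof -
    interpret P: left_module R "P \<gamma>" using that by (intro Pm)
    note l = node_linear[OF that(1), of \<mu>]
    note eq = linear_diff[OF Em Pm[OF that(1)] l] node_bv[OF g(1) assms(1) W(1) assms(5)] node_bv[OF g(1) assms(2) W(1) assms(5)]
      node_bv[OF g(1) assms(1) W(2) fx] node_bv[OF g(1) assms(2) W(2) fx]
    show ?thesis
    proof (cases "(\<beta>, \<gamma>) \<in> le")
      case True
      then have "(\<alpha>, \<gamma>) \<in> le" using le_trans assms(4) by blast
      then show ?thesis
        using True b f_comp[OF assms(4) True assms(5)] linear_closed[OF f] assms(5) by (simp add: eq)
    next
      case False
      then have "(\<gamma>, \<beta>) \<in> le" "\<gamma> \<noteq> \<beta>" using le_less_linear W g by auto
      then have "agree \<nu> \<nu>' \<gamma>" using agree_below_agree assms(3) by blast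
      then have "agree \<nu> \<mu> \<gamma> \<longleftrightarrow> agree \<nu>' \<mu> \<gamma>" using agree_trans agree_sym by blast
      then show ?thesis
        using False b linear_closed[OF f] assms(5) by (simp add: eq)
    qed
  qed
  then show ?thesis using b by (simp add: N_def)
qed

end

text \<open>
  A copy of the tree module in the universe. Here \<open>\<rho>\<close> sends a formal combination to the combination of
  threads that it denotes.
\<close>

locale tree_quotient = projective_chain +
  fixes X :: "('a, 'b) module" and \<rho> :: "(('b \<Rightarrow> 'b \<times> 'b \<Rightarrow> 'b) \<times> 'b \<times> 'b \<Rightarrow> 'a) \<Rightarrow> 'b"
  assumes Xmod: "X \<in> modules R" and \<rho>: "linear_map R E X \<rho>" and \<rho>_onto: "\<rho> ` carrier E = carrier X"
    and \<rho>_zero: "\<And>z. z \<in> carrier E \<Longrightarrow> \<rho> z = \<zero>\<^bsub>X\<^esub> \<longleftrightarrow> z \<in> N"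
begin

lemma Xm: "left_module R X"
  using Xmod by (simp add: modules_def)

sublocale X: left_module R X by (rule Xm)

lemma \<rho>_eq: "z \<in> carrier E \<Longrightarrow> w \<in> carrier E \<Longrightarrow> z \<ominus>\<^bsub>E\<^esub> w \<in> N \<Longrightarrow> \<rho> z = \<rho> w"
  using \<rho>_zero[of "z \<ominus>\<^bsub>E\<^esub> w"] linear_diff[OF Em Xm \<rho>, of z w] linear_closed[OF \<rho>]
  by (simp add: X.minus_eq_zero_iff)

definition gen where "gen \<nu> \<alpha> x = \<rho> (bv \<nu> \<alpha> x)"

lemma gen_linear:
  assumes "\<nu> \<in> branches" "\<alpha> \<in> W"
  shows "linear_map R (P \<alpha>) X (gen \<nu> \<alpha>)"
proof -
  interpret A: left_module R "P \<alpha>" using assms by (intro Pm)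
  note b = bv_closed[OF assms]
  show ?thesis
  proof (rule linear_mapI)
    fix x assume x: "x \<in> carrier (P \<alpha>)"
    show "gen \<nu> \<alpha> x \<in> carrier X" unfolding gen_def by (rule linear_closed[OF \<rho> b[OF x]])
    show "gen \<nu> \<alpha> (r \<odot>\<^bsub>P \<alpha>\<^esub> x) = r \<odot>\<^bsub>X\<^esub> gen \<nu> \<alpha> x" if r: "r \<in> carrier R" for r
      using \<rho>_eq[OF _ _ N_smult[OF assms x r]] b x r
      by (simp add: gen_def linear_smult[OF \<rho>] A.smult_closed E.smult_closed)
    show "gen \<nu> \<alpha> (x \<oplus>\<^bsub>P \<alpha>\<^esub> y) = gen \<nu> \<alpha> x \<oplus>\<^bsub>X\<^esub> gen \<nu> \<alpha> y" if y: "y \<in> carrier (P \<alpha>)" for y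
      using \<rho>_eq[OF _ _ N_add[OF assms x y]] b x y by (simp add: gen_def linear_add[OF \<rho>])
  qed
qed

lemma gen_segment:
  assumes "\<nu> \<in> branches" "\<nu>' \<in> branches" "agree_below \<nu> \<nu>' \<beta>" "(\<alpha>, \<beta>) \<in> le" "x \<in> carrier (P \<alpha>)"
  shows "gen \<nu> \<alpha> x = (gen \<nu>' \<alpha> x \<ominus>\<^bsub>X\<^esub> gen \<nu>' \<beta> (f \<alpha> \<beta> x)) \<oplus>\<^bsub>X\<^esub> gen \<nu> \<beta> (f \<alpha> \<beta> x)"
proof -
  have W: "\<alpha> \<in> W" "\<beta> \<in> W" using le_W assms(4) by auto
  have fx: "f \<alpha> \<beta> x \<in> carrier (P \<beta>)" by (rule linear_closed[OF f[OF assms(4)] assms(5)])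
  note b = bv_closed[OF assms(1) W(1) assms(5)] bv_closed[OF assms(2) W(1) assms(5)]
    bv_closed[OF assms(1) W(2) fx] bv_closed[OF assms(2) W(2) fx]
  have "gen \<nu> \<alpha> x \<ominus>\<^bsub>X\<^esub> gen \<nu> \<beta> (f \<alpha> \<beta> x) = gen \<nu>' \<alpha> x \<ominus>\<^bsub>X\<^esub> gen \<nu>' \<beta> (f \<alpha> \<beta> x)"
    using \<rho>_eq[OF _ _ N_segment[OF assms]] b by (simp add: gen_def linear_diff[OF Em Xm \<rho>])
  then show ?thesis
    using b linear_closed[OF \<rho>] X.minus_plus_cancel[of "gen \<nu> \<alpha> x" "gen \<nu> \<beta> (f \<alpha> \<beta> x)"] by (simp add: gen_def)
qed

lemma node_factor:
  assumes "\<gamma> \<in> W" "\<mu> \<in> branches"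
  obtains p where "linear_map R X (P \<gamma>) p" "\<And>z. z \<in> carrier E \<Longrightarrow> p (\<rho> z) = node \<gamma> \<mu> z"
  by (rule linear_factor[OF Em Xm Pm[OF assms(1)] \<rho> \<rho>_onto node_linear[OF assms(1), of \<mu>]])
    (use assms in \<open>auto simp: \<rho>_zero N_def\<close>)

definition \<iota> where "\<iota> = (\<lambda>(\<nu>, \<alpha>, x). gen \<nu> \<alpha> x)"

lemma \<iota>_closed: "\<iota> \<in> gens \<rightarrow> carrier X"
  using linear_closed[OF gen_linear] by (auto simp: \<iota>_def gens_def points_def)

lemma \<rho>_lift: "z \<in> carrier E \<Longrightarrow> \<rho> z = free_lift R gens X \<iota> z"
  using free_lift_eqI[OF Xm \<rho>, of z] by (simp add: \<iota>_def gen_def split_def)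

definition supp where "supp z = {s \<in> gens. z s \<noteq> \<zero>\<^bsub>R\<^esub>}"

lemma finite_supp: "z \<in> carrier E \<Longrightarrow> finite (supp z)"
  by (simp add: supp_def free_module_def)

definition fixed where "fixed x \<longleftrightarrow> (\<exists>e. finite_rank R X X e \<and> e x = x)"

lemma fixed_step:
  assumes "finite_rank R X X e" "x \<in> carrier X" "fixed (x \<ominus>\<^bsub>X\<^esub> e x)"
  shows "fixed x"
  using assms fixing_extend[OF Xm assms(1)] unfolding fixed_def by metis

text \<open>
  Once \<open>\<nu>\<close> has left the branches in \<open>F\<close>, the coordinate at the lowest level of \<open>\<nu>\<close> that occurs in \<open>z\<close>
  sees only the terms of \<open>z\<close> at that level: later threads have not started, and the threads along \<open>F\<close> pass
  elsewhere. The coordinate lies in a projective module, where it is fixed by a map of finite rank, and so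
  these terms can be stripped off. This leaves one level fewer.
\<close>

lemma strip_branch:
  assumes F: "F \<subseteq> branches" "\<And>z. z \<in> carrier E \<Longrightarrow> fst ` supp z \<subseteq> F \<Longrightarrow> fixed (\<rho> z)"
    and \<nu>: "\<nu> \<in> branches" and \<delta>: "\<delta> \<in> W" "\<And>\<nu>'. \<nu>' \<in> F \<Longrightarrow> \<not> agree \<nu>' \<nu> \<delta>"
    and z: "z \<in> carrier E" "\<And>\<mu> \<alpha> x. (\<mu>, \<alpha>, x) \<in> supp z \<Longrightarrow> \<mu> \<in> F \<or> (\<mu> = \<nu> \<and> (\<delta>, \<alpha>) \<in> le)"
  shows "fixed (\<rho> z)"
  using z
proof (induction "card {\<alpha>. \<exists>x. (\<nu>, \<alpha>, x) \<in> supp z}" arbitrary: z rule: less_induct)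
  case less
  let ?D = "\<lambda>z. {\<alpha>. \<exists>x. (\<nu>, \<alpha>, x) \<in> supp z}"
  note z = less.prems(1)
  have finD: "finite (?D z)"
    by (rule finite_subset[OF _ finite_imageI[OF finite_supp[OF z], of "\<lambda>s. fst (snd s)"]]) force
  have DW: "?D z \<subseteq> W" by (auto simp: supp_def gens_def points_def)
  have \<nu>F: "\<nu> \<notin> F" using \<delta>(2) agree_refl by blast
  show ?case
  proof (cases "?D z = {}")
    case True
    have "fst ` supp z \<subseteq> F"
    proof clarsimp
      fix \<mu> \<alpha> x assume s: "(\<mu>, \<alpha>, x) \<in> supp z"
      then show "\<mu> \<in> F" using less.prems(2)[OF s] True by auto
    qed
    then show ?thesis using F(2) z by blast
  next
    case False
    obtain \<alpha> where \<alpha>: "\<alpha> \<in> ?D z" "\<And>\<beta>. \<beta> \<in> ?D z \<Longrightarrow> (\<alpha>, \<beta>) \<in> le" by (rule le_min[OF DW False]) (rule that)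
    have \<alpha>W: "\<alpha> \<in> W" using \<alpha>(1) DW by blast
    have \<delta>\<alpha>: "(\<delta>, \<alpha>) \<in> le" using \<alpha>(1) less.prems(2) \<nu>F by blast
    interpret A: left_module R "P \<alpha>" by (rule Pm[OF \<alpha>W])
    define z' where "z' = (\<lambda>s\<in>gens. if fst s = \<nu> \<and> fst (snd s) = \<alpha> then \<zero>\<^bsub>R\<^esub> else z s)"
    have supp': "supp z' = {s \<in> supp z. \<not> (fst s = \<nu> \<and> fst (snd s) = \<alpha>)}"
      by (auto simp: supp_def z'_def)
    have "finite (supp z')" unfolding supp' using finite_supp[OF z] by simp
    moreover have "z' \<in> gens \<rightarrow>\<^sub>E carrier R" using z by (auto simp: z'_def free_module_def)
    ultimately have z': "z' \<in> carrier E" by (simp add: free_module_def supp_def)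
    have "?D z' = ?D z - {\<alpha>}" by (auto simp: supp')
    then have "card (?D z') < card (?D z)" using card_Diff1_less[OF finD \<alpha>(1)] by simp
    then have fix': "fixed (\<rho> z')"
      by (rule less.hyps) (use z' less.prems(2) in \<open>auto simp: supp'\<close>)
    have zc: "z s \<in> carrier R" if "s \<in> gens" for s using z that by (auto simp: free_module_def)
    \<comment> \<open>the terms of \<open>z\<close> on \<open>\<nu>\<close> at level \<open>\<alpha>\<close> add up, through \<open>k\<close>, to one element of \<open>P \<alpha>\<close>,
      and this element is the coordinate \<open>p\<close> of \<open>\<rho> z\<close>; the remaining terms are collected by \<open>j\<close>\<close>
    define k where "k = (\<lambda>(\<mu>, \<beta>, x). if \<mu> = \<nu> \<and> \<beta> = \<alpha> then x else \<zero>\<^bsub>P \<alpha>\<^esub>)"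
    define j where "j = (\<lambda>s. if fst s = \<nu> \<and> fst (snd s) = \<alpha> then \<zero>\<^bsub>X\<^esub> else \<iota> s)"
    have k: "k \<in> gens \<rightarrow> carrier (P \<alpha>)" by (auto simp: k_def gens_def points_def)
    have j: "j \<in> gens \<rightarrow> carrier X" using \<iota>_closed by (auto simp: j_def)
    note kl = free_lift_linear[OF A.left_module_axioms k] and jl = free_lift_linear[OF Xm j]
    obtain p where p: "linear_map R X (P \<alpha>) p" "\<And>z. z \<in> carrier E \<Longrightarrow> p (\<rho> z) = node \<alpha> \<nu> z"
      using node_factor[OF \<alpha>W \<nu>] by blast
    have pz: "p (\<rho> z) = free_lift R gens (P \<alpha>) k z"
      unfolding p(2)[OF z] node_def
    proof (rule free_lift_cong[OF A.left_module_axioms node_gen_closed[OF \<alpha>W] k z z])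
      fix s assume "s \<in> gens" "z s \<noteq> \<zero>\<^bsub>R\<^esub> \<or> z s \<noteq> \<zero>\<^bsub>R\<^esub>"
      then have s: "s \<in> supp z" by (auto simp: supp_def)
      obtain \<mu> \<beta> x where sx: "s = (\<mu>, \<beta>, x)" by (cases s)
      have x: "x \<in> carrier (P \<beta>)" using s sx by (auto simp: supp_def gens_def points_def)
      have "node_gen \<alpha> \<nu> s = k s"
      proof (cases "\<mu> = \<nu>")
        case True
        then have "(\<alpha>, \<beta>) \<in> le" using \<alpha>(2) s sx by blast
        then have "(\<beta>, \<alpha>) \<in> le \<longleftrightarrow> \<beta> = \<alpha>" using le_antisym le_refl \<alpha>W by blast
        then show ?thesis using True x \<alpha>W by (auto simp: node_gen_def k_def sx agree_refl f_id)
      next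
        case False
        then have "\<mu> \<in> F" using less.prems(2) s sx by blast
        then have "\<not> agree \<mu> \<nu> \<alpha>" using \<delta>(2) agree_mono[OF _ \<delta>\<alpha>] by blast
        then show ?thesis using False by (simp add: node_gen_def k_def sx)
      qed
      then show "z s \<odot>\<^bsub>P \<alpha>\<^esub> node_gen \<alpha> \<nu> s = z s \<odot>\<^bsub>P \<alpha>\<^esub> k s" by simp
    qed
    let ?x = "p (\<rho> z)"
    have \<rho>z: "\<rho> z \<in> carrier X" by (rule linear_closed[OF \<rho> z])
    have x: "?x \<in> carrier (P \<alpha>)" by (rule linear_closed[OF p(1) \<rho>z])
    note gl = gen_linear[OF \<nu> \<alpha>W]
    have "\<rho> z = gen \<nu> \<alpha> (free_lift R gens (P \<alpha>) k z) \<oplus>\<^bsub>X\<^esub> free_lift R gens X j z"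
    proof (rule free_lift_unique[OF Xm \<rho> linear_plus[OF Xm linear_comp[OF kl gl] jl] _ z])
      fix s assume s: "s \<in> gens"
      have "\<rho> (basis_vector R gens s) \<in> carrier X"
        by (rule linear_closed[OF \<rho> basis_vector_closed[OF Y.R.ring_axioms s]])
      then have "\<rho> (basis_vector R gens s) = gen \<nu> \<alpha> (k s) \<oplus>\<^bsub>X\<^esub> j s"
        using linear_zero[OF A.left_module_axioms Xm gl]
        by (auto simp: k_def j_def \<iota>_def gen_def split_def)
      then show "\<rho> (basis_vector R gens s) = gen \<nu> \<alpha> (free_lift R gens (P \<alpha>) k (basis_vector R gens s)) \<oplus>\<^bsub>X\<^esub>
          free_lift R gens X j (basis_vector R gens s)"
        by (simp add: free_lift_basis[OF A.left_module_axioms k s] free_lift_basis[OF Xm j s])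
    qed
    moreover have "free_lift R gens X j z = \<rho> z'"
      unfolding \<rho>_lift[OF z'] by (rule free_lift_cong[OF Xm j \<iota>_closed z z']) (use \<iota>_closed zc in \<open>auto simp: j_def z'_def Pi_iff\<close>)
    ultimately have split: "\<rho> z = gen \<nu> \<alpha> ?x \<oplus>\<^bsub>X\<^esub> \<rho> z'" unfolding pz by argo
    obtain e where e: "finite_rank R (P \<alpha>) (P \<alpha>) e" "e ?x = ?x"
      using projective_locally_projective[OF univ Rcard P[OF \<alpha>W]] x unfolding locally_projective_def by blast
    have fr: "finite_rank R X X (\<lambda>m. gen \<nu> \<alpha> (e (p m)))"
      using finite_rank_pre[OF finite_rank_post[OF A.left_module_axioms A.left_module_axioms Xm e(1) gl] p(1)] .
    have "\<rho> z \<ominus>\<^bsub>X\<^esub> gen \<nu> \<alpha> (e ?x) = \<rho> z'"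
      using linear_closed[OF gl x] linear_closed[OF \<rho> z'] unfolding e(2)
      by (subst split) (simp add: X.a_comm[of "gen \<nu> \<alpha> ?x"] a_minus_def X.a_assoc X.r_neg)
    then show ?thesis using fixed_step[OF fr \<rho>z] fix' by simp
  qed
qed

lemma branch_split:
  assumes "\<nu> \<in> branches" "\<mu> \<in> branches" "\<nu> \<noteq> \<mu>"
  obtains \<delta> where "\<delta> \<in> W" "\<not> agree \<nu> \<mu> \<delta>"
proof -
  obtain \<delta> where "\<delta> \<in> W" "\<nu> \<delta> \<noteq> \<mu> \<delta>"
    using assms PiE_ext unfolding branches_def by metis
  then show thesis using that le_refl unfolding agree_def by blast
qed

lemma branches_split:
  assumes "finite F" "F \<subseteq> branches" "\<nu> \<in> branches" "\<nu> \<notin> F"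
  obtains \<delta> where "\<delta> \<in> W" "\<And>\<mu>. \<mu> \<in> F \<Longrightarrow> \<not> agree \<mu> \<nu> \<delta>"
proof -
  have "\<forall>\<mu>\<in>F. \<exists>\<delta>. \<delta> \<in> W \<and> \<not> agree \<mu> \<nu> \<delta>"
    using branch_split[of _ \<nu>] assms by (metis subsetD)
  then obtain d where d: "\<And>\<mu>. \<mu> \<in> F \<Longrightarrow> d \<mu> \<in> W \<and> \<not> agree \<mu> \<nu> (d \<mu>)" by metis
  obtain m where m: "m \<in> W" "\<And>a. a \<in> d ` F \<Longrightarrow> (a, m) \<in> le"
    using le_max[of "d ` F"] d assms(1) by auto
  show thesis by (rule that[OF m(1)]) (use d m(2) agree_mono in blast)
qed

text \<open>
  Branches are added one at a time. Let \<open>\<delta>\<close> be the first level at which the new branch \<open>\<nu>\<close> has left all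
  earlier ones. Below \<open>\<delta>\<close> it still runs along one of them, so a thread that starts below \<open>\<delta>\<close>
  can be replaced by a segment of an old branch and a thread that starts at \<open>\<delta>\<close>. The rest is stripped off.
\<close>

lemma finite_branches_fixed:
  assumes "finite F" "F \<subseteq> branches"
  shows "z \<in> carrier E \<Longrightarrow> fst ` supp z \<subseteq> F \<Longrightarrow> fixed (\<rho> z)"
  using assms
proof (induction F arbitrary: z rule: finite_induct)
  case empty
  then have "z = \<zero>\<^bsub>E\<^esub>" by (auto simp: supp_def free_module_def fun_eq_iff PiE_iff extensional_def)
  then show ?case
    using linear_zero[OF Em Xm \<rho>] finite_rank.zero[of R X X] by (auto simp: fixed_def)
next
  case (insert \<nu> F)
  have F: "F \<subseteq> branches" "\<nu> \<in> branches" using insert.prems by auto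
  define \<Delta> where "\<Delta> = {\<delta> \<in> W. \<forall>\<mu>\<in>F. \<not> agree \<mu> \<nu> \<delta>}"
  have \<Delta>W: "\<Delta> \<subseteq> W" by (auto simp: \<Delta>_def)
  obtain \<delta>\<^sub>0 where "\<delta>\<^sub>0 \<in> W" "\<And>\<mu>. \<mu> \<in> F \<Longrightarrow> \<not> agree \<mu> \<nu> \<delta>\<^sub>0"
    by (rule branches_split[OF insert.hyps(1) F insert.hyps(2)]) (rule that)
  then have \<Delta>ne: "\<Delta> \<noteq> {}" by (auto simp: \<Delta>_def)
  obtain \<delta> where \<delta>: "\<delta> \<in> \<Delta>" "\<And>\<beta>. \<beta> \<in> \<Delta> \<Longrightarrow> (\<delta>, \<beta>) \<in> le"
    by (rule le_min[OF \<Delta>W \<Delta>ne]) (rule that)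
  have \<delta>W: "\<delta> \<in> W" using \<delta>(1) by (simp add: \<Delta>_def)
  \<comment> \<open>if there are levels below \<open>\<delta>\<close>, one branch of \<open>F\<close> agrees with \<open>\<nu>\<close> on all of them:
    otherwise every branch of \<open>F\<close> has left at some level below \<open>\<delta>\<close>, and the largest of these
    finitely many levels would contradict the minimality of \<open>\<delta>\<close>\<close>
  have ex: "\<exists>\<mu>\<in>F. agree_below \<nu> \<mu> \<delta>" if a: "\<alpha> \<in> W" "(\<delta>, \<alpha>) \<notin> le" for \<alpha>
  proof (rule ccontr)
    assume "\<not> ?thesis"
    then have "\<forall>\<mu>\<in>F. \<exists>\<beta>. (\<beta>, \<delta>) \<in> le \<and> \<beta> \<noteq> \<delta> \<and> \<not> agree \<mu> \<nu> \<beta>"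
      unfolding agree_below_def agree_def using le_refl le_W by metis
    then obtain d where d: "\<And>\<mu>. \<mu> \<in> F \<Longrightarrow> (d \<mu>, \<delta>) \<in> le \<and> d \<mu> \<noteq> \<delta> \<and> \<not> agree \<mu> \<nu> (d \<mu>)" by metis
    define A where "A = insert \<alpha> (d ` F)"
    have a': "(\<alpha>, \<delta>) \<in> le" "\<alpha> \<noteq> \<delta>" using le_less_linear[OF \<delta>W a] by auto
    have A: "finite A" "A \<noteq> {}" "\<And>b. b \<in> A \<Longrightarrow> (b, \<delta>) \<in> le \<and> b \<noteq> \<delta>" using insert.hyps(1) d a' by (auto simp: A_def)
    have "\<exists>m\<in>A. \<forall>b\<in>A. (b, m) \<in> le"
      using A(1,2,3)
    proof (induction A rule: finite_ne_induct)
      case (singleton x)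
      then show ?case using le_refl le_W by auto
    next
      case (insert x B)
      then obtain m where m: "m \<in> B" "\<forall>b\<in>B. (b, m) \<in> le" by auto
      have "x \<in> W" "m \<in> W" using insert.prems m(1) le_W by auto
      then show ?case using m le_total[of x m] le_trans le_refl by (metis insert_iff)
    qed
    then obtain m where m: "m \<in> A" "\<And>b. b \<in> A \<Longrightarrow> (b, m) \<in> le" by blast
    have "\<not> agree \<mu> \<nu> m" if "\<mu> \<in> F" for \<mu>
      using d[OF that] agree_mono[of \<mu> \<nu> m "d \<mu>"] m(2)[of "d \<mu>"] that by (auto simp: A_def)
    then have "m \<in> \<Delta>" using A(3)[OF m(1)] le_W by (auto simp: \<Delta>_def)
    then show False using \<delta>(2) A(3)[OF m(1)] le_antisym by blast
  qed
  define good where "good = {w \<in> carrier E. \<forall>s\<in>supp w. fst s \<in> F \<or> (fst s = \<nu> \<and> (\<delta>, fst (snd s)) \<in> le)}"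
  have good: "submodule good R E"
  proof (rule E.submoduleI)
    show "\<zero>\<^bsub>E\<^esub> \<in> good" by (auto simp: good_def supp_def free_module_def)
  next
    fix x y assume xy: "x \<in> good" "y \<in> good"
    have "supp (x \<oplus>\<^bsub>E\<^esub> y) \<subseteq> supp x \<union> supp y" by (auto simp: supp_def free_module_def)
    then show "x \<oplus>\<^bsub>E\<^esub> y \<in> good" using xy by (auto simp: good_def)
  next
    fix r x assume r: "r \<in> carrier R" and x: "x \<in> good"
    have "supp (r \<odot>\<^bsub>E\<^esub> x) \<subseteq> supp x" using r by (auto simp: supp_def free_module_def)
    then show "r \<odot>\<^bsub>E\<^esub> x \<in> good" using r x E.smult_closed by (auto simp: good_def)
  qed (auto simp: good_def)
  have bv_good: "bv \<mu> \<alpha> x \<in> good" if "\<mu> \<in> branches" "\<alpha> \<in> W" "x \<in> carrier (P \<alpha>)" "\<mu> \<in> F \<or> (\<mu> = \<nu> \<and> (\<delta>, \<alpha>) \<in> le)" for \<mu> \<alpha> x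
    using bv_closed[OF that(1-3)] that(4) by (auto simp: good_def supp_def basis_vector_def split: if_splits)
  have fixed_good: "fixed (\<rho> w)" if "w \<in> good" for w
    by (rule strip_branch[OF F(1) insert.IH F(2) \<delta>W]) (use that F \<delta>(1) in \<open>auto simp: good_def \<Delta>_def\<close>)
  have gen_good: "\<exists>w\<in>good. \<rho> w = gen \<mu> \<alpha> x"
    if "\<mu> \<in> insert \<nu> F" "\<alpha> \<in> W" "x \<in> carrier (P \<alpha>)" for \<mu> \<alpha> x
  proof (cases "\<mu> \<in> F \<or> (\<delta>, \<alpha>) \<in> le")
    case True
    then show ?thesis using bv_good[of \<mu> \<alpha> x] that F by (intro bexI[of _ "bv \<mu> \<alpha> x"]) (auto simp: gen_def)
  next
    case False
    then have \<mu>: "\<mu> = \<nu>" using that by simp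
    note \<alpha>W = that(2)
    obtain \<kappa> where \<kappa>: "\<kappa> \<in> F" "agree_below \<nu> \<kappa> \<delta>" using ex[OF \<alpha>W] False by blast
    have \<kappa>b: "\<kappa> \<in> branches" using \<kappa> F by blast
    have le: "(\<alpha>, \<delta>) \<in> le" using le_less_linear[OF \<delta>W that(2)] False by blast
    have fx: "f \<alpha> \<delta> x \<in> carrier (P \<delta>)" by (rule linear_closed[OF f[OF le] that(3)])
    let ?w = "(bv \<kappa> \<alpha> x \<ominus>\<^bsub>E\<^esub> bv \<kappa> \<delta> (f \<alpha> \<delta> x)) \<oplus>\<^bsub>E\<^esub> bv \<nu> \<delta> (f \<alpha> \<delta> x)"
    note g = E.submoduleD[OF good]
    have b: "bv \<kappa> \<alpha> x \<in> good" "bv \<kappa> \<delta> (f \<alpha> \<delta> x) \<in> good" "bv \<nu> \<delta> (f \<alpha> \<delta> x) \<in> good"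
      using bv_good \<kappa>(1) \<kappa>b F(2) that(2,3) \<delta>W fx le_refl by auto
    have "?w \<in> good" by (intro g(3) g(6) b)
    moreover have "\<rho> ?w = gen \<mu> \<alpha> x"
      unfolding \<mu> gen_segment[OF F(2) \<kappa>b \<kappa>(2) le that(3)] using b g(1)
      by (simp add: gen_def linear_add[OF \<rho>] linear_diff[OF Em Xm \<rho>] subset_iff)
    ultimately show ?thesis by blast
  qed
  have "\<exists>w\<in>good. \<rho> w = free_lift R gens X \<iota> z" 
  proof -
    have sup: "finite T \<Longrightarrow> T \<subseteq> supp z \<Longrightarrow> \<exists>w\<in>good. \<rho> w = (\<Oplus>\<^bsub>X\<^esub>s\<in>T. z s \<odot>\<^bsub>X\<^esub> \<iota> s)" for T
    proof (induction T rule: finite_induct)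
      case empty
      then show ?case using E.submoduleD(2)[OF good] linear_zero[OF Em Xm \<rho>] by auto
    next
      case (insert s T)
      then obtain w where w: "w \<in> good" "\<rho> w = (\<Oplus>\<^bsub>X\<^esub>s\<in>T. z s \<odot>\<^bsub>X\<^esub> \<iota> s)" by auto
      have s: "s \<in> supp z" "T \<subseteq> gens" using insert.prems by (auto simp: supp_def)
      have zc: "z t \<in> carrier R" if "t \<in> gens" for t using \<open>z \<in> carrier E\<close> that by (auto simp: free_module_def)
      obtain \<mu> \<alpha> x where sx: "s = (\<mu>, \<alpha>, x)" by (cases s)
      have "s \<in> gens" using s by (simp add: supp_def)
      then have sg: "\<mu> \<in> insert \<nu> F" "\<alpha> \<in> W" "x \<in> carrier (P \<alpha>)"
        using \<open>fst ` supp z \<subseteq> insert \<nu> F\<close> s(1) by (force simp: sx gens_def points_def)+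
      obtain v where v: "v \<in> good" "\<rho> v = gen \<mu> \<alpha> x" using gen_good[OF sg] by blast
      have "(\<Oplus>\<^bsub>X\<^esub>s\<in>insert s T. z s \<odot>\<^bsub>X\<^esub> \<iota> s) = z s \<odot>\<^bsub>X\<^esub> \<iota> s \<oplus>\<^bsub>X\<^esub> (\<Oplus>\<^bsub>X\<^esub>s\<in>T. z s \<odot>\<^bsub>X\<^esub> \<iota> s)"
        by (rule X.finsum_insert)
          (use insert.hyps s(2) \<open>s \<in> gens\<close> \<iota>_closed in \<open>auto intro!: X.smult_closed intro: zc\<close>)
      moreover have "\<rho> (z s \<odot>\<^bsub>E\<^esub> v \<oplus>\<^bsub>E\<^esub> w) = z s \<odot>\<^bsub>X\<^esub> \<iota> s \<oplus>\<^bsub>X\<^esub> (\<Oplus>\<^bsub>X\<^esub>s\<in>T. z s \<odot>\<^bsub>X\<^esub> \<iota> s)"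
        using v w E.submoduleD(1)[OF good] zc[OF \<open>s \<in> gens\<close>]
        by (simp add: linear_add[OF \<rho>] linear_smult[OF \<rho>] \<iota>_def sx subset_iff E.smult_closed)
      moreover have "z s \<odot>\<^bsub>E\<^esub> v \<oplus>\<^bsub>E\<^esub> w \<in> good"
        using E.submoduleD(3,4)[OF good] v w zc[OF \<open>s \<in> gens\<close>] by blast
      ultimately show ?case by metis
    qed
    show ?thesis using sup[of "supp z"] finite_supp[OF \<open>z \<in> carrier E\<close>] by (simp add: free_lift_def supp_def)
  qed
  then show ?case using fixed_good \<rho>_lift[OF \<open>z \<in> carrier E\<close>] by metis
qed

lemma tree_locally_projective: "locally_projective R X"
  unfolding locally_projective_def
proof (intro conjI ballI Xm)
  fix x assume "x \<in> carrier X"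
  then have "x \<in> \<rho> ` carrier E" using \<rho>_onto by simp
  then obtain z where z: "z \<in> carrier E" "\<rho> z = x" by auto
  have "fixed (\<rho> z)"
    by (rule finite_branches_fixed[of "fst ` supp z"])
      (use z finite_supp in \<open>auto simp: supp_def gens_def\<close>)
  then show "\<exists>e. finite_rank R X X e \<and> e x = x" by (simp add: fixed_def z)
qed

end

section \<open>Prediction along branches\<close>

context projective_chain
begin

text \<open>
  The values at level \<open>\<beta>\<close> of the cocycles attached to the branches, as a function on the generators of
  \<open>E\<close>. Generators that do not start by level \<open>\<beta>\<close> get the value zero, which does not matter for large
  \<open>\<beta>\<close> because only finitely many generators occur in each element of \<open>E\<close>.
\<close>

definition gen_cochain where
  "gen_cochain cc \<beta> = (\<lambda>(\<nu>, \<alpha>, x). if (\<alpha>, \<beta>) \<in> le then cc \<nu> \<alpha> \<beta> x else \<zero>\<^bsub>Y\<^esub>)"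

lemma cocycle_linear: "cocycle c \<Longrightarrow> (\<alpha>, \<beta>) \<in> le \<Longrightarrow> linear_map R (P \<alpha>) Y (c \<alpha> \<beta>)"
  by (auto simp: cocycle_def)

lemma cocycle_comp: "cocycle c \<Longrightarrow> (\<alpha>, \<beta>) \<in> le \<Longrightarrow> (\<beta>, \<gamma>) \<in> le \<Longrightarrow> x \<in> carrier (P \<alpha>) \<Longrightarrow>
    c \<alpha> \<gamma> x = c \<alpha> \<beta> x \<oplus>\<^bsub>Y\<^esub> c \<beta> \<gamma> (f \<alpha> \<beta> x)"
  by (auto simp: cocycle_def)

lemma gen_cochain_closed:
  assumes "\<And>\<nu>. \<nu> \<in> branches \<Longrightarrow> cocycle (cc \<nu>)"
  shows "gen_cochain cc \<beta> \<in> gens \<rightarrow> carrier Y"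
  using linear_closed[OF cocycle_linear[OF assms]] by (auto simp: gen_cochain_def gens_def points_def)

lemma finsum_fibres_zero:
  assumes "finite T" "g \<in> T \<rightarrow> carrier Y"
    and "\<And>i. i \<in> h ` T \<Longrightarrow> (\<Oplus>\<^bsub>Y\<^esub>t\<in>{t \<in> T. h t = i}. g t) = \<zero>\<^bsub>Y\<^esub>"
  shows "(\<Oplus>\<^bsub>Y\<^esub>t\<in>T. g t) = \<zero>\<^bsub>Y\<^esub>"
proof -
  have "T = (\<Union>i\<in>h ` T. {t \<in> T. h t = i})" by auto
  then have "(\<Oplus>\<^bsub>Y\<^esub>t\<in>T. g t) = (\<Oplus>\<^bsub>Y\<^esub>t\<in>(\<Union>i\<in>h ` T. {t \<in> T. h t = i}). g t)" by simp
  also have "\<dots> = (\<Oplus>\<^bsub>Y\<^esub>i\<in>h ` T. \<Oplus>\<^bsub>Y\<^esub>t\<in>{t \<in> T. h t = i}. g t)"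
    by (rule Y.add.finprod_UN_disjoint) (use assms(1,2) in \<open>auto simp: pairwise_def disjnt_def\<close>)
  also have "\<dots> = (\<Oplus>\<^bsub>Y\<^esub>i\<in>h ` T. \<zero>\<^bsub>Y\<^esub>)" by (rule Y.finsum_cong') (use assms(3) in auto)
  also have "\<dots> = \<zero>\<^bsub>Y\<^esub>" by simp
  finally show ?thesis .
qed

lemma branches_separated:
  assumes "finite F" "F \<subseteq> branches"
  obtains \<delta> where "\<delta> \<in> W" "\<And>\<nu> \<mu>. \<nu> \<in> F \<Longrightarrow> \<mu> \<in> F \<Longrightarrow> agree \<nu> \<mu> \<delta> \<Longrightarrow> \<nu> = \<mu>"
proof -
  have "\<exists>\<delta>. \<delta> \<in> W \<and> \<not> agree \<nu> \<mu> \<delta>" if nm: "\<nu> \<in> F" "\<mu> \<in> F" "\<nu> \<noteq> \<mu>" for \<nu> \<mu>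
  proof -
    have "\<nu> \<in> branches" "\<mu> \<in> branches" using nm assms by auto
    then obtain \<delta> where "\<delta> \<in> W" "\<nu> \<delta> \<noteq> \<mu> \<delta>" using nm(3) PiE_ext unfolding branches_def by metis
    then show ?thesis using le_refl unfolding agree_def by blast
  qed
  then obtain d where d: "\<And>\<nu> \<mu>. \<nu> \<in> F \<Longrightarrow> \<mu> \<in> F \<Longrightarrow> \<nu> \<noteq> \<mu> \<Longrightarrow> d \<nu> \<mu> \<in> W \<and> \<not> agree \<nu> \<mu> (d \<nu> \<mu>)" by metis
  let ?A = "(\<lambda>(\<nu>, \<mu>). d \<nu> \<mu>) ` {(\<nu>, \<mu>) \<in> F \<times> F. \<nu> \<noteq> \<mu>}"
  have A: "finite ?A" by (rule finite_imageI, rule finite_subset[of _ "F \<times> F"]) (use assms(1) in auto)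
  have AW: "?A \<subseteq> W" using d by auto
  obtain m where m: "m \<in> W" "\<And>a. a \<in> ?A \<Longrightarrow> (a, m) \<in> le" by (rule le_max[OF A AW]) (rule that)
  show thesis
  proof (rule that[OF m(1)], rule ccontr)
    fix \<nu> \<mu> assume *: "\<nu> \<in> F" "\<mu> \<in> F" "agree \<nu> \<mu> m" "\<nu> \<noteq> \<mu>"
    then have "(d \<nu> \<mu>, m) \<in> le" by (intro m(2)) force
    then show False using d[OF *(1,2,4)] agree_mono[OF *(3)] by blast
  qed
qed

text \<open>
  By the cocycle equation, the values at \<open>\<beta>\<close> and \<open>\<beta>\<^sub>0\<close> differ on each generator by \<open>cc \<nu> \<beta>\<^sub>0 \<beta>\<close> applied to its
  image in \<open>P \<beta>\<^sub>0\<close>. If all branches in \<open>z\<close> are separated at \<open>\<beta>\<^sub>0\<close> and all threads in \<open>z\<close> have started, then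
  these images add up, for each branch, to a coordinate of \<open>z\<close>, which is zero because \<open>z\<close> is a relation.
\<close>

lemma cochain_eventually_constant:
  assumes cc: "\<And>\<nu>. \<nu> \<in> branches \<Longrightarrow> cocycle (cc \<nu>)" and z: "z \<in> N"
  shows "\<exists>\<beta>\<^sub>0\<in>W. \<forall>\<beta>. (\<beta>\<^sub>0, \<beta>) \<in> le \<longrightarrow>
    free_lift R gens Y (gen_cochain cc \<beta>) z = free_lift R gens Y (gen_cochain cc \<beta>\<^sub>0) z"
proof -
  have zE: "z \<in> carrier E" using z by (simp add: N_def)
  define T where "T = {s \<in> gens. z s \<noteq> \<zero>\<^bsub>R\<^esub>}"
  have T: "finite T" using zE by (simp add: T_def free_module_def)
  have zc: "z t \<in> carrier R" if "t \<in> T" for t using zE that by (auto simp: free_module_def T_def)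
  have Tg: "fst t \<in> branches \<and> fst (snd t) \<in> W \<and> snd (snd t) \<in> carrier (P (fst (snd t)))" if "t \<in> T" for t
    using that by (auto simp: T_def gens_def points_def)
  have "fst ` T \<subseteq> branches" using Tg by auto
  then obtain \<delta> where \<delta>: "\<delta> \<in> W" "\<And>\<nu> \<mu>. \<nu> \<in> fst ` T \<Longrightarrow> \<mu> \<in> fst ` T \<Longrightarrow> agree \<nu> \<mu> \<delta> \<Longrightarrow> \<nu> = \<mu>"
    by (rule branches_separated[OF finite_imageI[OF T]]) (rule that)
  have fin: "finite (insert \<delta> ((\<lambda>s. fst (snd s)) ` T))" using T by simp
  have sub: "insert \<delta> ((\<lambda>s. fst (snd s)) ` T) \<subseteq> W" using Tg \<delta>(1) by auto
  obtain \<beta>\<^sub>0 where b0: "\<beta>\<^sub>0 \<in> W" "\<And>a. a \<in> insert \<delta> ((\<lambda>s. fst (snd s)) ` T) \<Longrightarrow> (a, \<beta>\<^sub>0) \<in> le"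
    by (rule le_max[OF fin sub]) (rule that)
  have sep: "\<nu> = \<mu>" if "\<nu> \<in> fst ` T" "\<mu> \<in> fst ` T" "agree \<nu> \<mu> \<beta>\<^sub>0" for \<nu> \<mu>
    using \<delta>(2)[OF that(1,2)] agree_mono[OF that(3)] b0(2)[of \<delta>] by blast
  have lev: "(fst (snd t), \<beta>\<^sub>0) \<in> le" if "t \<in> T" for t using b0(2) that by simp
  have "free_lift R gens Y (gen_cochain cc \<beta>) z = free_lift R gens Y (gen_cochain cc \<beta>\<^sub>0) z"
    if b: "(\<beta>\<^sub>0, \<beta>) \<in> le" for \<beta>
  proof -
    define g where "g t = z t \<odot>\<^bsub>Y\<^esub> cc (fst t) \<beta>\<^sub>0 \<beta> (f (fst (snd t)) \<beta>\<^sub>0 (snd (snd t)))" for t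
    define w where "w t = f (fst (snd t)) \<beta>\<^sub>0 (snd (snd t))" for t :: "('u \<Rightarrow> 'u \<times> 'u \<Rightarrow> 'u) \<times> 'u \<times> 'u"
    interpret B: left_module R "P \<beta>\<^sub>0" by (rule Pm[OF b0(1)])
    have w: "w t \<in> carrier (P \<beta>\<^sub>0)" if "t \<in> T" for t
      using linear_closed[OF f[OF lev[OF that]]] Tg[OF that] by (simp add: w_def)
    have g: "g t \<in> carrier Y" if "t \<in> T" for t
      using linear_closed[OF cocycle_linear[OF cc b] w[OF that]] Tg[OF that] zc[OF that]
      by (simp add: g_def Y.smult_closed flip: w_def)
    have c0: "z t \<odot>\<^bsub>Y\<^esub> gen_cochain cc \<beta>' t \<in> carrier Y" if "t \<in> T" for t \<beta>'
      using gen_cochain_closed[of cc \<beta>', OF cc] that zc[OF that] by (auto simp: T_def intro!: Y.smult_closed)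
    have split: "z t \<odot>\<^bsub>Y\<^esub> gen_cochain cc \<beta> t = z t \<odot>\<^bsub>Y\<^esub> gen_cochain cc \<beta>\<^sub>0 t \<oplus>\<^bsub>Y\<^esub> g t" if t: "t \<in> T" for t
    proof -
      obtain \<nu> \<alpha> x where tx: "t = (\<nu>, \<alpha>, x)" by (cases t)
      have l: "(\<alpha>, \<beta>\<^sub>0) \<in> le" "(\<alpha>, \<beta>) \<in> le" using lev[OF t] le_trans[OF _ b] tx by auto
      have n: "\<nu> \<in> branches" "x \<in> carrier (P \<alpha>)" using Tg[OF t] tx by auto
      show ?thesis
        using cocycle_comp[OF cc[OF n(1)] l(1) b n(2)] l zc[OF t] linear_closed[OF cocycle_linear[OF cc[OF n(1)]]]
          linear_closed[OF f] n b
        by (simp add: tx gen_cochain_def g_def Y.smult_r_distr)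
    qed
    have "(\<Oplus>\<^bsub>Y\<^esub>t\<in>T. g t) = \<zero>\<^bsub>Y\<^esub>"
    proof (rule finsum_fibres_zero[OF T])
      show "g \<in> T \<rightarrow> carrier Y" using g by auto
      fix \<nu> assume \<nu>: "\<nu> \<in> fst ` T"
      have nb: "\<nu> \<in> branches" using \<nu> Tg by auto
      let ?T = "{t \<in> T. fst t = \<nu>}"
      have zw: "z t \<odot>\<^bsub>P \<beta>\<^sub>0\<^esub> w t \<in> carrier (P \<beta>\<^sub>0)" if "t \<in> T" for t
        using zc[OF that] w[OF that] by (rule B.smult_closed)
      have "\<zero>\<^bsub>P \<beta>\<^sub>0\<^esub> = node \<beta>\<^sub>0 \<nu> z" using z b0(1) nb by (simp add: N_def)
      also have "\<dots> = (\<Oplus>\<^bsub>P \<beta>\<^sub>0\<^esub>t\<in>T. z t \<odot>\<^bsub>P \<beta>\<^sub>0\<^esub> node_gen \<beta>\<^sub>0 \<nu> t)" by (simp add: node_def free_lift_def T_def)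
      also have "\<dots> = (\<Oplus>\<^bsub>P \<beta>\<^sub>0\<^esub>t\<in>?T. z t \<odot>\<^bsub>P \<beta>\<^sub>0\<^esub> w t)"
      proof (rule B.add.finprod_mono_neutral_cong_right[OF T])
        show "\<And>i. i \<in> T - ?T \<Longrightarrow> z i \<odot>\<^bsub>P \<beta>\<^sub>0\<^esub> node_gen \<beta>\<^sub>0 \<nu> i = \<zero>\<^bsub>P \<beta>\<^sub>0\<^esub>"
          using sep \<nu> zc by (auto simp: node_gen_def split_def)
        show "z t \<odot>\<^bsub>P \<beta>\<^sub>0\<^esub> node_gen \<beta>\<^sub>0 \<nu> t = z t \<odot>\<^bsub>P \<beta>\<^sub>0\<^esub> w t" if "t \<in> ?T" for t
          using that lev[of t] by (auto simp: node_gen_def split_def w_def agree_refl)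
        show "(\<lambda>t. z t \<odot>\<^bsub>P \<beta>\<^sub>0\<^esub> node_gen \<beta>\<^sub>0 \<nu> t) \<in> T \<rightarrow> carrier (P \<beta>\<^sub>0)"
          using zc node_gen_closed[OF b0(1), of \<nu>] by (auto simp: T_def intro!: B.smult_closed)
      qed auto
      finally have sum0: "(\<Oplus>\<^bsub>P \<beta>\<^sub>0\<^esub>t\<in>?T. z t \<odot>\<^bsub>P \<beta>\<^sub>0\<^esub> w t) = \<zero>\<^bsub>P \<beta>\<^sub>0\<^esub>" by simp
      note cl = cocycle_linear[OF cc[OF nb] b]
      have "\<zero>\<^bsub>Y\<^esub> = cc \<nu> \<beta>\<^sub>0 \<beta> (\<Oplus>\<^bsub>P \<beta>\<^sub>0\<^esub>t\<in>?T. z t \<odot>\<^bsub>P \<beta>\<^sub>0\<^esub> w t)"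
        unfolding sum0 using linear_zero[OF B.left_module_axioms Ym cl] by simp
      also have "\<dots> = (\<Oplus>\<^bsub>Y\<^esub>t\<in>?T. cc \<nu> \<beta>\<^sub>0 \<beta> (z t \<odot>\<^bsub>P \<beta>\<^sub>0\<^esub> w t))"
        by (rule linear_finsum[OF B.left_module_axioms Ym cl]) (use T zw in auto)
      also have "\<dots> = (\<Oplus>\<^bsub>Y\<^esub>t\<in>?T. g t)"
        by (rule Y.finsum_cong') (use g zc w linear_smult[OF cl] in \<open>auto simp: g_def w_def\<close>)
      finally show "(\<Oplus>\<^bsub>Y\<^esub>t\<in>?T. g t) = \<zero>\<^bsub>Y\<^esub>" by simp
    qed
    moreover have "free_lift R gens Y (gen_cochain cc \<beta>) z =
        (\<Oplus>\<^bsub>Y\<^esub>t\<in>T. z t \<odot>\<^bsub>Y\<^esub> gen_cochain cc \<beta>\<^sub>0 t \<oplus>\<^bsub>Y\<^esub> g t)"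
      unfolding free_lift_def T_def[symmetric]
      by (rule Y.finsum_cong') (use split c0 g in auto)
    moreover have "\<dots> = (\<Oplus>\<^bsub>Y\<^esub>t\<in>T. z t \<odot>\<^bsub>Y\<^esub> gen_cochain cc \<beta>\<^sub>0 t) \<oplus>\<^bsub>Y\<^esub> (\<Oplus>\<^bsub>Y\<^esub>t\<in>T. g t)"
      by (rule Y.finsum_addf) (use c0 g in auto)
    moreover have "(\<Oplus>\<^bsub>Y\<^esub>t\<in>T. z t \<odot>\<^bsub>Y\<^esub> gen_cochain cc \<beta>\<^sub>0 t) \<in> carrier Y"
      by (rule Y.finsum_closed) (use c0 in auto)
    ultimately show ?thesis by (simp add: free_lift_def T_def)
  qed
  then show ?thesis using b0(1) by blast
qed

text \<open>
  The eventual values of the cochains form a linear map \<open>q\<close> on the relations \<open>N\<close>, which extends to a map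
  \<open>h\<close> on \<open>E\<close> because \<open>Ext\<^sup>1\<close> vanishes on the tree module; \<open>Q\<close> is the restriction of \<open>h\<close> to generators.
  Additivity of threads makes \<open>Q\<close> linear in \<open>x\<close>. On the relation that two branches with the same part
  below \<open>\<beta>\<close> have the same segment up to \<open>\<beta>\<close>, the value of \<open>q\<close> is the difference of the two cocycles, while
  the value of \<open>h\<close> is the difference of the two coboundaries.
\<close>

lemma branch_prediction:
  assumes ext: "\<And>X :: ('r, 'u) module. X \<in> modules R \<Longrightarrow> locally_projective R X \<Longrightarrow> trivial_group (Ext1 R X Y)"
    and cc: "\<And>\<nu>. \<nu> \<in> branches \<Longrightarrow> cocycle (cc \<nu>)"
  obtains Q where "\<And>\<nu> \<alpha>. \<nu> \<in> branches \<Longrightarrow> \<alpha> \<in> W \<Longrightarrow> linear_map R (P \<alpha>) Y (Q \<nu> \<alpha>)"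
    "\<And>\<nu> \<nu>' \<alpha> \<beta> x. \<nu> \<in> branches \<Longrightarrow> \<nu>' \<in> branches \<Longrightarrow> agree_below \<nu> \<nu>' \<beta> \<Longrightarrow> (\<alpha>, \<beta>) \<in> le \<Longrightarrow>
       x \<in> carrier (P \<alpha>) \<Longrightarrow>
       cc \<nu> \<alpha> \<beta> x \<ominus>\<^bsub>Y\<^esub> (Q \<nu> \<alpha> x \<ominus>\<^bsub>Y\<^esub> Q \<nu> \<beta> (f \<alpha> \<beta> x)) =
       cc \<nu>' \<alpha> \<beta> x \<ominus>\<^bsub>Y\<^esub> (Q \<nu>' \<alpha> x \<ominus>\<^bsub>Y\<^esub> Q \<nu>' \<beta> (f \<alpha> \<beta> x))"
proof -
  obtain X :: "('r, 'u) module" and \<rho> where X: "X \<in> modules R" "linear_map R E X \<rho>"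
    "\<rho> ` carrier E = carrier X" "\<And>z. z \<in> carrier E \<Longrightarrow> \<rho> z = \<zero>\<^bsub>X\<^esub> \<longleftrightarrow> z \<in> N"
    by (rule quotient_exists[OF Em N_sub E_card]) (rule that)
  interpret T: tree_quotient R W le P f Y X \<rho>
    by unfold_locales (use X in auto)
  have triv: "trivial_group (Ext1 R X Y)" by (rule ext[OF X(1) T.tree_locally_projective])
  have ker: "lin_kernel E X \<rho> = N" using X(4) by (auto simp: lin_kernel_def N_def)
  define q\<^sub>0 where "q\<^sub>0 \<beta> = free_lift R gens Y (gen_cochain cc \<beta>)" for \<beta>
  have gc: "gen_cochain cc \<beta> \<in> gens \<rightarrow> carrier Y" for \<beta> by (rule gen_cochain_closed[of cc, OF cc])
  have q0: "linear_map R E Y (q\<^sub>0 \<beta>)" for \<beta> unfolding q\<^sub>0_def by (rule free_lift_linear[OF Ym gc])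
  define stable where "stable z \<beta>\<^sub>0 \<longleftrightarrow> \<beta>\<^sub>0 \<in> W \<and> (\<forall>\<beta>. (\<beta>\<^sub>0, \<beta>) \<in> le \<longrightarrow> q\<^sub>0 \<beta> z = q\<^sub>0 \<beta>\<^sub>0 z)" for z \<beta>\<^sub>0
  have ex_stable: "\<exists>\<beta>\<^sub>0. stable z \<beta>\<^sub>0" if "z \<in> N" for z
    using cochain_eventually_constant[of cc, OF cc that] by (auto simp: stable_def q\<^sub>0_def)
  define q where "q z = q\<^sub>0 (SOME \<beta>\<^sub>0. stable z \<beta>\<^sub>0) z" for z
  have q: "q z = q\<^sub>0 \<beta> z" if "stable z \<beta>" for z \<beta>
  proof -
    define \<gamma> where "\<gamma> = (SOME \<beta>\<^sub>0. stable z \<beta>\<^sub>0)"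
    have s: "stable z \<gamma>" unfolding \<gamma>_def using that by (rule someI)
    have "\<gamma> \<in> W" "\<beta> \<in> W" using s that by (simp_all add: stable_def)
    then consider "(\<gamma>, \<beta>) \<in> le" | "(\<beta>, \<gamma>) \<in> le" using le_total by blast
    then have "q\<^sub>0 \<gamma> z = q\<^sub>0 \<beta> z"
      using s that by cases (simp_all add: stable_def)
    then show ?thesis unfolding q_def \<gamma>_def .
  qed
  have stable_up: "stable z \<beta>'" if "stable z \<beta>" "(\<beta>, \<beta>') \<in> le" for z \<beta> \<beta>'
    using that le_trans le_W unfolding stable_def by metis
  have common: "\<exists>\<beta>. stable x \<beta> \<and> stable y \<beta> \<and> stable z \<beta>" if xyz: "x \<in> N" "y \<in> N" "z \<in> N" for x y z
  proof -
    obtain a where a: "stable x a" using ex_stable[OF xyz(1)] by blast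
    obtain b where b: "stable y b" using ex_stable[OF xyz(2)] by blast
    obtain c where c: "stable z c" using ex_stable[OF xyz(3)] by blast
    note abc = a b c
    have "{a, b, c} \<subseteq> W" using abc by (auto simp: stable_def)
    then obtain m where "m \<in> W" and m: "\<And>d. d \<in> {a, b, c} \<Longrightarrow> (d, m) \<in> le"
      by (rule le_max[rotated]) (auto intro: that)
    have "stable x m" "stable y m" "stable z m"
      using stable_up[OF a m] stable_up[OF b m] stable_up[OF c m] by simp_all
    then show ?thesis by blast
  qed
  note Ns = E.submoduleD[OF N_sub]
  have ql: "linear_map R (E\<lparr>carrier := lin_kernel E X \<rho>\<rparr>) Y q"
    unfolding ker
  proof (rule linear_mapI, simp_all)
    fix x assume x: "x \<in> N"
    then have xE: "x \<in> carrier E" using Ns by blast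
    obtain b where b: "stable x b" using ex_stable[OF x] by blast
    show "q x \<in> carrier Y" unfolding q[OF b] by (rule linear_closed[OF q0 xE])
    show "q (r \<odot>\<^bsub>E\<^esub> x) = r \<odot>\<^bsub>Y\<^esub> q x" if r: "r \<in> carrier R" for r
    proof -
      obtain b where "stable x b" "stable (r \<odot>\<^bsub>E\<^esub> x) b" using common[OF x x Ns(4)[OF r x]] by blast
      then show ?thesis using q linear_smult[OF q0 r xE] by simp
    qed
    show "q (x \<oplus>\<^bsub>E\<^esub> y) = q x \<oplus>\<^bsub>Y\<^esub> q y" if y: "y \<in> N" for y
    proof -
      have yE: "y \<in> carrier E" using Ns y by blast
      obtain b where "stable x b" "stable y b" "stable (x \<oplus>\<^bsub>E\<^esub> y) b" using common[OF x y Ns(3)[OF x y]] by blast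
      then show ?thesis using q linear_add[OF q0 xE yE] by simp
    qed
  qed
  have "\<exists>h. linear_map R E Y h \<and> (\<forall>k\<in>N. h k = q k)"
    by (rule Ext1_trivial_extend[OF T.Xm Ym Em triv X(2,3) ql]) (auto simp: ker)
  then obtain h where h: "linear_map R E Y h" "\<And>k. k \<in> N \<Longrightarrow> h k = q k" by blast
  define Q where "Q \<nu> \<alpha> x = h (bv \<nu> \<alpha> x)" for \<nu> \<alpha> x
  have q0b: "q\<^sub>0 \<beta> (bv \<nu> \<alpha> x) = (if (\<alpha>, \<beta>) \<in> le then cc \<nu> \<alpha> \<beta> x else \<zero>\<^bsub>Y\<^esub>)"
    if "\<nu> \<in> branches" "\<alpha> \<in> W" "x \<in> carrier (P \<alpha>)" for \<nu> \<alpha> x \<beta>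
    unfolding q\<^sub>0_def using that by (subst free_lift_basis[OF Ym gc gensI]) (auto simp: gen_cochain_def)
  have hN: "h z = y" if "z \<in> N" "\<beta>\<^sub>0 \<in> W" "\<And>\<beta>. (\<beta>\<^sub>0, \<beta>) \<in> le \<Longrightarrow> q\<^sub>0 \<beta> z = y" for z y \<beta>\<^sub>0
  proof -
    have "stable z \<beta>\<^sub>0" using that le_refl by (auto simp: stable_def)
    then show ?thesis using h(2)[OF that(1)] q that le_refl by metis
  qed
  show thesis
  proof (rule that[of Q])
    fix \<nu> \<alpha> assume na: "\<nu> \<in> branches" "\<alpha> \<in> W"
    interpret A: left_module R "P \<alpha>" using na by (intro Pm)
    note b = bv_closed[OF na]
    show "linear_map R (P \<alpha>) Y (Q \<nu> \<alpha>)"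
    proof (rule linear_mapI)
      fix x assume x: "x \<in> carrier (P \<alpha>)"
      show "Q \<nu> \<alpha> x \<in> carrier Y" unfolding Q_def by (rule linear_closed[OF h(1) b[OF x]])
      show "Q \<nu> \<alpha> (r \<odot>\<^bsub>P \<alpha>\<^esub> x) = r \<odot>\<^bsub>Y\<^esub> Q \<nu> \<alpha> x" if r: "r \<in> carrier R" for r
      proof -
        have rx: "r \<odot>\<^bsub>P \<alpha>\<^esub> x \<in> carrier (P \<alpha>)" using r x by (rule A.smult_closed)
        have "h (bv \<nu> \<alpha> (r \<odot>\<^bsub>P \<alpha>\<^esub> x) \<ominus>\<^bsub>E\<^esub> r \<odot>\<^bsub>E\<^esub> bv \<nu> \<alpha> x) = \<zero>\<^bsub>Y\<^esub>"
        proof (rule hN[OF N_smult[OF na x r] na(2)])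
          fix \<beta> assume l: "(\<alpha>, \<beta>) \<in> le"
          note cl = cocycle_linear[OF cc[OF na(1)] l]
          show "q\<^sub>0 \<beta> (bv \<nu> \<alpha> (r \<odot>\<^bsub>P \<alpha>\<^esub> x) \<ominus>\<^bsub>E\<^esub> r \<odot>\<^bsub>E\<^esub> bv \<nu> \<alpha> x) = \<zero>\<^bsub>Y\<^esub>"
            using l na x r rx b linear_closed[OF cl x]
            by (simp add: linear_diff[OF Em Ym q0] linear_smult[OF q0] q0b E.smult_closed linear_smult[OF cl] Y.smult_closed)
        qed
        then show ?thesis
          using b x rx r linear_closed[OF h(1)]
          by (simp add: Q_def linear_diff[OF Em Ym h(1)] E.smult_closed linear_smult[OF h(1)] Y.minus_eq_zero_iff Y.smult_closed)
      qed
      show "Q \<nu> \<alpha> (x \<oplus>\<^bsub>P \<alpha>\<^esub> y) = Q \<nu> \<alpha> x \<oplus>\<^bsub>Y\<^esub> Q \<nu> \<alpha> y" if y: "y \<in> carrier (P \<alpha>)" for y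
      proof -
        have "h (bv \<nu> \<alpha> (x \<oplus>\<^bsub>P \<alpha>\<^esub> y) \<ominus>\<^bsub>E\<^esub> (bv \<nu> \<alpha> x \<oplus>\<^bsub>E\<^esub> bv \<nu> \<alpha> y)) = \<zero>\<^bsub>Y\<^esub>"
        proof (rule hN[OF N_add[OF na x y] na(2)])
          fix \<beta> assume l: "(\<alpha>, \<beta>) \<in> le"
          note cl = cocycle_linear[OF cc[OF na(1)] l]
          show "q\<^sub>0 \<beta> (bv \<nu> \<alpha> (x \<oplus>\<^bsub>P \<alpha>\<^esub> y) \<ominus>\<^bsub>E\<^esub> (bv \<nu> \<alpha> x \<oplus>\<^bsub>E\<^esub> bv \<nu> \<alpha> y)) = \<zero>\<^bsub>Y\<^esub>"
            using l na x y b linear_closed[OF cl]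
            by (simp add: linear_diff[OF Em Ym q0] linear_add[OF q0] q0b linear_add[OF cl])
        qed
        then show ?thesis
          using b x y linear_closed[OF h(1)]
          by (simp add: Q_def linear_diff[OF Em Ym h(1)] linear_add[OF h(1)] Y.minus_eq_zero_iff)
      qed
    qed
  next
    fix \<nu> \<nu>' \<alpha> \<beta> x
    assume nb: "\<nu> \<in> branches" "\<nu>' \<in> branches" and ag: "agree_below \<nu> \<nu>' \<beta>" and le: "(\<alpha>, \<beta>) \<in> le"
      and x: "x \<in> carrier (P \<alpha>)"
    have W: "\<alpha> \<in> W" "\<beta> \<in> W" using le_W le by auto
    have fx: "f \<alpha> \<beta> x \<in> carrier (P \<beta>)" by (rule linear_closed[OF f[OF le] x])
    note b = bv_closed[OF nb(1) W(1) x] bv_closed[OF nb(2) W(1) x]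
      bv_closed[OF nb(1) W(2) fx] bv_closed[OF nb(2) W(2) fx]
    have c: "cc \<nu> \<alpha> \<beta> x \<in> carrier Y" if "\<nu> \<in> branches" for \<nu> by (rule linear_closed[OF cocycle_linear[OF cc[OF that] le] x])
    let ?z = "(bv \<nu> \<alpha> x \<ominus>\<^bsub>E\<^esub> bv \<nu> \<beta> (f \<alpha> \<beta> x)) \<ominus>\<^bsub>E\<^esub> (bv \<nu>' \<alpha> x \<ominus>\<^bsub>E\<^esub> bv \<nu>' \<beta> (f \<alpha> \<beta> x))"
    have "h ?z = cc \<nu> \<alpha> \<beta> x \<ominus>\<^bsub>Y\<^esub> cc \<nu>' \<alpha> \<beta> x"
    proof (rule hN[OF N_segment[OF nb ag le x] W(2)])
      fix \<gamma> assume g: "(\<beta>, \<gamma>) \<in> le"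
      have ag: "(\<alpha>, \<gamma>) \<in> le" by (rule le_trans[OF le g])
      have "cc \<mu> \<alpha> \<gamma> x \<ominus>\<^bsub>Y\<^esub> cc \<mu> \<beta> \<gamma> (f \<alpha> \<beta> x) = cc \<mu> \<alpha> \<beta> x" if m: "\<mu> \<in> branches" for \<mu>
        using cocycle_comp[OF cc[OF m] le g x] c[OF m] linear_closed[OF cocycle_linear[OF cc[OF m] g] fx]
        by (simp add: a_minus_def Y.a_assoc Y.r_neg)
      then show "q\<^sub>0 \<gamma> ?z = cc \<nu> \<alpha> \<beta> x \<ominus>\<^bsub>Y\<^esub> cc \<nu>' \<alpha> \<beta> x"
        using b nb W x fx g ag by (simp add: linear_diff[OF Em Ym q0] q0b)
    qed
    then have eq: "(Q \<nu> \<alpha> x \<ominus>\<^bsub>Y\<^esub> Q \<nu> \<beta> (f \<alpha> \<beta> x)) \<ominus>\<^bsub>Y\<^esub> (Q \<nu>' \<alpha> x \<ominus>\<^bsub>Y\<^esub> Q \<nu>' \<beta> (f \<alpha> \<beta> x)) =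
        cc \<nu> \<alpha> \<beta> x \<ominus>\<^bsub>Y\<^esub> cc \<nu>' \<alpha> \<beta> x"
      using b by (simp add: Q_def linear_diff[OF Em Ym h(1)])
    show "cc \<nu> \<alpha> \<beta> x \<ominus>\<^bsub>Y\<^esub> (Q \<nu> \<alpha> x \<ominus>\<^bsub>Y\<^esub> Q \<nu> \<beta> (f \<alpha> \<beta> x)) =
       cc \<nu>' \<alpha> \<beta> x \<ominus>\<^bsub>Y\<^esub> (Q \<nu>' \<alpha> x \<ominus>\<^bsub>Y\<^esub> Q \<nu>' \<beta> (f \<alpha> \<beta> x))"
    proof (rule Y.minus_cong_swap)
      show "cc \<nu> \<alpha> \<beta> x \<in> carrier Y" "cc \<nu>' \<alpha> \<beta> x \<in> carrier Y" using c nb by auto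
      show "Q \<nu> \<alpha> x \<ominus>\<^bsub>Y\<^esub> Q \<nu> \<beta> (f \<alpha> \<beta> x) \<in> carrier Y" "Q \<nu>' \<alpha> x \<ominus>\<^bsub>Y\<^esub> Q \<nu>' \<beta> (f \<alpha> \<beta> x) \<in> carrier Y"
        unfolding Q_def using b linear_closed[OF h(1)] by auto
    qed (rule eq)
  qed
qed

text \<open>
  A diagonal argument: branches encode guesses, and some branch guesses the corrected cocycle that
  \<open>branch_prediction\<close> assigns to it. The attached cocycles are chosen so that this is impossible unless
  \<open>c\<close> is a coboundary.
\<close>

lemma cocycle_coboundary:
  assumes ext: "\<And>X :: ('r, 'u) module. X \<in> modules R \<Longrightarrow> locally_projective R X \<Longrightarrow> trivial_group (Ext1 R X Y)"
    and c: "cocycle c"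
  shows "coboundary c"
proof (rule ccontr)
  assume nc: "\<not> coboundary c"
  \<comment> \<open>\<open>p \<nu>\<close> is the guess of \<open>\<nu>\<close>; exactly one of \<open>p \<nu>\<close> and \<open>cc \<nu>\<close> is a coboundary,
    so the two are never cohomologous\<close>
  define p where "p \<nu> \<alpha> \<beta> x = \<nu> \<beta> (\<alpha>, x)" for \<nu> :: "'u \<Rightarrow> 'u \<times> 'u \<Rightarrow> 'u" and \<alpha> \<beta> x
  define cc where "cc \<nu> = (if coboundary (p \<nu>) then c else (\<lambda>_ _ _. \<zero>\<^bsub>Y\<^esub>))" for \<nu>
  have zc: "cocycle (\<lambda>_ _ _. \<zero>\<^bsub>Y\<^esub>)" using linear_const_zero[OF Ym] by (auto simp: cocycle_def)
  have cc: "cocycle (cc \<nu>)" for \<nu> using c zc by (simp add: cc_def)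
  obtain Q where Q: "\<And>\<nu> \<alpha>. \<nu> \<in> branches \<Longrightarrow> \<alpha> \<in> W \<Longrightarrow> linear_map R (P \<alpha>) Y (Q \<nu> \<alpha>)"
    "\<And>\<nu> \<nu>' \<alpha> \<beta> x. \<nu> \<in> branches \<Longrightarrow> \<nu>' \<in> branches \<Longrightarrow> agree_below \<nu> \<nu>' \<beta> \<Longrightarrow> (\<alpha>, \<beta>) \<in> le \<Longrightarrow>
       x \<in> carrier (P \<alpha>) \<Longrightarrow>
       cc \<nu> \<alpha> \<beta> x \<ominus>\<^bsub>Y\<^esub> (Q \<nu> \<alpha> x \<ominus>\<^bsub>Y\<^esub> Q \<nu> \<beta> (f \<alpha> \<beta> x)) =
       cc \<nu>' \<alpha> \<beta> x \<ominus>\<^bsub>Y\<^esub> (Q \<nu>' \<alpha> x \<ominus>\<^bsub>Y\<^esub> Q \<nu>' \<beta> (f \<alpha> \<beta> x))"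
    by (rule branch_prediction[of cc, OF ext]) ((assumption | rule cc)+, rule that)
  define e where "e \<nu> \<alpha> \<beta> x = cc \<nu> \<alpha> \<beta> x \<ominus>\<^bsub>Y\<^esub> (Q \<nu> \<alpha> x \<ominus>\<^bsub>Y\<^esub> Q \<nu> \<beta> (f \<alpha> \<beta> x))" for \<nu> \<alpha> \<beta> x
  have e_closed: "e \<nu> \<alpha> \<beta> x \<in> carrier Y" if "\<nu> \<in> branches" "(\<alpha>, \<beta>) \<in> le" "x \<in> carrier (P \<alpha>)" for \<nu> \<alpha> \<beta> x
    using that linear_closed[OF cocycle_linear[OF cc]] linear_closed[OF Q(1)] linear_closed[OF f] le_W
    by (auto simp: e_def)
  define label where "label \<beta> \<mu> = (\<lambda>(\<alpha>, x)\<in>points. if (\<alpha>, \<beta>) \<in> le then e \<mu> \<alpha> \<beta> x else \<zero>\<^bsub>Y\<^esub>)" for \<beta> \<mu>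
  have label: "label \<beta> \<mu> \<in> labels" if "\<mu> \<in> branches" for \<beta> \<mu>
    using e_closed[OF that] by (auto simp: label_def labels_def points_def)
  \<comment> \<open>The label at \<open>\<beta>\<close> is to be the value of \<open>e\<close> at \<open>\<beta>\<close>, which depends only on the branch below
    \<open>\<beta>\<close>. For the recursion, the part below \<open>\<beta>\<close> is completed to a branch by the arbitrary
    label \<open>a\<^sub>0\<close>.\<close>
  define a\<^sub>0 where "a\<^sub>0 = (\<lambda>_\<in>points. \<zero>\<^bsub>Y\<^esub>)"
  have a0: "a\<^sub>0 \<in> labels" by (simp add: a\<^sub>0_def labels_def)
  define cut where "cut \<beta> g = (\<lambda>\<delta>\<in>W. if (\<delta>, \<beta>) \<in> le \<and> \<delta> \<noteq> \<beta> \<and> g \<delta> \<in> labels then g \<delta> else a\<^sub>0)" for \<beta> g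
  have cut: "cut \<beta> g \<in> branches" for \<beta> g using a0 by (auto simp: cut_def branches_def)
  have "\<exists>g. \<forall>\<beta>. g \<beta> = label \<beta> (cut \<beta> g)"
  proof (rule dependent_wf_choice[OF le_wf, where P = "\<lambda>g \<beta> r. r = label \<beta> (cut \<beta> g)"])
    fix g h :: "'u \<Rightarrow> 'u \<times> 'u \<Rightarrow> 'u" and \<beta> r
    assume "\<And>z. (z, \<beta>) \<in> le - Id \<Longrightarrow> g z = h z"
    then have "cut \<beta> g = cut \<beta> h" by (auto simp: cut_def intro!: restrict_ext)
    then show "(r = label \<beta> (cut \<beta> g)) = (r = label \<beta> (cut \<beta> h))" by simp
  qed auto
  then obtain g where g: "\<And>\<beta>. g \<beta> = label \<beta> (cut \<beta> g)" by blast
  have gl: "g \<beta> \<in> labels" for \<beta> using g[of \<beta>] label[OF cut] by metis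
  define \<nu> where "\<nu> = restrict g W"
  have \<nu>: "\<nu> \<in> branches" using gl by (auto simp: \<nu>_def branches_def)
  have below: "agree_below (cut \<beta> g) \<nu> \<beta>" for \<beta>
    using gl le_W by (auto simp: agree_below_def cut_def \<nu>_def)
  \<comment> \<open>the branch \<open>\<nu>\<close> predicts itself\<close>
  have pe: "p \<nu> \<alpha> \<beta> x = e \<nu> \<alpha> \<beta> x" if l: "(\<alpha>, \<beta>) \<in> le" and x: "x \<in> carrier (P \<alpha>)" for \<alpha> \<beta> x
  proof -
    have W: "\<alpha> \<in> W" "\<beta> \<in> W" using le_W l by auto
    have "p \<nu> \<alpha> \<beta> x = label \<beta> (cut \<beta> g) (\<alpha>, x)" using W g[of \<beta>] by (simp add: p_def \<nu>_def)
    also have "\<dots> = e (cut \<beta> g) \<alpha> \<beta> x" using W l x by (simp add: label_def points_def)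
    also have "\<dots> = e \<nu> \<alpha> \<beta> x" unfolding e_def by (rule Q(2)[OF cut \<nu> below l x])
    finally show ?thesis .
  qed
  note Q\<nu> = Q(1)[OF \<nu>]
  have Qc: "Q \<nu> \<alpha> x \<in> carrier Y" "Q \<nu> \<beta> (f \<alpha> \<beta> x) \<in> carrier Y" "f \<alpha> \<beta> x \<in> carrier (P \<beta>)" "cc \<nu> \<alpha> \<beta> x \<in> carrier Y"
    if "(\<alpha>, \<beta>) \<in> le" "x \<in> carrier (P \<alpha>)" for \<alpha> \<beta> x
    using that le_W[OF that(1)] linear_closed[OF Q\<nu>] linear_closed[OF f] linear_closed[OF cocycle_linear[OF cc]] by auto
  show False
  proof (cases "coboundary (p \<nu>)")
    case True
    then obtain \<theta> where \<theta>: "\<And>\<alpha>. \<alpha> \<in> W \<Longrightarrow> linear_map R (P \<alpha>) Y (\<theta> \<alpha>)"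
      "\<And>\<alpha> \<beta> x. (\<alpha>, \<beta>) \<in> le \<Longrightarrow> \<alpha> \<noteq> \<beta> \<Longrightarrow> x \<in> carrier (P \<alpha>) \<Longrightarrow> p \<nu> \<alpha> \<beta> x = \<theta> \<alpha> x \<ominus>\<^bsub>Y\<^esub> \<theta> \<beta> (f \<alpha> \<beta> x)"
      unfolding coboundary_def by blast
    have "coboundary c"
      unfolding coboundary_def
    proof (intro exI[of _ "\<lambda>\<alpha> x. \<theta> \<alpha> x \<oplus>\<^bsub>Y\<^esub> Q \<nu> \<alpha> x"] conjI ballI allI impI)
      fix \<alpha> assume "\<alpha> \<in> W"
      then show "linear_map R (P \<alpha>) Y (\<lambda>x. \<theta> \<alpha> x \<oplus>\<^bsub>Y\<^esub> Q \<nu> \<alpha> x)" by (intro linear_plus Ym \<theta> Q\<nu>)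
    next
      fix \<alpha> \<beta> x assume l: "(\<alpha>, \<beta>) \<in> le" "\<alpha> \<noteq> \<beta>" and x: "x \<in> carrier (P \<alpha>)"
      note q = Qc[OF l(1) x]
      have t: "\<theta> \<alpha> x \<in> carrier Y" "\<theta> \<beta> (f \<alpha> \<beta> x) \<in> carrier Y" using \<theta>(1) le_W[OF l(1)] linear_closed x q(3) by metis+
      have "c \<alpha> \<beta> x \<ominus>\<^bsub>Y\<^esub> (Q \<nu> \<alpha> x \<ominus>\<^bsub>Y\<^esub> Q \<nu> \<beta> (f \<alpha> \<beta> x)) = \<theta> \<alpha> x \<ominus>\<^bsub>Y\<^esub> \<theta> \<beta> (f \<alpha> \<beta> x)"
        using pe[OF l(1) x] \<theta>(2)[OF l x] True by (simp add: e_def cc_def)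
      moreover have "c \<alpha> \<beta> x = (c \<alpha> \<beta> x \<ominus>\<^bsub>Y\<^esub> (Q \<nu> \<alpha> x \<ominus>\<^bsub>Y\<^esub> Q \<nu> \<beta> (f \<alpha> \<beta> x))) \<oplus>\<^bsub>Y\<^esub> (Q \<nu> \<alpha> x \<ominus>\<^bsub>Y\<^esub> Q \<nu> \<beta> (f \<alpha> \<beta> x))"
        using q True by (simp add: cc_def Y.minus_plus_cancel)
      ultimately show "c \<alpha> \<beta> x = (\<theta> \<alpha> x \<oplus>\<^bsub>Y\<^esub> Q \<nu> \<alpha> x) \<ominus>\<^bsub>Y\<^esub> (\<theta> \<beta> (f \<alpha> \<beta> x) \<oplus>\<^bsub>Y\<^esub> Q \<nu> \<beta> (f \<alpha> \<beta> x))"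
        using q t by (simp add: Y.plus_minus_plus)
    qed
    then show False using nc by blast
  next
    case False
    have "coboundary (p \<nu>)"
      unfolding coboundary_def
    proof (intro exI[of _ "\<lambda>\<alpha> x. \<ominus>\<^bsub>Y\<^esub> Q \<nu> \<alpha> x"] conjI ballI allI impI)
      fix \<alpha> assume "\<alpha> \<in> W"
      then show "linear_map R (P \<alpha>) Y (\<lambda>x. \<ominus>\<^bsub>Y\<^esub> Q \<nu> \<alpha> x)" by (intro linear_uminus Ym Q\<nu>)
    next
      fix \<alpha> \<beta> x assume l: "(\<alpha>, \<beta>) \<in> le" "\<alpha> \<noteq> \<beta>" and x: "x \<in> carrier (P \<alpha>)"
      show "p \<nu> \<alpha> \<beta> x = \<ominus>\<^bsub>Y\<^esub> Q \<nu> \<alpha> x \<ominus>\<^bsub>Y\<^esub> \<ominus>\<^bsub>Y\<^esub> Q \<nu> \<beta> (f \<alpha> \<beta> x)"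
        using Qc[OF l(1) x] False by (simp add: pe[OF l(1) x] e_def cc_def a_minus_def Y.minus_add)
    qed
    then show False using False by blast
  qed
qed

end

section \<open>Totally ordered direct limits\<close>

text \<open>
  Fix a well-order \<open>s\<close> of \<open>I\<close> and keep the elements that are \<open>r\<close>-above all their \<open>s\<close>-predecessors. On
  these, \<open>r\<close> and \<open>s\<close> coincide. They are cofinal, since the \<open>s\<close>-least element \<open>r\<close>-above \<open>i\<close> is one of them.
\<close>

lemma cofinal_well_order:
  assumes r: "linear_order_on I r"
  obtains W where "W \<subseteq> I" "well_order_on W (Restr r W)" "\<And>i. i \<in> I \<Longrightarrow> \<exists>w\<in>W. (i, w) \<in> r"
proof -
  obtain s where s: "well_order_on I s" using well_order_on by blast
  have rI: "(i, j) \<in> r \<Longrightarrow> i \<in> I \<and> j \<in> I" for i j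
    using r by (auto simp: linear_order_on_def partial_order_on_def preorder_on_def)
  have rr: "i \<in> I \<Longrightarrow> (i, i) \<in> r" for i
    using r by (auto simp: linear_order_on_def partial_order_on_def preorder_on_def refl_on_def)
  have rt: "trans r" and ra: "antisym r" and rtot: "total_on I r"
    using r by (auto simp: linear_order_on_def partial_order_on_def preorder_on_def)
  have stot: "total_on I s" and swf: "wf (s - Id)" 
    using s by (auto simp: well_order_on_def linear_order_on_def)
  have sI: "(i, j) \<in> s \<Longrightarrow> i \<in> I \<and> j \<in> I" for i j
    using s by (auto simp: well_order_on_def linear_order_on_def partial_order_on_def preorder_on_def)
  define W where "W = {i \<in> I. \<forall>j. (j, i) \<in> s - Id \<longrightarrow> (j, i) \<in> r}"
  have WI: "W \<subseteq> I" by (auto simp: W_def)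
  have sub: "Restr r W - Id \<subseteq> s - Id"
  proof (rule subrelI)
    fix a b assume "(a, b) \<in> Restr r W - Id"
    then have ab: "(a, b) \<in> r" "a \<in> W" "b \<in> W" and ne: "a \<noteq> b" by auto
    have "(b, a) \<notin> s"
    proof
      assume "(b, a) \<in> s"
      then have "(b, a) \<in> r" using ab(2) ne by (auto simp: W_def)
      then show False using antisymD[OF ra ab(1)] ne by simp
    qed
    then show "(a, b) \<in> s - Id" using stot ab WI ne by (auto simp: total_on_def)
  qed
  have "well_order_on W (Restr r W)"
    unfolding well_order_on_def linear_order_on_def partial_order_on_def preorder_on_def
  proof (intro conjI)
    show "Restr r W \<subseteq> W \<times> W" by auto
    show "refl_on W (Restr r W)" using rr WI by (auto simp: refl_on_def)
    show "trans (Restr r W)" using rt by (auto simp: trans_def)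
    show "antisym (Restr r W)" using ra by (auto simp: antisym_def)
    show "total_on W (Restr r W)" using rtot WI by (auto simp: total_on_def)
    show "wf (Restr r W - Id)" by (rule wf_subset[OF swf sub])
  qed
  moreover have "\<exists>w\<in>W. (i, w) \<in> r" if i: "i \<in> I" for i
  proof -
    define A where "A = {j \<in> I. (i, j) \<in> r}"
    have "i \<in> A" using i rr by (simp add: A_def)
    then obtain m where m: "m \<in> A" "\<And>y. (y, m) \<in> s - Id \<Longrightarrow> y \<notin> A"
      by (rule wfE_min[OF swf]) (rule that)
    have "m \<in> W"
      unfolding W_def
    proof (intro CollectI conjI allI impI)
      show "m \<in> I" using m(1) by (simp add: A_def)
      fix j assume j: "(j, m) \<in> s - Id"
      then have "j \<in> I" "(i, j) \<notin> r" using m(2)[OF j] sI by (auto simp: A_def)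
      then have "(j, i) \<in> r" using rtot rr i unfolding total_on_def by (cases "i = j") auto
      moreover have "(i, m) \<in> r" using m(1) by (simp add: A_def)
      ultimately show "(j, m) \<in> r" by (rule transD[OF rt])
    qed
    then show ?thesis using m(1) by (auto simp: A_def)
  qed
  ultimately show thesis using that WI by blast
qed

definition pair_module :: "('r, 'm) module \<Rightarrow> ('r, 'n) module \<Rightarrow> ('r, 'm \<times> 'n) module" where
  "pair_module M N =
     \<lparr>carrier = carrier M \<times> carrier N, monoid.mult = undefined, monoid.one = undefined,
      ring.zero = (\<zero>\<^bsub>M\<^esub>, \<zero>\<^bsub>N\<^esub>), ring.add = (\<lambda>x y. (fst x \<oplus>\<^bsub>M\<^esub> fst y, snd x \<oplus>\<^bsub>N\<^esub> snd y)),
      smult = (\<lambda>r x. (r \<odot>\<^bsub>M\<^esub> fst x, r \<odot>\<^bsub>N\<^esub> snd x))\<rparr>"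

lemma pair_module_left_module:
  assumes "left_module R M" "left_module R N"
  shows "left_module R (pair_module M N)"
proof -
  interpret M: left_module R M by fact
  interpret N: left_module R N by fact
  have "abelian_group (pair_module M N)"
  proof (rule abelian_groupI)
    fix x assume x: "x \<in> carrier (pair_module M N)"
    show "\<exists>y\<in>carrier (pair_module M N). y \<oplus>\<^bsub>pair_module M N\<^esub> x = \<zero>\<^bsub>pair_module M N\<^esub>"
      using x by (intro bexI[of _ "(\<ominus>\<^bsub>M\<^esub> fst x, \<ominus>\<^bsub>N\<^esub> snd x)"]) (auto simp: pair_module_def M.l_neg N.l_neg)
  qed (auto simp: pair_module_def M.a_ac N.a_ac)
  then show ?thesis
    using M.R.ring_axioms
    by (auto simp: left_module_def left_module_axioms_def pair_module_def M.smult_closed M.smult_l_distr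
        M.smult_r_distr M.smult_assoc M.smult_one N.smult_closed N.smult_l_distr
        N.smult_r_distr N.smult_assoc N.smult_one)
qed

lemma linear_lift_inj:
  assumes "left_module R F" "left_module R Y" "left_module R X"
    and j: "linear_map R Y X j" "inj_on j (carrier Y)"
    and h: "linear_map R F X h" "\<And>z. z \<in> carrier F \<Longrightarrow> h z \<in> j ` carrier Y"
  obtains G where "linear_map R F Y G" "\<And>z. z \<in> carrier F \<Longrightarrow> j (G z) = h z"
proof -
  interpret F: left_module R F by fact
  interpret Y: left_module R Y by fact
  define G where "G z = inv_into (carrier Y) j (h z)" for z
  have G: "G z \<in> carrier Y" "j (G z) = h z" if "z \<in> carrier F" for z
    using h(2)[OF that] by (auto simp: G_def inv_into_into f_inv_into_f)
  have eq: "y = y'" if "y \<in> carrier Y" "y' \<in> carrier Y" "j y = j y'" for y y'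
    using inj_onD[OF j(2)] that by blast
  have "linear_map R F Y G"
  proof (rule linear_mapI)
    fix x y assume xy: "x \<in> carrier F" "y \<in> carrier F"
    show "G (x \<oplus>\<^bsub>F\<^esub> y) = G x \<oplus>\<^bsub>Y\<^esub> G y"
      by (rule eq) (use xy G in \<open>simp_all add: linear_add[OF j(1)] linear_add[OF h(1)]\<close>)
  next
    fix r x assume rx: "r \<in> carrier R" "x \<in> carrier F"
    show "G (r \<odot>\<^bsub>F\<^esub> x) = r \<odot>\<^bsub>Y\<^esub> G x"
      by (rule eq) (use rx G in \<open>simp_all add: linear_smult[OF j(1)] linear_smult[OF h(1)] F.smult_closed Y.smult_closed\<close>)
  qed (rule G)
  then show thesis using that G(2) by blast
qed

text \<open>
  The lifts \<open>t \<alpha>\<close> of the limit maps to the free cover are compatible up to elements of the kernel \<open>K\<close>, and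
  \<open>g\<close> turns these elements into a cocycle. A cochain \<open>\<theta>\<close> with this coboundary corrects the lifts to a
  compatible family of maps to the pushout of the free cover along \<open>g\<close>. The universal property of the
  limit then splits the pushout, and a splitting amounts to an extension of \<open>g\<close>.
\<close>

lemma limit_Ext_trivial:
  fixes R :: "'r ring" and L Y :: "('r, 'u) module"
  assumes U: "universe TYPE('u)" and Rc: "|carrier R| <o |UNIV :: 'u set|"
    and Y: "Y \<in> modules R"
    and ext: "\<And>X :: ('r, 'u) module. X \<in> modules R \<Longrightarrow> locally_projective R X \<Longrightarrow> trivial_group (Ext1 R X Y)"
    and L: "L \<in> totally_ordered_limits_of_projectives R"
  shows "trivial_group (Ext1 R L Y)"
proof -
  obtain I :: "'u set" and r P f where I: "small I" "I \<noteq> {}" "linear_order_on I r"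
    and P: "\<And>i. i \<in> I \<Longrightarrow> P i \<in> projective_modules R" and ds: "direct_system R I r P f"
    and lim: "is_direct_limit R I r P f L"
    using L unfolding totally_ordered_limits_of_projectives_def by blast
  have LR: "L \<in> modules R" using lim by (simp add: is_direct_limit_def)
  obtain \<phi> where \<phi>: "cocone R I r P f L \<phi>"
    and univ0: "\<forall>N\<in>modules R. \<forall>\<psi>. cocone R I r P f N \<psi> \<longrightarrow>
       (\<exists>!u. u \<in> module_hom R L N \<and> (\<forall>i\<in>I. \<forall>x\<in>carrier (P i). u (\<phi> i x) = \<psi> i x))"
    using lim unfolding is_direct_limit_def by (elim conjE exE) (rule that)
  note univ = univ0[THEN bspec, THEN spec, THEN mp]
  obtain W where W: "W \<subseteq> I" "well_order_on W (Restr r W)" "\<And>i. i \<in> I \<Longrightarrow> \<exists>w\<in>W. (i, w) \<in> r"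
    by (rule cofinal_well_order[OF I(3)]) (rule that)
  have rI: "(i, j) \<in> r \<Longrightarrow> i \<in> I \<and> j \<in> I" for i j
    using I(3) by (auto simp: linear_order_on_def partial_order_on_def preorder_on_def)
  have fl: "linear_map R (P i) (P j) (f i j)" if "(i, j) \<in> r" for i j
    using ds that unfolding direct_system_def by (blast intro: module_hom_linear)
  have fid: "f i i x = x" if "i \<in> I" "x \<in> carrier (P i)" for i x
    using ds that unfolding direct_system_def by blast
  have fcomp: "f j k (f i j x) = f i k x" if "(i, j) \<in> r" "(j, k) \<in> r" "x \<in> carrier (P i)" for i j k x
    using ds that unfolding direct_system_def by blast
  have rtrans: "(i, k) \<in> r" if "(i, j) \<in> r" "(j, k) \<in> r" for i j k
    using I(3) that by (auto simp: linear_order_on_def partial_order_on_def preorder_on_def dest: transD)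
  have \<phi>l: "linear_map R (P i) L (\<phi> i)" if "i \<in> I" for i
    using \<phi> that unfolding cocone_def by (blast intro: module_hom_linear)
  have \<phi>f: "\<phi> j (f i j x) = \<phi> i x" if "(i, j) \<in> r" "x \<in> carrier (P i)" for i j x
    using \<phi> that unfolding cocone_def by blast
  have Wsmall: "small W" using I(1) card_le_subset[OF W(1)] unfolding small_def by blast
  have Wne: "W \<noteq> {}" using W(3) I(2) by blast
  interpret C: projective_chain R W "Restr r W" P f Y
    by unfold_locales (use U Rc Wsmall Wne W P fl fid fcomp Y in auto)
  have Lm: "left_module R L" using LR by (simp add: modules_def)
  interpret L: left_module R L by fact
  define F where "F = free_module R (carrier L)"
  define \<pi> where "\<pi> = free_cover R L (carrier L)"
  define K where "K = lin_kernel F L \<pi>"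
  have F: "left_module R F" unfolding F_def by (rule free_module_left_module[OF C.Y.R.ring_axioms])
  interpret F: left_module R F by fact
  have \<pi>: "linear_map R F L \<pi>" unfolding \<pi>_def F_def by (rule free_cover_linear[OF Lm]) simp
  have \<pi>_onto: "\<pi> ` carrier F = carrier L"
    using linear_closed[OF \<pi>] free_cover_onto[OF Lm] unfolding \<pi>_def F_def by (metis (no_types, lifting) image_subset_iff imageI subsetI subset_antisym)
  have Ks: "submodule K R F" unfolding K_def by (rule submodule_lin_kernel[OF F Lm \<pi>])
  note Kd = F.submoduleD[OF Ks]
  show ?thesis
    unfolding Ext1_trivial_iff[OF Lm C.Ym]
  proof (fold F_def \<pi>_def, fold K_def, intro allI impI)
    fix g assume g: "linear_map R (F\<lparr>carrier := K\<rparr>) Y g"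
    have gadd: "g (x \<oplus>\<^bsub>F\<^esub> y) = g x \<oplus>\<^bsub>Y\<^esub> g y" if "x \<in> K" "y \<in> K" for x y
      using linear_add[OF g] that by simp
    have gcl: "g x \<in> carrier Y" if "x \<in> K" for x using linear_closed[OF g] that by simp
    have gsm: "g (r \<odot>\<^bsub>F\<^esub> x) = r \<odot>\<^bsub>Y\<^esub> g x" if "r \<in> carrier R" "x \<in> K" for r x
      using linear_smult[OF g] that by simp
    have Km: "left_module R (F\<lparr>carrier := K\<rparr>)" by (rule F.submodule_left_module[OF Ks])
    have g0: "g \<zero>\<^bsub>F\<^esub> = \<zero>\<^bsub>Y\<^esub>" using linear_zero[OF Km C.Ym g] by simp
    have "\<forall>\<alpha>\<in>W. \<exists>t. linear_map R (P \<alpha>) F t \<and> (\<forall>x\<in>carrier (P \<alpha>). \<pi> (t x) = \<phi> \<alpha> x)"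
    proof
      fix \<alpha> assume "\<alpha> \<in> W"
      then have a: "\<alpha> \<in> I" using W(1) by blast
      show "\<exists>t. linear_map R (P \<alpha>) F t \<and> (\<forall>x\<in>carrier (P \<alpha>). \<pi> (t x) = \<phi> \<alpha> x)"
        by (rule projective_lift[OF U Rc P[OF a] F Lm \<pi> \<pi>_onto \<phi>l[OF a]]) blast
    qed
    then obtain t where t: "\<And>\<alpha>. \<alpha> \<in> W \<Longrightarrow> linear_map R (P \<alpha>) F (t \<alpha>)"
      "\<And>\<alpha> x. \<alpha> \<in> W \<Longrightarrow> x \<in> carrier (P \<alpha>) \<Longrightarrow> \<pi> (t \<alpha> x) = \<phi> \<alpha> x" by metis
    have tdK: "t \<alpha> x \<ominus>\<^bsub>F\<^esub> t \<beta> (f \<alpha> \<beta> x) \<in> K" if l: "(\<alpha>, \<beta>) \<in> Restr r W" and x: "x \<in> carrier (P \<alpha>)" for \<alpha> \<beta> x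
    proof -
      have w: "\<alpha> \<in> W" "\<beta> \<in> W" "(\<alpha>, \<beta>) \<in> r" using l by auto
      have fx: "f \<alpha> \<beta> x \<in> carrier (P \<beta>)" by (rule linear_closed[OF fl[OF w(3)] x])
      have "\<phi> \<alpha> x \<in> carrier L" using linear_closed[OF \<phi>l x] w W(1) by blast
      then show ?thesis
        using linear_closed[OF t(1)[OF w(1)] x] linear_closed[OF t(1)[OF w(2)] fx]
        by (simp add: K_def lin_kernel_def linear_diff[OF F Lm \<pi>] t(2)[OF w(1) x] t(2)[OF w(2) fx] \<phi>f[OF w(3) x])
    qed
    define c where "c = (\<lambda>\<alpha> \<beta> x. g (t \<alpha> x \<ominus>\<^bsub>F\<^esub> t \<beta> (f \<alpha> \<beta> x)))"
    have "C.cocycle c"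
      unfolding C.cocycle_def
    proof (intro conjI allI impI ballI)
      fix ab assume ab: "ab \<in> Restr r W"
      obtain \<alpha> \<beta> where [simp]: "ab = (\<alpha>, \<beta>)" by (cases ab)
      have w: "\<alpha> \<in> W" "\<beta> \<in> W" "(\<alpha>, \<beta>) \<in> r" using ab by auto
      have "linear_map R (P \<alpha>) F (\<lambda>x. t \<alpha> x \<ominus>\<^bsub>F\<^esub> t \<beta> (f \<alpha> \<beta> x))"
        by (intro linear_minus F t w linear_comp[OF fl])
      then have "linear_map R (P \<alpha>) (F\<lparr>carrier := K\<rparr>) (\<lambda>x. t \<alpha> x \<ominus>\<^bsub>F\<^esub> t \<beta> (f \<alpha> \<beta> x))"
        using tdK ab unfolding linear_map_def by simp
      from linear_comp[OF this g] show "case ab of (\<alpha>, \<beta>) \<Rightarrow> linear_map R (P \<alpha>) Y (c \<alpha> \<beta>)" by (simp add: c_def)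
    next
      fix \<alpha> \<beta> \<gamma> x assume ab: "(\<alpha>, \<beta>) \<in> Restr r W" and bc: "(\<beta>, \<gamma>) \<in> Restr r W" and x: "x \<in> carrier (P \<alpha>)"
      have w: "\<alpha> \<in> W" "\<beta> \<in> W" "\<gamma> \<in> W" "(\<alpha>, \<beta>) \<in> r" "(\<beta>, \<gamma>) \<in> r" using ab bc by auto
      have fx: "f \<alpha> \<beta> x \<in> carrier (P \<beta>)" by (rule linear_closed[OF fl[OF w(4)] x])
      have ffx: "f \<alpha> \<gamma> x \<in> carrier (P \<gamma>)" by (rule linear_closed[OF fl[OF rtrans[OF w(4,5)]] x])
      have "t \<alpha> x \<ominus>\<^bsub>F\<^esub> t \<gamma> (f \<alpha> \<gamma> x) = (t \<alpha> x \<ominus>\<^bsub>F\<^esub> t \<beta> (f \<alpha> \<beta> x)) \<oplus>\<^bsub>F\<^esub> (t \<beta> (f \<alpha> \<beta> x) \<ominus>\<^bsub>F\<^esub> t \<gamma> (f \<alpha> \<gamma> x))"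
        using linear_closed[OF t(1)[OF w(1)] x] linear_closed[OF t(1)[OF w(2)] fx] linear_closed[OF t(1)[OF w(3)] ffx]
        by (simp add: F.minus_plus_telescope)
      then show "c \<alpha> \<gamma> x = c \<alpha> \<beta> x \<oplus>\<^bsub>Y\<^esub> c \<beta> \<gamma> (f \<alpha> \<beta> x)"
        using gadd[OF tdK[OF ab x] tdK[OF bc fx]] by (simp add: c_def fcomp[OF w(4,5) x])
    qed
    then have "C.coboundary c" using C.cocycle_coboundary[of c] ext by blast
    then obtain \<theta> where \<theta>: "\<And>\<alpha>. \<alpha> \<in> W \<Longrightarrow> linear_map R (P \<alpha>) Y (\<theta> \<alpha>)"
      "\<And>\<alpha> \<beta> x. (\<alpha>, \<beta>) \<in> Restr r W \<Longrightarrow> \<alpha> \<noteq> \<beta> \<Longrightarrow> x \<in> carrier (P \<alpha>) \<Longrightarrow> c \<alpha> \<beta> x = \<theta> \<alpha> x \<ominus>\<^bsub>Y\<^esub> \<theta> \<beta> (f \<alpha> \<beta> x)"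
      unfolding C.coboundary_def by blast
    \<comment> \<open>the pushout of \<open>F\<close> and \<open>Y\<close> over \<open>K\<close>, as the quotient of \<open>F \<times> Y\<close> by the elements \<open>(k, - g k)\<close>\<close>
    let ?FY = "pair_module F Y"
    have FY: "left_module R ?FY" by (rule pair_module_left_module[OF F C.Ym])
    interpret FY: left_module R ?FY by fact
    have FYs: "carrier ?FY = carrier F \<times> carrier Y" "\<zero>\<^bsub>?FY\<^esub> = (\<zero>\<^bsub>F\<^esub>, \<zero>\<^bsub>Y\<^esub>)"
      "\<And>x y x' y'. (x, y) \<oplus>\<^bsub>?FY\<^esub> (x', y') = (x \<oplus>\<^bsub>F\<^esub> x', y \<oplus>\<^bsub>Y\<^esub> y')" "\<And>r x y. r \<odot>\<^bsub>?FY\<^esub> (x, y) = (r \<odot>\<^bsub>F\<^esub> x, r \<odot>\<^bsub>Y\<^esub> y)"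
      by (simp_all add: pair_module_def)
    have FYneg: "\<ominus>\<^bsub>?FY\<^esub> (x, y) = (\<ominus>\<^bsub>F\<^esub> x, \<ominus>\<^bsub>Y\<^esub> y)" if "x \<in> carrier F" "y \<in> carrier Y" for x y
      using that by (intro FY.minus_equality) (auto simp: FYs F.l_neg C.Y.l_neg)
    have FYminus: "(x, y) \<ominus>\<^bsub>?FY\<^esub> (x', y') = (x \<ominus>\<^bsub>F\<^esub> x', y \<ominus>\<^bsub>Y\<^esub> y')" if "x' \<in> carrier F" "y' \<in> carrier Y" for x y x' y'
      using that by (simp add: a_minus_def FYneg FYs)
    define N where "N = (\<lambda>k. (k, \<ominus>\<^bsub>Y\<^esub> g k)) ` K"
    have Ns: "submodule N R ?FY"
    proof (rule FY.submoduleI)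
      show "N \<subseteq> carrier ?FY" using Kd(1) gcl by (auto simp: N_def FYs)
      have mem: "(k, y) \<in> N" if "k \<in> K" "y = \<ominus>\<^bsub>Y\<^esub> g k" for k y using that by (simp add: N_def)
      show "\<zero>\<^bsub>?FY\<^esub> \<in> N" unfolding FYs(2) by (rule mem) (use Kd(2) g0 in simp_all)
      show "x \<oplus>\<^bsub>?FY\<^esub> y \<in> N" if xy: "x \<in> N" "y \<in> N" for x y
      proof -
        obtain k k' where k: "k \<in> K" "x = (k, \<ominus>\<^bsub>Y\<^esub> g k)" "k' \<in> K" "y = (k', \<ominus>\<^bsub>Y\<^esub> g k')"
          using xy unfolding N_def by blast
        show ?thesis unfolding k(2,4) FYs by (rule mem) (use k gcl Kd(3) in \<open>simp_all add: gadd C.Y.minus_add\<close>)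
      qed
      show "r \<odot>\<^bsub>?FY\<^esub> x \<in> N" if rx: "r \<in> carrier R" "x \<in> N" for r x
      proof -
        obtain k where k: "k \<in> K" "x = (k, \<ominus>\<^bsub>Y\<^esub> g k)" using rx(2) unfolding N_def by blast
        show ?thesis unfolding k(2) FYs by (rule mem) (use k gcl Kd(4) rx(1) in \<open>simp_all add: gsm C.Y.smult_r_minus\<close>)
      qed
    qed
    have "|carrier L| <o |UNIV :: 'u set|" "|carrier Y| <o |UNIV :: 'u set|"
      using LR Y by (auto simp: modules_def small_def)
    then have card: "|carrier ?FY| <o |UNIV :: 'u set|"
      unfolding FYs(1) unfolding F_def by (intro universe_Times[OF U] universe_free_module[OF U Rc])
    obtain X :: "('r, 'u) module" and \<rho> where X: "X \<in> modules R" "linear_map R ?FY X \<rho>"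
      "\<rho> ` carrier ?FY = carrier X" "\<And>x. x \<in> carrier ?FY \<Longrightarrow> \<rho> x = \<zero>\<^bsub>X\<^esub> \<longleftrightarrow> x \<in> N"
      by (rule quotient_exists[OF FY Ns card]) (rule that)
    have Xm: "left_module R X" using X(1) by (simp add: modules_def)
    interpret X: left_module R X by fact
    note \<rho> = X(2)
    have \<rho>eq: "\<rho> (x, y) = \<rho> (x', y')"
      if "x \<in> carrier F" "y \<in> carrier Y" "x' \<in> carrier F" "y' \<in> carrier Y"
        "x \<ominus>\<^bsub>F\<^esub> x' \<in> K" "y \<ominus>\<^bsub>Y\<^esub> y' = \<ominus>\<^bsub>Y\<^esub> g (x \<ominus>\<^bsub>F\<^esub> x')" for x y x' y'
    proof -
      have "(x, y) \<ominus>\<^bsub>?FY\<^esub> (x', y') \<in> N" using that by (simp add: FYminus N_def)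
      then have "\<rho> ((x, y) \<ominus>\<^bsub>?FY\<^esub> (x', y')) = \<zero>\<^bsub>X\<^esub>"
        using X(4) FY.submoduleD(1)[OF Ns] by blast
      then have "\<rho> (x, y) \<ominus>\<^bsub>X\<^esub> \<rho> (x', y') = \<zero>\<^bsub>X\<^esub>"
        using that linear_diff[OF FY Xm \<rho>, of "(x, y)" "(x', y')"] by (simp add: FYs(1))
      then show ?thesis using that linear_closed[OF \<rho>] by (simp add: X.minus_eq_zero_iff FYs(1))
    qed
    define s where "s = (\<lambda>\<alpha> x. \<rho> (t \<alpha> x, \<ominus>\<^bsub>Y\<^esub> \<theta> \<alpha> x))"
    have sl: "linear_map R (P \<alpha>) X (s \<alpha>)" if w: "\<alpha> \<in> W" for \<alpha>
    proof -
      have "linear_map R (P \<alpha>) ?FY (\<lambda>x. (t \<alpha> x, \<ominus>\<^bsub>Y\<^esub> \<theta> \<alpha> x))"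
        using t(1)[OF w] linear_uminus[OF C.Ym \<theta>(1)[OF w]] by (simp add: linear_map_def FYs)
      from linear_comp[OF this \<rho>] show ?thesis by (simp add: s_def)
    qed
    have sf: "s \<beta> (f \<alpha> \<beta> x) = s \<alpha> x" if l: "(\<alpha>, \<beta>) \<in> Restr r W" and x: "x \<in> carrier (P \<alpha>)" for \<alpha> \<beta> x
    proof (cases "\<alpha> = \<beta>")
      case True
      then show ?thesis using l x fid W(1) by auto
    next
      case False
      have w: "\<alpha> \<in> W" "\<beta> \<in> W" "(\<alpha>, \<beta>) \<in> r" using l by auto
      have fx: "f \<alpha> \<beta> x \<in> carrier (P \<beta>)" by (rule linear_closed[OF fl[OF w(3)] x])
      note cl = linear_closed[OF t(1)[OF w(1)] x] linear_closed[OF t(1)[OF w(2)] fx]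
        linear_closed[OF \<theta>(1)[OF w(1)] x] linear_closed[OF \<theta>(1)[OF w(2)] fx]
      have "\<ominus>\<^bsub>Y\<^esub> \<theta> \<alpha> x \<ominus>\<^bsub>Y\<^esub> \<ominus>\<^bsub>Y\<^esub> \<theta> \<beta> (f \<alpha> \<beta> x) = \<ominus>\<^bsub>Y\<^esub> (\<theta> \<alpha> x \<ominus>\<^bsub>Y\<^esub> \<theta> \<beta> (f \<alpha> \<beta> x))"
        using cl by (simp add: a_minus_def C.Y.minus_add)
      also have "\<dots> = \<ominus>\<^bsub>Y\<^esub> g (t \<alpha> x \<ominus>\<^bsub>F\<^esub> t \<beta> (f \<alpha> \<beta> x))" using \<theta>(2)[OF l False x] by (simp add: c_def)
      finally have "s \<alpha> x = s \<beta> (f \<alpha> \<beta> x)" unfolding s_def using cl tdK[OF l x] by (intro \<rho>eq) simp_all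
      then show ?thesis by simp
    qed
    \<comment> \<open>the compatible maps on \<open>W\<close> extend to all of \<open>I\<close> through any larger index in \<open>W\<close>\<close>
    obtain w where w: "\<And>i. i \<in> I \<Longrightarrow> w i \<in> W \<and> (i, w i) \<in> r" using W(3) by metis
    define \<psi> where "\<psi> i = restrict (\<lambda>x. s (w i) (f i (w i) x)) (carrier (P i))" for i
    have Pm: "left_module R (P i)" if "i \<in> I" for i using P[OF that] by (simp add: projective_modules_def modules_def)
    have \<psi>s: "\<psi> i x = s v (f i v x)" if i: "i \<in> I" and v: "v \<in> W" "(i, v) \<in> r" and x: "x \<in> carrier (P i)" for i v x
    proof -
      note wi = w[OF i]
      consider "(w i, v) \<in> Restr r W" | "(v, w i) \<in> Restr r W" using C.le_total[of "w i" v] wi v by blast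
      then show ?thesis
      proof cases
        case 1
        then show ?thesis using sf[OF 1 linear_closed[OF fl x]] fcomp[of i "w i" v x] wi x by (simp add: \<psi>_def)
      next
        case 2
        then show ?thesis using sf[OF 2 linear_closed[OF fl x]] fcomp[of i v "w i" x] v x by (simp add: \<psi>_def)
      qed
    qed
    have "cocone R I r P f X \<psi>"
      unfolding cocone_def
    proof (intro conjI ballI)
      fix i assume i: "i \<in> I"
      show "\<psi> i \<in> module_hom R (P i) X"
        unfolding \<psi>_def using w[OF i] by (intro linear_module_hom Pm i linear_comp[OF fl sl]) auto
    next
      fix ij assume "ij \<in> r"
      moreover obtain i j where "ij = (i, j)" by (cases ij)
      ultimately have ij: "ij = (i, j)" "(i, j) \<in> r" by auto
      then have I: "i \<in> I" "j \<in> I" using rI by auto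
      have "\<psi> j (f i j x) = \<psi> i x" if x: "x \<in> carrier (P i)" for x
        using \<psi>s[OF I(1) _ rtrans[OF ij(2)] x, of "w j"] w[OF I(2)] linear_closed[OF fl[OF ij(2)] x] fcomp[OF ij(2) _ x, of "w j"]
        by (simp add: \<psi>_def)
      then show "case ij of (i, j) \<Rightarrow> \<forall>x\<in>carrier (P i). \<psi> j (f i j x) = \<psi> i x" using ij by simp
    qed
    then obtain u where u: "u \<in> module_hom R L X" "\<And>i x. i \<in> I \<Longrightarrow> x \<in> carrier (P i) \<Longrightarrow> u (\<phi> i x) = \<psi> i x"
      using univ[OF X(1)] by blast
    note ul = module_hom_linear[OF u(1)]
    have pl: "linear_map R ?FY L (\<lambda>x. \<pi> (fst x))"
      by (rule linear_comp[OF _ \<pi>]) (auto simp: linear_map_def FYs)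
    obtain p where p: "linear_map R X L p" "\<And>x. x \<in> carrier ?FY \<Longrightarrow> p (\<rho> x) = \<pi> (fst x)"
      by (rule linear_factor[OF FY Xm Lm X(2,3) pl])
        (use X(4) that in \<open>auto simp: N_def K_def lin_kernel_def\<close>)
    have pu: "p (u x) = x" if x: "x \<in> carrier L" for x
    proof -
      have "\<exists>!v. v \<in> module_hom R L L \<and> (\<forall>i\<in>I. \<forall>x\<in>carrier (P i). v (\<phi> i x) = \<phi> i x)" by (rule univ[OF LR \<phi>])
      moreover have "restrict (\<lambda>x. p (u x)) (carrier L) \<in> module_hom R L L"
        by (rule linear_module_hom[OF Lm linear_comp[OF ul p(1)]])
      moreover have "restrict (\<lambda>x. x) (carrier L) \<in> module_hom R L L"
        by (rule linear_module_hom[OF Lm linear_id])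
      moreover have "restrict (\<lambda>x. p (u x)) (carrier L) (\<phi> i x) = \<phi> i x" if i: "i \<in> I" and x: "x \<in> carrier (P i)" for i x
      proof -
        note wi = w[OF i]
        have fx: "f i (w i) x \<in> carrier (P (w i))" using linear_closed[OF fl x] wi by blast
        have wW: "w i \<in> W" using wi by blast
        have "p (s (w i) (f i (w i) x)) = \<pi> (t (w i) (f i (w i) x))"
          unfolding s_def using linear_closed[OF t(1)[OF wW] fx] linear_closed[OF \<theta>(1)[OF wW] fx]
          by (subst p(2)) (simp_all add: FYs)
        then show ?thesis
          using u(2)[OF i x] linear_closed[OF \<phi>l[OF i] x] t(2)[OF wW fx] \<phi>f[of i "w i" x] wi x by (simp add: \<psi>_def)
      qed
      moreover have "restrict (\<lambda>x. x) (carrier L) (\<phi> i x) = \<phi> i x" if "i \<in> I" "x \<in> carrier (P i)" for i x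
        using linear_closed[OF \<phi>l] that by simp
      ultimately have "restrict (\<lambda>x. p (u x)) (carrier L) = restrict (\<lambda>x. x) (carrier L)" by blast
      from fun_cong[OF this, of x] show ?thesis using x by simp
    qed
    define j where "j = (\<lambda>y. \<rho> (\<zero>\<^bsub>F\<^esub>, y))"
    have jl: "linear_map R Y X j"
    proof -
      have "linear_map R Y ?FY (\<lambda>y. (\<zero>\<^bsub>F\<^esub>, y))" by (auto simp: linear_map_def FYs)
      from linear_comp[OF this \<rho>] show ?thesis by (simp add: j_def)
    qed
    have jinj: "inj_on j (carrier Y)"
    proof (rule inj_onI)
      fix y y' assume y: "y \<in> carrier Y" "y' \<in> carrier Y" and "j y = j y'"
      then have "j (y \<ominus>\<^bsub>Y\<^esub> y') = \<zero>\<^bsub>X\<^esub>" using linear_closed[OF jl] by (simp add: linear_diff[OF C.Ym Xm jl])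
      then have "(\<zero>\<^bsub>F\<^esub>, y \<ominus>\<^bsub>Y\<^esub> y') \<in> N" using y X(4) by (simp add: j_def FYs)
      then have "y \<ominus>\<^bsub>Y\<^esub> y' = \<zero>\<^bsub>Y\<^esub>" using g0 by (auto simp: N_def)
      then show "y = y'" using y by (simp add: C.Y.minus_eq_zero_iff)
    qed
    have il: "linear_map R F X (\<lambda>z. \<rho> (z, \<zero>\<^bsub>Y\<^esub>) \<ominus>\<^bsub>X\<^esub> u (\<pi> z))"
    proof (rule linear_minus[OF Xm _ linear_comp[OF \<pi> ul]])
      have "linear_map R F ?FY (\<lambda>z. (z, \<zero>\<^bsub>Y\<^esub>))" by (auto simp: linear_map_def FYs)
      from linear_comp[OF this \<rho>] show "linear_map R F X (\<lambda>z. \<rho> (z, \<zero>\<^bsub>Y\<^esub>))" .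
    qed
    have rng: "\<rho> (z, \<zero>\<^bsub>Y\<^esub>) \<ominus>\<^bsub>X\<^esub> u (\<pi> z) \<in> j ` carrier Y" if z: "z \<in> carrier F" for z
    proof -
      have "u (\<pi> z) \<in> \<rho> ` carrier ?FY" using linear_closed[OF ul linear_closed[OF \<pi> z]] X(3) by simp
      then obtain z' y where zy: "z' \<in> carrier F" "y \<in> carrier Y" "u (\<pi> z) = \<rho> (z', y)" by (auto simp: FYs)
      have "\<pi> z' = \<pi> z" using pu[OF linear_closed[OF \<pi> z]] p(2)[of "(z', y)"] zy by (simp add: FYs)
      then have k: "z \<ominus>\<^bsub>F\<^esub> z' \<in> K" using z zy linear_closed[OF \<pi>] by (simp add: K_def lin_kernel_def linear_diff[OF F Lm \<pi>])
      have "\<rho> (z, \<zero>\<^bsub>Y\<^esub>) \<ominus>\<^bsub>X\<^esub> u (\<pi> z) = \<rho> (z \<ominus>\<^bsub>F\<^esub> z', \<zero>\<^bsub>Y\<^esub> \<ominus>\<^bsub>Y\<^esub> y)"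
        using z zy linear_diff[OF FY Xm \<rho>, of "(z, \<zero>\<^bsub>Y\<^esub>)" "(z', y)"] by (simp add: FYs FYminus)
      also have "\<dots> = j (g (z \<ominus>\<^bsub>F\<^esub> z') \<ominus>\<^bsub>Y\<^esub> y)"
        unfolding j_def
      proof (rule \<rho>eq)
        show "\<zero>\<^bsub>Y\<^esub> \<ominus>\<^bsub>Y\<^esub> y \<ominus>\<^bsub>Y\<^esub> (g (z \<ominus>\<^bsub>F\<^esub> z') \<ominus>\<^bsub>Y\<^esub> y) = \<ominus>\<^bsub>Y\<^esub> g (z \<ominus>\<^bsub>F\<^esub> z' \<ominus>\<^bsub>F\<^esub> \<zero>\<^bsub>F\<^esub>)"
          using z zy gcl[OF k] C.Y.minus_minus_cancel[of "\<zero>\<^bsub>Y\<^esub>" "g (z \<ominus>\<^bsub>F\<^esub> z')" y] by (simp add: a_minus_def[of Y "\<zero>\<^bsub>Y\<^esub>" "g _"])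
      qed (use z zy k gcl[OF k] in auto)
      finally show ?thesis using gcl[OF k] zy(2) by auto
    qed
    obtain G where G: "linear_map R F Y G" "\<And>z. z \<in> carrier F \<Longrightarrow> j (G z) = \<rho> (z, \<zero>\<^bsub>Y\<^esub>) \<ominus>\<^bsub>X\<^esub> u (\<pi> z)"
      by (rule linear_lift_inj[OF F C.Ym Xm jl jinj il rng]) (assumption, rule that)
    have "G k = g k" if k: "k \<in> K" for k
    proof (rule inj_onD[OF jinj])
      have kF: "k \<in> carrier F" "\<pi> k = \<zero>\<^bsub>L\<^esub>" using k by (auto simp: K_def lin_kernel_def)
      have "j (G k) = \<rho> (k, \<zero>\<^bsub>Y\<^esub>)"
        using G(2)[OF kF(1)] kF linear_zero[OF Lm Xm ul] linear_closed[OF \<rho>, of "(k, \<zero>\<^bsub>Y\<^esub>)"] by (simp add: FYs)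
      also have "\<dots> = j (g k)"
        unfolding j_def using k kF gcl[OF k] by (intro \<rho>eq) (simp_all add: a_minus_def[of Y])
      finally show "j (G k) = j (g k)" .
      show "G k \<in> carrier Y" "g k \<in> carrier Y" using linear_closed[OF G(1) kF(1)] gcl[OF k] by auto
    qed
    then show "\<exists>h. linear_map R F Y h \<and> (\<forall>k\<in>K. h k = g k)" using G(1) by blast
  qed
qed

section \<open>Filtrations\<close>

lemma quotient_module_map:
  assumes M: "left_module R M" and H: "submodule H R M" and X: "left_module R X"
    and iso: "module_isomorphic R (quotient_module M H) X"
  obtains p where "linear_map R M X p" "p ` carrier M = carrier X" "lin_kernel M X p = H"
proof -
  interpret M: left_module R M by fact
  interpret H: submodule H R M by fact
  note Hd = M.submoduleD[OF H]
  interpret A: abelian_subgroup H M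
    by (rule abelian_subgroupI3[OF additive_subgroup.intro[OF H.subgroup_axioms] M.M.abelian_group_axioms])
  let ?Q = "quotient_module M H"
  define q where "q x = H +>\<^bsub>M\<^esub> x" for x
  have Q: "carrier ?Q = a_rcosets\<^bsub>M\<^esub> H" "\<And>U V. U \<oplus>\<^bsub>?Q\<^esub> V = U <+>\<^bsub>M\<^esub> V"
    "\<And>r U. r \<odot>\<^bsub>?Q\<^esub> U = (\<Union>u\<in>U. H +>\<^bsub>M\<^esub> (r \<odot>\<^bsub>M\<^esub> u))"
    by (simp_all add: quotient_module_def)
  have Qc: "carrier ?Q = q ` carrier M" by (auto simp: Q A_RCOSETS_def' q_def)
  have smult: "r \<odot>\<^bsub>?Q\<^esub> q x = q (r \<odot>\<^bsub>M\<^esub> x)" if r: "r \<in> carrier R" and x: "x \<in> carrier M" for r x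
  proof -
    have "H +>\<^bsub>M\<^esub> (r \<odot>\<^bsub>M\<^esub> u) = H +>\<^bsub>M\<^esub> (r \<odot>\<^bsub>M\<^esub> x)" if u: "u \<in> H +>\<^bsub>M\<^esub> x" for u
    proof -
      obtain h where h: "h \<in> H" "u = h \<oplus>\<^bsub>M\<^esub> x" using u by (auto simp: a_r_coset_def')
      then have "r \<odot>\<^bsub>M\<^esub> u = r \<odot>\<^bsub>M\<^esub> h \<oplus>\<^bsub>M\<^esub> r \<odot>\<^bsub>M\<^esub> x" using r x Hd(1) by (auto simp: M.smult_r_distr)
      then have "r \<odot>\<^bsub>M\<^esub> u \<in> H +>\<^bsub>M\<^esub> (r \<odot>\<^bsub>M\<^esub> x)" using Hd(4)[OF r h(1)] by (auto simp: a_r_coset_def')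
      then show ?thesis using A.a_repr_independence' M.smult_closed[OF r x] by blast
    qed
    moreover have "x \<in> H +>\<^bsub>M\<^esub> x" by (rule A.a_rcos_self[OF x])
    ultimately show ?thesis unfolding Q(3) q_def by blast
  qed
  obtain f where f: "f \<in> module_hom R ?Q X" "bij_betw f (carrier ?Q) (carrier X)"
    using iso by (auto simp: module_isomorphic_def)
  note fl = module_hom_linear[OF f(1)]
  have q: "linear_map R M ?Q q"
  proof (rule linear_mapI)
    show "q x \<in> carrier ?Q" if "x \<in> carrier M" for x using that by (simp add: Qc)
    show "q (x \<oplus>\<^bsub>M\<^esub> y) = q x \<oplus>\<^bsub>?Q\<^esub> q y" if "x \<in> carrier M" "y \<in> carrier M" for x y
      using A.a_rcos_sum[OF that] by (simp add: Q(2) q_def)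
    show "q (r \<odot>\<^bsub>M\<^esub> x) = r \<odot>\<^bsub>?Q\<^esub> q x" if "r \<in> carrier R" "x \<in> carrier M" for r x
      using smult that by simp
  qed
  have fq: "linear_map R M X (\<lambda>x. f (q x))" by (rule linear_comp[OF q fl])
  have qH: "q x = H \<longleftrightarrow> x \<in> H" if x: "x \<in> carrier M" for x
    using A.a_rcos_const[of x] A.a_rcos_self[OF x] by (auto simp: q_def)
  have f0: "f H = \<zero>\<^bsub>X\<^esub>" using linear_zero[OF M X fq] qH[of "\<zero>\<^bsub>M\<^esub>"] Hd(2) by simp
  have Hq: "H \<in> carrier ?Q" unfolding Qc using qH[of "\<zero>\<^bsub>M\<^esub>"] Hd(2) by (metis M.M.zero_closed imageI)
  show thesis
  proof (rule that[OF fq])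
    show "(\<lambda>x. f (q x)) ` carrier M = carrier X"
      using f(2) by (auto simp: bij_betw_def Qc image_image)
    show "lin_kernel M X (\<lambda>x. f (q x)) = H"
    proof safe
      fix x assume "x \<in> lin_kernel M X (\<lambda>x. f (q x))"
      then have x: "x \<in> carrier M" "f (q x) = f H" by (auto simp: lin_kernel_def f0)
      then have "q x = H" using f(2) Hq Qc by (metis bij_betw_def imageI inj_onD)
      then show "x \<in> H" using qH x by blast
    next
      fix x assume x: "x \<in> H"
      then have "q x = H" using qH Hd(1) by blast
      then show "x \<in> lin_kernel M X (\<lambda>x. f (q x))" using x Hd(1) f0 by (auto simp: lin_kernel_def)
    qed
  qed
qed

lemma linear_glue:
  assumes F: "left_module R F" and G: "\<And>i. i \<in> J \<Longrightarrow> submodule (G i) R F"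
    and h: "\<And>i. i \<in> J \<Longrightarrow> linear_map R (F\<lparr>carrier := G i\<rparr>) Y (h i)"
    and dir: "\<And>i j. i \<in> J \<Longrightarrow> j \<in> J \<Longrightarrow> \<exists>k\<in>J. G i \<subseteq> G k \<and> G j \<subseteq> G k \<and> (\<forall>z\<in>G i. h k z = h i z) \<and> (\<forall>z\<in>G j. h k z = h j z)"
  shows "\<exists>f. linear_map R (F\<lparr>carrier := (\<Union>i\<in>J. G i)\<rparr>) Y f \<and> (\<forall>i\<in>J. \<forall>z\<in>G i. f z = h i z)"
proof -
  interpret F: left_module R F by fact
  define c where "c z = (SOME i. i \<in> J \<and> z \<in> G i)" for z
  have c: "c z \<in> J \<and> z \<in> G (c z)" if "i \<in> J" "z \<in> G i" for z i
    unfolding c_def by (rule someI[of _ i]) (use that in auto)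
  have eq: "h (c z) z = h i z" if "i \<in> J" "z \<in> G i" for z i
    using dir[of "c z" i] c[OF that] that by metis
  have "linear_map R (F\<lparr>carrier := (\<Union>i\<in>J. G i)\<rparr>) Y (\<lambda>z. h (c z) z)"
  proof (rule linear_mapI)
    fix x assume "x \<in> carrier (F\<lparr>carrier := (\<Union>i\<in>J. G i)\<rparr>)"
    then obtain i where i: "i \<in> J" "x \<in> G i" by auto
    show "h (c x) x \<in> carrier Y" unfolding eq[OF i] using linear_closed[OF h[OF i(1)]] i(2) by simp
    show "h (c (r \<odot>\<^bsub>F\<lparr>carrier := (\<Union>i\<in>J. G i)\<rparr>\<^esub> x)) (r \<odot>\<^bsub>F\<lparr>carrier := (\<Union>i\<in>J. G i)\<rparr>\<^esub> x) = r \<odot>\<^bsub>Y\<^esub> h (c x) x"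
      if r: "r \<in> carrier R" for r
      using eq[OF i] eq[OF i(1) F.submoduleD(4)[OF G[OF i(1)] r i(2)]] linear_smult[OF h[OF i(1)] r] i(2) by simp
    fix y assume "y \<in> carrier (F\<lparr>carrier := (\<Union>i\<in>J. G i)\<rparr>)"
    then obtain j where j: "j \<in> J" "y \<in> G j" by auto
    obtain k where k: "k \<in> J" "x \<in> G k" "y \<in> G k" using dir[OF i(1) j(1)] i j by blast
    show "h (c (x \<oplus>\<^bsub>F\<lparr>carrier := (\<Union>i\<in>J. G i)\<rparr>\<^esub> y)) (x \<oplus>\<^bsub>F\<lparr>carrier := (\<Union>i\<in>J. G i)\<rparr>\<^esub> y) = h (c x) x \<oplus>\<^bsub>Y\<^esub> h (c y) y"
      using eq[OF k(1,2)] eq[OF k(1,3)] eq[OF k(1) F.submoduleD(3)[OF G[OF k(1)] k(2,3)]] linear_add[OF h[OF k(1)]] k by simp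
  qed
  then show ?thesis using eq by blast
qed

text \<open>
  Eklof's lemma, in the form of a transfinite extension: the preimages \<open>G \<alpha>\<close> of the members of the
  filtration in the free cover start with the kernel, and a map on \<open>G \<alpha>\<close> extends to the next one because
  their quotient is in \<open>\<S>\<close>. At limits the maps are glued.
\<close>

lemma filtered_Ext_trivial:
  fixes R :: "'r ring" and N :: "('r, 'u) module" and Y :: "('r, 'n) module"
  assumes N: "left_module R N" and Y: "left_module R Y" and fil: "filtered_by R \<S> N"
    and S: "\<And>X. X \<in> \<S> \<Longrightarrow> left_module R X \<and> trivial_group (Ext1 R X Y)"
  shows "trivial_group (Ext1 R N Y)"
proof -
  interpret N: left_module R N by fact
  interpret Y: left_module R Y by fact
  obtain r :: "'u rel" and C where fc: "Well_order r \<and> small (Field r) \<and> Field r \<noteq> {} \<and>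
      (\<forall>\<alpha>\<in>Field r. submodule (C \<alpha>) R N) \<and>
      (\<forall>(\<alpha>, \<beta>)\<in>r. C \<alpha> \<subseteq> C \<beta>) \<and>
      (\<forall>\<alpha>\<in>Field r. underS r \<alpha> = {} \<longrightarrow> C \<alpha> = {\<zero>\<^bsub>N\<^esub>}) \<and>
      (\<forall>\<alpha>. limit_element r \<alpha> \<longrightarrow> C \<alpha> = (\<Union>\<beta>\<in>underS r \<alpha>. C \<beta>)) \<and>
      carrier N = (\<Union>\<alpha>\<in>Field r. C \<alpha>) \<and>
      (\<forall>\<alpha> \<beta>. immediate_succ r \<alpha> \<beta> \<longrightarrow>
         (\<exists>X\<in>\<S>. module_isomorphic R (quotient_module (N\<lparr>carrier := C \<beta>\<rparr>) (C \<alpha>)) X))"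
    using fil unfolding filtered_by_def by (elim exE) (rule that)
  then have wo: "Well_order r" and ne: "Field r \<noteq> {}"
    and 1: "\<forall>\<alpha>\<in>Field r. submodule (C \<alpha>) R N" and 2: "\<forall>(\<alpha>, \<beta>)\<in>r. C \<alpha> \<subseteq> C \<beta>"
    and 3: "\<forall>\<alpha>\<in>Field r. underS r \<alpha> = {} \<longrightarrow> C \<alpha> = {\<zero>\<^bsub>N\<^esub>}"
    and 4: "\<forall>\<alpha>. limit_element r \<alpha> \<longrightarrow> C \<alpha> = (\<Union>\<beta>\<in>underS r \<alpha>. C \<beta>)"
    and Cun: "carrier N = (\<Union>\<alpha>\<in>Field r. C \<alpha>)"
    and 5: "\<forall>\<alpha> \<beta>. immediate_succ r \<alpha> \<beta> \<longrightarrow>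
       (\<exists>X\<in>\<S>. module_isomorphic R (quotient_module (N\<lparr>carrier := C \<beta>\<rparr>) (C \<alpha>)) X)"
    by - (elim conjE, assumption)+
  have Csub: "\<And>\<alpha>. \<alpha> \<in> Field r \<Longrightarrow> submodule (C \<alpha>) R N" using 1 by blast
  have Cmono: "\<And>\<alpha> \<beta>. (\<alpha>, \<beta>) \<in> r \<Longrightarrow> C \<alpha> \<subseteq> C \<beta>" using 2 by blast
  have C0: "\<And>\<alpha>. \<alpha> \<in> Field r \<Longrightarrow> underS r \<alpha> = {} \<Longrightarrow> C \<alpha> = {\<zero>\<^bsub>N\<^esub>}" using 3 by blast
  have Clim: "\<And>\<alpha>. limit_element r \<alpha> \<Longrightarrow> C \<alpha> = (\<Union>\<beta>\<in>underS r \<alpha>. C \<beta>)" using 4 by blast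
  have Csucc: "\<And>\<alpha> \<beta>. immediate_succ r \<alpha> \<beta> \<Longrightarrow>
       \<exists>X\<in>\<S>. module_isomorphic R (quotient_module (N\<lparr>carrier := C \<beta>\<rparr>) (C \<alpha>)) X" using 5 by blast
  define F where "F = free_module R (carrier N)"
  define \<pi> where "\<pi> = free_cover R N (carrier N)"
  define K where "K = lin_kernel F N \<pi>"
  have F: "left_module R F" unfolding F_def by (rule free_module_left_module[OF N.R.ring_axioms])
  interpret F: left_module R F by fact
  have \<pi>: "linear_map R F N \<pi>" unfolding \<pi>_def F_def by (rule free_cover_linear[OF N]) simp
  have \<pi>_onto: "\<exists>a\<in>carrier F. \<pi> a = x" if "x \<in> carrier N" for x
    by (rule free_cover_onto[OF N that]) (auto simp: F_def \<pi>_def)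
  define G where "G \<alpha> = {z \<in> carrier F. \<pi> z \<in> C \<alpha>}" for \<alpha>
  have Gsub: "submodule (G \<alpha>) R F" if "\<alpha> \<in> Field r" for \<alpha>
    unfolding G_def by (rule submodule_vimage[OF F N \<pi> Csub[OF that]])
  have Gmono: "G \<alpha> \<subseteq> G \<beta>" if "(\<alpha>, \<beta>) \<in> r" for \<alpha> \<beta> using Cmono[OF that] by (auto simp: G_def)
  have KG: "K \<subseteq> G \<alpha>" if "\<alpha> \<in> Field r" for \<alpha>
    using N.submoduleD(2)[OF Csub[OF that]] by (auto simp: K_def lin_kernel_def G_def)
  have rF: "(\<alpha>, \<beta>) \<in> r \<Longrightarrow> \<alpha> \<in> Field r \<and> \<beta> \<in> Field r" for \<alpha> \<beta> by (auto simp: Field_def)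
  have total: "(\<alpha>, \<beta>) \<in> r \<or> (\<beta>, \<alpha>) \<in> r" if "\<alpha> \<in> Field r" "\<beta> \<in> Field r" for \<alpha> \<beta>
    using wo that by (cases "\<alpha> = \<beta>") (auto simp: order_on_defs well_order_on_def total_on_def refl_on_def)
  have antisym: "\<alpha> = \<beta>" if "(\<alpha>, \<beta>) \<in> r" "(\<beta>, \<alpha>) \<in> r" for \<alpha> \<beta>
    using wo that by (auto simp: order_on_defs well_order_on_def dest: antisymD)
  have wfr: "wf (r - Id)" using wo by (simp add: well_order_on_def)
  have US: "underS r \<alpha> = {\<beta>. (\<beta>, \<alpha>) \<in> r - Id}" for \<alpha> by (auto simp: underS_def)
  show ?thesis
    unfolding Ext1_trivial_iff[OF N Y]
  proof (fold F_def \<pi>_def, fold K_def, intro allI impI)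
    fix g assume g: "linear_map R (F\<lparr>carrier := K\<rparr>) Y g"
    define good where "good f \<alpha> h \<longleftrightarrow> (\<alpha> \<in> Field r \<longrightarrow>
      linear_map R (F\<lparr>carrier := G \<alpha>\<rparr>) Y h \<and> (\<forall>k\<in>K. h k = g k) \<and> (\<forall>\<beta>\<in>underS r \<alpha>. \<forall>z\<in>G \<beta>. h z = f \<beta> z))"
      for f :: "'u \<Rightarrow> ('u \<Rightarrow> 'r) \<Rightarrow> 'n" and \<alpha> h
    have "\<exists>f. \<forall>\<alpha>. good f \<alpha> (f \<alpha>)"
    proof (rule dependent_wf_choice[OF wfr])
      fix f f' :: "'u \<Rightarrow> ('u \<Rightarrow> 'r) \<Rightarrow> 'n" and \<alpha> h
      assume "\<And>\<beta>. (\<beta>, \<alpha>) \<in> r - Id \<Longrightarrow> f \<beta> = f' \<beta>"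
      then show "good f \<alpha> h = good f' \<alpha> h" by (simp add: good_def US)
    next
      fix \<alpha> and f :: "'u \<Rightarrow> ('u \<Rightarrow> 'r) \<Rightarrow> 'n"
      assume IH: "\<And>\<beta>. (\<beta>, \<alpha>) \<in> r - Id \<Longrightarrow> good f \<beta> (f \<beta>)"
      have lin: "linear_map R (F\<lparr>carrier := G \<beta>\<rparr>) Y (f \<beta>)" and ext: "\<And>k. k \<in> K \<Longrightarrow> f \<beta> k = g k"
        and coh: "\<And>\<gamma> z. \<gamma> \<in> underS r \<beta> \<Longrightarrow> z \<in> G \<gamma> \<Longrightarrow> f \<beta> z = f \<gamma> z"
        if "\<beta> \<in> underS r \<alpha>" for \<beta>
        using IH[of \<beta>] that rF by (auto simp: good_def US)
      show "\<exists>h. good f \<alpha> h"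
      proof (cases "\<alpha> \<in> Field r")
        case False
        then show ?thesis by (simp add: good_def)
      next
        case \<alpha>: True
        consider "underS r \<alpha> = {}" | "limit_element r \<alpha>" | \<beta> where "immediate_succ r \<beta> \<alpha>"
          using \<alpha> by (auto simp: limit_element_def)
        then show ?thesis
        proof cases
          case 1
          then have "G \<alpha> = K" using C0[OF \<alpha> 1] by (simp add: G_def K_def lin_kernel_def)
          then show ?thesis using g 1 by (auto simp: good_def)
        next
          case 2
          have lt: "\<beta> \<in> Field r" if "\<beta> \<in> underS r \<alpha>" for \<beta> using that rF by (auto simp: US)
          have "G \<alpha> = (\<Union>\<beta>\<in>underS r \<alpha>. G \<beta>)" using Clim[OF 2] by (auto simp: G_def)
          moreover have "\<exists>h. linear_map R (F\<lparr>carrier := (\<Union>\<beta>\<in>underS r \<alpha>. G \<beta>)\<rparr>) Y h \<and> (\<forall>\<beta>\<in>underS r \<alpha>. \<forall>z\<in>G \<beta>. h z = f \<beta> z)"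
          proof (rule linear_glue[OF F])
            fix i j assume i: "i \<in> underS r \<alpha>" and j: "j \<in> underS r \<alpha>"
            have up: "G i \<subseteq> G j \<and> (\<forall>z\<in>G i. f j z = f i z)" if "(i, j) \<in> r" "j \<in> underS r \<alpha>" for i j
              using Gmono[OF that(1)] coh[OF that(2), of i] that(1) by (cases "i = j") (auto simp: US)
            show "\<exists>k\<in>underS r \<alpha>. G i \<subseteq> G k \<and> G j \<subseteq> G k \<and> (\<forall>z\<in>G i. f k z = f i z) \<and> (\<forall>z\<in>G j. f k z = f j z)"
              using total[OF lt[OF i] lt[OF j]]
            proof
              assume "(i, j) \<in> r"
              then show ?thesis using up[OF _ j] j by blast
            next
              assume "(j, i) \<in> r"
              then show ?thesis using up[OF _ i] i by blast
            qed
          qed (use Gsub lt lin in auto)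
          ultimately obtain h where h: "linear_map R (F\<lparr>carrier := G \<alpha>\<rparr>) Y h" "\<And>\<beta> z. \<beta> \<in> underS r \<alpha> \<Longrightarrow> z \<in> G \<beta> \<Longrightarrow> h z = f \<beta> z"
            by auto
          obtain \<beta> where \<beta>: "\<beta> \<in> underS r \<alpha>" using 2 by (auto simp: limit_element_def)
          have "h k = g k" if "k \<in> K" for k using h(2)[OF \<beta>] KG[OF lt[OF \<beta>]] ext[OF \<beta> that] that by auto
          then show ?thesis using h by (auto simp: good_def)
        next
          case 3
          have \<beta>: "\<beta> \<in> underS r \<alpha>" and imm: "\<And>\<gamma>. \<beta> \<in> underS r \<gamma> \<Longrightarrow> (\<alpha>, \<gamma>) \<in> r"
            using 3 by (auto simp: immediate_succ_def)
          have \<beta>F: "\<beta> \<in> Field r" and \<beta>\<alpha>: "(\<beta>, \<alpha>) \<in> r" using \<beta> rF by (auto simp: US)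
          obtain X where X: "X \<in> \<S>" "module_isomorphic R (quotient_module (N\<lparr>carrier := C \<alpha>\<rparr>) (C \<beta>)) X"
            using Csucc[OF 3] by blast
          have Xm: "left_module R X" and triv: "trivial_group (Ext1 R X Y)" using S[OF X(1)] by auto
          have Cm: "left_module R (N\<lparr>carrier := C \<alpha>\<rparr>)" by (rule N.submodule_left_module[OF Csub[OF \<alpha>]])
          have Cs: "submodule (C \<beta>) R (N\<lparr>carrier := C \<alpha>\<rparr>)"
            by (rule left_module.submoduleI[OF Cm]) (use N.submoduleD[OF Csub[OF \<beta>F]] Cmono[OF \<beta>\<alpha>] in auto)
          obtain p where p: "linear_map R (N\<lparr>carrier := C \<alpha>\<rparr>) X p" "p ` carrier (N\<lparr>carrier := C \<alpha>\<rparr>) = carrier X"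
            "lin_kernel (N\<lparr>carrier := C \<alpha>\<rparr>) X p = C \<beta>"
            by (rule quotient_module_map[OF Cm Cs Xm X(2)]) (rule that)
          let ?E = "F\<lparr>carrier := G \<alpha>\<rparr>"
          have E: "left_module R ?E" by (rule F.submodule_left_module[OF Gsub[OF \<alpha>]])
          have p\<pi>: "linear_map R ?E X (\<lambda>z. p (\<pi> z))"
            by (rule linear_comp[OF _ p(1)]) (use \<pi> in \<open>auto simp: linear_map_def G_def\<close>)
          have onto: "(\<lambda>z. p (\<pi> z)) ` carrier ?E = carrier X"
          proof -
            have "\<pi> ` G \<alpha> = C \<alpha>"
              using \<pi>_onto N.submoduleD(1)[OF Csub[OF \<alpha>]] by (force simp: G_def)
            then show ?thesis using p(2) image_image[of p \<pi> "G \<alpha>"] by simp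
          qed
          have ker: "lin_kernel ?E X (\<lambda>z. p (\<pi> z)) = G \<beta>"
          proof -
            have "p x = \<zero>\<^bsub>X\<^esub> \<longleftrightarrow> x \<in> C \<beta>" if "x \<in> C \<alpha>" for x using p(3) that by (auto simp: lin_kernel_def)
            then show ?thesis using Cmono[OF \<beta>\<alpha>] by (auto simp: lin_kernel_def G_def)
          qed
          have fb: "linear_map R (?E\<lparr>carrier := lin_kernel ?E X (\<lambda>z. p (\<pi> z))\<rparr>) Y (f \<beta>)"
            unfolding ker using lin[OF \<beta>] by simp
          obtain h where h: "linear_map R ?E Y h" "\<And>k. k \<in> lin_kernel ?E X (\<lambda>z. p (\<pi> z)) \<Longrightarrow> h k = f \<beta> k"
            by (rule Ext1_trivial_extend[OF Xm Y E triv p\<pi> onto fb]) (rule that)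
          have hb: "h z = f \<beta> z" if "z \<in> G \<beta>" for z using h(2) that by (simp add: ker)
          have "h z = f \<gamma> z" if \<gamma>: "\<gamma> \<in> underS r \<alpha>" and z: "z \<in> G \<gamma>" for \<gamma> z
          proof (cases "\<gamma> = \<beta>")
            case True
            then show ?thesis using hb z by simp
          next
            case False
            have "\<gamma> \<in> Field r" using \<gamma> rF by (auto simp: US)
            have "(\<beta>, \<gamma>) \<notin> r"
            proof
              assume "(\<beta>, \<gamma>) \<in> r"
              then have "(\<alpha>, \<gamma>) \<in> r" using imm[of \<gamma>] False by (auto simp: US)
              then show False using \<gamma> antisym by (auto simp: US)
            qed
            then have l: "(\<gamma>, \<beta>) \<in> r" using total[OF \<beta>F \<open>\<gamma> \<in> Field r\<close>] by blast
            then have "\<gamma> \<in> underS r \<beta>" using False by (simp add: US)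
            then show ?thesis using coh[OF \<beta> _ z] hb Gmono[OF l] z by auto
          qed
          moreover have "h k = g k" if "k \<in> K" for k using hb[of k] KG[OF \<beta>F] ext[OF \<beta> that] that by auto
          ultimately show ?thesis using h(1) by (auto simp: good_def)
        qed
      qed
    qed
    then obtain f where f: "\<And>\<alpha>. \<alpha> \<in> Field r \<Longrightarrow> good f \<alpha> (f \<alpha>)" by blast
    have lin: "linear_map R (F\<lparr>carrier := G \<beta>\<rparr>) Y (f \<beta>)" and ext: "\<And>k. k \<in> K \<Longrightarrow> f \<beta> k = g k"
      and coh: "\<And>\<gamma> z. \<gamma> \<in> underS r \<beta> \<Longrightarrow> z \<in> G \<gamma> \<Longrightarrow> f \<beta> z = f \<gamma> z"
      if "\<beta> \<in> Field r" for \<beta>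
      using f[OF that] that by (auto simp: good_def)
    have "\<exists>h. linear_map R (F\<lparr>carrier := (\<Union>\<beta>\<in>Field r. G \<beta>)\<rparr>) Y h \<and> (\<forall>\<beta>\<in>Field r. \<forall>z\<in>G \<beta>. h z = f \<beta> z)"
    proof (rule linear_glue[OF F])
      fix i j assume i: "i \<in> Field r" and j: "j \<in> Field r"
      have up: "G i \<subseteq> G j \<and> (\<forall>z\<in>G i. f j z = f i z)" if "(i, j) \<in> r" for i j
        using Gmono[OF that] coh[of j i] rF[OF that] that by (cases "i = j") (auto simp: US)
      show "\<exists>k\<in>Field r. G i \<subseteq> G k \<and> G j \<subseteq> G k \<and> (\<forall>z\<in>G i. f k z = f i z) \<and> (\<forall>z\<in>G j. f k z = f j z)"
        using total[OF i j]
      proof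
        assume "(i, j) \<in> r"
        then show ?thesis using up j by blast
      next
        assume "(j, i) \<in> r"
        then show ?thesis using up i by blast
      qed
    qed (use Gsub lin in auto)
    moreover have "(\<Union>\<beta>\<in>Field r. G \<beta>) = carrier F" using linear_closed[OF \<pi>] Cun by (auto simp: G_def)
    ultimately obtain h where h: "linear_map R F Y h" "\<And>\<beta> z. \<beta> \<in> Field r \<Longrightarrow> z \<in> G \<beta> \<Longrightarrow> h z = f \<beta> z"
      by auto
    obtain \<beta> where \<beta>: "\<beta> \<in> Field r" using ne by blast
    have "h k = g k" if "k \<in> K" for k using h(2)[OF \<beta>] KG[OF \<beta>] ext[OF \<beta> that] that by auto
    then show "\<exists>h. linear_map R F Y h \<and> (\<forall>k\<in>K. h k = g k)" using h(1) by blast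
  qed
qed

section \<open>Characters of abelian groups\<close>

definition circle :: "complex monoid" where
  "circle = \<lparr>carrier = {z. cmod z = 1}, monoid.mult = (*), one = 1\<rparr>"

lemma circle_simps [simp]: "carrier circle = {z. cmod z = 1}" "x \<otimes>\<^bsub>circle\<^esub> y = x * y" "\<one>\<^bsub>circle\<^esub> = 1"
  by (simp_all add: circle_def)

lemma circle_comm_group: "comm_group circle"
proof (rule comm_groupI)
  fix x assume x: "x \<in> carrier circle"
  then have "x \<noteq> 0" by auto
  with x show "\<exists>y\<in>carrier circle. y \<otimes>\<^bsub>circle\<^esub> x = \<one>\<^bsub>circle\<^esub>"
    by (intro bexI[of _ "inverse x"]) (auto simp: norm_inverse)
qed (auto simp: norm_mult)

lemma circle_root:
  assumes "cmod v = 1" "n > 0"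
  obtains w where "cmod w = 1" "w ^ n = v"
proof -
  obtain t where "v = cis t" using assms(1) by (metis rcis_cmod_Arg rcis_def mult_1 of_real_1)
  then have "cis (t / real n) ^ n = v" using assms(2) by (simp add: DeMoivre)
  then show thesis using that[of "cis (t / real n)"] by simp
qed

lemma circle_root_of_unity:
  assumes "n > 1"
  obtains w where "cmod w = 1" "w ^ n = 1" "w \<noteq> 1"
proof -
  let ?w = "cis (2 * pi / real n)"
  have "?w ^ n = 1" using assms by (simp add: DeMoivre)
  moreover have "?w \<noteq> 1"
  proof
    assume "?w = 1"
    then have "cos (2 * pi / real n) = 1" by (simp add: complex_eq_iff)
    then obtain k :: int where "2 * pi / real n = of_int k * 2 * pi" using cos_one_2pi_int by auto
    then have "(2 * pi) * (1 / real n) = (2 * pi) * of_int k" by (simp add: mult_ac)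
    then have "1 / real n = of_int k" by (subst (asm) mult_cancel_left) simp
    then have "1 = of_int k * real n" using assms by (simp add: field_simps)
    then have "1 = k * int n" by (metis of_int_1 of_int_eq_iff of_int_mult of_int_of_nat_eq)
    then have "int n dvd 1" by (metis dvd_triv_right)
    then show False using assms by simp
  qed
  ultimately show thesis using that[of ?w] by simp
qed

text \<open>
  The graph of a character on some subgroup of \<open>G\<close>. Extending such a graph is a matter of inclusion, which
  suits Zorn's lemma. The last clause makes the relation single-valued.
\<close>

definition char_graph :: "('g, 'x) monoid_scheme \<Rightarrow> ('g \<times> complex) set \<Rightarrow> bool" where
  "char_graph G \<Gamma> \<longleftrightarrow> \<Gamma> \<subseteq> carrier G \<times> {z. cmod z = 1} \<and> (\<one>\<^bsub>G\<^esub>, 1) \<in> \<Gamma> \<and>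
     (\<forall>x v y w. (x, v) \<in> \<Gamma> \<longrightarrow> (y, w) \<in> \<Gamma> \<longrightarrow> (x \<otimes>\<^bsub>G\<^esub> inv\<^bsub>G\<^esub> y, v / w) \<in> \<Gamma>) \<and>
     (\<forall>v. (\<one>\<^bsub>G\<^esub>, v) \<in> \<Gamma> \<longrightarrow> v = 1)"

context comm_group
begin

lemma char_graphD:
  assumes "char_graph G \<Gamma>"
  shows "(x, v) \<in> \<Gamma> \<Longrightarrow> x \<in> carrier G \<and> cmod v = 1" "(\<one>, 1) \<in> \<Gamma>"
    and "(x, v) \<in> \<Gamma> \<Longrightarrow> (y, w) \<in> \<Gamma> \<Longrightarrow> (x \<otimes> inv y, v / w) \<in> \<Gamma>"
    and "(x, v) \<in> \<Gamma> \<Longrightarrow> (inv x, 1 / v) \<in> \<Gamma>"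
    and "(x, v) \<in> \<Gamma> \<Longrightarrow> (y, w) \<in> \<Gamma> \<Longrightarrow> (x \<otimes> y, v * w) \<in> \<Gamma>"
    and "(x, v) \<in> \<Gamma> \<Longrightarrow> (x, v') \<in> \<Gamma> \<Longrightarrow> v = v'"
    and "(x, v) \<in> \<Gamma> \<Longrightarrow> (x [^] (k :: int), v powi k) \<in> \<Gamma>"
proof -
  show c: "x \<in> carrier G \<and> cmod v = 1" if "(x, v) \<in> \<Gamma>" for x v using assms that by (auto simp: char_graph_def)
  show o: "(\<one>, 1) \<in> \<Gamma>" using assms by (simp add: char_graph_def)
  show d: "(x \<otimes> inv y, v / w) \<in> \<Gamma>" if "(x, v) \<in> \<Gamma>" "(y, w) \<in> \<Gamma>" for x v y w
    using assms that unfolding char_graph_def by blast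
  show i: "(inv x, 1 / v) \<in> \<Gamma>" if "(x, v) \<in> \<Gamma>" for x v using d[OF o that] c[OF that] by simp
  show m: "(x \<otimes> y, v * w) \<in> \<Gamma>" if "(x, v) \<in> \<Gamma>" "(y, w) \<in> \<Gamma>" for x v y w
    using d[OF that(1) i[OF that(2)]] c[OF that(2)] by simp
  show "v = v'" if "(x, v) \<in> \<Gamma>" "(x, v') \<in> \<Gamma>"
  proof -
    have "(\<one>, v / v') \<in> \<Gamma>" using d[OF that] c[OF that(1)] by simp
    then have "v / v' = 1" using assms unfolding char_graph_def by blast
    then show ?thesis using c[OF that(2)] by (metis divide_eq_1_iff)
  qed
  have n: "(x [^] (n :: nat), v ^ n) \<in> \<Gamma>" if "(x, v) \<in> \<Gamma>" for x v n
  proof (induction n)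
    case 0
    then show ?case using o by simp
  next
    case (Suc n)
    then show ?case using m[OF Suc that] by (simp add: mult.commute)
  qed
  show "(x [^] (k :: int), v powi k) \<in> \<Gamma>" if xv: "(x, v) \<in> \<Gamma>"
  proof (cases k rule: int_cases)
    case (nonneg m)
    then show ?thesis using n[OF xv, of m] by (simp add: int_pow_int)
  next
    case (neg m)
    have "(inv (x [^] Suc m), 1 / v ^ Suc m) \<in> \<Gamma>" by (rule i[OF n[OF xv]])
    moreover have "x [^] k = inv (x [^] Suc m)" unfolding neg using c[OF xv] by (intro int_pow_neg_int) simp
    moreover have "v powi k = 1 / v ^ Suc m" unfolding neg by (simp only: power_int_minus power_int_of_nat inverse_eq_divide)
    ultimately show ?thesis by (simp only:)
  qed
qed

text \<open>
  The new value \<open>w\<close> at \<open>g\<close> is admissible when it agrees with the given character on all powers of \<open>g\<close> in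
  its domain.
\<close>

lemma char_graph_adjoin:
  assumes \<Gamma>: "char_graph G \<Gamma>" and g: "g \<in> carrier G" and w: "cmod w = 1"
    and compat: "\<And>(k :: int) v. (g [^] k, v) \<in> \<Gamma> \<Longrightarrow> v = w powi k"
  obtains \<Gamma>' where "char_graph G \<Gamma>'" "\<Gamma> \<subseteq> \<Gamma>'" "(g, w) \<in> \<Gamma>'"
proof -
  note D = char_graphD[OF \<Gamma>]
  have w0: "w \<noteq> 0" using w by auto
  define \<Gamma>' where "\<Gamma>' = {(h \<otimes> g [^] k, v * w powi k) | h v (k :: int). (h, v) \<in> \<Gamma>}"
  have mem: "(h \<otimes> g [^] k, v * w powi k) \<in> \<Gamma>'" if "(h, v) \<in> \<Gamma>" for h v and k :: int
    using that unfolding \<Gamma>'_def by blast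
  have "char_graph G \<Gamma>'"
    unfolding char_graph_def
  proof (intro conjI allI impI)
    show "\<Gamma>' \<subseteq> carrier G \<times> {z. cmod z = 1}"
      using D(1) g w by (auto simp: \<Gamma>'_def norm_mult norm_power_int)
    show "(\<one>, 1) \<in> \<Gamma>'" using mem[OF D(2), of 0] by simp
  next
    fix x v y u assume "(x, v) \<in> \<Gamma>'" "(y, u) \<in> \<Gamma>'"
    then obtain h a k h' a' k' where h: "x = h \<otimes> g [^] (k :: int)" "v = a * w powi k" "(h, a) \<in> \<Gamma>"
      "y = h' \<otimes> g [^] (k' :: int)" "u = a' * w powi k'" "(h', a') \<in> \<Gamma>"
      unfolding \<Gamma>'_def by blast
    have hc: "h \<in> carrier G" "h' \<in> carrier G" using D(1) h by auto
    have "x \<otimes> inv y = (h \<otimes> inv h') \<otimes> g [^] (k - k')"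
      using hc g by (simp add: h inv_mult int_pow_diff m_ac)
    moreover have "v / u = (a / a') * w powi (k - k')"
      using w0 by (simp add: h power_int_diff)
    ultimately show "(x \<otimes> inv y, v / u) \<in> \<Gamma>'" using mem[OF D(3)[OF h(3,6)]] by simp
  next
    fix v assume "(\<one>, v) \<in> \<Gamma>'"
    then obtain h a k where h: "\<one> = h \<otimes> g [^] (k :: int)" "v = a * w powi k" "(h, a) \<in> \<Gamma>"
      unfolding \<Gamma>'_def by blast
    have "h = inv (g [^] k)" using h(1) D(1)[OF h(3)] g inv_equality[of h "g [^] k"] by simp
    then have "h = g [^] (- k)" using g by (simp add: int_pow_neg)
    then have "a = w powi (- k)" using compat h(3) by simp
    then show "v = 1" using w0 by (simp add: h(2) power_int_minus)
  qed
  moreover have "\<Gamma> \<subseteq> \<Gamma>'"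
  proof
    fix p assume "p \<in> \<Gamma>"
    then show "p \<in> \<Gamma>'" using mem[of "fst p" "snd p" 0] D(1)[of "fst p" "snd p"] by simp
  qed
  moreover have "(g, w) \<in> \<Gamma>'" using mem[OF D(2), of 1] g by (simp add: int_pow_1)
  ultimately show thesis using that by blast
qed

text \<open>
  The exponents of the powers of \<open>g\<close> in the domain form a subgroup of the integers, which is generated by
  its least positive element.
\<close>

lemma dom_int_pow_dvd:
  assumes \<Gamma>: "char_graph G \<Gamma>" and g: "g \<in> carrier G" and n: "n > 0" "(g [^] n, v\<^sub>0) \<in> \<Gamma>"
    and least: "\<And>m v. 0 < m \<Longrightarrow> m < n \<Longrightarrow> (g [^] m, v) \<notin> \<Gamma>" and k: "(g [^] (k :: int), v) \<in> \<Gamma>"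
  shows "k = int n * (k div int n)" "v = v\<^sub>0 powi (k div int n)"
proof -
  note D = char_graphD[OF \<Gamma>]
  let ?q = "k div int n"
  have nq: "((g [^] n) [^] ?q, v\<^sub>0 powi ?q) \<in> \<Gamma>" by (rule D(7)[OF n(2)])
  have p: "(g [^] n) [^] ?q = g [^] (int n * ?q)" using g by (simp add: int_pow_pow int_pow_int flip: int_pow_int)
  have "g [^] k \<otimes> inv (g [^] (int n * ?q)) = g [^] (k mod int n)"
    using g by (simp add: int_pow_diff[symmetric] minus_mult_div_eq_mod)
  then have "(g [^] (k mod int n), v / v\<^sub>0 powi ?q) \<in> \<Gamma>" using D(3)[OF k nq] p by simp
  moreover have "k mod int n = int (nat (k mod int n))" using n(1) by simp
  ultimately have "(g [^] nat (k mod int n), v / v\<^sub>0 powi ?q) \<in> \<Gamma>" by (metis int_pow_int)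
  moreover have "nat (k mod int n) < n" using n(1) by (simp add: nat_less_iff)
  ultimately have "nat (k mod int n) = 0" using least by (metis not_gr0)
  then have "k mod int n = 0" using n(1) by (simp add: nat_eq_iff)
  then show kk: "k = int n * ?q" by (metis mult_div_mod_eq add.right_neutral)
  show "v = v\<^sub>0 powi ?q" using D(6)[OF _ nq, of v] k p kk by metis
qed

text \<open>
  This is where divisibility of the circle enters: if \<open>n\<close> is the least positive exponent with \<open>g\<^sup>n\<close> in the
  domain, the new value at \<open>g\<close> is an \<open>n\<close>-th root of the value there. If there is no such \<open>n\<close>, any value
  will do.
\<close>

lemma char_graph_adjoin_ex:
  assumes \<Gamma>: "char_graph G \<Gamma>" and g: "g \<in> carrier G"
  obtains \<Gamma>' w where "char_graph G \<Gamma>'" "\<Gamma> \<subseteq> \<Gamma>'" "(g, w) \<in> \<Gamma>'"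
proof -
  note D = char_graphD[OF \<Gamma>]
  have "\<exists>w. cmod w = 1 \<and> (\<forall>(k :: int) v. (g [^] k, v) \<in> \<Gamma> \<longrightarrow> v = w powi k)"
  proof (cases "\<exists>n > (0 :: nat). \<exists>v. (g [^] n, v) \<in> \<Gamma>")
    case True
    define n where "n = (LEAST n :: nat. n > 0 \<and> (\<exists>v. (g [^] n, v) \<in> \<Gamma>))"
    have n: "n > 0 \<and> (\<exists>v. (g [^] n, v) \<in> \<Gamma>)" 
      unfolding n_def by (rule LeastI_ex[of "\<lambda>n :: nat. n > 0 \<and> (\<exists>v. (g [^] n, v) \<in> \<Gamma>)"]) (rule True)
    then obtain v\<^sub>0 where v0: "(g [^] n, v\<^sub>0) \<in> \<Gamma>" by blast
    have least: "(g [^] m, v) \<notin> \<Gamma>" if "0 < m" "m < n" for m v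
      using not_less_Least[of m "\<lambda>n :: nat. n > 0 \<and> (\<exists>v. (g [^] n, v) \<in> \<Gamma>)"] that by (auto simp: n_def)
    obtain w where w: "cmod w = 1" "w ^ n = v\<^sub>0" using circle_root[of v\<^sub>0 n] D(1)[OF v0] n by blast
    have "v = w powi k" if "(g [^] k, v) \<in> \<Gamma>" for k :: int and v
    proof -
      note k = dom_int_pow_dvd[OF \<Gamma> g conjunct1[OF n] v0 least that]
      have "w powi (int n * (k div int n)) = v\<^sub>0 powi (k div int n)" by (simp add: power_int_mult w(2))
      with arg_cong[OF k(1), of "\<lambda>k. w powi k"] show ?thesis using k(2) by (simp only: power_int_1_left)
    qed
    then show ?thesis using w(1) by blast
  next
    case False
    have "v = 1 powi k" if kv: "(g [^] k, v) \<in> \<Gamma>" for k :: int and v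
    proof -
      have "k = 0"
      proof (rule ccontr)
        assume "k \<noteq> 0"
        have "\<exists>v. (g [^] \<bar>k\<bar>, v) \<in> \<Gamma>"
          using kv D(4)[OF kv] g by (cases "k \<ge> 0") (auto simp: int_pow_neg)
        moreover have "g [^] \<bar>k\<bar> = g [^] nat \<bar>k\<bar>" by (metis abs_ge_zero int_nat_eq int_pow_int)
        ultimately show False using False \<open>k \<noteq> 0\<close> by (metis zero_less_abs_iff zero_less_nat_eq)
      qed
      then show ?thesis using kv D(2,6) by simp
    qed
    then show ?thesis by (intro exI[of _ 1]) auto
  qed
  then obtain w where w: "cmod w = 1" "\<And>(k :: int) v. (g [^] k, v) \<in> \<Gamma> \<Longrightarrow> v = w powi k" by blast
  show thesis by (rule char_graph_adjoin[OF \<Gamma> g w]) (assumption, rule that)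
qed

lemma character_extension:
  assumes \<Gamma>: "char_graph G \<Gamma>"
  obtains \<chi> where "\<chi> \<in> hom G circle" "\<And>x v. (x, v) \<in> \<Gamma> \<Longrightarrow> \<chi> x = v"
proof -
  define A where "A = {\<Delta>. char_graph G \<Delta> \<and> \<Gamma> \<subseteq> \<Delta>}"
  have "\<exists>M\<in>A. \<forall>X\<in>A. M \<subseteq> X \<longrightarrow> X = M"
  proof (rule subset_Zorn_nonempty)
    show "A \<noteq> {}" using \<Gamma> by (auto simp: A_def)
    fix C assume C: "C \<noteq> {}" "subset.chain A C"
    have cg: "char_graph G \<Delta>" "\<Gamma> \<subseteq> \<Delta>" if "\<Delta> \<in> C" for \<Delta> using C(2) that by (auto simp: A_def subset.chain_def)
    have two: "\<exists>\<Delta>\<in>C. p \<in> \<Delta> \<and> q \<in> \<Delta>" if "p \<in> \<Union>C" "q \<in> \<Union>C" for p q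
      using that C(2) unfolding subset_chain_def by blast
    have "char_graph G (\<Union>C)"
      unfolding char_graph_def
    proof (intro conjI allI impI)
      show "\<Union>C \<subseteq> carrier G \<times> {z. cmod z = 1}" using cg unfolding char_graph_def by blast
      show "(\<one>, 1) \<in> \<Union>C" using C(1) cg unfolding char_graph_def by blast
    next
      fix x v y w assume "(x, v) \<in> \<Union>C" "(y, w) \<in> \<Union>C"
      then obtain \<Delta> where "\<Delta> \<in> C" "(x, v) \<in> \<Delta>" "(y, w) \<in> \<Delta>" using two by blast
      then show "(x \<otimes> inv y, v / w) \<in> \<Union>C" using char_graphD(3)[OF cg(1)] by blast
    next
      fix v assume "(\<one>, v) \<in> \<Union>C"
      then show "v = 1" using cg(1) unfolding char_graph_def by blast
    qed
    then show "\<Union>C \<in> A" using C(1) cg by (auto simp: A_def)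
  qed
  then obtain M where M: "M \<in> A" "\<And>X. X \<in> A \<Longrightarrow> M \<subseteq> X \<Longrightarrow> X = M" by blast
  have Mg: "char_graph G M" and \<Gamma>M: "\<Gamma> \<subseteq> M" using M(1) by (auto simp: A_def)
  note D = char_graphD[OF Mg]
  have tot: "\<exists>v. (x, v) \<in> M" if x: "x \<in> carrier G" for x
  proof -
    obtain M' w where M': "char_graph G M'" "M \<subseteq> M'" "(x, w) \<in> M'" by (rule char_graph_adjoin_ex[OF Mg x]) (rule that)
    then have "M' = M" using M(2)[of M'] \<Gamma>M by (auto simp: A_def)
    then show ?thesis using M'(3) by blast
  qed
  define \<chi> where "\<chi> x = (SOME v. (x, v) \<in> M)" for x
  have \<chi>: "(x, \<chi> x) \<in> M" if "x \<in> carrier G" for x unfolding \<chi>_def by (rule someI_ex[OF tot[OF that]])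
  have \<chi>_eq: "\<chi> x = v" if "(x, v) \<in> M" for x v using D(6)[OF \<chi> that] D(1)[OF that] by blast
  have "\<chi> \<in> hom G circle"
    by (rule homI) (use \<chi> D(1) \<chi>_eq[OF D(5)[OF \<chi> \<chi>]] in auto)
  then show thesis using that \<chi>_eq \<Gamma>M by blast
qed

text \<open>
  The character is first defined on the group generated by \<open>H\<close> and \<open>g\<close>, trivially on \<open>H\<close>. Its value at \<open>g\<close>
  is free if no power of \<open>g\<close> lies in \<open>H\<close>, and otherwise can be a nontrivial root of unity.
\<close>

lemma character_separation:
  assumes H: "subgroup H G" and g: "g \<in> carrier G" "g \<notin> H"
  obtains \<chi> where "\<chi> \<in> hom G circle" "\<And>x. x \<in> H \<Longrightarrow> \<chi> x = 1" "\<chi> g \<noteq> 1"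
proof -
  interpret H: subgroup H G by fact
  define \<Gamma> :: "('a \<times> complex) set" where "\<Gamma> = H \<times> {1}"
  have \<Gamma>: "char_graph G \<Gamma>" by (auto simp: char_graph_def \<Gamma>_def)
  note D = char_graphD[OF \<Gamma>]
  have "\<exists>w. cmod w = 1 \<and> w \<noteq> 1 \<and> (\<forall>(k :: int) v. (g [^] k, v) \<in> \<Gamma> \<longrightarrow> v = w powi k)"
  proof (cases "\<exists>n > (0 :: nat). g [^] n \<in> H")
    case True
    define n where "n = (LEAST n :: nat. n > 0 \<and> g [^] n \<in> H)"
    have n: "n > 0 \<and> g [^] n \<in> H" 
      unfolding n_def by (rule LeastI_ex[of "\<lambda>n :: nat. n > 0 \<and> g [^] n \<in> H"]) (rule True)
    have least: "(g [^] m, v) \<notin> \<Gamma>" if "0 < m" "m < n" for m v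
      using not_less_Least[of m "\<lambda>n :: nat. n > 0 \<and> g [^] n \<in> H"] that by (auto simp: n_def \<Gamma>_def)
    have "n \<noteq> 1" using n g by auto
    then obtain w where w: "cmod w = 1" "w ^ n = 1" "w \<noteq> 1" using circle_root_of_unity[of n] n by (metis less_one nat_neq_iff not_less_zero)
    have v0: "(g [^] n, 1) \<in> \<Gamma>" using n by (simp add: \<Gamma>_def)
    have "v = w powi k" if "(g [^] k, v) \<in> \<Gamma>" for k :: int and v
    proof -
      note k = dom_int_pow_dvd[OF \<Gamma> g(1) conjunct1[OF n] v0 least that]
      have "w powi (int n * (k div int n)) = 1" by (simp add: power_int_mult w(2))
      with arg_cong[OF k(1), of "\<lambda>k. w powi k"] show ?thesis using k(2) by (simp only: power_int_1_left)
    qed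
    then show ?thesis using w by blast
  next
    case False
    have "v = (- 1) powi k" if kv: "(g [^] k, v) \<in> \<Gamma>" for k :: int and v
    proof -
      have "k = 0"
      proof (rule ccontr)
        assume "k \<noteq> 0"
        have "g [^] \<bar>k\<bar> \<in> H"
          using kv H.m_inv_closed[of "g [^] k"] g by (cases "k \<ge> 0") (auto simp: int_pow_neg \<Gamma>_def)
        moreover have "g [^] \<bar>k\<bar> = g [^] nat \<bar>k\<bar>" by (metis abs_ge_zero int_nat_eq int_pow_int)
        ultimately show False using False \<open>k \<noteq> 0\<close> by (metis zero_less_abs_iff zero_less_nat_eq)
      qed
      then show ?thesis using kv by (simp add: \<Gamma>_def)
    qed
    then show ?thesis by (intro exI[of _ "- 1"]) auto
  qed
  then obtain w where w: "cmod w = 1" "w \<noteq> 1" "\<And>(k :: int) v. (g [^] k, v) \<in> \<Gamma> \<Longrightarrow> v = w powi k" by blast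
  obtain \<Gamma>' where \<Gamma>': "char_graph G \<Gamma>'" "\<Gamma> \<subseteq> \<Gamma>'" "(g, w) \<in> \<Gamma>'"
    by (rule char_graph_adjoin[OF \<Gamma> g(1) w(1) w(3)]) (assumption, rule that)
  obtain \<chi> where \<chi>: "\<chi> \<in> hom G circle" "\<And>x v. (x, v) \<in> \<Gamma>' \<Longrightarrow> \<chi> x = v"
    by (rule character_extension[OF \<Gamma>'(1)]) (rule that)
  show thesis
    by (rule that[OF \<chi>(1)]) (use \<chi>(2) \<Gamma>'(2,3) w(2) in \<open>auto simp: \<Gamma>_def\<close>)
qed

end

section \<open>Character modules and flatness\<close>

text \<open>
  Scalars act through the argument, so the characters of a left module form a right module, and vice
  versa.
\<close>

definition character_module :: "('r, 'm) module \<Rightarrow> ('r, 'm \<Rightarrow> complex) module" where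
  "character_module M =
     \<lparr>carrier = {\<chi> \<in> carrier M \<rightarrow>\<^sub>E {z. cmod z = 1}.
        \<forall>x\<in>carrier M. \<forall>y\<in>carrier M. \<chi> (x \<oplus>\<^bsub>M\<^esub> y) = \<chi> x * \<chi> y},
      monoid.mult = undefined, monoid.one = undefined,
      ring.zero = (\<lambda>x\<in>carrier M. 1), ring.add = (\<lambda>\<chi> \<psi>. \<lambda>x\<in>carrier M. \<chi> x * \<psi> x),
      smult = (\<lambda>r \<chi>. \<lambda>x\<in>carrier M. \<chi> (r \<odot>\<^bsub>M\<^esub> x))\<rparr>"

lemma character_module_simps:
  "\<chi> \<in> carrier (character_module M) \<longleftrightarrow> \<chi> \<in> extensional (carrier M) \<and> (\<forall>x\<in>carrier M. cmod (\<chi> x) = 1) \<and>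
     (\<forall>x\<in>carrier M. \<forall>y\<in>carrier M. \<chi> (x \<oplus>\<^bsub>M\<^esub> y) = \<chi> x * \<chi> y)"
  "\<zero>\<^bsub>character_module M\<^esub> = (\<lambda>x\<in>carrier M. 1)"
  "\<chi> \<oplus>\<^bsub>character_module M\<^esub> \<psi> = (\<lambda>x\<in>carrier M. \<chi> x * \<psi> x)"
  "r \<odot>\<^bsub>character_module M\<^esub> \<chi> = (\<lambda>x\<in>carrier M. \<chi> (r \<odot>\<^bsub>M\<^esub> x))"
  by (auto simp: character_module_def PiE_iff)

lemma character_nonzero: "\<chi> \<in> carrier (character_module M) \<Longrightarrow> x \<in> carrier M \<Longrightarrow> \<chi> x \<noteq> 0"
  by (auto simp: character_module_simps)

lemma character_left_module:
  assumes "left_module R M"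
  shows "left_module (opposite R) (character_module M)"
proof -
  interpret M: left_module R M by fact
  note s = character_module_simps
  have nz: "\<chi> x \<noteq> 0" if "\<forall>x\<in>carrier M. cmod (\<chi> x) = 1" "x \<in> carrier M" for \<chi> x using that by force
  have "abelian_group (character_module M)"
  proof (rule abelian_groupI)
    fix \<chi> assume \<chi>: "\<chi> \<in> carrier (character_module M)"
    show "\<exists>\<psi>\<in>carrier (character_module M). \<psi> \<oplus>\<^bsub>character_module M\<^esub> \<chi> = \<zero>\<^bsub>character_module M\<^esub>"
    proof (rule bexI)
      show "(\<lambda>x\<in>carrier M. inverse (\<chi> x)) \<in> carrier (character_module M)"
        using \<chi> by (auto simp: s norm_inverse)
      show "(\<lambda>x\<in>carrier M. inverse (\<chi> x)) \<oplus>\<^bsub>character_module M\<^esub> \<chi> = \<zero>\<^bsub>character_module M\<^esub>"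
        using character_nonzero[OF \<chi>] by (auto simp: s intro!: restrict_ext)
    qed
    show "\<zero>\<^bsub>character_module M\<^esub> \<oplus>\<^bsub>character_module M\<^esub> \<chi> = \<chi>"
      using \<chi> by (auto simp: s fun_eq_iff extensional_def)
  qed (auto simp: s norm_mult fun_eq_iff mult_ac)
  moreover have "left_module_axioms (opposite R) (character_module M)"
    by (rule left_module_axioms.intro)
      (auto simp: s M.smult_closed M.smult_r_distr M.smult_l_distr M.smult_assoc M.smult_one fun_eq_iff extensional_def)
  ultimately show ?thesis using opposite_ring[OF M.R.ring_axioms] by (simp add: left_module_def)
qed

lemma character_module_card:
  assumes U: "universe TYPE('u)" and M: "|carrier M| <o |UNIV :: 'u set|"
  shows "|carrier (character_module M)| <o |UNIV :: 'u set|"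
  by (rule card_le_subset[OF _ universe_PiE[OF U M universe_complex[OF U]]])
    (auto simp: character_module_simps PiE_iff extensional_def)

text \<open>
  The kernel of the restriction from characters of \<open>M\<close> to characters of \<open>A\<close>. It is isomorphic to the
  character module of the quotient of \<open>M\<close> by \<open>A\<close>.
\<close>

definition annihilator :: "('r, 'm) module \<Rightarrow> 'm set \<Rightarrow> ('m \<Rightarrow> complex) set" where
  "annihilator M A = {\<chi> \<in> carrier (character_module M). \<forall>a\<in>A. \<chi> a = 1}"

lemma annihilator_submodule:
  assumes M: "left_module R M" and A: "submodule A R M"
  shows "submodule (annihilator M A) (opposite R) (character_module M)"
proof -
  interpret C: left_module "opposite R" "character_module M" by (rule character_left_module[OF M])
  note Ad = left_module.submoduleD[OF M A]
  show ?thesis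
  proof (rule C.submoduleI)
    show "annihilator M A \<subseteq> carrier (character_module M)" by (auto simp: annihilator_def)
    show "\<zero>\<^bsub>character_module M\<^esub> \<in> annihilator M A"
      using Ad(1) C.M.zero_closed by (auto simp: annihilator_def character_module_simps(2))
    show "x \<oplus>\<^bsub>character_module M\<^esub> y \<in> annihilator M A" if "x \<in> annihilator M A" "y \<in> annihilator M A" for x y
      using that Ad(1) C.M.a_closed[of x y] by (auto simp: annihilator_def character_module_simps(3))
    show "r \<odot>\<^bsub>character_module M\<^esub> x \<in> annihilator M A" if "r \<in> carrier (opposite R)" "x \<in> annihilator M A" for r x
      using that Ad(1,4) C.smult_closed[of r x] by (auto simp: annihilator_def character_module_simps(4))
  qed
qed

lemma character_extend_submodule:
  assumes M: "left_module R M" and K: "submodule K R M"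
    and c: "\<And>x. x \<in> K \<Longrightarrow> cmod (c x) = 1" "\<And>x y. x \<in> K \<Longrightarrow> y \<in> K \<Longrightarrow> c (x \<oplus>\<^bsub>M\<^esub> y) = c x * c y"
  obtains \<chi> where "\<chi> \<in> carrier (character_module M)" "\<And>x. x \<in> K \<Longrightarrow> \<chi> x = c x"
proof -
  interpret M: left_module R M by fact
  note Kd = M.submoduleD[OF K]
  have nz: "c x \<noteq> 0" if "x \<in> K" for x using c(1)[OF that] by auto
  have c0: "c \<zero>\<^bsub>M\<^esub> = 1" using c(2)[OF Kd(2,2)] nz[OF Kd(2)] by simp
  have cm: "c (x \<ominus>\<^bsub>M\<^esub> y) = c x / c y" if "x \<in> K" "y \<in> K" for x y
  proof -
    have "c (x \<ominus>\<^bsub>M\<^esub> y) * c y = c x"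
      using c(2)[OF Kd(6)[OF that] that(2)] that Kd(1) by (simp add: M.minus_plus_cancel subset_iff)
    then show ?thesis using nz[OF that(2)] by (simp add: field_simps)
  qed
  define \<Gamma> where "\<Gamma> = (\<lambda>x. (x, c x)) ` K"
  have "char_graph (add_monoid M) \<Gamma>"
    unfolding char_graph_def
  proof (intro conjI allI impI)
    show "\<Gamma> \<subseteq> carrier (add_monoid M) \<times> {z. cmod z = 1}" using c(1) Kd(1) by (auto simp: \<Gamma>_def)
    show "(\<one>\<^bsub>add_monoid M\<^esub>, 1) \<in> \<Gamma>" using Kd(2) c0 by (force simp: \<Gamma>_def)
  next
    fix x v y w assume "(x, v) \<in> \<Gamma>" "(y, w) \<in> \<Gamma>"
    then have xy: "x \<in> K" "v = c x" "y \<in> K" "w = c y" by (auto simp: \<Gamma>_def)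
    have "(x \<ominus>\<^bsub>M\<^esub> y, c (x \<ominus>\<^bsub>M\<^esub> y)) \<in> \<Gamma>" using Kd(6)[OF xy(1,3)] by (auto simp: \<Gamma>_def)
    then show "(x \<otimes>\<^bsub>add_monoid M\<^esub> inv\<^bsub>add_monoid M\<^esub> y, v / w) \<in> \<Gamma>"
      using xy by (simp add: cm) (simp add: a_minus_def a_inv_def)
  next
    fix v assume "(\<one>\<^bsub>add_monoid M\<^esub>, v) \<in> \<Gamma>"
    then show "v = 1" using c0 by (auto simp: \<Gamma>_def)
  qed
  then obtain \<chi> where \<chi>: "\<chi> \<in> hom (add_monoid M) circle" "\<And>x v. (x, v) \<in> \<Gamma> \<Longrightarrow> \<chi> x = v"
    by (rule comm_group.character_extension[OF M.M.a_comm_group]) (rule that)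
  show thesis
  proof (rule that)
    show "restrict \<chi> (carrier M) \<in> carrier (character_module M)"
      using \<chi>(1) by (auto simp: character_module_simps hom_def)
    show "restrict \<chi> (carrier M) x = c x" if "x \<in> K" for x
      using \<chi>(2)[of x "c x"] that Kd(1) by (auto simp: \<Gamma>_def)
  qed
qed

text \<open>
  These maps are the same as characters of the tensor product of \<open>A\<close> and \<open>M\<close>, and also the same as
  linear maps from \<open>M\<close> to the character module of \<open>A\<close>.
\<close>

definition balanced :: "'r ring \<Rightarrow> ('r, 'a) module \<Rightarrow> ('r, 'm) module \<Rightarrow> ('a \<Rightarrow> 'm \<Rightarrow> complex) \<Rightarrow> bool" where
  "balanced R A M \<beta> \<longleftrightarrow>
     (\<forall>a\<in>carrier A. \<forall>x\<in>carrier M. cmod (\<beta> a x) = 1) \<and>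
     (\<forall>a\<in>carrier A. \<forall>b\<in>carrier A. \<forall>x\<in>carrier M. \<beta> (a \<oplus>\<^bsub>A\<^esub> b) x = \<beta> a x * \<beta> b x) \<and>
     (\<forall>a\<in>carrier A. \<forall>x\<in>carrier M. \<forall>y\<in>carrier M. \<beta> a (x \<oplus>\<^bsub>M\<^esub> y) = \<beta> a x * \<beta> a y) \<and>
     (\<forall>r\<in>carrier R. \<forall>a\<in>carrier A. \<forall>x\<in>carrier M. \<beta> (r \<odot>\<^bsub>A\<^esub> a) x = \<beta> a (r \<odot>\<^bsub>M\<^esub> x))"

lemma balancedD:
  assumes "balanced R A M \<beta>"
  shows "a \<in> carrier A \<Longrightarrow> x \<in> carrier M \<Longrightarrow> cmod (\<beta> a x) = 1"
    "a \<in> carrier A \<Longrightarrow> x \<in> carrier M \<Longrightarrow> \<beta> a x \<noteq> 0"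
    "a \<in> carrier A \<Longrightarrow> b \<in> carrier A \<Longrightarrow> x \<in> carrier M \<Longrightarrow> \<beta> (a \<oplus>\<^bsub>A\<^esub> b) x = \<beta> a x * \<beta> b x"
    "a \<in> carrier A \<Longrightarrow> x \<in> carrier M \<Longrightarrow> y \<in> carrier M \<Longrightarrow> \<beta> a (x \<oplus>\<^bsub>M\<^esub> y) = \<beta> a x * \<beta> a y"
    "r \<in> carrier R \<Longrightarrow> a \<in> carrier A \<Longrightarrow> x \<in> carrier M \<Longrightarrow> \<beta> (r \<odot>\<^bsub>A\<^esub> a) x = \<beta> a (r \<odot>\<^bsub>M\<^esub> x)"
  using assms unfolding balanced_def by force+

definition tensor_character :: "('r, 'a) module \<Rightarrow> ('r, 'm) module \<Rightarrow> ('a \<Rightarrow> 'm \<Rightarrow> complex) \<Rightarrow> ('a \<times> 'm \<Rightarrow>\<^sub>0 int) \<Rightarrow> complex" where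
  "tensor_character A M \<beta> = frag_lift (carrier A \<times> carrier M) circle (\<lambda>(a, x). \<beta> a x)"

lemma circle_inv: "cmod z = 1 \<Longrightarrow> inv\<^bsub>circle\<^esub> z = 1 / z"
proof -
  assume z: "cmod z = 1"
  interpret comm_group circle by (rule circle_comm_group)
  show ?thesis by (rule inv_equality) (use z in \<open>auto simp: norm_divide\<close>)
qed

lemma frag_hom_circle_diff:
  assumes "h \<in> hom (free_Abelian_group S) circle" "Poly_Mapping.keys c \<subseteq> S" "Poly_Mapping.keys d \<subseteq> S"
  shows "h (c - d) = h c / h d"
proof -
  have "group circle" using circle_comm_group by (simp add: comm_group_def)
  then show ?thesis
    using frag_hom_diff[OF _ assms] hom_in_carrier[OF assms(1), of d] assms(3) by (simp add: circle_inv)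
qed

lemma
  assumes A: "left_module (opposite R) A" and M: "left_module R M" and \<beta>: "balanced R A M \<beta>"
  shows tensor_character_hom: "tensor_character A M \<beta> \<in> hom (rel_group (carrier A) (carrier M)) circle"
    and tensor_character_of: "a \<in> carrier A \<Longrightarrow> x \<in> carrier M \<Longrightarrow> tensor_character A M \<beta> (frag_of (a, x)) = \<beta> a x"
    and tensor_character_relations: "c \<in> tensor_relations R A M \<Longrightarrow> tensor_character A M \<beta> c = 1"
proof -
  interpret A: left_module "opposite R" A by fact
  interpret M: left_module R M by fact
  note B = balancedD[OF \<beta>]
  have cl: "(\<lambda>(a, x). \<beta> a x) ` (carrier A \<times> carrier M) \<subseteq> carrier circle" using B by auto
  show h: "tensor_character A M \<beta> \<in> hom (rel_group (carrier A) (carrier M)) circle"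
    unfolding tensor_character_def by (rule frag_lift_hom[OF circle_comm_group cl])
  show of: "tensor_character A M \<beta> (frag_of (a, x)) = \<beta> a x" if "a \<in> carrier A" "x \<in> carrier M" for a x
    unfolding tensor_character_def using frag_lift_of[OF circle_comm_group cl, of "(a, x)"] that by simp
  have g: "group circle" using circle_comm_group by (simp add: comm_group_def)
  note diff = frag_hom_circle_diff[OF h]
  have k2: "Poly_Mapping.keys (frag_of p - frag_of q) \<subseteq> carrier A \<times> carrier M"
    if "p \<in> carrier A \<times> carrier M" "q \<in> carrier A \<times> carrier M" for p q
    using keys_diff[of "frag_of p" "frag_of q"] that by (auto simp: keys_frag_of)
  have sm: "r \<odot>\<^bsub>A\<^esub> x \<in> carrier A" if "r \<in> carrier R" "x \<in> carrier A" for r x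
    using A.smult_closed that by simp
  show "tensor_character A M \<beta> c = 1" if c: "c \<in> tensor_relations R A M"
  proof -
    have "tensor_character A M \<beta> c = \<one>\<^bsub>circle\<^esub>"
    proof (rule hom_relations_one[OF A M g h _ c])
      fix c assume "c \<in> tensor_relators R A M"
      then show "tensor_character A M \<beta> c = \<one>\<^bsub>circle\<^esub>"
      proof (cases rule: tensor_relators_cases)
        case (1 x x' y)
        then show ?thesis using B by (simp add: diff k2 keys_frag_of of)
      next
        case (2 x y y')
        then show ?thesis using B by (simp add: diff k2 keys_frag_of of)
      next
        case (3 r x y)
        then show ?thesis using B sm M.smult_closed by (simp add: diff k2 keys_frag_of of)
      qed
    qed
    then show ?thesis by simp
  qed
qed

lemma balanced_of_hom:
  assumes A: "left_module (opposite R) A" and M: "left_module R M"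
    and h: "h \<in> hom (rel_group (carrier A) (carrier M)) circle"
    and rel: "\<And>c. c \<in> tensor_relators R A M \<Longrightarrow> h c = 1"
  shows "balanced R A M (\<lambda>a x. h (frag_of (a, x)))"
proof -
  interpret A: left_module "opposite R" A by fact
  interpret M: left_module R M by fact
  note diff = frag_hom_circle_diff[OF h]
  have k2: "Poly_Mapping.keys (frag_of p - frag_of q) \<subseteq> carrier A \<times> carrier M"
    if "p \<in> carrier A \<times> carrier M" "q \<in> carrier A \<times> carrier M" for p q
    using keys_diff[of "frag_of p" "frag_of q"] that by (auto simp: keys_frag_of)
  have sm: "r \<odot>\<^bsub>A\<^esub> x \<in> carrier A" if "r \<in> carrier R" "x \<in> carrier A" for r x
    using A.smult_closed that by simp
  have u: "cmod (h (frag_of (a, x))) = 1" if "a \<in> carrier A" "x \<in> carrier M" for a x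
    using hom_in_carrier[OF h, of "frag_of (a, x)"] that by (simp add: keys_frag_of)
  have nz: "h (frag_of (a, x)) \<noteq> 0" if "a \<in> carrier A" "x \<in> carrier M" for a x
    using u[OF that] by auto
  show ?thesis
    unfolding balanced_def
  proof (intro conjI ballI)
    show "cmod (h (frag_of (a, x))) = 1" if "a \<in> carrier A" "x \<in> carrier M" for a x by (rule u[OF that])
  next
    fix a b x assume c: "a \<in> carrier A" "b \<in> carrier A" "x \<in> carrier M"
    have "frag_of (a \<oplus>\<^bsub>A\<^esub> b, x) - frag_of (a, x) - frag_of (b, x) \<in> tensor_relators R A M"
      unfolding tensor_relators_def using c by blast
    from rel[OF this] have "h (frag_of (a \<oplus>\<^bsub>A\<^esub> b, x)) / h (frag_of (a, x)) / h (frag_of (b, x)) = 1"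
      using c by (simp add: diff k2 keys_frag_of)
    then show "h (frag_of (a \<oplus>\<^bsub>A\<^esub> b, x)) = h (frag_of (a, x)) * h (frag_of (b, x))"
      using c nz by (simp add: divide_eq_eq mult.commute)
  next
    fix a x y assume c: "a \<in> carrier A" "x \<in> carrier M" "y \<in> carrier M"
    have "frag_of (a, x \<oplus>\<^bsub>M\<^esub> y) - frag_of (a, x) - frag_of (a, y) \<in> tensor_relators R A M"
      unfolding tensor_relators_def using c by blast
    from rel[OF this] have "h (frag_of (a, x \<oplus>\<^bsub>M\<^esub> y)) / h (frag_of (a, x)) / h (frag_of (a, y)) = 1"
      using c by (simp add: diff k2 keys_frag_of)
    then show "h (frag_of (a, x \<oplus>\<^bsub>M\<^esub> y)) = h (frag_of (a, x)) * h (frag_of (a, y))"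
      using c nz by (simp add: divide_eq_eq mult.commute)
  next
    fix r a x assume c: "r \<in> carrier R" "a \<in> carrier A" "x \<in> carrier M"
    have "frag_of (r \<odot>\<^bsub>A\<^esub> a, x) - frag_of (a, r \<odot>\<^bsub>M\<^esub> x) \<in> tensor_relators R A M"
      unfolding tensor_relators_def using c by blast
    from rel[OF this] show "h (frag_of (r \<odot>\<^bsub>A\<^esub> a, x)) = h (frag_of (a, r \<odot>\<^bsub>M\<^esub> x))"
      using c nz sm M.smult_closed by (simp add: diff keys_frag_of)
  qed
qed

text \<open>
  The tensor product of \<open>A\<close> and \<open>M\<close> is a subgroup of that of \<open>B\<close> and \<open>M\<close>, and characters extend from
  subgroups. The character is prescribed on the sums of image tensors and relations; flatness says
  exactly that this is well defined.
\<close>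

lemma flat_balanced_extend_small:
  fixes M :: "('r, 'u) module" and A B :: "('r, 'u) module"
  assumes M: "M \<in> flat_modules R" and A: "A \<in> modules (opposite R)" and B: "B \<in> modules (opposite R)"
    and f: "linear_map (opposite R) A B f" "inj_on f (carrier A)" and \<beta>: "balanced R A M \<beta>"
  obtains \<beta>' where "balanced R B M \<beta>'" "\<And>a x. a \<in> carrier A \<Longrightarrow> x \<in> carrier M \<Longrightarrow> \<beta>' (f a) x = \<beta> a x"
proof -
  have Mm: "left_module R M" using M by (simp add: flat_modules_def modules_def)
  have Am: "left_module (opposite R) A" and Bm: "left_module (opposite R) B" using A B by (simp_all add: modules_def)
  let ?f = "restrict f (carrier A)"
  have f': "?f \<in> module_hom (opposite R) A B" by (rule linear_module_hom[OF Am f(1)])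
  have inj': "inj_on ?f (carrier A)" using f(2) by (simp add: inj_on_def)
  have "inj_on (tensor_map R B M ?f) (carrier (tensor_product R A M))"
    using M A B f' inj' unfolding flat_modules_def by blast
  then have key: "c \<in> tensor_relations R A M" if "Poly_Mapping.keys c \<subseteq> carrier A \<times> carrier M"
      "frag_map ?f c \<in> tensor_relations R B M" for c
    using that unfolding tensor_map_inj_iff[OF Am Bm Mm module_hom_linear[OF f']] by blast
  let ?G = "rel_group (carrier B) (carrier M)"
  interpret G: comm_group ?G by (rule abelian_free_Abelian_group)
  let ?\<beta> = "tensor_character A M \<beta>"
  note h = tensor_character_hom[OF Am Mm \<beta>]
  define \<Gamma> where "\<Gamma> = {(frag_map ?f c + r, ?\<beta> c) | c r. Poly_Mapping.keys c \<subseteq> carrier A \<times> carrier M \<and> r \<in> tensor_relations R B M}"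
  have mem: "(frag_map ?f c + r, ?\<beta> c) \<in> \<Gamma>" if "Poly_Mapping.keys c \<subseteq> carrier A \<times> carrier M" "r \<in> tensor_relations R B M" for c r
    using that unfolding \<Gamma>_def by blast
  have im: "?f ` carrier A \<subseteq> carrier B" using linear_closed[OF f(1)] by auto
  note rel = relations_keys[OF Bm Mm] relations_zero[OF Bm Mm] relations_diff[OF Bm Mm] relations_uminus[OF Bm Mm]
  have carr: "Poly_Mapping.keys (frag_map ?f c + r) \<subseteq> carrier B \<times> carrier M"
    if "Poly_Mapping.keys c \<subseteq> carrier A \<times> carrier M" "r \<in> tensor_relations R B M" for c r
    using keys_add[of "frag_map ?f c" r] frag_map_keys[OF that(1) im] rel(1)[OF that(2)] by blast
  have bu: "cmod (?\<beta> c) = 1" if "Poly_Mapping.keys c \<subseteq> carrier A \<times> carrier M" for c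
    using hom_in_carrier[OF h, of c] that by simp
  have b0: "?\<beta> 0 = 1" using tensor_character_relations[OF Am Mm \<beta> relations_zero[OF Am Mm]] .
  have "char_graph ?G \<Gamma>"
    unfolding char_graph_def
  proof (intro conjI allI impI)
    show "\<Gamma> \<subseteq> carrier ?G \<times> {z. cmod z = 1}" using carr bu by (auto simp: \<Gamma>_def)
    show "(\<one>\<^bsub>?G\<^esub>, 1) \<in> \<Gamma>" using mem[of 0 0] rel(2) b0 by simp
  next
    fix x v y w assume "(x, v) \<in> \<Gamma>" "(y, w) \<in> \<Gamma>"
    then obtain c r d s where c: "Poly_Mapping.keys c \<subseteq> carrier A \<times> carrier M" "r \<in> tensor_relations R B M"
        "x = frag_map ?f c + r" "v = ?\<beta> c"
      and d: "Poly_Mapping.keys d \<subseteq> carrier A \<times> carrier M" "s \<in> tensor_relations R B M"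
        "y = frag_map ?f d + s" "w = ?\<beta> d"
      unfolding \<Gamma>_def by blast
    have cd: "Poly_Mapping.keys (c - d) \<subseteq> carrier A \<times> carrier M" using keys_diff[of c d] c d by blast
    have "x \<otimes>\<^bsub>?G\<^esub> inv\<^bsub>?G\<^esub> y = frag_map ?f (c - d) + (r - s)"
      using carr[OF d(1,2)] by (simp add: c(3) d(3) frag_extend_diff)
    moreover have "v / w = ?\<beta> (c - d)" using frag_hom_circle_diff[OF h c(1) d(1)] by (simp add: c(4) d(4))
    ultimately show "(x \<otimes>\<^bsub>?G\<^esub> inv\<^bsub>?G\<^esub> y, v / w) \<in> \<Gamma>" using mem[OF cd rel(3)[OF c(2) d(2)]] by simp
  next
    fix v assume "(\<one>\<^bsub>?G\<^esub>, v) \<in> \<Gamma>"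
    then have "(0, v) \<in> \<Gamma>" by simp
    then obtain c r where c: "Poly_Mapping.keys c \<subseteq> carrier A \<times> carrier M" "r \<in> tensor_relations R B M"
        "0 = frag_map ?f c + r" "v = ?\<beta> c" unfolding \<Gamma>_def by blast
    have "frag_map ?f c = - r" using c(3) by (metis add_eq_0_iff2)
    then have "c \<in> tensor_relations R A M" using key[OF c(1)] rel(4)[OF c(2)] by simp
    then show "v = 1" using tensor_character_relations[OF Am Mm \<beta>] c(4) by simp
  qed
  then obtain \<chi> where \<chi>: "\<chi> \<in> hom ?G circle" "\<And>x v. (x, v) \<in> \<Gamma> \<Longrightarrow> \<chi> x = v"
    by (rule G.character_extension) (rule that)
  show thesis
  proof (rule that)
    show "balanced R B M (\<lambda>a x. \<chi> (frag_of (a, x)))"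
    proof (rule balanced_of_hom[OF Bm Mm \<chi>(1)])
      fix c assume "c \<in> tensor_relators R B M"
      from mem[of 0, OF _ relators_relations[OF this]] show "\<chi> c = 1" using \<chi>(2) b0 by simp
    qed
    show "\<chi> (frag_of (f a, x)) = \<beta> a x" if "a \<in> carrier A" "x \<in> carrier M" for a x
    proof -
      have "(frag_map ?f (frag_of (a, x)) + 0, ?\<beta> (frag_of (a, x))) \<in> \<Gamma>"
        by (rule mem[OF _ rel(2)]) (use that in \<open>simp add: keys_frag_of\<close>)
      from \<chi>(2)[OF this] show ?thesis using that by (simp add: tensor_character_of[OF Am Mm \<beta>])
    qed
  qed
qed

lemma flat_balanced_extend:
  fixes M :: "('r, 'u) module" and A :: "('r, 'a) module" and B :: "('r, 'b) module"
  assumes M: "M \<in> flat_modules R" and A: "left_module (opposite R) A" "|carrier A| <o |UNIV :: 'u set|"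
    and B: "left_module (opposite R) B" "|carrier B| <o |UNIV :: 'u set|"
    and f: "linear_map (opposite R) A B f" "inj_on f (carrier A)" and \<beta>: "balanced R A M \<beta>"
  obtains \<beta>' where "balanced R B M \<beta>'" "\<And>a x. a \<in> carrier A \<Longrightarrow> x \<in> carrier M \<Longrightarrow> \<beta>' (f a) x = \<beta> a x"
proof -
  obtain A' :: "('r, 'u) module" and \<rho>\<^sub>A \<sigma>\<^sub>A where A': "A' \<in> modules (opposite R)" "linear_map (opposite R) A A' \<rho>\<^sub>A"
    "linear_map (opposite R) A' A \<sigma>\<^sub>A" "\<And>x. x \<in> carrier A \<Longrightarrow> \<sigma>\<^sub>A (\<rho>\<^sub>A x) = x" "\<And>x. x \<in> carrier A' \<Longrightarrow> \<rho>\<^sub>A (\<sigma>\<^sub>A x) = x"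
    by (rule small_copy[OF A]) (rule that)
  obtain B' :: "('r, 'u) module" and \<rho>\<^sub>B \<sigma>\<^sub>B where B': "B' \<in> modules (opposite R)" "linear_map (opposite R) B B' \<rho>\<^sub>B"
    "linear_map (opposite R) B' B \<sigma>\<^sub>B" "\<And>x. x \<in> carrier B \<Longrightarrow> \<sigma>\<^sub>B (\<rho>\<^sub>B x) = x" "\<And>x. x \<in> carrier B' \<Longrightarrow> \<rho>\<^sub>B (\<sigma>\<^sub>B x) = x"
    by (rule small_copy[OF B]) (rule that)
  have fl: "linear_map (opposite R) A' B' (\<lambda>x. \<rho>\<^sub>B (f (\<sigma>\<^sub>A x)))"
    by (rule linear_comp[OF linear_comp[OF A'(3) f(1)] B'(2)])
  have inj: "inj_on (\<lambda>x. \<rho>\<^sub>B (f (\<sigma>\<^sub>A x))) (carrier A')"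
  proof (rule inj_onI)
    fix x y assume xy: "x \<in> carrier A'" "y \<in> carrier A'" "\<rho>\<^sub>B (f (\<sigma>\<^sub>A x)) = \<rho>\<^sub>B (f (\<sigma>\<^sub>A y))"
    note c = linear_closed[OF A'(3) xy(1)] linear_closed[OF A'(3) xy(2)]
    have "\<sigma>\<^sub>B (\<rho>\<^sub>B (f (\<sigma>\<^sub>A x))) = \<sigma>\<^sub>B (\<rho>\<^sub>B (f (\<sigma>\<^sub>A y)))" by (simp only: xy(3))
    then have "f (\<sigma>\<^sub>A x) = f (\<sigma>\<^sub>A y)"
      by (simp only: B'(4)[OF linear_closed[OF f(1) c(1)]] B'(4)[OF linear_closed[OF f(1) c(2)]])
    then have "\<sigma>\<^sub>A x = \<sigma>\<^sub>A y" by (rule inj_onD[OF f(2) _ c])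
    then have "\<rho>\<^sub>A (\<sigma>\<^sub>A x) = \<rho>\<^sub>A (\<sigma>\<^sub>A y)" by (rule arg_cong)
    then show "x = y" unfolding A'(5)[OF xy(1)] A'(5)[OF xy(2)] .
  qed
  have \<beta>': "balanced R A' M (\<lambda>a. \<beta> (\<sigma>\<^sub>A a))"
    using \<beta> linear_closed[OF A'(3)] linear_add[OF A'(3)] linear_smult[OF A'(3)] unfolding balanced_def by simp
  obtain \<gamma> where \<gamma>: "balanced R B' M \<gamma>"
    "\<And>a x. a \<in> carrier A' \<Longrightarrow> x \<in> carrier M \<Longrightarrow> \<gamma> (\<rho>\<^sub>B (f (\<sigma>\<^sub>A a))) x = \<beta> (\<sigma>\<^sub>A a) x"
    by (rule flat_balanced_extend_small[OF M A'(1) B'(1) fl inj \<beta>']) (rule that)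
  show thesis
  proof (rule that)
    show "balanced R B M (\<lambda>b. \<gamma> (\<rho>\<^sub>B b))"
      using \<gamma>(1) linear_closed[OF B'(2)] linear_add[OF B'(2)] linear_smult[OF B'(2)] unfolding balanced_def by simp
    show "\<gamma> (\<rho>\<^sub>B (f a)) x = \<beta> a x" if "a \<in> carrier A" "x \<in> carrier M" for a x
      using \<gamma>(2)[OF linear_closed[OF A'(2) that(1)] that(2)] A'(4)[OF that(1)] by simp
  qed
qed

lemma Ext1_trivial_iso:
  assumes X: "left_module R X" and Y: "left_module R Y" and Y': "left_module R Y'"
    and \<rho>: "linear_map R Y Y' \<rho>" and \<sigma>: "linear_map R Y' Y \<sigma>" "\<And>y. y \<in> carrier Y' \<Longrightarrow> \<rho> (\<sigma> y) = y"
    and triv: "trivial_group (Ext1 R X Y)"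
  shows "trivial_group (Ext1 R X Y')"
  unfolding Ext1_trivial_iff[OF X Y']
proof (intro allI impI)
  fix g assume g: "linear_map R (free_module R (carrier X)\<lparr>carrier := free_kernel R X\<rparr>) Y' g"
  obtain h where h: "linear_map R (free_module R (carrier X)) Y h" "\<forall>k\<in>free_kernel R X. h k = \<sigma> (g k)"
    using triv linear_comp[OF g \<sigma>(1)] unfolding Ext1_trivial_iff[OF X Y] by blast
  have "\<rho> (h k) = g k" if "k \<in> free_kernel R X" for k
    using h(2) \<sigma>(2)[OF linear_closed[OF g]] that by simp
  then show "\<exists>h. linear_map R (free_module R (carrier X)) Y' h \<and> (\<forall>k\<in>free_kernel R X. h k = g k)"
    using linear_comp[OF h(1) \<rho>] by blast
qed

abbreviation annihilator_module :: "('r, 'm) module \<Rightarrow> 'm set \<Rightarrow> ('r, 'm \<Rightarrow> complex) module" where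
  "annihilator_module B A \<equiv> (character_module B)\<lparr>carrier := annihilator B A\<rparr>"

lemma annihilator_left_module:
  assumes B: "left_module (opposite R) B" and A: "submodule A (opposite R) B"
  shows "left_module R (annihilator_module B A)"
  using left_module.submodule_left_module[OF character_left_module[OF B] annihilator_submodule[OF B A]] by simp

text \<open>
  The characters \<open>V\<close> of the free cover \<open>G\<close> that are trivial on its kernel \<open>K\<close> are the characters of \<open>F\<close>.
  By flatness the evaluation of \<open>V\<close> on \<open>F\<close> extends to a balanced map \<open>\<beta>'\<close> on all characters of \<open>G\<close>.
  Dividing \<open>\<chi>\<close> by \<open>\<beta>' \<chi>\<close> leaves \<open>\<chi>\<close> unchanged on \<open>K\<close> and kills \<open>V\<close>, so it extends characters of \<open>K\<close> to \<open>G\<close>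
  linearly and independently of choices. A map from \<open>K\<close> to characters of \<open>B\<close> is a family of characters of
  \<open>K\<close> indexed by \<open>B\<close>, and is extended in this way.
\<close>

lemma annihilator_Ext_trivial:
  fixes F :: "('r, 'u) module" and B :: "('r, 'b) module"
  assumes U: "universe TYPE('u)" and Rc: "|carrier R| <o |UNIV :: 'u set|"
    and F: "F \<in> flat_modules R" and B: "left_module (opposite R) B" and A: "submodule A (opposite R) B"
  shows "trivial_group (Ext1 R F (annihilator_module B A))"
proof -
  have Fm: "left_module R F" "|carrier F| <o |UNIV :: 'u set|" using F by (auto simp: flat_modules_def modules_def small_def)
  interpret F: left_module R F by fact
  interpret B: left_module "opposite R" B by fact
  note Ad = B.submoduleD[OF A]
  note C = annihilator_left_module[OF B A]
  define G where "G = free_module R (carrier F)"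
  define \<pi> where "\<pi> = free_cover R F (carrier F)"
  define K where "K = lin_kernel G F \<pi>"
  have G: "left_module R G" unfolding G_def by (rule free_module_left_module[OF F.R.ring_axioms])
  interpret G: left_module R G by fact
  have \<pi>: "linear_map R G F \<pi>" unfolding \<pi>_def G_def by (rule free_cover_linear[OF Fm(1)]) simp
  define sec where "sec x = basis_vector R (carrier F) x" for x
  have sec: "sec x \<in> carrier G" "\<pi> (sec x) = x" if "x \<in> carrier F" for x
    unfolding sec_def G_def \<pi>_def using that
    by (auto intro: basis_vector_closed[OF F.R.ring_axioms] free_cover_basis[OF Fm(1)])
  have Ks: "submodule K R G" unfolding K_def by (rule submodule_lin_kernel[OF G Fm(1) \<pi>])
  note Kd = G.submoduleD[OF Ks]
  let ?Gc = "character_module G" and ?V = "annihilator_module G K"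
  have Gc: "left_module (opposite R) ?Gc" by (rule character_left_module[OF G])
  have V: "left_module (opposite R) ?V" by (rule left_module.submodule_left_module[OF Gc annihilator_submodule[OF G Ks]])
  interpret Gc: left_module "opposite R" ?Gc by fact
  have Gcard: "|carrier ?Gc| <o |UNIV :: 'u set|"
    unfolding G_def by (intro character_module_card[OF U] universe_free_module[OF U Rc] Fm)
  have Vsub: "annihilator G K \<subseteq> carrier ?Gc" by (auto simp: annihilator_def)
  have Vcard: "|carrier ?V| <o |UNIV :: 'u set|" using card_le_subset[OF Vsub Gcard] by simp
  have ch: "cmod (\<chi> z) = 1" "\<chi> z \<noteq> 0" if "\<chi> \<in> carrier ?Gc" "z \<in> carrier G" for \<chi> z
    using that character_nonzero by (auto simp: character_module_simps)
  have chadd: "\<chi> (z \<oplus>\<^bsub>G\<^esub> w) = \<chi> z * \<chi> w" if "\<chi> \<in> carrier ?Gc" "z \<in> carrier G" "w \<in> carrier G" for \<chi> z w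
    using that by (auto simp: character_module_simps)
  have Veq: "\<chi> z = \<chi> w" if \<chi>: "\<chi> \<in> annihilator G K" and zw: "z \<in> carrier G" "w \<in> carrier G" "\<pi> z = \<pi> w" for \<chi> z w
  proof -
    have "z \<ominus>\<^bsub>G\<^esub> w \<in> K" using zw linear_closed[OF \<pi>] by (simp add: K_def lin_kernel_def linear_diff[OF G Fm(1) \<pi>])
    then have "\<chi> (z \<ominus>\<^bsub>G\<^esub> w) = 1" using \<chi> by (simp add: annihilator_def)
    moreover have "\<chi> ((z \<ominus>\<^bsub>G\<^esub> w) \<oplus>\<^bsub>G\<^esub> w) = \<chi> (z \<ominus>\<^bsub>G\<^esub> w) * \<chi> w" using \<chi> zw Vsub by (intro chadd) auto
    ultimately show ?thesis using zw by (simp add: G.minus_plus_cancel)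
  qed
  define \<beta> where "\<beta> \<chi> x = \<chi> (sec x)" for \<chi> :: "('u \<Rightarrow> 'r) \<Rightarrow> complex" and x
  have "balanced R ?V F \<beta>"
    unfolding balanced_def
  proof (intro conjI ballI)
    fix \<chi> x assume "\<chi> \<in> carrier ?V" and x: "x \<in> carrier F"
    then have \<chi>: "\<chi> \<in> annihilator G K" "\<chi> \<in> carrier ?Gc" using Vsub by auto
    show "cmod (\<beta> \<chi> x) = 1" using ch \<chi> sec x by (simp add: \<beta>_def)
    show "\<beta> (\<chi> \<oplus>\<^bsub>?V\<^esub> \<psi>) x = \<beta> \<chi> x * \<beta> \<psi> x" for \<psi> using sec x by (simp add: \<beta>_def character_module_simps)
    show "\<beta> \<chi> (x \<oplus>\<^bsub>F\<^esub> y) = \<beta> \<chi> x * \<beta> \<chi> y" if y: "y \<in> carrier F" for y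
    proof -
      have "\<chi> (sec (x \<oplus>\<^bsub>F\<^esub> y)) = \<chi> (sec x \<oplus>\<^bsub>G\<^esub> sec y)"
        by (rule Veq[OF \<chi>(1)]) (use sec x y in \<open>auto simp: linear_add[OF \<pi>]\<close>)
      then show ?thesis using chadd[OF \<chi>(2)] sec x y by (simp add: \<beta>_def)
    qed
    show "\<beta> (r \<odot>\<^bsub>?V\<^esub> \<chi>) x = \<beta> \<chi> (r \<odot>\<^bsub>F\<^esub> x)" if r: "r \<in> carrier R" for r
    proof -
      have "\<chi> (sec (r \<odot>\<^bsub>F\<^esub> x)) = \<chi> (r \<odot>\<^bsub>G\<^esub> sec x)"
        by (rule Veq[OF \<chi>(1)]) (use sec x r F.smult_closed G.smult_closed in \<open>auto simp: linear_smult[OF \<pi>]\<close>)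
      then show ?thesis using sec x by (simp add: \<beta>_def character_module_simps)
    qed
  qed
  then obtain \<beta>' where \<beta>': "balanced R ?Gc F \<beta>'" "\<And>\<chi> x. \<chi> \<in> carrier ?V \<Longrightarrow> x \<in> carrier F \<Longrightarrow> \<beta>' \<chi> x = \<beta> \<chi> x"
    using flat_balanced_extend[OF F V Vcard Gc Gcard, of "\<lambda>x. x" \<beta>] Vsub
    by (auto simp: linear_map_def subset_iff inj_on_def)
  note b = balancedD[OF \<beta>'(1)]
  \<comment> \<open>\<open>\<tau>\<close> depends only on the restriction of \<open>\<chi>\<close> to \<open>K\<close>\<close>
  define \<tau> where "\<tau> \<chi> z = \<chi> z / \<beta>' \<chi> (\<pi> z)" for \<chi> z
  have \<pi>c: "\<pi> z \<in> carrier F" if "z \<in> carrier G" for z by (rule linear_closed[OF \<pi> that])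
  have \<tau>1: "cmod (\<tau> \<chi> z) = 1" if "\<chi> \<in> carrier ?Gc" "z \<in> carrier G" for \<chi> z
    using ch(1)[OF that] b(1)[OF that(1) \<pi>c[OF that(2)]] by (simp add: \<tau>_def norm_divide)
  have \<tau>z: "\<tau> \<chi> (z \<oplus>\<^bsub>G\<^esub> w) = \<tau> \<chi> z * \<tau> \<chi> w" if "\<chi> \<in> carrier ?Gc" "z \<in> carrier G" "w \<in> carrier G" for \<chi> z w
    using that by (simp add: \<tau>_def chadd linear_add[OF \<pi>] b(4) \<pi>c)
  have \<tau>r: "\<tau> \<chi> (r \<odot>\<^bsub>G\<^esub> z) = \<tau> (r \<odot>\<^bsub>?Gc\<^esub> \<chi>) z" if "\<chi> \<in> carrier ?Gc" "z \<in> carrier G" "r \<in> carrier R" for \<chi> z r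
  proof -
    have "(r \<odot>\<^bsub>?Gc\<^esub> \<chi>) z = \<chi> (r \<odot>\<^bsub>G\<^esub> z)" using that by (simp add: character_module_simps(4))
    then show ?thesis using that by (simp add: \<tau>_def linear_smult[OF \<pi>] b(5) \<pi>c)
  qed
  have \<tau>add: "\<tau> (\<chi> \<oplus>\<^bsub>?Gc\<^esub> \<psi>) z = \<tau> \<chi> z * \<tau> \<psi> z" if "\<chi> \<in> carrier ?Gc" "\<psi> \<in> carrier ?Gc" "z \<in> carrier G" for \<chi> \<psi> z
  proof -
    have "(\<chi> \<oplus>\<^bsub>?Gc\<^esub> \<psi>) z = \<chi> z * \<psi> z" using that by (simp add: character_module_simps(3))
    then show ?thesis using that by (simp add: \<tau>_def b(3) \<pi>c)
  qed
  have \<tau>V: "\<tau> \<chi> z = 1" if \<chi>: "\<chi> \<in> annihilator G K" and z: "z \<in> carrier G" for \<chi> z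
  proof -
    have "\<beta>' \<chi> (\<pi> z) = \<chi> (sec (\<pi> z))" using \<beta>'(2)[of \<chi> "\<pi> z"] \<chi> \<pi>c[OF z] by (simp add: \<beta>_def)
    also have "\<dots> = \<chi> z" by (rule Veq[OF \<chi>]) (use sec \<pi>c[OF z] z in auto)
    finally show ?thesis using ch(2)[of \<chi> z] \<chi> Vsub z by (auto simp: \<tau>_def)
  qed
  have \<tau>K: "\<tau> \<chi> k = \<chi> k" if \<chi>: "\<chi> \<in> carrier ?Gc" and k: "k \<in> K" for \<chi> k
  proof -
    have "\<beta>' \<chi> (\<zero>\<^bsub>F\<^esub> \<oplus>\<^bsub>F\<^esub> \<zero>\<^bsub>F\<^esub>) = \<beta>' \<chi> \<zero>\<^bsub>F\<^esub> * \<beta>' \<chi> \<zero>\<^bsub>F\<^esub>" by (rule b(4)) (use \<chi> in auto)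
    then have "\<beta>' \<chi> \<zero>\<^bsub>F\<^esub> = 1" using b(2)[OF \<chi>, of "\<zero>\<^bsub>F\<^esub>"] by simp
    then show ?thesis using k by (simp add: \<tau>_def K_def lin_kernel_def)
  qed
  have \<tau>eq: "\<tau> \<chi> z = \<tau> \<psi> z"
    if \<chi>: "\<chi> \<in> carrier ?Gc" and \<psi>: "\<psi> \<in> carrier ?Gc" and eq: "\<And>k. k \<in> K \<Longrightarrow> \<chi> k = \<psi> k" and z: "z \<in> carrier G" for \<chi> \<psi> z
  proof -
    define \<delta> where "\<delta> = (\<lambda>z\<in>carrier G. \<chi> z / \<psi> z)"
    have "\<delta> \<in> carrier ?Gc"
      using \<chi> \<psi> ch(1)[OF \<chi>] ch(1)[OF \<psi>] chadd[OF \<chi>] chadd[OF \<psi>]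
      by (simp add: character_module_simps(1) \<delta>_def norm_divide)
    moreover have "\<delta> k = 1" if k: "k \<in> K" for k
      using eq[OF k] ch(2)[OF \<psi>, of k] k Kd(1) by (auto simp: \<delta>_def)
    ultimately have \<delta>: "\<delta> \<in> annihilator G K" "\<delta> \<in> carrier ?Gc" by (auto simp: annihilator_def)
    have "\<delta> \<oplus>\<^bsub>?Gc\<^esub> \<psi> = \<chi>"
    proof (rule extensionalityI)
      show "\<delta> \<oplus>\<^bsub>?Gc\<^esub> \<psi> \<in> extensional (carrier G)" by (simp add: character_module_simps(3))
      show "\<chi> \<in> extensional (carrier G)" using \<chi> by (simp add: character_module_simps(1))
      show "(\<delta> \<oplus>\<^bsub>?Gc\<^esub> \<psi>) x = \<chi> x" if "x \<in> carrier G" for x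
        using that ch(2)[OF \<psi> that] by (simp add: character_module_simps(3) \<delta>_def)
    qed
    then show ?thesis using \<tau>add[OF \<delta>(2) \<psi> z] \<tau>V[OF \<delta>(1) z] by simp
  qed
  show ?thesis
    unfolding Ext1_trivial_iff[OF Fm(1) C]
  proof (fold G_def \<pi>_def, fold K_def, intro allI impI)
    fix g assume g: "linear_map R (G\<lparr>carrier := K\<rparr>) (annihilator_module B A) g"
    have gk: "g k \<in> annihilator B A" if "k \<in> K" for k using linear_closed[OF g] that by simp
    have gch: "g k \<in> carrier (character_module B)" if "k \<in> K" for k using gk[OF that] by (simp add: annihilator_def)
    have gadd: "g (k \<oplus>\<^bsub>G\<^esub> l) = g k \<oplus>\<^bsub>character_module B\<^esub> g l" if "k \<in> K" "l \<in> K" for k l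
      using linear_add[OF g] that by simp
    have gsm: "g (r \<odot>\<^bsub>G\<^esub> k) = r \<odot>\<^bsub>character_module B\<^esub> g k" if "r \<in> carrier R" "k \<in> K" for r k
      using linear_smult[OF g] that by simp
    \<comment> \<open>the extensions \<open>X b\<close> are chosen without regard to linearity in \<open>b\<close>, which \<open>\<tau>\<close> restores\<close>
    have "\<forall>b\<in>carrier B. \<exists>\<chi>. \<chi> \<in> carrier ?Gc \<and> (\<forall>k\<in>K. \<chi> k = g k b)"
    proof
      fix b assume b: "b \<in> carrier B"
      show "\<exists>\<chi>. \<chi> \<in> carrier ?Gc \<and> (\<forall>k\<in>K. \<chi> k = g k b)"
      proof (rule character_extend_submodule[OF G Ks, of "\<lambda>k. g k b"])
        show "cmod (g k b) = 1" if "k \<in> K" for k using gch[OF that] b by (simp add: character_module_simps(1))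
        show "g (k \<oplus>\<^bsub>G\<^esub> l) b = g k b * g l b" if "k \<in> K" "l \<in> K" for k l
          using gadd[OF that] b by (simp add: character_module_simps(3))
      qed blast
    qed
    then obtain X where X: "\<And>b. b \<in> carrier B \<Longrightarrow> X b \<in> carrier ?Gc" "\<And>b k. b \<in> carrier B \<Longrightarrow> k \<in> K \<Longrightarrow> X b k = g k b"
      by metis
    define h where "h z = (\<lambda>b\<in>carrier B. \<tau> (X b) z)" for z
    have Xadd: "\<tau> (X (a \<oplus>\<^bsub>B\<^esub> b)) z = \<tau> (X a) z * \<tau> (X b) z"
      if ab: "a \<in> carrier B" "b \<in> carrier B" and z: "z \<in> carrier G" for a b z
    proof -
      have "\<tau> (X (a \<oplus>\<^bsub>B\<^esub> b)) z = \<tau> (X a \<oplus>\<^bsub>?Gc\<^esub> X b) z"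
      proof (rule \<tau>eq[OF X(1) _ _ z])
        show "X (a \<oplus>\<^bsub>B\<^esub> b) k = (X a \<oplus>\<^bsub>?Gc\<^esub> X b) k" if k: "k \<in> K" for k
          using gch[OF k] k ab Kd(1) by (auto simp: X(2) character_module_simps)
      qed (use ab X(1) in auto)
      then show ?thesis using \<tau>add[OF X(1)[OF ab(1)] X(1)[OF ab(2)] z] by simp
    qed
    have hann: "h z \<in> annihilator B A" if z: "z \<in> carrier G" for z
    proof -
      have "h z \<in> carrier (character_module B)"
        using \<tau>1[OF X(1) z] Xadd[OF _ _ z] by (simp add: character_module_simps(1) h_def)
      moreover have "h z a = 1" if a: "a \<in> A" for a
      proof -
        have aB: "a \<in> carrier B" using a Ad(1) by blast
        have "X a \<in> annihilator G K"
          using X[OF aB] gk a by (auto simp: annihilator_def)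
        then show ?thesis using \<tau>V z aB by (simp add: h_def)
      qed
      ultimately show ?thesis by (simp add: annihilator_def)
    qed
    have hk: "h k = g k" if k: "k \<in> K" for k
    proof (rule extensionalityI)
      show "h k \<in> extensional (carrier B)" by (simp add: h_def)
      show "g k \<in> extensional (carrier B)" using gch[OF k] by (simp add: character_module_simps(1))
      show "h k b = g k b" if "b \<in> carrier B" for b
        using that \<tau>K[OF X(1)[OF that] k] X(2)[OF that k] by (simp add: h_def)
    qed
    have "linear_map R G (annihilator_module B A) h"
    proof (rule linear_mapI)
      fix z assume z: "z \<in> carrier G"
      show "h z \<in> carrier (annihilator_module B A)" using hann[OF z] by simp
      show "h (z \<oplus>\<^bsub>G\<^esub> w) = h z \<oplus>\<^bsub>annihilator_module B A\<^esub> h w" if w: "w \<in> carrier G" for w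
        using \<tau>z[OF X(1) z w] by (auto simp: h_def character_module_simps(3) intro!: restrict_ext)
      show "h (r \<odot>\<^bsub>G\<^esub> z) = r \<odot>\<^bsub>annihilator_module B A\<^esub> h z" if r: "r \<in> carrier R" for r
      proof -
        have "\<tau> (X b) (r \<odot>\<^bsub>G\<^esub> z) = \<tau> (X (r \<odot>\<^bsub>B\<^esub> b)) z" if b: "b \<in> carrier B" for b
        proof -
          have rb: "r \<odot>\<^bsub>B\<^esub> b \<in> carrier B" using B.smult_closed r b by simp
          have rX: "r \<odot>\<^bsub>?Gc\<^esub> X b \<in> carrier ?Gc" using Gc.smult_closed r X(1)[OF b] by simp
          have "\<tau> (r \<odot>\<^bsub>?Gc\<^esub> X b) z = \<tau> (X (r \<odot>\<^bsub>B\<^esub> b)) z"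
          proof (rule \<tau>eq[OF rX X(1)[OF rb] _ z])
            fix k assume k: "k \<in> K"
            have "(r \<odot>\<^bsub>?Gc\<^esub> X b) k = X b (r \<odot>\<^bsub>G\<^esub> k)" using k Kd(1) by (auto simp: character_module_simps(4))
            also have "\<dots> = g (r \<odot>\<^bsub>G\<^esub> k) b" by (rule X(2)[OF b Kd(4)[OF r k]])
            also have "\<dots> = g k (r \<odot>\<^bsub>B\<^esub> b)" using b by (simp add: gsm[OF r k] character_module_simps(4))
            also have "\<dots> = X (r \<odot>\<^bsub>B\<^esub> b) k" by (rule X(2)[OF rb k, symmetric])
            finally show "(r \<odot>\<^bsub>?Gc\<^esub> X b) k = X (r \<odot>\<^bsub>B\<^esub> b) k" .
          qed
          then show ?thesis using \<tau>r[OF X(1)[OF b] z r] by simp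
        qed
        then show ?thesis
          using B.smult_closed r by (auto simp: h_def character_module_simps(4) intro!: restrict_ext)
      qed
    qed
    then show "\<exists>h. linear_map R G (annihilator_module B A) h \<and> (\<forall>k\<in>K. h k = g k)" using hk by blast
  qed
qed

text \<open>
  Suppose a nonzero tensor over \<open>A\<close> becomes zero over \<open>B\<close>. Some character does not kill it. This character
  is a linear map from \<open>Y\<close> to the characters of \<open>A\<close>; it lifts to the characters of \<open>B\<close>, because the
  kernel of the restriction is orthogonal to \<open>Y\<close>. The lift is a character that kills the image of the
  tensor, and yet has the same value there.
\<close>

lemma flat_of_annihilator_Ext_trivial:
  fixes Y :: "('r, 'u) module"
  assumes Y: "Y \<in> modules R"
    and ext: "\<And>(B :: ('r, 'u) module) A. B \<in> modules (opposite R) \<Longrightarrow> submodule A (opposite R) B \<Longrightarrow>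
       trivial_group (Ext1 R Y (annihilator_module B A))"
  shows "Y \<in> flat_modules R"
  unfolding flat_modules_def
proof (intro CollectI conjI ballI impI Y)
  fix A B :: "('r, 'u) module" and f
  assume AB: "A \<in> modules (opposite R)" "B \<in> modules (opposite R)" and f: "f \<in> module_hom (opposite R) A B"
    and inj: "inj_on f (carrier A)"
  have A: "left_module (opposite R) A" and B: "left_module (opposite R) B" using AB by (auto simp: modules_def)
  have Ym: "left_module R Y" using Y by (simp add: modules_def)
  interpret A: left_module "opposite R" A by fact
  interpret B: left_module "opposite R" B by fact
  interpret Y: left_module R Y by fact
  note fl = module_hom_linear[OF f]
  define S where "S = f ` carrier A"
  have S: "submodule S (opposite R) B"
  proof (rule B.submoduleI)
    show "S \<subseteq> carrier B" using linear_closed[OF fl] by (auto simp: S_def)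
    show "\<zero>\<^bsub>B\<^esub> \<in> S" using linear_zero[OF A B fl] A.M.zero_closed unfolding S_def by (metis imageI)
    show "x \<oplus>\<^bsub>B\<^esub> y \<in> S" if xy: "x \<in> S" "y \<in> S" for x y
    proof -
      obtain a b where ab: "a \<in> carrier A" "x = f a" "b \<in> carrier A" "y = f b" using xy by (auto simp: S_def)
      have "x \<oplus>\<^bsub>B\<^esub> y = f (a \<oplus>\<^bsub>A\<^esub> b)" using ab by (simp add: linear_add[OF fl])
      then show ?thesis using ab by (auto simp: S_def)
    qed
    show "r \<odot>\<^bsub>B\<^esub> x \<in> S" if rx: "r \<in> carrier (opposite R)" "x \<in> S" for r x
    proof -
      obtain a where a: "a \<in> carrier A" "x = f a" using rx by (auto simp: S_def)
      have "r \<odot>\<^bsub>B\<^esub> x = f (r \<odot>\<^bsub>A\<^esub> a)" using a rx by (simp add: linear_smult[OF fl])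
      then show ?thesis using a rx A.smult_closed by (auto simp: S_def)
    qed
  qed
  note Sd = B.submoduleD[OF S]
  have f_inv: "inv_into (carrier A) f (f a) = a" if "a \<in> carrier A" for a using inv_into_f_f[OF inj that] .
  let ?Bc = "character_module B" and ?C = "annihilator_module B S"
  have Bc: "left_module R ?Bc" using character_left_module[OF B] by simp
  interpret Bc: left_module R ?Bc by fact
  have C: "left_module R ?C" by (rule annihilator_left_module[OF B S])
  have triv: "trivial_group (Ext1 R Y ?C)" by (rule ext[OF AB(2) S])
  show "inj_on (tensor_map R B Y f) (carrier (tensor_product R A Y))"
    unfolding tensor_map_inj_iff[OF A B Ym fl]
  proof (intro allI impI, rule ccontr)
    fix c assume c: "Poly_Mapping.keys c \<subseteq> carrier A \<times> carrier Y" and fc: "frag_map f c \<in> tensor_relations R B Y"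
      and nc: "c \<notin> tensor_relations R A Y"
    obtain \<chi> where \<chi>: "\<chi> \<in> hom (rel_group (carrier A) (carrier Y)) circle"
      "\<And>x. x \<in> tensor_relations R A Y \<Longrightarrow> \<chi> x = 1" "\<chi> c \<noteq> 1"
      by (rule comm_group.character_separation[OF abelian_free_Abelian_group relations_subgroup[OF A Ym], of c])
        (use c nc in \<open>auto intro: that\<close>)
    define \<beta> where "\<beta> a y = \<chi> (frag_of (a, y))" for a y
    have \<beta>: "balanced R A Y \<beta>"
      unfolding \<beta>_def by (rule balanced_of_hom[OF A Ym \<chi>(1)]) (intro \<chi>(2) relators_relations)
    note b = balancedD[OF \<beta>]
    \<comment> \<open>the map from \<open>Y\<close> to the characters of \<open>A\<close> is first lifted on the free cover, by \<open>\<psi>\<close>; on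
      the kernel \<open>\<psi>\<close> has values in the annihilator, and subtracting an extension \<open>\<omega>\<close> of these
      values makes the lift descend to \<open>Y\<close>\<close>
    define F where "F = free_module R (carrier Y)"
    define \<pi> where "\<pi> = free_cover R Y (carrier Y)"
    define K where "K = lin_kernel F Y \<pi>"
    have F: "left_module R F" unfolding F_def by (rule free_module_left_module[OF Y.R.ring_axioms])
    interpret F: left_module R F by fact
    have \<pi>: "linear_map R F Y \<pi>" unfolding \<pi>_def F_def by (rule free_cover_linear[OF Ym]) simp
    have \<pi>_onto: "\<pi> ` carrier F = carrier Y"
    proof
      show "\<pi> ` carrier F \<subseteq> carrier Y" using linear_closed[OF \<pi>] by auto
      show "carrier Y \<subseteq> \<pi> ` carrier F"
      proof
        fix y assume "y \<in> carrier Y"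
        then obtain a where "a \<in> carrier F" "\<pi> a = y" unfolding F_def \<pi>_def by (rule free_cover_onto[OF Ym])
        then show "y \<in> \<pi> ` carrier F" by blast
      qed
    qed
    have "\<forall>y\<in>carrier Y. \<exists>\<psi>. \<psi> \<in> carrier ?Bc \<and> (\<forall>a\<in>carrier A. \<psi> (f a) = \<beta> a y)"
    proof
      fix y assume y: "y \<in> carrier Y"
      show "\<exists>\<psi>. \<psi> \<in> carrier ?Bc \<and> (\<forall>a\<in>carrier A. \<psi> (f a) = \<beta> a y)"
      proof (rule character_extend_submodule[OF B S, of "\<lambda>x. \<beta> (inv_into (carrier A) f x) y"])
        show "cmod (\<beta> (inv_into (carrier A) f x) y) = 1" if "x \<in> S" for x
          using that b(1) y by (auto simp: S_def f_inv)
        show "\<beta> (inv_into (carrier A) f (x \<oplus>\<^bsub>B\<^esub> x')) y = \<beta> (inv_into (carrier A) f x) y * \<beta> (inv_into (carrier A) f x') y"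
          if "x \<in> S" "x' \<in> S" for x x'
          using that b(3) y f_inv by (auto simp: S_def linear_add[OF fl, symmetric])
        fix \<psi> assume \<psi>: "\<psi> \<in> carrier ?Bc" "\<And>x. x \<in> S \<Longrightarrow> \<psi> x = \<beta> (inv_into (carrier A) f x) y"
        have "\<psi> (f a) = \<beta> a y" if "a \<in> carrier A" for a using \<psi>(2)[of "f a"] f_inv[OF that] that by (simp add: S_def)
        then show ?thesis using \<psi>(1) by blast
      qed
    qed
    then obtain \<psi>\<^sub>0 where \<psi>\<^sub>0: "\<And>y. y \<in> carrier Y \<Longrightarrow> \<psi>\<^sub>0 y \<in> carrier ?Bc"
      "\<And>y a. y \<in> carrier Y \<Longrightarrow> a \<in> carrier A \<Longrightarrow> \<psi>\<^sub>0 y (f a) = \<beta> a y" by metis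
    have \<psi>\<^sub>0c: "\<psi>\<^sub>0 \<in> carrier Y \<rightarrow> carrier ?Bc" using \<psi>\<^sub>0(1) by auto
    define \<psi> where "\<psi> = free_lift R (carrier Y) ?Bc \<psi>\<^sub>0"
    have \<psi>: "linear_map R F ?Bc \<psi>" unfolding \<psi>_def F_def by (rule free_lift_linear[OF Bc \<psi>\<^sub>0c])
    let ?Ac = "character_module A"
    have Ac: "left_module R ?Ac" using character_left_module[OF A] by simp
    have res: "linear_map R ?Bc ?Ac (\<lambda>\<chi>. \<lambda>a\<in>carrier A. \<chi> (f a))"
    proof (rule linear_mapI)
      fix \<chi> assume \<chi>: "\<chi> \<in> carrier ?Bc"
      show "(\<lambda>a\<in>carrier A. \<chi> (f a)) \<in> carrier ?Ac"
        using \<chi> linear_closed[OF fl] by (simp add: character_module_simps(1) linear_add[OF fl])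
      show "(\<lambda>a\<in>carrier A. (\<chi> \<oplus>\<^bsub>?Bc\<^esub> \<chi>') (f a)) = (\<lambda>a\<in>carrier A. \<chi> (f a)) \<oplus>\<^bsub>?Ac\<^esub> (\<lambda>a\<in>carrier A. \<chi>' (f a))" for \<chi>'
        using linear_closed[OF fl] by (auto simp: character_module_simps(3) intro!: restrict_ext)
      show "(\<lambda>a\<in>carrier A. (r \<odot>\<^bsub>?Bc\<^esub> \<chi>) (f a)) = r \<odot>\<^bsub>?Ac\<^esub> (\<lambda>a\<in>carrier A. \<chi> (f a))" if "r \<in> carrier R" for r
        using that linear_closed[OF fl] linear_smult[OF fl] A.smult_closed
        by (auto simp: character_module_simps(4) intro!: restrict_ext)
    qed
    have adj: "linear_map R Y ?Ac (\<lambda>y. \<lambda>a\<in>carrier A. \<beta> a y)"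
    proof (rule linear_mapI)
      fix y assume y: "y \<in> carrier Y"
      show "(\<lambda>a\<in>carrier A. \<beta> a y) \<in> carrier ?Ac" using b y by (simp add: character_module_simps(1))
      show "(\<lambda>a\<in>carrier A. \<beta> a (y \<oplus>\<^bsub>Y\<^esub> y')) = (\<lambda>a\<in>carrier A. \<beta> a y) \<oplus>\<^bsub>?Ac\<^esub> (\<lambda>a\<in>carrier A. \<beta> a y')"
        if "y' \<in> carrier Y" for y' using b(4) y that by (auto simp: character_module_simps(3) intro!: restrict_ext)
      show "(\<lambda>a\<in>carrier A. \<beta> a (r \<odot>\<^bsub>Y\<^esub> y)) = r \<odot>\<^bsub>?Ac\<^esub> (\<lambda>a\<in>carrier A. \<beta> a y)" if "r \<in> carrier R" for r
        using b(5) y that A.smult_closed by (auto simp: character_module_simps(4) intro!: restrict_ext)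
    qed
    have \<psi>f: "\<psi> z (f a) = \<beta> a (\<pi> z)" if z: "z \<in> carrier F" and a: "a \<in> carrier A" for z a
    proof -
      have "(\<lambda>a\<in>carrier A. \<psi> z (f a)) = (\<lambda>a\<in>carrier A. \<beta> a (\<pi> z))"
      proof (rule free_lift_unique[OF Ac, where f = "\<lambda>z. \<lambda>a\<in>carrier A. \<psi> z (f a)" and f' = "\<lambda>z. \<lambda>a\<in>carrier A. \<beta> a (\<pi> z)"])
        show "linear_map R (free_module R (carrier Y)) ?Ac (\<lambda>z. \<lambda>a\<in>carrier A. \<psi> z (f a))"
          using linear_comp[OF \<psi> res] by (simp add: F_def)
        show "linear_map R (free_module R (carrier Y)) ?Ac (\<lambda>z. \<lambda>a\<in>carrier A. \<beta> a (\<pi> z))"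
          using linear_comp[OF \<pi> adj] by (simp add: F_def)
        show "(\<lambda>a\<in>carrier A. \<psi> (basis_vector R (carrier Y) y) (f a)) = (\<lambda>a\<in>carrier A. \<beta> a (\<pi> (basis_vector R (carrier Y) y)))"
          if y: "y \<in> carrier Y" for y
          unfolding \<psi>_def \<pi>_def free_lift_basis[OF Bc \<psi>\<^sub>0c y] free_cover_basis[OF Ym subset_refl y]
          using \<psi>\<^sub>0(2)[OF y] by (auto intro!: restrict_ext)
        show "z \<in> carrier (free_module R (carrier Y))" using z by (simp add: F_def)
      qed
      from fun_cong[OF this, of a] show ?thesis using a by simp
    qed
    have \<psi>K: "\<psi> k \<in> annihilator B S" if k: "k \<in> K" for k
    proof -
      have kF: "k \<in> carrier F" "\<pi> k = \<zero>\<^bsub>Y\<^esub>" using k by (auto simp: K_def lin_kernel_def)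
      have "\<psi> k (f a) = 1" if a: "a \<in> carrier A" for a
        using \<psi>f[OF kF(1) a] b(4)[OF a Y.M.zero_closed Y.M.zero_closed] b(2)[OF a Y.M.zero_closed] kF(2) by simp
      then show ?thesis using linear_closed[OF \<psi> kF(1)] by (auto simp: annihilator_def S_def)
    qed
    have gl: "linear_map R (F\<lparr>carrier := K\<rparr>) ?C \<psi>"
      using \<psi> \<psi>K by (auto simp: linear_map_def K_def lin_kernel_def)
    obtain \<omega> where \<omega>: "linear_map R F ?C \<omega>" "\<And>k. k \<in> K \<Longrightarrow> \<omega> k = \<psi> k"
      using triv gl unfolding Ext1_trivial_iff[OF Ym C] F_def \<pi>_def K_def by blast
    have \<omega>B: "linear_map R F ?Bc \<omega>" using \<omega>(1) by (auto simp: linear_map_def annihilator_def)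
    have dl: "linear_map R F ?Bc (\<lambda>z. \<psi> z \<ominus>\<^bsub>?Bc\<^esub> \<omega> z)" by (rule linear_minus[OF Bc \<psi> \<omega>B])
    obtain \<gamma> where \<gamma>: "linear_map R Y ?Bc \<gamma>" "\<And>z. z \<in> carrier F \<Longrightarrow> \<gamma> (\<pi> z) = \<psi> z \<ominus>\<^bsub>?Bc\<^esub> \<omega> z"
    proof (rule linear_factor[OF F Ym Bc \<pi> \<pi>_onto dl])
      show "\<psi> x \<ominus>\<^bsub>?Bc\<^esub> \<omega> x = \<zero>\<^bsub>?Bc\<^esub>" if "x \<in> carrier F" "\<pi> x = \<zero>\<^bsub>Y\<^esub>" for x
        using \<omega>(2)[of x] linear_closed[OF \<psi> that(1)] that by (simp add: K_def lin_kernel_def)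
    qed (rule that)
    have \<gamma>f: "\<gamma> y (f a) = \<beta> a y" if y: "y \<in> carrier Y" and a: "a \<in> carrier A" for y a
    proof -
      obtain z where z: "z \<in> carrier F" "y = \<pi> z" using \<pi>_onto y by blast
      have fa: "f a \<in> carrier B" "f a \<in> S" using linear_closed[OF fl a] a by (auto simp: S_def)
      have "\<gamma> y \<oplus>\<^bsub>?Bc\<^esub> \<omega> z = \<psi> z"
        using \<gamma>(2)[OF z(1)] linear_closed[OF \<psi> z(1)] linear_closed[OF \<omega>B z(1)] z(2) by (simp add: Bc.minus_plus_cancel)
      from fun_cong[OF this, of "f a"] have "\<gamma> y (f a) * \<omega> z (f a) = \<psi> z (f a)"
        using fa by (simp add: character_module_simps(3))
      moreover have "\<omega> z (f a) = 1" using linear_closed[OF \<omega>(1) z(1)] fa by (simp add: annihilator_def)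
      ultimately show ?thesis using \<psi>f[OF z(1) a] z(2) by simp
    qed
    define \<beta>' where "\<beta>' b y = \<gamma> y b" for b y
    have \<beta>': "balanced R B Y \<beta>'"
      using linear_closed[OF \<gamma>(1)] linear_add[OF \<gamma>(1)] linear_smult[OF \<gamma>(1)]
      by (simp add: balanced_def \<beta>'_def character_module_simps)
    have fA: "f ` carrier A \<subseteq> carrier B" using linear_closed[OF fl] by blast
    have "Poly_Mapping.keys c \<subseteq> carrier A \<times> carrier Y \<and> tensor_character B Y \<beta>' (frag_map f c) = \<chi> c"
    proof (rule free_Abelian_group_induct[OF c])
      show "Poly_Mapping.keys 0 \<subseteq> carrier A \<times> carrier Y \<and> tensor_character B Y \<beta>' (frag_map f 0) = \<chi> 0"
        using tensor_character_relations[OF B Ym \<beta>' relations_zero[OF B Ym]] \<chi>(2)[OF relations_zero[OF A Ym]] by simp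
    next
      fix x y assume k: "Poly_Mapping.keys x \<subseteq> carrier A \<times> carrier Y" "Poly_Mapping.keys y \<subseteq> carrier A \<times> carrier Y"
        and IH: "Poly_Mapping.keys x \<subseteq> carrier A \<times> carrier Y \<and> tensor_character B Y \<beta>' (frag_map f x) = \<chi> x"
          "Poly_Mapping.keys y \<subseteq> carrier A \<times> carrier Y \<and> tensor_character B Y \<beta>' (frag_map f y) = \<chi> y"
      have "tensor_character B Y \<beta>' (frag_map f (x - y)) = \<chi> (x - y)"
        using IH by (simp add: frag_extend_diff frag_hom_circle_diff[OF \<chi>(1) k]
            frag_hom_circle_diff[OF tensor_character_hom[OF B Ym \<beta>'] frag_map_keys[OF k(1) fA] frag_map_keys[OF k(2) fA]])
      then show "Poly_Mapping.keys (x - y) \<subseteq> carrier A \<times> carrier Y \<and> tensor_character B Y \<beta>' (frag_map f (x - y)) = \<chi> (x - y)"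
        using keys_diff[of x y] k by auto
    next
      fix p assume "p \<in> carrier A \<times> carrier Y"
      then obtain a y where p: "p = (a, y)" "a \<in> carrier A" "y \<in> carrier Y" by auto
      then show "Poly_Mapping.keys (frag_of p) \<subseteq> carrier A \<times> carrier Y \<and> tensor_character B Y \<beta>' (frag_map f (frag_of p)) = \<chi> (frag_of p)"
        using linear_closed[OF fl] \<gamma>f[OF p(3,2)]
        by (simp add: keys_frag_of tensor_character_of[OF B Ym \<beta>'] \<beta>'_def \<beta>_def)
    qed
    then show False using tensor_character_relations[OF B Ym \<beta>' fc] \<chi>(3) by simp
  qed
qed

section \<open>The cotorsion pair generated by flat Mittag-Leffler modules\<close>

theorem corollary2p6:
  fixes R :: "'r ring"
  assumes "universe TYPE('u)"
    and "ring R"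
    and "|carrier R| <o |UNIV :: 'u set|"
    and "\<And>M :: ('r, 'u) module. M \<in> flat_modules R \<Longrightarrow>
           filtered_by R (totally_ordered_limits_of_projectives R) M"
  shows "cotorsion_pair_generated_by R (flat_mittag_leffler_modules R :: ('r, 'u) module set) =
           (flat_modules R, cotorsion_modules R)"
proof -
  let ?FM = "flat_mittag_leffler_modules R :: ('r, 'u) module set"
  have perp: "right_perp R ?FM = cotorsion_modules R"
  proof
    show "cotorsion_modules R \<subseteq> right_perp R ?FM"
      by (auto simp: cotorsion_modules_def right_perp_def flat_mittag_leffler_modules_def)
    show "right_perp R ?FM \<subseteq> cotorsion_modules R"
    proof
      fix Y assume Y: "Y \<in> right_perp R ?FM"
      have YR: "Y \<in> modules R" using Y by (simp add: right_perp_def)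
      have lp: "trivial_group (Ext1 R X Y)" if "X \<in> modules R" "locally_projective R X" for X :: "('r, 'u) module"
        using Y locally_projective_flat[OF that(2,1)] locally_projective_mittag_leffler[OF that(2,1)]
        by (simp add: right_perp_def flat_mittag_leffler_modules_def)
      have "trivial_group (Ext1 R F Y)" if F: "F \<in> flat_modules R" for F :: "('r, 'u) module"
      proof (rule filtered_Ext_trivial[OF _ _ assms(4)[OF F]])
        show "left_module R F" "left_module R Y" using F YR by (auto simp: flat_modules_def modules_def)
        fix L :: "('r, 'u) module" assume L: "L \<in> totally_ordered_limits_of_projectives R"
        have "L \<in> modules R" using L by (auto simp: totally_ordered_limits_of_projectives_def is_direct_limit_def)
        then show "left_module R L \<and> trivial_group (Ext1 R L Y)"
          using limit_Ext_trivial[OF assms(1,3) YR lp L] by (simp add: modules_def)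
      qed
      then show "Y \<in> cotorsion_modules R" using YR by (simp add: cotorsion_modules_def)
    qed
  qed
  have "left_perp R (cotorsion_modules R) = (flat_modules R :: ('r, 'u) module set)"
  proof
    show "(flat_modules R :: ('r, 'u) module set) \<subseteq> left_perp R (cotorsion_modules R)"
      by (auto simp: left_perp_def cotorsion_modules_def flat_modules_def)
    show "left_perp R (cotorsion_modules R) \<subseteq> (flat_modules R :: ('r, 'u) module set)"
    proof
      fix Y :: "('r, 'u) module" assume Y: "Y \<in> left_perp R (cotorsion_modules R)"
      have YR: "Y \<in> modules R" and Ym: "left_module R Y" using Y by (auto simp: left_perp_def modules_def)
      show "Y \<in> flat_modules R"
      proof (rule flat_of_annihilator_Ext_trivial[OF YR])
        fix B :: "('r, 'u) module" and A assume B: "B \<in> modules (opposite R)" and A: "submodule A (opposite R) B"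
        \<comment> \<open>cotorsion modules have carriers in the universe, so a copy stands in for the annihilator\<close>
        have Bm: "left_module (opposite R) B" "|carrier B| <o |UNIV :: 'u set|" using B by (auto simp: modules_def small_def)
        let ?C = "annihilator_module B A"
        have C: "left_module R ?C" by (rule annihilator_left_module[OF Bm(1) A])
        have "|carrier ?C| <o |UNIV :: 'u set|"
          by (rule card_le_subset[OF _ character_module_card[OF assms(1) Bm(2)]]) (auto simp: annihilator_def)
        then obtain C' :: "('r, 'u) module" and \<rho> \<sigma> where C': "C' \<in> modules R" "linear_map R ?C C' \<rho>" "linear_map R C' ?C \<sigma>"
          "\<And>x. x \<in> carrier ?C \<Longrightarrow> \<sigma> (\<rho> x) = x" "\<And>x. x \<in> carrier C' \<Longrightarrow> \<rho> (\<sigma> x) = x"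
          by (rule small_copy[OF C]) (rule that)
        have Cm: "left_module R C'" using C'(1) by (simp add: modules_def)
        have "C' \<in> cotorsion_modules R"
          unfolding cotorsion_modules_def
        proof (intro CollectI conjI ballI C'(1))
          fix F :: "('r, 'u) module" assume F: "F \<in> flat_modules R"
          then have "left_module R F" by (simp add: flat_modules_def modules_def)
          then show "trivial_group (Ext1 R F C')"
            using Ext1_trivial_iso[OF _ C Cm C'(2,3,5) annihilator_Ext_trivial[OF assms(1,3) F Bm(1) A]] by blast
        qed
        then have "trivial_group (Ext1 R Y C')" using Y by (simp add: left_perp_def)
        then show "trivial_group (Ext1 R Y ?C)"
          using Ext1_trivial_iso[OF Ym Cm C C'(3,2,4)] by blast
      qed
    qed
  qed
  then show ?thesis by (simp add: cotorsion_pair_generated_by_def perp)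
qed

end
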